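(* Let $(M^{2n+1},T^{1,0})$ be a CR manifold. If $p,r\in\{0,\dots,n+1\}$ and $q,s\in\{0,\dots,n\}$, then the operator $\sqcup\colon H_R^{p,q}(M)\times H_R^{r,s}(M)\to H_R^{p+r,q+s}(M)$, $$[\omega]\sqcup[\tau]:=\bigl[\pi^{p+r,q+s}\bigl(\pi(\omega\wedge\tau)\bigr)\bigr],$$ is well-defined and associative.
   Context: CR manifolds. A CR manifold $(M^{2n+1},T^{1,0})$ is a connected real $(2n+1)$-manifold with a complex rank $n$ distribution $T^{1,0}\subset TM\otimes\mathbb C$ such that, with $T^{0,1}:=\overline{T^{1,0}}$, one has $T^{1,0}\cap T^{0,1}=\{0\}$, $[T^{1,0},T^{1,0}]\subset T^{1,0}$, and, for every real one-form $\theta$ on an open set $U$ with $\ker\theta=H|_U$, where $H:=\operatorname{Re}(T^{1,0}\oplus T^{0,1})$, the Levi form $L(Z,W):=-i\,d\theta(Z,\overline W)$ is a nondegenerate hermitian form on $T^{1,0}|_U$. Such a $\theta$ is called a local contact form; its Reeb vector field $T$ is determined by $\theta(T)=1$, $d\theta(T,\cdot)=0$. Rumin complex. Let $\mathscr A^k$ be the sheaf of smooth real $k$-forms. For $k\le n$ put $\mathscr R^k:=\{\omega\in\mathscr A^k:\theta\wedge\omega\wedge d\theta^{n+1-k}=0,\ \theta\wedge d\omega\wedge d\theta^{n-k}=0\}$; for $k\ge n+1$ put $\mathscr R^k:=\{\omega\in\mathscr A^k:\theta\wedge\omega=0,\ \theta\wedge d\omega=0\}$, $\theta$ any local contact form (the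 choice is irrelevant). Then $d(\mathscr R^k)\subset\mathscr R^{k+1}$. Bigrading. Let $\mathscr R^k_{\mathbb C}:=\mathscr R^k\otimes\mathbb C$, $H_{\mathbb C}:=H\otimes\mathbb C$ and $\Lambda^{p,q}:=\Lambda^p(T^{1,0})^*\otimes\Lambda^q(T^{0,1})^*$. For $p\in\{0,\dots,n+1\}$, $q\in\{0,\dots,n\}$ put $\mathscr R^{p,q}:=\{\omega\in\mathscr R^{p+q}_{\mathbb C}:\omega|_{H_{\mathbb C}}\text{ is a section of }\Lambda^{p,q}\}$ if $p+q\le n$, and $\mathscr R^{p,q}:=\{\omega\in\mathscr R^{p+q}_{\mathbb C}:(T\lrcorner\omega)|_{H_{\mathbb C}}\text{ is a section of }\Lambda^{p-1,q}\}$ if $p+q\ge n+1$; put $\mathscr R^{p,q}=0$ for other $p,q$. Then $\mathscr R^k_{\mathbb C}=\bigoplus_{p+q=k}\mathscr R^{p,q}$, with projections $\pi^{p,q}\colon\mathscr R^{p+q}_{\mathbb C}\to\mathscr R^{p,q}$. Set $\bar\partial_b:=\pi^{p,q+1}\circ d$ on $\mathscr R^{p,q}$; then $\bar\partial_b^2=0$. With $\mathcal R^{p,q}$ the global sections of $\mathscr R^{p,q}$, put $H_R^{p,q}(M):=\ker(\bar\partial_b\colon\mathcal R^{p,q}\to\mathcal R^{p,q+1})/\operatorname{im}(\bar\partial_b\colon\mathcal R^{p,q-1}\to\mathcal R^{p,q})$ (zero if $p\notin\{0,\dots,n+1\}$ or $q\notin\{0,\dots,n\}$). The operators $\Gamma$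 and $\pi$. For $\omega\in\mathscr A^k$ with $k\le n$ there is a unique form $\theta\wedge\xi$, $\xi\in\mathscr A^{k-2}$, with $\theta\wedge\omega\wedge d\theta^{n+1-k}=\theta\wedge\xi\wedge d\theta^{n+2-k}$, and $\Gamma\omega:=\theta\wedge\xi$. For $k\ge n+1$ there is a unique form $\theta\wedge\xi$, $\xi\in\mathscr A^{2n-k}$, with $\theta\wedge\omega=\theta\wedge\xi\wedge d\theta^{k-n}$, and $\Gamma\omega:=\theta\wedge\xi\wedge d\theta^{k-n-1}$. (Forms of negative degree are zero.) $\Gamma$ is independent of the local contact form. Set $\pi\omega:=\omega-d\Gamma\omega-\Gamma d\omega$, a projection $\mathscr A^k\to\mathscr R^k$. Extend $\Gamma,\pi$ complex linearly. *)

theory Defs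
  imports "HOL-Analysis.Analysis" "HOL-Library.Function_Algebras"
begin

section \<open>Smooth maps between Euclidean spaces\<close>

text \<open>Intended for open domains \<open>S\<close> of finite-dimensional spaces, where having continuous
  iterated directional derivatives of all orders is the usual notion of smoothness.\<close>

primrec Ck_on :: "nat \<Rightarrow> ('u::real_normed_vector \<Rightarrow> 'w::real_normed_vector) \<Rightarrow> 'u set \<Rightarrow> bool" where
  "Ck_on 0 f S \<longleftrightarrow> continuous_on S f"
| "Ck_on (Suc k) f S \<longleftrightarrow> (\<forall>x\<in>S. f differentiable (at x)) \<and>
     (\<forall>v. Ck_on k (\<lambda>x. frechet_derivative f (at x) v) S)"

definition smooth_on :: "('u::real_normed_vector \<Rightarrow> 'w::real_normed_vector) \<Rightarrow> 'u set \<Rightarrow> bool" where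
  "smooth_on f S \<longleftrightarrow> (\<forall>k. Ck_on k f S)"


section \<open>Alternating forms\<close>

text \<open>An alternating \<open>k\<close>-form on a vector space is a function on lists of vectors that is
  multilinear and alternating on lists of length \<open>k\<close> and, by convention, \<open>0\<close> on all other
  lists.  The degree is an integer, so that the only form of negative degree is \<open>0\<close>.\<close>

definition alternating_form :: "int \<Rightarrow> ('v::real_vector list \<Rightarrow> 'b::real_vector) \<Rightarrow> bool" where
  "alternating_form k f \<longleftrightarrow>
     (\<forall>vs. int (length vs) \<noteq> k \<longrightarrow> f vs = 0) \<and>
     (\<forall>vs. \<forall>i<length vs. linear (\<lambda>v. f (vs[i := v]))) \<and>
     (\<forall>vs i j. i < j \<and> j < length vs \<and> vs ! i = vs ! j \<longrightarrow> f vs = 0)"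

text \<open>A (not necessarily smooth) differential form on a manifold with point type \<open>'a\<close> and
  model space \<open>'v\<close> is a family of such functions indexed by the points.\<close>

type_synonym ('a, 'v, 'b) form = "'a \<Rightarrow> 'v list \<Rightarrow> 'b"

text \<open>Wedge product as the sum over all \<open>(k, l)\<close>-shuffles: the first factor receives the
  arguments at the positions in \<open>S\<close>, the second one the remaining arguments, and the sign is
  that of the shuffle, whose inversions are the pairs counted below.  Subsets \<open>S\<close> of the
  wrong cardinality contribute \<open>0\<close>, so the degrees need not be mentioned.\<close>

definition wedge :: "('a, 'v, 'b::comm_ring_1) form \<Rightarrow> ('a, 'v, 'b) form \<Rightarrow> ('a, 'v, 'b) form"
    (infixr \<open>\<^bold>\<and>\<close> 75) where
  "(\<omega> \<^bold>\<and> \<tau>) x vs =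
     (\<Sum>S\<in>Pow {..<length vs}.
        (- 1) ^ card {(i, j). i \<in> S \<and> j \<in> {..<length vs} - S \<and> j < i}
        * \<omega> x (nths vs S) * \<tau> x (nths vs (- S)))"

primrec wedge_power :: "('a, 'v, 'b::comm_ring_1) form \<Rightarrow> nat \<Rightarrow> ('a, 'v, 'b) form" where
  "wedge_power \<omega> 0 = (\<lambda>x vs. if vs = [] then 1 else 0)"
| "wedge_power \<omega> (Suc m) = \<omega> \<^bold>\<and> wedge_power \<omega> m"

text \<open>The exterior derivative on the model space.\<close>

definition euclidean_ext_deriv ::
    "('v::real_normed_vector, 'v, 'b::real_normed_vector) form \<Rightarrow> ('v, 'v, 'b) form" where
  "euclidean_ext_deriv \<alpha> y vs =
     (\<Sum>i<length vs. (- 1) ^ i *\<^sub>R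
        frechet_derivative (\<lambda>z. \<alpha> z (take i vs @ drop (Suc i) vs)) (at y) (vs ! i))"


section \<open>Complexification\<close>

definition vec_of_real :: "real^'m \<Rightarrow> complex^'m" where
  "vec_of_real v = (\<chi> i. complex_of_real (v $ i))"

definition vec_Re :: "complex^'m \<Rightarrow> real^'m" where
  "vec_Re Z = (\<chi> i. Re (Z $ i))"

definition vec_Im :: "complex^'m \<Rightarrow> real^'m" where
  "vec_Im Z = (\<chi> i. Im (Z $ i))"

definition vec_cnj :: "complex^'m \<Rightarrow> complex^'m" where
  "vec_cnj Z = (\<chi> i. cnj (Z $ i))"

text \<open>Complex linear extension of a real linear map, and complex multilinear extension of a
  real multilinear function, from \<open>real^'m\<close> to its complexification.\<close>

definition complex_extension :: "(real^'m \<Rightarrow> complex^'m) \<Rightarrow> complex^'m \<Rightarrow> complex^'m" where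
  "complex_extension L Z = L (vec_Re Z) + \<i> *s L (vec_Im Z)"

fun multi_extension :: "((real^'m) list \<Rightarrow> complex) \<Rightarrow> (complex^'m) list \<Rightarrow> complex" where
  "multi_extension f [] = f []"
| "multi_extension f (Z # Zs) =
     multi_extension (\<lambda>vs. f (vec_Re Z # vs)) Zs + \<i> * multi_extension (\<lambda>vs. f (vec_Im Z # vs)) Zs"

text \<open>Complex valued forms are the complexification of the real valued ones.\<close>

definition form_Re :: "('a, 'v, complex) form \<Rightarrow> ('a, 'v, real) form" where
  "form_Re \<omega> x vs = Re (\<omega> x vs)"

definition form_Im :: "('a, 'v, complex) form \<Rightarrow> ('a, 'v, real) form" where
  "form_Im \<omega> x vs = Im (\<omega> x vs)"

definition form_Complex ::
    "('a, 'v, real) form \<Rightarrow> ('a, 'v, real) form \<Rightarrow> ('a, 'v, complex) form" where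
  "form_Complex \<alpha> \<beta> x vs = Complex (\<alpha> x vs) (\<beta> x vs)"


section \<open>Manifolds, differential forms and vector fields\<close>

text \<open>A chart is a pair of its domain and its coordinate map.\<close>

type_synonym ('a, 'v) chart = "'a set \<times> ('a \<Rightarrow> 'v)"

abbreviation chart_inv :: "('a, 'v) chart \<Rightarrow> 'v \<Rightarrow> 'a" where
  "chart_inv c \<equiv> inv_into (fst c) (snd c)"

definition smooth_atlas ::
    "('a::topological_space, 'v::real_normed_vector) chart set \<Rightarrow> bool" where
  "smooth_atlas charts \<longleftrightarrow>
     (\<forall>c\<in>charts. open (fst c) \<and> open (snd c ` fst c) \<and>
        homeomorphism (fst c) (snd c ` fst c) (snd c) (chart_inv c)) \<and>
     (\<Union>c\<in>charts. fst c) = UNIV \<and>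
     (\<forall>c\<in>charts. \<forall>c'\<in>charts. smooth_on (snd c' \<circ> chart_inv c) (snd c ` (fst c \<inter> fst c')))"

text \<open>The manifold is the whole type \<open>'a\<close>, with the smooth structure given by the atlas
  \<open>charts\<close>.  Its tangent space at \<open>x\<close> is represented by the model space \<open>real^'m\<close> by
  means of the coordinates of one chosen chart \<open>chart_at x\<close> around \<open>x\<close>; in any other chart
  the coordinates of a tangent vector are obtained through the derivative of the transition
  map.  Complexified tangent vectors are elements of \<open>complex^'m\<close>.\<close>

locale atlas =
  fixes charts :: "('a::topological_space, real^'m) chart set"
begin

definition chart_at :: "'a \<Rightarrow> ('a, real^'m) chart" where
  "chart_at x = (SOME c. c \<in> charts \<and> x \<in> fst c)"

text \<open>Change of coordinates of tangent vectors at \<open>x\<close> from the chart \<open>c\<close> to the chart \<open>c'\<close>.\<close>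

definition tangent_change ::
    "('a, real^'m) chart \<Rightarrow> ('a, real^'m) chart \<Rightarrow> 'a \<Rightarrow> real^'m \<Rightarrow> real^'m" where
  "tangent_change c c' x = frechet_derivative (snd c' \<circ> chart_inv c) (at (snd c x))"

text \<open>Coordinate expressions of forms and of complex vector fields in a chart.\<close>

definition form_in_chart ::
    "('a, real^'m) chart \<Rightarrow> ('a, real^'m, 'b) form \<Rightarrow> (real^'m, real^'m, 'b) form" where
  "form_in_chart c \<omega> y vs =
     (let x = chart_inv c y in \<omega> x (map (tangent_change c (chart_at x) x) vs))"

definition field_in_chart ::
    "('a, real^'m) chart \<Rightarrow> ('a \<Rightarrow> complex^'m) \<Rightarrow> real^'m \<Rightarrow> complex^'m" where
  "field_in_chart c Z y =
     (let x = chart_inv c y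
      in complex_extension (vec_of_real \<circ> tangent_change (chart_at x) c x) (Z x))"

text \<open>Smooth \<open>k\<close>-forms on the open set \<open>U\<close>.  The values outside \<open>U\<close> are irrelevant.\<close>

definition forms_on :: "'a set \<Rightarrow> int \<Rightarrow> ('a, real^'m, 'b::real_normed_vector) form set" where
  "forms_on U k =
     {\<omega>. (\<forall>x\<in>U. alternating_form k (\<omega> x)) \<and>
         (\<forall>c\<in>charts. \<forall>vs. smooth_on (\<lambda>y. form_in_chart c \<omega> y vs) (snd c ` (fst c \<inter> U)))}"

definition ext_deriv ::
    "('a, real^'m, 'b::real_normed_vector) form \<Rightarrow> ('a, real^'m, 'b) form" where
  "ext_deriv \<omega> x =
     euclidean_ext_deriv (form_in_chart (chart_at x) \<omega>) (snd (chart_at x) x)"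

definition smooth_field_on :: "'a set \<Rightarrow> ('a \<Rightarrow> complex^'m) \<Rightarrow> bool" where
  "smooth_field_on U Z \<longleftrightarrow>
     (\<forall>c\<in>charts. smooth_on (field_in_chart c Z) (snd c ` (fst c \<inter> U)))"

definition lie_bracket ::
    "('a \<Rightarrow> complex^'m) \<Rightarrow> ('a \<Rightarrow> complex^'m) \<Rightarrow> 'a \<Rightarrow> complex^'m" where
  "lie_bracket Z W x =
     (let c = chart_at x; y = snd c x
      in complex_extension (frechet_derivative (field_in_chart c W) (at y)) (Z x)
         - complex_extension (frechet_derivative (field_in_chart c Z) (at y)) (W x))"

end


section \<open>CR manifolds\<close>

locale CR_data = atlas charts
  for charts :: "('a::{t2_space, second_countable_topology}, real^'m) chart set" +
  fixes n :: nat and T10 :: "'a \<Rightarrow> (complex^'m) set"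
begin

definition T01 :: "'a \<Rightarrow> (complex^'m) set" where
  "T01 x = vec_cnj ` T10 x"

definition H :: "'a \<Rightarrow> (real^'m) set" where
  "H x = {vec_Re (Z + W) |Z W. Z \<in> T10 x \<and> W \<in> T01 x}"

definition complex_distribution :: bool where
  "complex_distribution \<longleftrightarrow>
     (\<forall>x. vec.subspace (T10 x) \<and> vec.dim (T10 x) = n) \<and>
     (\<forall>x. \<exists>U (Z :: nat \<Rightarrow> 'a \<Rightarrow> complex^'m). open U \<and> x \<in> U \<and>
        (\<forall>i<n. smooth_field_on U (Z i)) \<and>
        (\<forall>y\<in>U. T10 y = vec.span ((\<lambda>i. Z i y) ` {..<n})))"

definition involutive :: bool where
  "involutive \<longleftrightarrow>
     (\<forall>U Z W. open U \<and> smooth_field_on U Z \<and> smooth_field_on U W \<and>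
        (\<forall>x\<in>U. Z x \<in> T10 x \<and> W x \<in> T10 x) \<longrightarrow> (\<forall>x\<in>U. lie_bracket Z W x \<in> T10 x))"

definition contact_form :: "'a set \<Rightarrow> ('a, real^'m, real) form \<Rightarrow> bool" where
  "contact_form U \<theta> \<longleftrightarrow>
     open U \<and> \<theta> \<in> forms_on U 1 \<and> (\<forall>x\<in>U. {v. \<theta> x [v] = 0} = H x)"

definition reeb_vector :: "('a, real^'m, real) form \<Rightarrow> 'a \<Rightarrow> real^'m \<Rightarrow> bool" where
  "reeb_vector \<theta> x T \<longleftrightarrow> \<theta> x [T] = 1 \<and> (\<forall>v. ext_deriv \<theta> x [T, v] = 0)"

definition levi_form ::
    "('a, real^'m, real) form \<Rightarrow> 'a \<Rightarrow> complex^'m \<Rightarrow> complex^'m \<Rightarrow> complex" where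
  "levi_form \<theta> x Z W =
     - \<i> * multi_extension (\<lambda>vs. complex_of_real (ext_deriv \<theta> x vs)) [Z, vec_cnj W]"

definition levi_nondegenerate :: bool where
  "levi_nondegenerate \<longleftrightarrow>
     (\<forall>U \<theta>. contact_form U \<theta> \<longrightarrow>
        (\<forall>x\<in>U. (\<forall>Z\<in>T10 x. \<forall>W\<in>T10 x. levi_form \<theta> x W Z = cnj (levi_form \<theta> x Z W)) \<and>
               (\<forall>Z\<in>T10 x. (\<forall>W\<in>T10 x. levi_form \<theta> x Z W = 0) \<longrightarrow> Z = 0)))"

end

locale CR_manifold = CR_data charts n T10
  for charts :: "('a::{t2_space, second_countable_topology}, real^'m) chart set"
    and n :: nat and T10 :: "'a \<Rightarrow> (complex^'m) set" +
  assumes dimension: "CARD('m) = 2 * n + 1"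
    and connected_manifold: "connected (UNIV :: 'a set)"
    and atlas: "smooth_atlas charts"
    and T10_distribution: "complex_distribution"
    and T10_T01_disjoint: "\<And>x. T10 x \<inter> T01 x = {0}"
    and T10_involutive: "involutive"
    and nondegenerate: "levi_nondegenerate"
begin


section \<open>The Rumin complex\<close>

definition rumin :: "nat \<Rightarrow> ('a, real^'m, real) form set" where
  "rumin k =
     {\<omega> \<in> forms_on UNIV (int k). \<forall>U \<theta>. contact_form U \<theta> \<longrightarrow>
        (\<forall>x\<in>U.
          if k \<le> n
          then (\<theta> \<^bold>\<and> \<omega> \<^bold>\<and> wedge_power (ext_deriv \<theta>) (n + 1 - k)) x = 0 \<and>
               (\<theta> \<^bold>\<and> ext_deriv \<omega> \<^bold>\<and> wedge_power (ext_deriv \<theta>) (n - k)) x = 0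
          else (\<theta> \<^bold>\<and> \<omega>) x = 0 \<and> (\<theta> \<^bold>\<and> ext_deriv \<omega>) x = 0)}"

definition rumin_complex :: "nat \<Rightarrow> ('a, real^'m, complex) form set" where
  "rumin_complex k = {\<omega>. form_Re \<omega> \<in> rumin k \<and> form_Im \<omega> \<in> rumin k}"

text \<open>The value \<open>f\<close> at \<open>x\<close> of a form of degree \<open>p + q\<close> is of type \<open>(p, q)\<close> on \<open>H \<otimes> \<complex>\<close>,
  the direct sum of \<open>T10\<close> and \<open>T01\<close>, if it lies in the summand
  \<open>\<Lambda>\<^sup>p(T10)\<^sup>* \<otimes> \<Lambda>\<^sup>q(T01)\<^sup>*\<close>, i.e. vanishes on \<open>a\<close> vectors of \<open>T10\<close> and
  \<open>b\<close> vectors of \<open>T01\<close> whenever \<open>a + b = p + q\<close> and \<open>(a, b) \<noteq> (p, q)\<close>.\<close>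

definition has_type_on_H :: "nat \<Rightarrow> nat \<Rightarrow> 'a \<Rightarrow> ((real^'m) list \<Rightarrow> complex) \<Rightarrow> bool" where
  "has_type_on_H p q x f \<longleftrightarrow>
     (\<forall>Zs Ws. set Zs \<subseteq> T10 x \<and> set Ws \<subseteq> T01 x \<and> length Zs + length Ws = p + q \<and>
        (length Zs, length Ws) \<noteq> (p, q) \<longrightarrow> multi_extension f (Zs @ Ws) = 0)"

text \<open>Note that \<open>p + q \<ge> n + 1\<close> and \<open>q \<le> n\<close> force \<open>p \<ge> 1\<close>, so \<open>p - 1\<close> is not truncated.\<close>

definition rumin_pq :: "nat \<Rightarrow> nat \<Rightarrow> ('a, real^'m, complex) form set" where
  "rumin_pq p q =
     (if p \<le> n + 1 \<and> q \<le> n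
      then {\<omega> \<in> rumin_complex (p + q).
              if p + q \<le> n then \<forall>x. has_type_on_H p q x (\<omega> x)
              else \<forall>U \<theta> x T. contact_form U \<theta> \<and> x \<in> U \<and> reeb_vector \<theta> x T \<longrightarrow>
                     has_type_on_H (p - 1) q x (\<lambda>vs. \<omega> x (T # vs))}
      else {0})"

text \<open>The projections of the direct sum decomposition of \<open>rumin_complex (p + q)\<close>.\<close>

definition proj_pq :: "nat \<Rightarrow> nat \<Rightarrow> ('a, real^'m, complex) form \<Rightarrow> ('a, real^'m, complex) form" where
  "proj_pq p q \<omega> =
     (THE \<eta>. \<exists>c. (\<forall>i\<le>p + q. c i \<in> rumin_pq i (p + q - i)) \<and>
                 \<omega> = (\<Sum>i\<le>p + q. c i) \<and> \<eta> = c p)"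

definition dbar :: "nat \<Rightarrow> nat \<Rightarrow> ('a, real^'m, complex) form \<Rightarrow> ('a, real^'m, complex) form" where
  "dbar p q \<omega> = proj_pq p (q + 1) (ext_deriv \<omega>)"


section \<open>Cohomology\<close>

definition cocycles :: "nat \<Rightarrow> nat \<Rightarrow> ('a, real^'m, complex) form set" where
  "cocycles p q = {\<omega> \<in> rumin_pq p q. dbar p q \<omega> = 0}"

definition coboundaries :: "nat \<Rightarrow> nat \<Rightarrow> ('a, real^'m, complex) form set" where
  "coboundaries p q = (if q = 0 then {0} else dbar p (q - 1) ` rumin_pq p (q - 1))"

definition cohomologous :: "nat \<Rightarrow> nat \<Rightarrow> ('a, real^'m, complex) form rel" where
  "cohomologous p q =
     {(\<omega>, \<omega>'). \<omega> \<in> cocycles p q \<and> \<omega>' \<in> cocycles p q \<and> \<omega> - \<omega>' \<in> coboundaries p q}"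

definition cohomology :: "nat \<Rightarrow> nat \<Rightarrow> ('a, real^'m, complex) form set set" where
  "cohomology p q = cocycles p q // cohomologous p q"

definition cohomology_class ::
    "nat \<Rightarrow> nat \<Rightarrow> ('a, real^'m, complex) form \<Rightarrow> ('a, real^'m, complex) form set" where
  "cohomology_class p q \<omega> = cohomologous p q `` {\<omega>}"


section \<open>The operators \<open>\<Gamma>\<close> and \<open>\<pi>\<close>, and the product\<close>

text \<open>The form \<open>\<Gamma> \<omega>\<close> for \<open>\<omega>\<close> of degree \<open>k\<close>, glued from its descriptions on the domains of
  the local contact forms.\<close>

definition Gamma :: "nat \<Rightarrow> ('a, real^'m, real) form \<Rightarrow> ('a, real^'m, real) form" where
  "Gamma k \<omega> =
     (THE \<eta>. \<eta> \<in> forms_on UNIV (int k - 1) \<and>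
        (\<forall>U \<theta>. contact_form U \<theta> \<longrightarrow>
          (if k \<le> n
           then \<exists>\<xi>\<in>forms_on U (int k - 2). \<forall>x\<in>U.
                  (\<theta> \<^bold>\<and> \<omega> \<^bold>\<and> wedge_power (ext_deriv \<theta>) (n + 1 - k)) x =
                    (\<theta> \<^bold>\<and> \<xi> \<^bold>\<and> wedge_power (ext_deriv \<theta>) (n + 2 - k)) x \<and>
                  \<eta> x = (\<theta> \<^bold>\<and> \<xi>) x
           else \<exists>\<xi>\<in>forms_on U (2 * int n - int k). \<forall>x\<in>U.
                  (\<theta> \<^bold>\<and> \<omega>) x = (\<theta> \<^bold>\<and> \<xi> \<^bold>\<and> wedge_power (ext_deriv \<theta>) (k - n)) x \<and>
                  \<eta> x = (\<theta> \<^bold>\<and> \<xi> \<^bold>\<and> wedge_power (ext_deriv \<theta>) (k - n - 1)) x)))"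

definition rumin_projection :: "nat \<Rightarrow> ('a, real^'m, real) form \<Rightarrow> ('a, real^'m, real) form" where
  "rumin_projection k \<omega> = \<omega> - ext_deriv (Gamma k \<omega>) - Gamma (k + 1) (ext_deriv \<omega>)"

definition rumin_projection_complex ::
    "nat \<Rightarrow> ('a, real^'m, complex) form \<Rightarrow> ('a, real^'m, complex) form" where
  "rumin_projection_complex k \<omega> =
     form_Complex (rumin_projection k (form_Re \<omega>)) (rumin_projection k (form_Im \<omega>))"

text \<open>The product on representatives of bidegrees \<open>(p, q)\<close> and \<open>(r, s)\<close>, and on classes.  The
  union has only one distinct member exactly when the product is well-defined.\<close>

definition form_product :: "nat \<Rightarrow> nat \<Rightarrow> nat \<Rightarrow> nat \<Rightarrow>
    ('a, real^'m, complex) form \<Rightarrow> ('a, real^'m, complex) form \<Rightarrow> ('a, real^'m, complex) form" where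
  "form_product p q r s \<omega> \<tau> =
     proj_pq (p + r) (q + s) (rumin_projection_complex (p + q + r + s) (\<omega> \<^bold>\<and> \<tau>))"

definition cohomology_product :: "nat \<Rightarrow> nat \<Rightarrow> nat \<Rightarrow> nat \<Rightarrow>
    ('a, real^'m, complex) form set \<Rightarrow> ('a, real^'m, complex) form set \<Rightarrow>
    ('a, real^'m, complex) form set" where
  "cohomology_product p q r s X Y =
     (\<Union>\<omega>\<in>X. \<Union>\<tau>\<in>Y. cohomology_class (p + r) (q + s) (form_product p q r s \<omega> \<tau>))"

end

end

theory Submission
  imports Defs
begin

text \<open>Let \<open>F q\<close> consist of the complex forms that vanish when contracted with \<open>q\<close> vectors of \<open>T01\<close>.
  Then \<open>F (a + 1) \<and> F (b + 1) \<subseteq> F (a + b + 1)\<close>, by integrability \<open>d (F q) \<subseteq> F (q + 1)\<close>, and by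
  the algebra of the Lefschetz operator \<open>\<Gamma> (F q) \<subseteq> F (q - 1)\<close>. Rumin forms of type \<open>(p, q)\<close> lie in
  \<open>F (q + 1)\<close>, and the projection to type \<open>(p, q)\<close> changes a Rumin form in \<open>F (q + 1)\<close> by an element of
  \<open>F q\<close>. Hence, modulo \<open>F q\<close>, cocycles are the \<open>w \<in> F (q + 1)\<close> with \<open>dw \<in> F (q + 1)\<close>, and coboundaries
  are the elements of \<open>F q + d (F q)\<close>. Modulo the latter \<open>\<pi>w = w - d\<Gamma>w - \<Gamma>dw\<close> is congruent to \<open>w\<close>, so the
  product on cohomology is induced by the wedge product.\<close>

section \<open>Smooth functions\<close>

text \<open>Types of Rumin forms are read off on H only, and the \<theta>-component is recovered by
  differentiation, so neither the differential nor the wedge product respects them. The filtration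
  does not see this: it is defined without a contact form and is multiplicative, and so
  associativity of the wedge product is enough. The shifts by one have a simple origin.
  Differentiation can add one (0,1)-covector, while \<Gamma> divides by d\<theta>, which is of type
  (1,1), and so loses one. Thus for w and dw in F (q + 1) both \<Gamma>w and \<Gamma>dw lie in F q,
  which is why the coboundary space needs both F q and d (F q). Two obstacles shape the remaining
  work. Contact forms are used only locally, so \<Gamma> and the decomposition into types are
  constructed near each point and glued by uniqueness. And the filtration has to be split into types
  smoothly: this is done with the derivation that counts arguments in T01 along the Reeb splitting.
  Its eigenspaces on the filtration steps are separated by scalar factors only, and it multiplies
  d\<theta> by 1 and kills \<theta>, so it is compatible with the Lefschetz equation that defines
  \<Gamma>.\<close>

abbreviation (input) DD :: "'v::real_normed_vector \<Rightarrow> ('v \<Rightarrow> 'w::real_normed_vector) \<Rightarrow> 'v \<Rightarrow> 'w" where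
  "DD v f x \<equiv> frechet_derivative f (at x) v"

lemma has_derivative_cong_open:
  assumes "open S" "x \<in> S" "\<And>y. y \<in> S \<Longrightarrow> f y = g y"
  shows "(f has_derivative D) (at x) \<longleftrightarrow> (g has_derivative D) (at x)"
  using has_derivative_transform_within_open[of _ D x UNIV S] assms by metis

lemma frechet_derivative_cong_open:
  assumes "open S" "x \<in> S" "\<And>y. y \<in> S \<Longrightarrow> f y = g y"
  shows "frechet_derivative f (at x) = frechet_derivative g (at x)"
  unfolding frechet_derivative_def using has_derivative_cong_open[OF assms] by simp

lemma differentiable_cong_open:
  assumes "open S" "x \<in> S" "\<And>y. y \<in> S \<Longrightarrow> f y = g y"
  shows "f differentiable (at x) \<longleftrightarrow> g differentiable (at x)"
  unfolding differentiable_def using has_derivative_cong_open[OF assms] by simp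

lemma Ck_on_cong:
  assumes "open S" "\<And>y. y \<in> S \<Longrightarrow> f y = g y"
  shows "Ck_on k f S \<longleftrightarrow> Ck_on k g S"
  using assms(2)
proof (induction k arbitrary: f g)
  case 0
  then show ?case by (simp cong: continuous_on_cong)
next
  case (Suc k)
  have "f differentiable (at x) \<longleftrightarrow> g differentiable (at x)" if "x \<in> S" for x
    by (rule differentiable_cong_open[OF assms(1) that Suc.prems])
  moreover have "Ck_on k (DD v f) S \<longleftrightarrow>
      Ck_on k (DD v g) S" for v
    by (intro Suc.IH) (simp add: frechet_derivative_cong_open[OF assms(1) _ Suc.prems])
  ultimately show ?case by auto
qed

lemma Ck_on_Suc_imp: "Ck_on (Suc k) f S \<Longrightarrow> Ck_on k f S"
proof (induction k arbitrary: f)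
  case 0
  then show ?case
    by (auto intro!: continuous_at_imp_continuous_on differentiable_imp_continuous_within)
next
  case (Suc k)
  then show ?case by (metis Ck_on.simps(2))
qed

lemma Ck_on_subset: "Ck_on k f S \<Longrightarrow> T \<subseteq> S \<Longrightarrow> Ck_on k f T"
  by (induction k arbitrary: f) (auto intro: continuous_on_subset)

lemma Ck_on_local:
  assumes "\<And>x. x \<in> S \<Longrightarrow> \<exists>T. open T \<and> x \<in> T \<and> Ck_on k f T"
  shows "Ck_on k f S"
  using assms
proof (induction k arbitrary: f)
  case 0
  show ?case unfolding Ck_on.simps
  proof (rule continuous_at_imp_continuous_on, rule ballI)
    fix x assume "x \<in> S"
    then obtain T where "open T" "x \<in> T" "continuous_on T f" using 0[of x] by auto
    then show "isCont f x" by (simp add: continuous_on_eq_continuous_at)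
  qed
next
  case (Suc k)
  show ?case unfolding Ck_on.simps
  proof (intro conjI ballI allI)
    show "f differentiable (at x)" if "x \<in> S" for x
      using Suc.prems[OF that] by auto
    show "Ck_on k (DD v f) S" for v
    proof (rule Suc.IH)
      fix x assume "x \<in> S"
      from Suc.prems[OF this] show "\<exists>T. open T \<and> x \<in> T \<and> Ck_on k (DD v f) T"
        by auto
    qed
  qed
qed

lemma Ck_on_const: "Ck_on k (\<lambda>x. c) S"
  by (induction k arbitrary: c) auto

lemma Ck_on_add:
  assumes "open S"
  shows "Ck_on k f S \<Longrightarrow> Ck_on k g S \<Longrightarrow> Ck_on k (\<lambda>x. f x + g x) S"
proof (induction k arbitrary: f g)
  case (Suc k)
  have d: "((\<lambda>x. f x + g x) has_derivative
      (\<lambda>v. DD v f x + DD v g x)) (at x)" if "x \<in> S" for x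
    using Suc.prems that by (intro has_derivative_add) (auto simp: frechet_derivative_works)
  have "Ck_on k (\<lambda>x. DD v (\<lambda>x. f x + g x) x) S" for v
  proof -
    have "Ck_on k (\<lambda>x. DD v f x + DD v g x) S"
      using Suc by auto
    then show ?thesis
      using frechet_derivative_at[OF d] by (subst Ck_on_cong[OF assms]) (auto simp: fun_eq_iff)
  qed
  then show ?case using d by (auto simp: differentiable_def)
qed (auto intro: continuous_intros)

text \<open>The Leibniz rule writes the derivative as a sum of terms of the same bilinear shape, so
  one induction serves products and scalar multiples alike.\<close>

lemma Ck_on_bilinear:
  assumes "open S" "bounded_bilinear b"
  shows "Ck_on k f S \<Longrightarrow> Ck_on k g S \<Longrightarrow> Ck_on k (\<lambda>x. b (f x) (g x)) S"
proof (induction k arbitrary: f g)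
  case 0
  then show ?case using bounded_bilinear.continuous_on[OF assms(2)] by auto
next
  case (Suc k)
  have d: "((\<lambda>x. b (f x) (g x)) has_derivative
      (\<lambda>v. b (f x) (DD v g x) + b (DD v f x) (g x))) (at x)"
    if "x \<in> S" for x
    using Suc.prems that
    by (intro bounded_bilinear.FDERIV[OF assms(2)]) (auto simp: frechet_derivative_works)
  have "Ck_on k (\<lambda>x. DD v (\<lambda>x. b (f x) (g x)) x) S" for v
  proof -
    have "Ck_on k (\<lambda>x. b (f x) (DD v g x) + b (DD v f x) (g x)) S"
      using Suc.prems Ck_on_Suc_imp[OF Suc.prems(1)] Ck_on_Suc_imp[OF Suc.prems(2)]
      by (intro Ck_on_add[OF assms(1)] Suc.IH) auto
    then show ?thesis
      using frechet_derivative_at[OF d] by (subst Ck_on_cong[OF assms(1)]) (auto simp: fun_eq_iff)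
  qed
  then show ?case using d by (auto simp: differentiable_def)
qed

lemma Ck_on_linear:
  assumes "open S" "bounded_linear L" "Ck_on k f S"
  shows "Ck_on k (\<lambda>x. L (f x)) S"
  using assms(3)
proof (induction k arbitrary: f)
  case 0
  then show ?case using bounded_linear.continuous_on[OF assms(2)] by auto
next
  case (Suc k)
  have d: "((\<lambda>x. L (f x)) has_derivative (\<lambda>v. L (DD v f x))) (at x)"
    if "x \<in> S" for x
    using Suc.prems that
    by (intro bounded_linear.has_derivative[OF assms(2)]) (auto simp: frechet_derivative_works)
  have "Ck_on k (\<lambda>x. DD v (\<lambda>x. L (f x)) x) S" for v
  proof -
    have "Ck_on k (\<lambda>x. L (DD v f x)) S" using Suc by auto
    then show ?thesis
      using frechet_derivative_at[OF d] by (subst Ck_on_cong[OF assms(1)]) (auto simp: fun_eq_iff)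
  qed
  then show ?case using d by (auto simp: differentiable_def)
qed

lemma Ck_on_sum:
  assumes "open S" "\<And>i. i \<in> I \<Longrightarrow> Ck_on k (f i) S"
  shows "Ck_on k (\<lambda>x. \<Sum>i\<in>I. f i x) S"
  using assms(2)
  by (induction I rule: infinite_finite_induct) (auto simp: Ck_on_const intro!: Ck_on_add[OF assms(1)])

text \<open>\<open>Ck_on\<close> controls derivatives in fixed directions only. In the chain rule
  the direction moves with the point, and this expansion turns it into smooth coefficients times
  derivatives in fixed directions.\<close>

lemma frechet_derivative_basis:
  fixes g :: "'u::euclidean_space \<Rightarrow> 'w::real_normed_vector"
  assumes "g differentiable (at y)"
  shows "DD v g y = (\<Sum>b\<in>Basis. (v \<bullet> b) *\<^sub>R DD b g y)"
proof -
  have l: "linear (frechet_derivative g (at y))" by (rule linear_frechet_derivative[OF assms])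
  have "DD v g y = DD (\<Sum>b\<in>Basis. (v \<bullet> b) *\<^sub>R b) g y"
    by (simp add: euclidean_representation)
  then show ?thesis by (simp add: linear_sum[OF l] linear_cmul[OF l])
qed

lemma Ck_on_compose:
  fixes g :: "'u::euclidean_space \<Rightarrow> 'w::real_normed_vector" and f :: "'v::real_normed_vector \<Rightarrow> 'u"
  assumes "open S" "open T" "f ` S \<subseteq> T"
  shows "Ck_on k g T \<Longrightarrow> Ck_on k f S \<Longrightarrow> Ck_on k (\<lambda>x. g (f x)) S"
proof (induction k arbitrary: g)
  case 0
  then show ?case using continuous_on_compose2[OF _ _ assms(3)] by simp
next
  case (Suc k)
  have d: "((\<lambda>x. g (f x)) has_derivative
      (\<lambda>v. DD (frechet_derivative f (at x) v) g (f x))) (at x)" if "x \<in> S" for x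
  proof (rule has_derivative_compose[where f = f and g = g])
    show "(f has_derivative frechet_derivative f (at x)) (at x)"
      using Suc.prems(2) that by (simp add: frechet_derivative_works)
    show "(g has_derivative frechet_derivative g (at (f x))) (at (f x))"
      using Suc.prems(1) that assms(3) by (simp add: frechet_derivative_works image_subset_iff)
  qed
  have "Ck_on k (\<lambda>x. DD v (\<lambda>x. g (f x)) x) S" for v
  proof -
    have "Ck_on k (\<lambda>x. \<Sum>b\<in>Basis. (DD v f x \<bullet> b) *\<^sub>R
        DD b g (f x)) S"
      using Suc.prems Ck_on_Suc_imp[OF Suc.prems(2)]
      by (intro Ck_on_sum[OF assms(1)] Ck_on_bilinear[OF assms(1) bounded_bilinear_scaleR] Suc.IH
          Ck_on_linear[OF assms(1) bounded_linear_inner_left]) auto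
    moreover have "DD v (\<lambda>x. g (f x)) x =
        (\<Sum>b\<in>Basis. (DD v f x \<bullet> b) *\<^sub>R DD b g (f x))"
      if "x \<in> S" for x
    proof -
      have "g differentiable (at (f x))" using Suc.prems(1) assms(3) that by auto
      from frechet_derivative_basis[OF this, of "DD v f x"]
      show ?thesis using frechet_derivative_at[OF d[OF that], THEN fun_cong, of v] by simp
    qed
    ultimately show ?thesis by (subst Ck_on_cong[OF assms(1)])
  qed
  moreover have "(\<lambda>x. g (f x)) differentiable (at x)" if "x \<in> S" for x
    using d[OF that] unfolding differentiable_def by blast
  ultimately show ?case by simp
qed

lemma Ck_on_inverse:
  fixes f :: "'v::real_normed_vector \<Rightarrow> 'w::real_normed_field"
  assumes "open S" "\<And>x. x \<in> S \<Longrightarrow> f x \<noteq> 0" "Ck_on k f S"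
  shows "Ck_on k (\<lambda>x. inverse (f x)) S"
  using assms(3)
proof (induction k)
  case 0
  then show ?case using assms(2) continuous_on_inverse[of S f] by auto
next
  case (Suc k)
  have d: "((\<lambda>x. inverse (f x)) has_derivative
      (\<lambda>v. - (inverse (f x) * DD v f x * inverse (f x)))) (at x)" if "x \<in> S" for x
  proof (rule Deriv.has_derivative_inverse)
    show "f x \<noteq> 0" by (rule assms(2)[OF that])
    show "(f has_derivative frechet_derivative f (at x)) (at x)"
      using Suc.prems that by (simp add: frechet_derivative_works)
  qed
  have "Ck_on k (\<lambda>x. DD v (\<lambda>x. inverse (f x)) x) S" for v
  proof -
    have "Ck_on k (\<lambda>x. - (inverse (f x) * DD v f x * inverse (f x))) S"
    proof (rule Ck_on_linear[OF assms(1) bounded_linear_minus[OF bounded_linear_ident]])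
      have i: "Ck_on k (\<lambda>x. inverse (f x)) S" by (rule Suc.IH[OF Ck_on_Suc_imp[OF Suc.prems]])
      have "Ck_on k (DD v f) S" using Suc.prems by simp
      from Ck_on_bilinear[OF assms(1) bounded_bilinear_mult Ck_on_bilinear[OF assms(1) bounded_bilinear_mult i this] i]
      show "Ck_on k (\<lambda>x. inverse (f x) * DD v f x * inverse (f x)) S" .
    qed
    moreover have "DD v (\<lambda>x. inverse (f x)) x =
        - (inverse (f x) * DD v f x * inverse (f x))" if "x \<in> S" for x
      using frechet_derivative_at[OF d[OF that], symmetric] by (rule fun_cong)
    ultimately show ?thesis by (subst Ck_on_cong[OF assms(1)])
  qed
  moreover have "(\<lambda>x. inverse (f x)) differentiable (at x)" if "x \<in> S" for x
    using d[OF that] unfolding differentiable_def by blast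
  ultimately show ?case by simp
qed

lemma smooth_on_cong:
  "open S \<Longrightarrow> (\<And>y. y \<in> S \<Longrightarrow> f y = g y) \<Longrightarrow> smooth_on f S \<longleftrightarrow> smooth_on g S"
  unfolding smooth_on_def using Ck_on_cong by blast

lemma smooth_on_subset: "smooth_on f S \<Longrightarrow> T \<subseteq> S \<Longrightarrow> smooth_on f T"
  unfolding smooth_on_def using Ck_on_subset by blast

lemma smooth_on_local:
  "(\<And>x. x \<in> S \<Longrightarrow> \<exists>T. open T \<and> x \<in> T \<and> smooth_on f T) \<Longrightarrow> smooth_on f S"
  unfolding smooth_on_def using Ck_on_local by meson

lemma smooth_on_const [simp]: "smooth_on (\<lambda>x. c) S"
  unfolding smooth_on_def using Ck_on_const by blast

lemma smooth_on_add: "open S \<Longrightarrow> smooth_on f S \<Longrightarrow> smooth_on g S \<Longrightarrow> smooth_on (\<lambda>x. f x + g x) S"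
  unfolding smooth_on_def using Ck_on_add by blast

lemma smooth_on_bilinear:
  "open S \<Longrightarrow> bounded_bilinear b \<Longrightarrow> smooth_on f S \<Longrightarrow> smooth_on g S \<Longrightarrow> smooth_on (\<lambda>x. b (f x) (g x)) S"
  unfolding smooth_on_def using Ck_on_bilinear by blast

lemma smooth_on_linear:
  "open S \<Longrightarrow> bounded_linear L \<Longrightarrow> smooth_on f S \<Longrightarrow> smooth_on (\<lambda>x. L (f x)) S"
  unfolding smooth_on_def using Ck_on_linear by blast

lemma smooth_on_sum:
  "open S \<Longrightarrow> (\<And>i. i \<in> I \<Longrightarrow> smooth_on (f i) S) \<Longrightarrow> smooth_on (\<lambda>x. \<Sum>i\<in>I. f i x) S"
  unfolding smooth_on_def by (simp add: Ck_on_sum)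

lemma smooth_on_mult:
  fixes f :: "'v::real_normed_vector \<Rightarrow> 'w::real_normed_algebra"
  shows "open S \<Longrightarrow> smooth_on f S \<Longrightarrow> smooth_on g S \<Longrightarrow> smooth_on (\<lambda>x. f x * g x) S"
  using smooth_on_bilinear[OF _ bounded_bilinear_mult] .

lemma smooth_on_prod:
  fixes f :: "'i \<Rightarrow> 'v::real_normed_vector \<Rightarrow> 'w::real_normed_field"
  assumes "open S" "\<And>i. i \<in> I \<Longrightarrow> smooth_on (f i) S"
  shows "smooth_on (\<lambda>x. \<Prod>i\<in>I. f i x) S"
  using assms(2) by (induction I rule: infinite_finite_induct) (auto intro!: smooth_on_mult[OF assms(1)])

lemma smooth_on_uminus: "open S \<Longrightarrow> smooth_on f S \<Longrightarrow> smooth_on (\<lambda>x. - f x) S"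
  by (rule smooth_on_linear[OF _ bounded_linear_minus[OF bounded_linear_ident]])

lemma smooth_on_diff: "open S \<Longrightarrow> smooth_on f S \<Longrightarrow> smooth_on g S \<Longrightarrow> smooth_on (\<lambda>x. f x - g x) S"
  using smooth_on_add[of S f "\<lambda>x. - g x"] smooth_on_uminus[of S g] by simp

lemma smooth_on_compose:
  fixes g :: "'u::euclidean_space \<Rightarrow> 'w::real_normed_vector"
  shows "open S \<Longrightarrow> open T \<Longrightarrow> f ` S \<subseteq> T \<Longrightarrow> smooth_on g T \<Longrightarrow> smooth_on f S \<Longrightarrow> smooth_on (\<lambda>x. g (f x)) S"
  unfolding smooth_on_def by (simp add: Ck_on_compose)

lemma smooth_on_inverse:
  fixes f :: "'v::real_normed_vector \<Rightarrow> 'w::real_normed_field"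
  shows "open S \<Longrightarrow> (\<And>x. x \<in> S \<Longrightarrow> f x \<noteq> 0) \<Longrightarrow> smooth_on f S \<Longrightarrow> smooth_on (\<lambda>x. inverse (f x)) S"
  unfolding smooth_on_def by (simp add: Ck_on_inverse)

lemma smooth_on_divide:
  fixes f :: "'v::real_normed_vector \<Rightarrow> 'w::real_normed_field"
  shows "open S \<Longrightarrow> (\<And>x. x \<in> S \<Longrightarrow> g x \<noteq> 0) \<Longrightarrow> smooth_on f S \<Longrightarrow> smooth_on g S \<Longrightarrow> smooth_on (\<lambda>x. f x / g x) S"
  unfolding divide_inverse by (intro smooth_on_mult smooth_on_inverse)

lemma smooth_on_imp_differentiable: "smooth_on f S \<Longrightarrow> x \<in> S \<Longrightarrow> f differentiable (at x)"
  unfolding smooth_on_def by (metis Ck_on.simps(2))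

lemma smooth_on_imp_continuous_on: "smooth_on f S \<Longrightarrow> continuous_on S f"
  unfolding smooth_on_def by (metis Ck_on.simps(1))

lemma smooth_on_frechet_derivative:
  "smooth_on f S \<Longrightarrow> smooth_on (DD v f) S"
  unfolding smooth_on_def by (metis Ck_on.simps(2))

lemma smooth_on_has_derivative:
  "smooth_on f S \<Longrightarrow> x \<in> S \<Longrightarrow> (f has_derivative frechet_derivative f (at x)) (at x)"
  using smooth_on_imp_differentiable frechet_derivative_works by blast

lemma smooth_on_vec:
  fixes f :: "'v::real_normed_vector \<Rightarrow> 'w::euclidean_space ^ 'm"
  assumes "open S" "\<And>i. smooth_on (\<lambda>x. f x $ i) S"
  shows "smooth_on f S"
proof -
  have "smooth_on (\<lambda>x. \<Sum>i\<in>UNIV. axis i (f x $ i)) S"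
  proof (intro smooth_on_sum[OF assms(1)] smooth_on_linear[OF assms(1) _ assms(2)])
    fix i :: 'm
    show "bounded_linear (axis i :: 'w \<Rightarrow> _)"
      by (rule linear_conv_bounded_linear[THEN iffD1], rule linearI) (auto simp: vec_eq_iff axis_def)
  qed
  moreover have "(\<Sum>i\<in>UNIV. axis i (f x $ i)) = f x" for x
    by (simp add: vec_eq_iff axis_def sum.delta)
  ultimately show ?thesis by simp
qed

lemma smooth_on_vec_nth:
  "open S \<Longrightarrow> smooth_on f S \<Longrightarrow> smooth_on (\<lambda>x. f x $ i) S"
  by (rule smooth_on_linear[OF _ bounded_linear_vec_nth])

subsection \<open>Symmetry of second derivatives\<close>

text \<open>The mean value theorem is applied twice: in direction \<open>u\<close> to the difference
  of \<open>f\<close> along the two parallel sides, then in direction \<open>v\<close> to the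
  derivative \<open>DD u f\<close>. The left side of the equation is symmetric in \<open>u\<close>
  and \<open>v\<close>, which is what the next lemma exploits.\<close>

lemma second_difference:
  fixes f :: "'v::real_normed_vector \<Rightarrow> real"
  assumes "smooth_on f S" "h > 0"
    and box: "\<And>s t. 0 \<le> s \<Longrightarrow> s \<le> h \<Longrightarrow> 0 \<le> t \<Longrightarrow> t \<le> h \<Longrightarrow> x + s *\<^sub>R u + t *\<^sub>R v \<in> S"
  shows "\<exists>s t. 0 \<le> s \<and> s \<le> h \<and> 0 \<le> t \<and> t \<le> h \<and>
     f (x + h *\<^sub>R u + h *\<^sub>R v) - f (x + h *\<^sub>R u) - f (x + h *\<^sub>R v) + f x =
     h * h * DD v (DD u f) (x + s *\<^sub>R u + t *\<^sub>R v)"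
proof -
  have line: "((\<lambda>s. g (a + s *\<^sub>R w)) has_real_derivative DD w g (a + s *\<^sub>R w)) (at s)"
    if "smooth_on g S" "a + s *\<^sub>R w \<in> S" for g :: "'v \<Rightarrow> real" and a w s
  proof -
    have "((\<lambda>s. a + s *\<^sub>R w) has_derivative (\<lambda>r. r *\<^sub>R w)) (at s)"
      by (auto intro!: derivative_eq_intros)
    from has_derivative_compose[OF this smooth_on_has_derivative[OF that]]
    have "((\<lambda>s. g (a + s *\<^sub>R w)) has_derivative (\<lambda>r. DD (r *\<^sub>R w) g (a + s *\<^sub>R w))) (at s)" .
    moreover have "DD (r *\<^sub>R w) g (a + s *\<^sub>R w) =
        DD w g (a + s *\<^sub>R w) * r" for r
      using linear_cmul[OF linear_frechet_derivative[OF smooth_on_imp_differentiable[OF that]]]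
      by (simp add: mult.commute)
    ultimately show ?thesis by (simp add: has_field_derivative_def)
  qed
  have "\<exists>s. 0 < s \<and> s < h \<and> (f (x + h *\<^sub>R v + h *\<^sub>R u) - f (x + h *\<^sub>R u)) - (f (x + h *\<^sub>R v + 0 *\<^sub>R u) - f (x + 0 *\<^sub>R u)) =
     (h - 0) * (DD u f (x + h *\<^sub>R v + s *\<^sub>R u) - DD u f (x + s *\<^sub>R u))"
  proof -
    have "((\<lambda>s. f (x + h *\<^sub>R v + s *\<^sub>R u) - f (x + s *\<^sub>R u)) has_real_derivative
      (DD u f (x + h *\<^sub>R v + s *\<^sub>R u) - DD u f (x + s *\<^sub>R u))) (at s)"
      if "0 \<le> s" "s \<le> h" for s
      using box[OF that, of h] box[OF that, of 0] assms(2)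
      by (intro DERIV_diff line assms(1)) (auto simp: algebra_simps)
    from MVT2[OF assms(2) this] show ?thesis by auto
  qed
  then obtain s where s: "0 < s" "s < h" and eq: "(f (x + h *\<^sub>R v + h *\<^sub>R u) - f (x + h *\<^sub>R u)) - (f (x + h *\<^sub>R v) - f x) =
     h * (DD u f (x + h *\<^sub>R v + s *\<^sub>R u) - DD u f (x + s *\<^sub>R u))"
    by auto
  have "\<exists>t. 0 < t \<and> t < h \<and> DD u f (x + s *\<^sub>R u + h *\<^sub>R v) -
      DD u f (x + s *\<^sub>R u + 0 *\<^sub>R v) =
      (h - 0) * DD v (DD u f) (x + s *\<^sub>R u + t *\<^sub>R v)"
  proof -
    have "((\<lambda>t. DD u f (x + s *\<^sub>R u + t *\<^sub>R v)) has_real_derivative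
       DD v (DD u f) (x + s *\<^sub>R u + t *\<^sub>R v)) (at t)"
      if "0 \<le> t" "t \<le> h" for t
      using box[of s t] s that
      by (intro line smooth_on_frechet_derivative[OF assms(1)]) auto
    from MVT2[OF assms(2) this] show ?thesis by auto
  qed
  then obtain t where t: "0 < t" "t < h" "DD u f (x + s *\<^sub>R u + h *\<^sub>R v) -
      DD u f (x + s *\<^sub>R u) =
      h * DD v (DD u f) (x + s *\<^sub>R u + t *\<^sub>R v)"
    by auto
  show ?thesis
    using s t eq by (intro exI[of _ s] exI[of _ t]) (auto simp: algebra_simps)
qed

text \<open>The symmetric second difference forces the two mixed derivatives to agree at a pair of
  points arbitrarily close to \<open>x\<close>; continuity does the rest.\<close>

lemma symmetric_second_derivative_real:
  fixes f :: "'v::real_normed_vector \<Rightarrow> real"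
  assumes "smooth_on f S" "open S" "x \<in> S"
  shows "DD v (DD u f) x =
         DD u (DD v f) x" (is "?A u v x = ?A v u x")
proof (rule ccontr)
  assume neq: "?A u v x \<noteq> ?A v u x"
  \<comment> \<open>Half the gap: values within \<open>e\<close> of the two distinct limits cannot
    coincide.\<close>
  define e where "e = \<bar>?A u v x - ?A v u x\<bar> / 2"
  have e: "e > 0" using neq by (simp add: e_def)
  have cont: "\<exists>d>0. \<forall>y\<in>S. dist y x < d \<longrightarrow> dist (?A u v y) (?A u v x) < e" for u v
    using smooth_on_imp_continuous_on[OF smooth_on_frechet_derivative[OF smooth_on_frechet_derivative[OF assms(1)]]]
      assms(3) e unfolding continuous_on_iff by blast
  obtain d1 where d1: "d1 > 0" "\<And>y. y \<in> S \<Longrightarrow> dist y x < d1 \<Longrightarrow> dist (?A u v y) (?A u v x) < e"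
    using cont by metis
  obtain d2 where d2: "d2 > 0" "\<And>y. y \<in> S \<Longrightarrow> dist y x < d2 \<Longrightarrow> dist (?A v u y) (?A v u x) < e"
    using cont by metis
  obtain d3 where d3: "d3 > 0" "\<And>y. dist y x < d3 \<Longrightarrow> y \<in> S"
    using assms(2,3) unfolding open_dist by blast
  define d where "d = min d1 (min d2 d3)"
  \<comment> \<open>Small enough that the whole parallelogram with sides \<open>h\<close> times
    \<open>u\<close> and \<open>v\<close> stays within distance \<open>d\<close> of
    \<open>x\<close>; the summand 1 covers the case where both vectors vanish.\<close>
  define h where "h = d / (2 * (norm u + norm v + 1))"
  have pos: "norm u + norm v + 1 > 0" by (smt (verit) norm_ge_zero)
  have d: "d > 0" using d1 d2 d3 by (simp add: d_def)
  have h: "h > 0" using d pos by (simp add: h_def)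
  have near: "dist (x + s *\<^sub>R a + t *\<^sub>R b) x < d"
    if "0 \<le> s" "s \<le> h" "0 \<le> t" "t \<le> h" "norm a + norm b = norm u + norm v" for s t a b
  proof -
    have "norm (s *\<^sub>R a + t *\<^sub>R b) \<le> s * norm a + t * norm b"
      using that by (metis abs_of_nonneg norm_scaleR norm_triangle_ineq)
    also have "\<dots> \<le> h * norm a + h * norm b"
      using that by (intro add_mono mult_right_mono) auto
    also have "\<dots> = h * (norm u + norm v)" using that by (simp add: distrib_left[symmetric])
    also have "\<dots> < h * (2 * (norm u + norm v + 1))"
      using h pos by (intro mult_strict_left_mono) (smt (verit) norm_ge_zero)+
    also have "\<dots> = d" using pos by (simp add: h_def)
    finally show ?thesis by (simp add: dist_norm add.assoc)
  qed
  have box: "x + s *\<^sub>R a + t *\<^sub>R b \<in> S"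
    if "0 \<le> s" "s \<le> h" "0 \<le> t" "t \<le> h" "norm a + norm b = norm u + norm v" for s t a b
    using near[OF that] d3 by (simp add: d_def)
  obtain s t where st: "0 \<le> s" "s \<le> h" "0 \<le> t" "t \<le> h"
     "f (x + h *\<^sub>R u + h *\<^sub>R v) - f (x + h *\<^sub>R u) - f (x + h *\<^sub>R v) + f x = h * h * ?A u v (x + s *\<^sub>R u + t *\<^sub>R v)"
    using second_difference[OF assms(1) h, of x u v] box by blast
  obtain s' t' where st': "0 \<le> s'" "s' \<le> h" "0 \<le> t'" "t' \<le> h"
     "f (x + h *\<^sub>R v + h *\<^sub>R u) - f (x + h *\<^sub>R v) - f (x + h *\<^sub>R u) + f x = h * h * ?A v u (x + s' *\<^sub>R v + t' *\<^sub>R u)"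
    using second_difference[OF assms(1) h, of x v u] box by (metis add.commute)
  have "h * h * ?A u v (x + s *\<^sub>R u + t *\<^sub>R v) = h * h * ?A v u (x + s' *\<^sub>R v + t' *\<^sub>R u)"
    using st(5) st'(5) by (simp add: algebra_simps)
  then have "?A u v (x + s *\<^sub>R u + t *\<^sub>R v) = ?A v u (x + s' *\<^sub>R v + t' *\<^sub>R u)" using h by simp
  moreover have "dist (?A u v (x + s *\<^sub>R u + t *\<^sub>R v)) (?A u v x) < e"
    using near[of s t u v] box[of s t u v] st d1 by (simp add: d_def)
  moreover have "dist (?A v u (x + s' *\<^sub>R v + t' *\<^sub>R u)) (?A v u x) < e"
    using near[of s' t' v u] box[of s' t' v u] st' d2 by (simp add: d_def add.commute)
  moreover have False if "a = b" "dist a c < \<bar>c - d\<bar> / 2" "dist b d < \<bar>c - d\<bar> / 2" for a b c d :: real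
    using that by (auto simp: dist_real_def abs_if split: if_splits)
  ultimately show False unfolding e_def by blast
qed

lemma symmetric_second_derivative:
  fixes f :: "'v::real_normed_vector \<Rightarrow> 'w::euclidean_space"
  assumes "smooth_on f S" "open S" "x \<in> S"
  shows "DD v (DD u f) x =
         DD u (DD v f) x"
proof (rule euclidean_eqI)
  fix b :: 'w assume "b \<in> Basis"
  have fd: "frechet_derivative (\<lambda>y. g y \<bullet> b) (at y) = (\<lambda>w. DD w g y \<bullet> b)"
    if "smooth_on g S" "y \<in> S" for g :: "'v \<Rightarrow> 'w" and y
    using frechet_derivative_at[OF bounded_linear.has_derivative[OF bounded_linear_inner_left
          smooth_on_has_derivative[OF that]]] by metis
  have sec: "DD v (\<lambda>y. DD u (\<lambda>y. f y \<bullet> b) y) x =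
      DD v (DD u f) x \<bullet> b" for u v
  proof -
    have "frechet_derivative (\<lambda>y. DD u (\<lambda>y. f y \<bullet> b) y) (at x) =
      frechet_derivative (\<lambda>y. DD u f y \<bullet> b) (at x)"
      using fd[OF assms(1)] by (intro frechet_derivative_cong_open[OF assms(2,3)]) simp
    then show ?thesis using fd[OF smooth_on_frechet_derivative[OF assms(1)] assms(3)] by simp
  qed
  show "DD v (DD u f) x \<bullet> b =
        DD u (DD v f) x \<bullet> b"
    unfolding sec[symmetric]
    by (rule symmetric_second_derivative_real[OF smooth_on_linear[OF assms(2) bounded_linear_inner_left assms(1)] assms(2,3)])
qed

subsection \<open>Smooth dependence of solutions of linear systems\<close>

lemma smooth_on_det:
  fixes A :: "'v::real_normed_vector \<Rightarrow> 'w::real_normed_field^'m^'m"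
  assumes "open S" "\<And>i j. smooth_on (\<lambda>y. A y $ i $ j) S"
  shows "smooth_on (\<lambda>y. det (A y)) S"
  unfolding det_def by (intro smooth_on_sum smooth_on_mult smooth_on_prod assms smooth_on_const)

text \<open>Cramer's rule exhibits the solution as a quotient of smooth determinants. This is the
  source of smoothness for the Reeb field and for the projections onto T01.\<close>

lemma smooth_on_linear_solve:
  fixes A :: "'v::real_normed_vector \<Rightarrow> 'w::real_normed_field^'m^'m"
  assumes "open S" "\<And>i j. smooth_on (\<lambda>y. A y $ i $ j) S" "\<And>i. smooth_on (\<lambda>y. b y $ i) S"
    and det: "\<And>y. y \<in> S \<Longrightarrow> det (A y) \<noteq> 0" and sol: "\<And>y. y \<in> S \<Longrightarrow> A y *v f y = b y"
  shows "smooth_on (\<lambda>y. f y $ i) S"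
proof -
  have "f y $ i = det (\<chi> r j. if j = i then b y $ r else A y $ r $ j) / det (A y)" if "y \<in> S" for y
    by (subst cramer[OF det[OF that], THEN iffD1, OF sol[OF that]]) simp
  moreover have "smooth_on (\<lambda>y. det (\<chi> r j. if j = i then b y $ r else A y $ r $ j) / det (A y)) S"
  proof (intro smooth_on_divide[OF assms(1)] smooth_on_det[OF assms(1)] det)
    fix r j show "smooth_on (\<lambda>y. (\<chi> r j. if j = i then b y $ r else A y $ r $ j) $ r $ j) S"
      using assms(2,3) by (cases "j = i") auto
  qed (use assms in auto)
  ultimately show ?thesis by (subst smooth_on_cong[OF assms(1)])
qed

section \<open>The ring of multilinear functions under the wedge product\<close>

text \<open>Arbitrary functions on lists of vectors form an associative ring under the shuffle product.
  The contraction with a vector is a derivation twisted by the grading involution; since a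
  list function is determined by its value at the empty list and its contractions, this
  rule determines the product, and identities are proved by induction on the list.\<close>

typedef ('v, 'b) mform = "UNIV :: ('v list \<Rightarrow> 'b) set" morphisms app mf by simp

declare mf_inverse [simplified, simp] app_inverse [simp]

lemma mform_eqI: "(\<And>vs. app f vs = app g vs) \<Longrightarrow> f = g"
  by (metis app_inverse ext)

lemma mf_inject_iff [simp]: "mf f = mf g \<longleftrightarrow> f = g"
  by (metis mf_inverse UNIV_I)

text \<open>Separates the subsets containing 0 from the others; for shuffles this decides which
  factor receives the first argument.\<close>

lemma sum_Pow_Suc:
  "(\<Sum>S\<in>Pow {..<Suc n}. F S) =
     (\<Sum>S\<in>Pow {..<n}. F (insert 0 (Suc ` S))) + (\<Sum>S\<in>Pow {..<n}. F (Suc ` S :: nat set))"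
  for F :: "nat set \<Rightarrow> 'b::comm_monoid_add"
proof -
  have Pow_Suc: "Pow (Suc ` {..<n}) = (\<lambda>S. Suc ` S) ` Pow {..<n}"
    by (simp add: image_Pow_surj)
  have inj: "inj_on (\<lambda>S. Suc ` S) A" for A
    by (rule inj_onI) (simp add: inj_image_eq_iff)
  have inj': "inj_on (insert 0) (Pow (Suc ` {..<n}))"
    by (rule inj_onI) (auto simp: set_eq_iff)
  have "Pow {..<Suc n} = Pow (Suc ` {..<n}) \<union> insert 0 ` Pow (Suc ` {..<n})"
    by (simp only: lessThan_Suc_eq_insert_0 Pow_insert)
  moreover have "Pow (Suc ` {..<n}) \<inter> insert 0 ` Pow (Suc ` {..<n}) = {}" by auto
  ultimately have "(\<Sum>S\<in>Pow {..<Suc n}. F S) =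
      (\<Sum>S\<in>Pow (Suc ` {..<n}). F S) + (\<Sum>S\<in>insert 0 ` Pow (Suc ` {..<n}). F S)"
    by (simp add: sum.union_disjoint)
  also have "(\<Sum>S\<in>insert 0 ` Pow (Suc ` {..<n}). F S) = (\<Sum>S\<in>Pow (Suc ` {..<n}). F (insert 0 S))"
    by (rule sum.reindex_cong[OF inj']) auto
  finally show ?thesis
    unfolding Pow_Suc by (simp add: sum.reindex[OF inj] add.commute)
qed

text \<open>If the first argument goes to \<omega>, position 0 lies in the shuffle set and creates
  no inversion. If it goes to \<tau>, every position given to \<omega> is inverted with 0, which is
  the sign (-1) to the number of arguments of \<omega>. Neither linearity nor alternation
  enters.\<close>

lemma wedge_Cons:
  fixes \<omega> \<tau> :: "('a, 'v, 'b::comm_ring_1) form"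
  shows "(\<omega> \<^bold>\<and> \<tau>) x (v # vs) = ((\<lambda>x us. \<omega> x (v # us)) \<^bold>\<and> \<tau>) x vs +
     ((\<lambda>x us. (- 1) ^ length us * \<omega> x us) \<^bold>\<and> (\<lambda>x us. \<tau> x (v # us))) x vs"
proof -
  let ?n = "length vs"
  let ?inv = "\<lambda>S n. {(i, j). i \<in> S \<and> j \<in> {..<n} - S \<and> j < (i::nat)}"
  let ?F = "\<lambda>S. (- 1) ^ card (?inv S (Suc ?n)) * \<omega> x (nths (v # vs) S) * \<tau> x (nths (v # vs) (- S))"
  have inj: "inj (map_prod Suc Suc)" by (rule map_prod_inj_on[of Suc UNIV Suc UNIV, simplified])
  have fin: "finite (?inv S n)" if "S \<subseteq> {..<?n}" for S n
    by (rule finite_subset[of _ "{..<?n} \<times> {..<?n}"]) (use that in auto)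
  have compl: "{j. Suc j \<notin> A} = - {j. Suc j \<in> A}" for A by auto
  have Suc_image: "{j. Suc j \<in> Suc ` S} = S" for S by auto
  have mem: "(i, j) \<in> map_prod Suc Suc ` X \<longleftrightarrow> (\<exists>i' j'. i = Suc i' \<and> j = Suc j' \<and> (i', j') \<in> X)" for i j X
    by force
  have one: "?F (insert 0 (Suc ` S)) =
      (- 1) ^ card (?inv S ?n) * \<omega> x (v # nths vs S) * \<tau> x (nths vs (- S))" for S
  proof -
    have "?inv (insert 0 (Suc ` S)) (Suc ?n) = map_prod Suc Suc ` ?inv S ?n"
    proof (rule set_eqI)
      fix p :: "nat \<times> nat" obtain i j where p: "p = (i, j)" by (cases p)
      show "p \<in> ?inv (insert 0 (Suc ` S)) (Suc ?n) \<longleftrightarrow> p \<in> map_prod Suc Suc ` ?inv S ?n"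
        unfolding p mem by (cases i; cases j) auto
    qed
    then show ?thesis
      using inj by (simp add: card_image inj_on_subset nths_Cons compl Suc_image)
  qed
  have two: "?F (Suc ` S) = (- 1) ^ card (?inv S ?n) *
      ((- 1) ^ length (nths vs S) * \<omega> x (nths vs S)) * \<tau> x (v # nths vs (- S))" if S: "S \<subseteq> {..<?n}" for S
  proof -
    have "?inv (Suc ` S) (Suc ?n) = map_prod Suc Suc ` ?inv S ?n \<union> (\<lambda>i. (Suc i, 0)) ` S"
    proof (rule set_eqI)
      fix p :: "nat \<times> nat" obtain i j where p: "p = (i, j)" by (cases p)
      show "p \<in> ?inv (Suc ` S) (Suc ?n) \<longleftrightarrow> p \<in> map_prod Suc Suc ` ?inv S ?n \<union> (\<lambda>i. (Suc i, 0)) ` S"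
        unfolding p Un_iff mem by (cases i; cases j) auto
    qed
    moreover have "card ((\<lambda>i. (Suc i, 0::nat)) ` S) = card S" by (rule card_image) (auto intro: inj_onI)
    moreover have "card (map_prod Suc Suc ` ?inv S ?n \<union> (\<lambda>i. (Suc i, 0)) ` S) =
        card (map_prod Suc Suc ` ?inv S ?n) + card ((\<lambda>i. (Suc i, 0::nat)) ` S)"
      using S fin[OF S] finite_subset[OF S] by (intro card_Un_disjoint) auto
    ultimately have "card (?inv (Suc ` S) (Suc ?n)) = card (?inv S ?n) + card S"
      using inj by (simp add: card_image inj_on_subset)
    moreover have "length (nths vs S) = card S"
    proof -
      have "{i. i < length vs \<and> i \<in> S} = S" using S by auto
      then show ?thesis by (simp add: length_nths)
    qed
    ultimately show ?thesis
      by (simp add: nths_Cons compl Suc_image power_add mult.assoc)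
  qed
  have "(\<omega> \<^bold>\<and> \<tau>) x (v # vs) = (\<Sum>S\<in>Pow {..<Suc ?n}. ?F S)"
    by (simp add: wedge_def)
  also have "\<dots> = (\<Sum>S\<in>Pow {..<?n}. ?F (insert 0 (Suc ` S))) + (\<Sum>S\<in>Pow {..<?n}. ?F (Suc ` S))"
    by (rule sum_Pow_Suc)
  also have "(\<Sum>S\<in>Pow {..<?n}. ?F (insert 0 (Suc ` S))) = ((\<lambda>x us. \<omega> x (v # us)) \<^bold>\<and> \<tau>) x vs"
    unfolding wedge_def by (intro sum.cong refl) (rule one)
  also have "(\<Sum>S\<in>Pow {..<?n}. ?F (Suc ` S)) =
      ((\<lambda>x us. (- 1) ^ length us * \<omega> x us) \<^bold>\<and> (\<lambda>x us. \<tau> x (v # us))) x vs"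
    unfolding wedge_def by (intro sum.cong refl two) auto
  finally show ?thesis .
qed

lemma wedge_Nil: "(\<omega> \<^bold>\<and> \<tau>) x [] = \<omega> x [] * \<tau> x []"
  by (simp add: wedge_def)

definition ctr :: "'v \<Rightarrow> ('v, 'b) mform \<Rightarrow> ('v, 'b) mform" where
  "ctr v f = mf (\<lambda>vs. app f (v # vs))"

definition ginv :: "('v, 'b::comm_ring_1) mform \<Rightarrow> ('v, 'b) mform" where
  "ginv f = mf (\<lambda>vs. (- 1) ^ length vs * app f vs)"

text \<open>Scalars enter as forms of degree 0, so scalar multiplication is the ring product and the
  ring laws cover it.\<close>

definition sc :: "'b::comm_ring_1 \<Rightarrow> ('v, 'b) mform" where
  "sc c = mf (\<lambda>vs. if vs = [] then c else 0)"

lemma app_ctr [simp]: "app (ctr v f) vs = app f (v # vs)"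
  by (simp add: ctr_def)

lemma app_ginv [simp]: "app (ginv f) vs = (- 1) ^ length vs * app f vs"
  by (simp add: ginv_def)

lemma app_sc [simp]: "app (sc c) vs = (if vs = [] then c else 0)"
  by (simp add: sc_def)

lemma mform_eq_iff: "f = g \<longleftrightarrow> app f [] = app g [] \<and> (\<forall>v. ctr v f = ctr v g)"
proof
  assume r: "app f [] = app g [] \<and> (\<forall>v. ctr v f = ctr v g)"
  show "f = g"
  proof (rule mform_eqI)
    fix vs show "app f vs = app g vs" using r by (cases vs) (auto, metis app_ctr)
  qed
qed auto

instantiation mform :: (type, comm_ring_1) ring_1
begin

definition "f + g = mf (\<lambda>vs. app f vs + app g vs)"
definition "f - g = mf (\<lambda>vs. app f vs - app g vs)"
definition "- f = mf (\<lambda>vs. - app f vs)"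
definition "0 = mf (\<lambda>vs. 0)"
definition "1 = mf (\<lambda>vs. if vs = [] then 1 else 0)"
definition "f * g = mf (\<lambda>vs. ((\<lambda>x. app f) \<^bold>\<and> (\<lambda>x. app g)) () vs)"

lemma app_add [simp]: "app (f + g) vs = app f vs + app g vs" by (simp add: plus_mform_def)

lemma app_diff [simp]: "app (f - g) vs = app f vs - app g vs" by (simp add: minus_mform_def)

lemma app_uminus [simp]: "app (- f) vs = - app f vs" by (simp add: uminus_mform_def)

lemma app_0 [simp]: "app 0 vs = 0" by (simp add: zero_mform_def)

lemma app_1 [simp]: "app 1 vs = (if vs = [] then 1 else 0)" by (simp add: one_mform_def)

lemma app_mult_Nil [simp]: "app (f * g) [] = app f [] * app g []"
  by (simp add: times_mform_def wedge_Nil)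

lemma app_mult_Cons: "app (f * g) (v # vs) = app (ctr v f * g) vs + app (ginv f * ctr v g) vs"
  by (simp add: times_mform_def wedge_Cons ctr_def ginv_def)

lemma mform_distrib_right: "(f + g) * h = f * h + g * (h :: ('a, 'b) mform)"
proof (rule mform_eqI)
  fix vs show "app ((f + g) * h) vs = app (f * h + g * h) vs"
  proof (induction vs arbitrary: f g h)
    case (Cons v vs)
    have "ctr v (f + g) = ctr v f + ctr v g" "ginv (f + g) = ginv f + ginv g"
      by (auto intro!: mform_eqI simp: algebra_simps)
    then show ?case using Cons by (simp add: app_mult_Cons)
  qed (simp add: algebra_simps)
qed

lemma mform_distrib_left: "h * (f + g) = h * f + h * (g :: ('a, 'b) mform)"
proof (rule mform_eqI)
  fix vs show "app (h * (f + g)) vs = app (h * f + h * g) vs"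
  proof (induction vs arbitrary: f g h)
    case (Cons v vs)
    have "ctr v (f + g) = ctr v f + ctr v g" by (auto intro!: mform_eqI)
    then show ?case using Cons by (simp add: app_mult_Cons)
  qed (simp add: algebra_simps)
qed

lemma ginv_mult_mform: "ginv (f * g) = ginv f * ginv (g :: ('a, 'b) mform)"
proof (rule mform_eqI)
  \<comment> \<open>The ring laws for signs are not yet at hand before the instance is established,
    so they are derived here from distributivity.\<close>
  have neg: "app (- f * g) vs = - app (f * g) vs" "app (f * - g) vs = - app (f * g) vs"
    for vs and f g :: "('a, 'b) mform"
  proof -
    have "app ((- f + f) * g) vs = app (- f * g) vs + app (f * g) vs"
      by (simp add: mform_distrib_right)
    moreover have "app (0 * g) vs = 0" for g :: "('a, 'b) mform"
      using mform_distrib_right[of 0 0 g] by (metis add.right_neutral add_cancel_right_right app_add app_0 mform_eqI)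
    moreover have "- f + f = 0" by (rule mform_eqI) simp
    ultimately show "app (- f * g) vs = - app (f * g) vs" by (simp add: eq_neg_iff_add_eq_0)
    have "app (f * (- g + g)) vs = app (f * - g) vs + app (f * g) vs"
      by (simp add: mform_distrib_left)
    moreover have "app (f * 0) vs = 0" for f :: "('a, 'b) mform"
      using mform_distrib_left[of f 0 0] by (metis add.right_neutral add_cancel_right_right app_add app_0 mform_eqI)
    moreover have "- g + g = 0" by (rule mform_eqI) simp
    ultimately show "app (f * - g) vs = - app (f * g) vs" by (simp add: eq_neg_iff_add_eq_0)
  qed
  fix vs show "app (ginv (f * g)) vs = app (ginv f * ginv g) vs"
  proof (induction vs arbitrary: f g)
    case (Cons v vs)
    have c: "ctr v (ginv f) = - ginv (ctr v f)" "ctr v (ginv g) = - ginv (ctr v g)"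
      by (auto intro!: mform_eqI)
    have "app (ginv (f * g)) (v # vs) = - ((- 1) ^ length vs * app (ctr v f * g) vs)
        - (- 1) ^ length vs * app (ginv f * ctr v g) vs"
      by (simp add: app_mult_Cons algebra_simps)
    also have "\<dots> = - app (ginv (ctr v f * g)) vs - app (ginv (ginv f * ctr v g)) vs" by simp
    also have "\<dots> = - app (ginv (ctr v f) * ginv g) vs - app (ginv (ginv f) * ginv (ctr v g)) vs"
      by (simp only: Cons)
    also have "\<dots> = app (ginv f * ginv g) (v # vs)"
      by (simp add: app_mult_Cons c neg)
    finally show ?case .
  qed simp
qed

instance
proof
  fix f g h :: "('a, 'b) mform"
  show "f + g + h = f + (g + h)" by (rule mform_eqI) (simp add: add.assoc)
  show "f + g = g + f" by (rule mform_eqI) (simp add: add.commute)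
  show "0 + f = f" "- f + f = 0" "f - g = f + - g" by (rule mform_eqI, simp)+
  show "(0 :: ('a, 'b) mform) \<noteq> 1"
  proof
    assume "(0 :: ('a, 'b) mform) = 1"
    then have "app (0 :: ('a, 'b) mform) [] = app 1 []" by simp
    then show False by simp
  qed
  show "(f + g) * h = f * h + g * h" "h * (f + g) = h * f + h * g" for h
    by (rule mform_distrib_right mform_distrib_left)+
  show "f * g * h = f * (g * h)"
  proof (rule mform_eqI)
    fix vs show "app (f * g * h) vs = app (f * (g * h)) vs"
    proof (induction vs arbitrary: f g h)
      case (Cons v vs)
      have c: "ctr v (f * g) = ctr v f * g + ginv f * ctr v g" for f g :: "('a, 'b) mform"
        by (rule mform_eqI) (simp add: app_mult_Cons)
      show ?case
        by (simp add: app_mult_Cons c mform_distrib_left mform_distrib_right ginv_mult_mform Cons add.assoc)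
    qed (simp add: mult.assoc)
  qed
  show "1 * f = f"
  proof (rule mform_eqI)
    fix vs show "app (1 * f) vs = app f vs"
    proof (induction vs arbitrary: f)
      case (Cons v vs)
      have "ctr v (1 :: ('a, 'b) mform) = 0" "ginv (1 :: ('a, 'b) mform) = 1" by (auto intro!: mform_eqI)
      moreover have "app (0 * f) vs = 0"
        using mform_distrib_right[of 0 0 f] by (metis add.right_neutral add_cancel_right_right app_add app_0 mform_eqI)
      ultimately show ?case using Cons by (simp add: app_mult_Cons)
    qed simp
  qed
  show "f * 1 = f"
  proof (rule mform_eqI)
    fix vs show "app (f * 1) vs = app f vs"
    proof (induction vs arbitrary: f)
      case (Cons v vs)
      have "ctr v (1 :: ('a, 'b) mform) = 0" by (auto intro!: mform_eqI)
      moreover have "app (g * 0) vs = 0" for g :: "('a, 'b) mform"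
        using mform_distrib_left[of g 0 0] by (metis add.right_neutral add_cancel_right_right app_add app_0 mform_eqI)
      ultimately show ?case using Cons by (simp add: app_mult_Cons)
    qed simp
  qed
qed

end

lemma app_sum: "app (\<Sum>i\<in>I. f i) vs = (\<Sum>i\<in>I. app (f i) vs)"
  by (induction I rule: infinite_finite_induct) auto

lemma ctr_add [simp]: "ctr v (f + g) = ctr v f + ctr v g"
  and ctr_diff [simp]: "ctr v (f - g) = ctr v f - ctr v g"
  and ctr_uminus [simp]: "ctr v (- f) = - ctr v f"
  and ctr_0 [simp]: "ctr v 0 = 0"
  and ctr_1 [simp]: "ctr v 1 = 0"
  and ctr_sc [simp]: "ctr v (sc c) = 0"
  by (rule mform_eqI; simp)+

lemma ctr_sum: "ctr v (\<Sum>i\<in>I. f i) = (\<Sum>i\<in>I. ctr v (f i))" by (rule mform_eqI) (simp add: app_sum)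

lemma ctr_mult: "ctr v (f * g) = ctr v f * g + ginv f * ctr v g"
  by (rule mform_eqI) (simp add: app_mult_Cons)
lemma ctr_ginv: "ctr v (ginv f) = - ginv (ctr v f)" by (rule mform_eqI) simp

lemma ginv_add [simp]: "ginv (f + g) = ginv f + ginv g" by (rule mform_eqI) (simp add: algebra_simps)
lemma ginv_diff [simp]: "ginv (f - g) = ginv f - ginv g" by (rule mform_eqI) (simp add: algebra_simps)
lemma ginv_uminus [simp]: "ginv (- f) = - ginv f"
  and ginv_0 [simp]: "ginv 0 = 0"
  and ginv_1 [simp]: "ginv 1 = 1"
  and ginv_sc [simp]: "ginv (sc c) = sc c"
  by (rule mform_eqI; simp)+

lemma ginv_ginv [simp]: "ginv (ginv f) = f"
  by (rule mform_eqI) (simp add: mult.assoc[symmetric] power_add[symmetric] flip: mult_2)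
lemma ginv_mult: "ginv (f * g) = ginv f * ginv g" by (rule ginv_mult_mform)
lemma app_sc_mult [simp]: "app (sc c * f) vs = c * app f vs"
  by (induction vs arbitrary: f) (auto simp: app_mult_Cons)

lemma sc_commute: "f * sc c = sc c * f"
proof (rule mform_eqI)
  fix vs show "app (f * sc c) vs = app (sc c * f) vs"
  proof (induction vs arbitrary: f)
    case (Cons v vs)
    have "app (f * sc c) (v # vs) = app (ctr v f * sc c) vs" by (simp add: app_mult_Cons)
    then show ?case using Cons by simp
  qed (simp add: mult.commute)
qed

lemma sc_left_commute: "f * (sc c * g) = sc c * (f * g)"
  by (metis mult.assoc sc_commute)

lemma sc_0 [simp]: "sc 0 = 0"
  and sc_1 [simp]: "sc 1 = 1"
  and sc_add: "sc (a + b) = sc a + sc b"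
  and sc_diff: "sc (a - b) = sc a - sc b"
  and sc_uminus: "sc (- a) = - sc a"
  and sc_mult: "sc (a * b) = sc a * sc b"
  by (rule mform_eqI; simp)+

lemma sc_mult_mult: "sc a * (sc b * f) = sc (a * b) * f" by (simp add: sc_mult mult.assoc)
lemma sc_of_nat: "sc (of_nat k) = of_nat k" by (induction k) (auto simp: sc_add)
lemma ctr_sc_mult: "ctr v (sc c * f) = sc c * ctr v f" by (simp add: ctr_mult)
lemma ginv_sc_mult: "ginv (sc c * f) = sc c * ginv f" by (simp add: ginv_mult)

lemma mf_wedge: "mf ((\<omega> \<^bold>\<and> \<tau>) x) = mf (\<omega> x) * mf (\<tau> x)"
  by (simp add: times_mform_def fun_eq_iff wedge_def)

lemma mf_wedge_power: "mf (wedge_power \<omega> m x) = mf (\<omega> x) ^ m"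
proof (induction m)
  case 0
  show ?case by (rule mform_eqI) simp
qed (simp add: mf_wedge)

subsection \<open>Alternating forms\<close>

definition alt :: "int \<Rightarrow> ('v::real_vector, 'b::real_normed_field) mform \<Rightarrow> bool" where
  "alt k f \<longleftrightarrow> alternating_form k (app f)"

lemma alt_length: "alt k f \<Longrightarrow> int (length vs) \<noteq> k \<Longrightarrow> app f vs = 0"
  by (simp add: alt_def alternating_form_def)

lemma alt_neg: "alt k f \<Longrightarrow> k < 0 \<Longrightarrow> f = 0"
  by (rule mform_eqI) (simp add: alt_length)

lemma alt_linear: "alt k f \<Longrightarrow> linear (\<lambda>v. app f (v # vs))"
proof -
  assume "alt k f"
  then have "\<forall>vs. \<forall>i<length vs. linear (\<lambda>v. app f (vs[i := v]))"
    by (simp add: alt_def alternating_form_def)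
  from this[THEN spec[of _ "undefined # vs"], THEN spec[of _ 0]] show ?thesis by simp
qed

lemma alt_ctr:
  assumes "alt k f"
  shows "alt (k - 1) (ctr v f)"
proof -
  have l: "\<And>vs. int (length vs) \<noteq> k \<Longrightarrow> app f vs = 0"
    and m: "\<And>vs i. i < length vs \<Longrightarrow> linear (\<lambda>v. app f (vs[i := v]))"
    and a: "\<And>vs i j. i < j \<Longrightarrow> j < length vs \<Longrightarrow> vs ! i = vs ! j \<Longrightarrow> app f vs = 0"
    using assms unfolding alt_def alternating_form_def by blast+
  show ?thesis unfolding alt_def alternating_form_def
  proof (intro conjI allI impI)
    show "app (ctr v f) vs = 0" if "int (length vs) \<noteq> k - 1" for vs using that l[of "v # vs"] by simp
    show "linear (\<lambda>w. app (ctr v f) (vs[i := w]))" if "i < length vs" for vs i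
      using m[of "Suc i" "v # vs"] that by simp
    show "app (ctr v f) vs = 0" if "i < j \<and> j < length vs \<and> vs ! i = vs ! j" for vs i j
      using a[of "Suc i" "Suc j" "v # vs"] that by simp
  qed
qed

lemma alt_ctr_add: "alt k f \<Longrightarrow> ctr (v + w) f = ctr v f + ctr w f"
  by (rule mform_eqI) (simp add: linear_add[OF alt_linear])

lemma alt_ctr_scaleR: "alt k f \<Longrightarrow> ctr (r *\<^sub>R v) f = sc (of_real r) * ctr v f"
  by (rule mform_eqI) (simp add: linear_cmul[OF alt_linear] scaleR_conv_of_real)

lemma alt_ctr_diff: "alt k f \<Longrightarrow> ctr (v - w) f = ctr v f - ctr w f"
  by (rule mform_eqI) (simp add: linear_diff[OF alt_linear])

lemma alt_ctr_zero: "alt k f \<Longrightarrow> ctr 0 f = 0"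
  by (rule mform_eqI) (simp add: linear_0[OF alt_linear])

lemma alt_ctr_sum: "alt k f \<Longrightarrow> ctr (\<Sum>i\<in>I. v i) f = (\<Sum>i\<in>I. ctr (v i) f)"
  by (rule mform_eqI) (simp add: linear_sum[OF alt_linear] app_sum)

lemma alt_ctr_self: "alt k f \<Longrightarrow> ctr v (ctr v f) = 0"
proof (rule mform_eqI)
  fix vs assume "alt k f"
  then have "\<forall>vs i j. i < j \<and> j < length vs \<and> vs ! i = vs ! j \<longrightarrow> app f vs = 0"
    by (simp add: alt_def alternating_form_def)
  from this[THEN spec[of _ "v # v # vs"], THEN spec[of _ 0], THEN spec[of _ 1]]
  show "app (ctr v (ctr v f)) vs = app 0 vs" by simp
qed

lemma alt_ctr_swap: "alt k f \<Longrightarrow> ctr v (ctr w f) = - ctr w (ctr v f)"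
proof -
  assume f: "alt k f"
  have "ctr (v + w) (ctr (v + w) f) = 0" by (rule alt_ctr_self[OF f])
  then have "ctr w (ctr v f) + ctr v (ctr w f) = 0"
    by (simp add: alt_ctr_add[OF f] alt_ctr_add[OF alt_ctr[OF f]] alt_ctr_self[OF f])
  then show ?thesis by (simp only: eq_neg_iff_add_eq_0 add.commute)
qed

lemma alt_Nil: "alt k f \<Longrightarrow> k \<noteq> 0 \<Longrightarrow> app f [] = 0"
  by (simp add: alt_length)

text \<open>Alternation is reduced to the leading one or two arguments, which makes it provable by
  recursion over contractions.\<close>

lemma altI:
  assumes ctr: "\<And>v. alt (k - 1) (ctr v f)" and lin: "\<And>vs. linear (\<lambda>v. app f (v # vs))"
    and self: "\<And>v. ctr v (ctr v f) = 0" and Nil: "k \<noteq> 0 \<Longrightarrow> app f [] = 0"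
  shows "alt k f"
  unfolding alt_def alternating_form_def
proof (intro conjI allI impI)
  show "app f vs = 0" if "int (length vs) \<noteq> k" for vs
  proof (cases vs)
    case (Cons v us)
    then show ?thesis using alt_length[OF ctr, of us v] that by simp
  qed (use that Nil in auto)
  show "linear (\<lambda>v. app f (vs[i := v]))" if "i < length vs" for vs i
  proof (cases vs)
    case (Cons w us)
    show ?thesis
    proof (cases i)
      case (Suc j)
      have "linear (\<lambda>v. app (ctr w f) (us[j := v]))"
        using ctr[of w] that Cons Suc unfolding alt_def alternating_form_def by simp
      then show ?thesis using Cons Suc by simp
    qed (use lin Cons in auto)
  qed (use that in auto)
  \<comment> \<open>Polarization of the vanishing on a repeated leading pair.\<close>
  have swap: "app f (v # w # us) = - app f (w # v # us)" for v w us
  proof -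
    have add: "app f ((v + w) # u # us) = app f (v # u # us) + app f (w # u # us)" for u
      using linear_add[OF lin] by blast
    have add': "app f (u # (v + w) # us) = app f (u # v # us) + app f (u # w # us)" for u
      using linear_add[OF alt_linear[OF ctr]] by (metis app_ctr)
    have "app f (u # u # us) = 0" for u
      using self[of u] by (metis app_ctr app_0)
    then have "app f (v # w # us) + app f (w # v # us) = 0"
      using add add' by (metis add.left_neutral add.right_neutral)
    then show ?thesis by (simp add: eq_neg_iff_add_eq_0)
  qed
  have ctr_alt: "app f (w # us) = 0" if "i < j" "j < length us" "us ! i = us ! j" for w us i j
    using ctr[of w] that unfolding alt_def alternating_form_def by (metis app_ctr)
  show "app f vs = 0" if vs: "i < j \<and> j < length vs \<and> vs ! i = vs ! j" for vs i j
  proof (cases vs)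
    case (Cons v us)
    show ?thesis
    proof (cases i)
      case 0
      then obtain j' where j: "j = Suc j'" using vs by (cases j) auto
      show ?thesis
      proof (cases us)
        case (Cons u ws)
        show ?thesis
        proof (cases j')
          case 0
          then show ?thesis using vs \<open>vs = v # us\<close> \<open>i = 0\<close> j Cons self[of v] by (metis app_ctr app_0 nth_Cons_0 nth_Cons_Suc)
        next
          case (Suc l)
          \<comment> \<open>The repetition sits at position 0 and at a position beyond 1; exchanging
            the first two arguments moves it inside a contraction.\<close>
          then have "app f (u # v # ws) = 0"
            using vs \<open>vs = v # us\<close> \<open>i = 0\<close> j Cons by (intro ctr_alt[of 0 j']) auto
          then show ?thesis using swap[of v u ws] \<open>vs = v # us\<close> Cons by simp
        qed
      qed (use vs \<open>vs = v # us\<close> j in auto)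
    next
      case (Suc i')
      then show ?thesis using vs Cons ctr_alt[of i' "j - 1" us v] by (cases j) auto
    qed
  qed (use vs in auto)
qed

lemma alt_0 [simp]: "alt k 0"
  by (simp add: alt_def alternating_form_def linear_iff)

lemma alt_add: "alt k f \<Longrightarrow> alt k g \<Longrightarrow> alt k (f + g)"
  unfolding alt_def alternating_form_def by (simp add: linear_compose_add)

lemma alt_sc_mult: "alt k f \<Longrightarrow> alt k (sc c * f)"
  unfolding alt_def alternating_form_def by (simp add: linear_iff algebra_simps)

lemma alt_uminus: "alt k f \<Longrightarrow> alt k (- f)"
  using alt_sc_mult[of k f "-1"] by (simp add: sc_uminus)

lemma alt_diff: "alt k f \<Longrightarrow> alt k g \<Longrightarrow> alt k (f - g)"
  using alt_add[of k f "- g"] alt_uminus by fastforce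

lemma alt_sum: "(\<And>i. i \<in> I \<Longrightarrow> alt k (f i)) \<Longrightarrow> alt k (\<Sum>i\<in>I. f i)"
  by (induction I rule: infinite_finite_induct) (auto intro: alt_add)

lemma alt_sc: "alt 0 (sc c)"
  by (rule altI) (auto simp: linear_iff)

lemma alt_1: "alt 0 1" using alt_sc[of 1] by simp

lemma alt_0_eq_sc: "alt 0 f \<Longrightarrow> f = sc (app f [])"
  by (rule mform_eqI) (simp add: alt_length)

lemma alt_ginv: "alt k f \<Longrightarrow> ginv f = (if even k then f else - f)"
proof (rule mform_eqI)
  fix vs assume f: "alt k f"
  show "app (ginv f) vs = app (if even k then f else - f) vs"
  proof (cases "int (length vs) = k")
    case True
    then show ?thesis by (auto simp: uminus_power_if)
  qed (simp add: alt_length[OF f])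
qed

lemma alt_ginv_alt: "alt k f \<Longrightarrow> alt k (ginv f)"
  by (simp add: alt_ginv alt_uminus)

text \<open>Contraction lowers the total degree by one, so the induction runs on a bound
  \<open>n\<close> for it. A factor of degree 0 has zero contraction, which keeps the degrees
  nonnegative.\<close>

lemma alt_mult_aux: "alt k f \<Longrightarrow> alt l g \<Longrightarrow> 0 \<le> k \<Longrightarrow> 0 \<le> l \<Longrightarrow> k + l < int n \<Longrightarrow> alt (k + l) (f * g)"
proof (induction n arbitrary: k l f g)
  case (Suc n)
  note f = Suc.prems(1) and g = Suc.prems(2)
  show ?case
  proof (rule altI)
    fix v
    have "alt (k + l - 1) (ctr v f * g)"
    proof (cases "k = 0")
      case False
      then show ?thesis
        using Suc.IH[OF alt_ctr[OF f] g] Suc.prems by (simp add: algebra_simps)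
    qed (use alt_neg[OF alt_ctr[OF f]] in simp)
    moreover have "alt (k + l - 1) (ginv f * ctr v g)"
    proof (cases "l = 0")
      case False
      then show ?thesis
        using Suc.IH[OF alt_ginv_alt[OF f] alt_ctr[OF g]] Suc.prems by (simp add: algebra_simps)
    qed (use alt_neg[OF alt_ctr[OF g]] in simp)
    ultimately show "alt (k + l - 1) (ctr v (f * g))" by (simp add: ctr_mult alt_add)
    show "ctr v (ctr v (f * g)) = 0"
      by (simp add: ctr_mult ctr_ginv alt_ctr_self[OF f] alt_ctr_self[OF g])
    show "linear (\<lambda>v. app (f * g) (v # vs))" for vs
      by (rule linearI)
        (simp_all add: app_mult_Cons alt_ctr_add[OF f] alt_ctr_add[OF g] alt_ctr_scaleR[OF f]
          alt_ctr_scaleR[OF g] distrib_left distrib_right mult.assoc sc_left_commute scaleR_conv_of_real)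
    show "app (f * g) [] = 0" if "k + l \<noteq> 0"
      using that alt_Nil[OF f] alt_Nil[OF g] by fastforce
  qed
qed simp

lemma alt_mult: "alt k f \<Longrightarrow> alt l g \<Longrightarrow> alt (k + l) (f * g)"
proof -
  assume f: "alt k f" and g: "alt l g"
  show ?thesis
  proof (cases "k < 0 \<or> l < 0")
    case True
    then show ?thesis using alt_neg[OF f] alt_neg[OF g] by auto
  next
    case False
    then show ?thesis using alt_mult_aux[OF f g, of "nat (k + l + 1)"] by simp
  qed
qed

lemma alt_power: "alt k f \<Longrightarrow> alt (int m * k) (f ^ m)"
proof (induction m)
  case (Suc m)
  then show ?case using alt_mult[OF Suc.prems Suc.IH[OF Suc.prems]] by (simp add: algebra_simps)
qed (simp add: alt_1)

text \<open>The contractions of a one-form are scalars, hence central; moving the one-form past each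
  argument of \<open>f\<close> contributes one sign, collected in \<open>ginv\<close>. Here
  \<open>f\<close> is an arbitrary list function.\<close>

lemma one_form_commute: "alt 1 a \<Longrightarrow> a * f = ginv f * a"
proof (rule mform_eqI)
  fix vs assume a: "alt 1 a"
  show "app (a * f) vs = app (ginv f * a) vs"
  proof (induction vs arbitrary: f)
    case (Cons v vs)
    have c: "ctr v a = sc (app a [v])" using alt_0_eq_sc[OF alt_ctr[OF a, simplified]] by simp
    show ?case using Cons
      by (simp add: app_mult_Cons ctr_ginv alt_ginv[OF a] c sc_commute)
  qed (simp add: alt_Nil[OF a])
qed

text \<open>Contractions of a two-form are one-forms, whose commutation rule carries the induction;
  the two signs cancel.\<close>

lemma two_form_commute: "alt 2 b \<Longrightarrow> b * f = f * b"
proof (rule mform_eqI)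
  fix vs assume b: "alt 2 b"
  show "app (b * f) vs = app (f * b) vs"
  proof (induction vs arbitrary: f)
    case (Cons v vs)
    show ?case using Cons one_form_commute[OF alt_ctr[OF b, of v, simplified], of f]
      by (simp add: app_mult_Cons alt_ginv[OF b])
  qed (simp add: mult.commute)
qed

lemma one_form_square: "alt 1 a \<Longrightarrow> a * a = (0 :: ('v::real_vector, 'b::real_normed_field) mform)"
proof -
  assume a: "alt 1 a"
  have "a * a = - (a * a)" using one_form_commute[OF a, of a] by (simp add: alt_ginv[OF a])
  then have "app (a * a) vs = - app (a * a) vs" for vs by (metis app_uminus)
  then have "app (a * a) vs + app (a * a) vs = 0" for vs by (metis add.right_inverse)
  then have "app (a * a) vs = 0" for vs by (simp flip: mult_2)
  then show ?thesis by (intro mform_eqI) simp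
qed

lemma ctr_two_form_power: "alt 2 b \<Longrightarrow> ctr v (b ^ Suc m) = sc (of_nat (Suc m)) * (ctr v b * b ^ m)"
proof (induction m)
  case (Suc m)
  note b = Suc.prems
  have "ctr v (b ^ Suc (Suc m)) = ctr v b * b ^ Suc m + b * ctr v (b ^ Suc m)"
    by (simp only: power_Suc[of b "Suc m"] ctr_mult alt_ginv[OF b]) simp
  also have "b * ctr v (b ^ Suc m) = sc (of_nat (Suc m)) * (b * (ctr v b * b ^ m))"
    by (simp only: Suc.IH[OF b] sc_left_commute)
  also have "b * (ctr v b * b ^ m) = ctr v b * b ^ Suc m"
    by (simp only: mult.assoc[symmetric] two_form_commute[OF b, of "ctr v b"] power_Suc)
  also have "ctr v b * b ^ Suc m + sc (of_nat (Suc m)) * (ctr v b * b ^ Suc m) =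
      sc (of_nat (Suc (Suc m))) * (ctr v b * b ^ Suc m)"
    by (simp only: of_nat_Suc[of "Suc m"] sc_add sc_1 distrib_right mult_1_left)
  finally show ?case .
qed simp

subsection \<open>Coordinates\<close>

text \<open>The coordinate differentials, as constant forms with real or complex
  coefficients.\<close>

definition cov :: "'m \<Rightarrow> (real^'m, 'b::real_normed_field) mform" where
  "cov i = mf (\<lambda>vs. case vs of [v] \<Rightarrow> of_real (v $ i) | _ \<Rightarrow> 0)"

lemma app_cov_Nil [simp]: "app (cov i) [] = 0" by (simp add: cov_def)
lemma ctr_cov [simp]: "ctr v (cov i) = sc (of_real (v $ i))"
proof (rule mform_eqI)
  fix vs show "app (ctr v (cov i)) vs = app (sc (of_real (v $ i))) vs"
    by (cases vs) (auto simp: cov_def)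
qed

lemma alt_cov: "alt 1 (cov i :: (real^'m, 'b::real_normed_field) mform)"
proof (rule altI)
  show "linear (\<lambda>v. app (cov i :: (real^'m, 'b) mform) (v # vs))" for vs
    by (rule linearI) (auto simp: cov_def scaleR_conv_of_real[where 'a = 'b] split: list.splits)
qed (simp_all add: alt_sc)

lemma ctr_axis_sum:
  assumes "alt k f"
  shows "ctr v f = (\<Sum>i\<in>UNIV. sc (of_real (v $ i)) * ctr (axis i 1) f)"
proof -
  have "v = (\<Sum>i\<in>UNIV. (v $ i) *\<^sub>R axis i 1)"
    by (simp add: vec_eq_iff axis_def if_distrib[of "\<lambda>x. _ * x"] cong: if_cong)
  then have "ctr v f = ctr (\<Sum>i\<in>UNIV. (v $ i) *\<^sub>R axis i 1) f" by simp
  then show ?thesis by (simp only: alt_ctr_sum[OF assms] alt_ctr_scaleR[OF assms])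
qed

text \<open>Euler's formula: it reduces statements about forms of degree \<open>k\<close> to forms of smaller degree.\<close>

lemma euler:
  assumes "alt k f"
  shows "(\<Sum>i\<in>UNIV. cov i * ctr (axis i 1) f) = sc (of_int k) * f"
proof (rule mform_eqI)
  fix vs show "app (\<Sum>i\<in>UNIV. cov i * ctr (axis i 1) f) vs = app (sc (of_int k) * f) vs"
    using assms
  proof (induction vs arbitrary: k f)
    case Nil
    then show ?case using alt_Nil[OF Nil] by (cases "k = 0") (auto simp: app_sum)
  next
    case (Cons v vs)
    have "ctr v (\<Sum>i\<in>UNIV. cov i * ctr (axis i 1) f) =
        (\<Sum>i\<in>UNIV. sc (of_real (v $ i)) * ctr (axis i 1) f) + (\<Sum>i\<in>UNIV. cov i * ctr (axis i 1) (ctr v f))"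
      by (simp add: ctr_sum ctr_mult alt_ginv[OF alt_cov] alt_ctr_swap[OF Cons.prems, of v] sum.distrib)
    then have "app (\<Sum>i\<in>UNIV. cov i * ctr (axis i 1) f) (v # vs) =
        app (ctr v f + (\<Sum>i\<in>UNIV. cov i * ctr (axis i 1) (ctr v f))) vs"
      by (simp flip: app_ctr ctr_axis_sum[OF Cons.prems])
    also have "\<dots> = app (ctr v f) vs + app (sc (of_int (k - 1)) * ctr v f) vs"
      by (simp only: app_add Cons.IH[OF alt_ctr[OF Cons.prems]])
    finally show ?case by (simp add: algebra_simps)
  qed
qed

text \<open>Contracting \<open>cov i * f\<close> with the i-th basis vector gives \<open>f\<close>
  minus the i-th summand of Euler's formula. It recovers a form from its products with covectors, as
  Euler's formula recovers it from its contractions.\<close>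

lemma euler_dual:
  fixes f :: "(real^'m, 'b::real_normed_field) mform"
  assumes "alt k f"
  shows "(\<Sum>i\<in>UNIV. ctr (axis i 1) (cov i * f)) = sc (of_int (int CARD('m) - k)) * f"
proof -
  have "(\<Sum>i\<in>UNIV. ctr (axis i 1) (cov i * f)) = (\<Sum>i\<in>UNIV. f - cov i * ctr (axis i 1) f)"
    by (simp add: ctr_mult alt_ginv[OF alt_cov])
  also have "\<dots> = of_nat CARD('m) * f - sc (of_int k) * f"
    by (simp add: sum_subtractf euler[OF assms])
  also have "\<dots> = sc (of_int (int CARD('m) - k)) * f"
    by (simp add: sc_diff left_diff_distrib flip: sc_of_nat)
  finally show ?thesis .
qed

lemma alt_zero_if_axes:
  fixes f :: "(real^'m, 'b::real_normed_field) mform"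
  assumes "alt k f" "\<And>is. app f (map (\<lambda>i. axis i 1) is) = 0"
  shows "f = 0"
proof (rule mform_eqI)
  fix vs show "app f vs = app 0 vs" using assms
  proof (induction vs arbitrary: k f)
    case Nil
    then show ?case using Nil(2)[of "[]"] by simp
  next
    case (Cons v vs)
    have "app (ctr (axis i 1) f) vs = 0" for i
      using Cons.IH[OF alt_ctr[OF Cons.prems(1)]] Cons.prems(2)[of "i # is" for "is"] by simp
    then show ?case
      using arg_cong[OF ctr_axis_sum[OF Cons.prems(1), of v], of "\<lambda>g. app g vs"] by (simp add: app_sum)
  qed
qed

lemma one_form_eqI:
  fixes f g :: "(real^'m, 'b::real_normed_field) mform"
  assumes "alt 1 f" "alt 1 g" "\<And>j. app f [axis j 1] = app g [axis j 1]"
  shows "f = g"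
proof -
  have "f - g = 0"
  proof (rule alt_zero_if_axes[OF alt_diff[OF assms(1,2)]])
    fix js :: "'m list"
    show "app (f - g) (map (\<lambda>i. axis i 1) js) = 0"
    proof (cases "length js = 1")
      case True
      then obtain j where "js = [j]" by (auto simp: length_Suc_conv)
      then show ?thesis using assms(3)[of j] by simp
    next
      case False
      then show ?thesis by (intro alt_length[OF alt_diff[OF assms(1,2)]]) simp
    qed
  qed
  then show ?thesis by simp
qed

lemma alt_nondistinct: "alt k f \<Longrightarrow> \<not> distinct vs \<Longrightarrow> app f vs = 0"
  unfolding alt_def alternating_form_def distinct_conv_nth by (metis linorder_neqE_nat)

lemma alt_zero_if_degree_gt:
  fixes f :: "(real^'m, 'b::real_normed_field) mform"
  assumes "alt k f" "k > int CARD('m)"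
  shows "f = 0"
proof (rule alt_zero_if_axes[OF assms(1)])
  fix "is" :: "'m list"
  show "app f (map (\<lambda>i. axis i 1) is) = 0"
  proof (cases "distinct is")
    case True
    then have "length is \<le> CARD('m)" by (metis card_mono distinct_card finite subset_UNIV)
    then show ?thesis using assms(2) by (intro alt_length[OF assms(1)]) simp
  next
    case False
    then show ?thesis by (intro alt_nondistinct[OF assms(1)]) (simp add: distinct_map)
  qed
qed

lemma alt_move_front: "alt k f \<Longrightarrow> app f (us @ v # ws) = (- 1) ^ length us * app f (v # us @ ws)"
proof (induction us arbitrary: k f)
  case (Cons u us)
  have "app f (u # us @ v # ws) = (- 1) ^ length us * app (ctr u f) (v # us @ ws)"
    using Cons.IH[OF alt_ctr[OF Cons.prems], of u] by simp
  also have "app (ctr u f) (v # us @ ws) = - app f (v # u # us @ ws)"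
    using arg_cong[OF alt_ctr_swap[OF Cons.prems, of v u], of "\<lambda>g. app g (us @ ws)"] by simp
  finally show ?case by simp
qed simp

text \<open>Permuting arguments only changes the sign. Tracking vanishing instead of values avoids
  the sign of the permutation.\<close>

lemma alt_mset_zero:
  "alt k f \<Longrightarrow> mset us = mset vs \<Longrightarrow> app f us = 0 \<Longrightarrow> app f vs = 0"
proof (induction us arbitrary: k f vs)
  case (Cons u us)
  have "u \<in> set vs" using mset_eq_setD[OF Cons.prems(2)] by auto
  from split_list[OF this] obtain as bs where vs: "vs = as @ u # bs" by (elim exE)
  have "app (ctr u f) (as @ bs) = 0"
  proof (rule Cons.IH[OF alt_ctr[OF Cons.prems(1)]])
    show "mset us = mset (as @ bs)" using Cons.prems(2) vs by simp
    show "app (ctr u f) us = 0" using Cons.prems(3) by simp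
  qed
  then show ?case unfolding vs alt_move_front[OF Cons.prems(1)] by simp
qed simp

lemma top_degree_zero:
  fixes f :: "(real^'m, 'b::real_normed_field) mform"
  assumes "alt (int CARD('m)) f" "set E = UNIV" "distinct E" "app f (map (\<lambda>i. axis i 1) E) = 0"
  shows "f = 0"
proof (rule alt_zero_if_axes[OF assms(1)])
  fix "is" :: "'m list"
  show "app f (map (\<lambda>i. axis i 1) is) = 0"
  proof (cases "distinct is \<and> length is = CARD('m)")
    case True
    then have "set is = UNIV" by (metis card_subset_eq distinct_card finite subset_UNIV)
    then have "mset E = mset is" using True assms(2,3) by (metis set_eq_iff_mset_eq_distinct)
    then show ?thesis
      by (intro alt_mset_zero[OF assms(1) _ assms(4)]) (simp add: mset_map)
  next
    case False
    then show ?thesis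
      using alt_nondistinct[OF assms(1)] alt_length[OF assms(1)] by (auto simp: distinct_map)
  qed
qed

text \<open>Forms of top degree form a line; the cross-multiplied formulation allows either value on
  the basis to be zero.\<close>

lemma top_degree_proportional:
  fixes f g :: "(real^'m, 'b::real_normed_field) mform"
  assumes "alt (int CARD('m)) f" "alt (int CARD('m)) g" "set E = UNIV" "distinct E"
  shows "sc (app f (map (\<lambda>i. axis i 1) E)) * g = sc (app g (map (\<lambda>i. axis i 1) E)) * f"
proof -
  have "sc (app f (map (\<lambda>i. axis i 1) E)) * g - sc (app g (map (\<lambda>i. axis i 1) E)) * f = 0"
    by (rule top_degree_zero[OF _ assms(3,4)]) (auto intro: alt_diff alt_sc_mult assms)
  then show ?thesis by simp
qed

subsection \<open>Pullback\<close>

definition pb :: "('u \<Rightarrow> 'v) \<Rightarrow> ('v, 'b) mform \<Rightarrow> ('u, 'b) mform" where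
  "pb A f = mf (\<lambda>vs. app f (map A vs))"

lemma app_pb [simp]: "app (pb A f) vs = app f (map A vs)" by (simp add: pb_def)

lemma ctr_pb: "ctr v (pb A f) = pb A (ctr (A v) f)"
  and pb_add [simp]: "pb A (f + g) = pb A f + pb A g"
  and pb_diff [simp]: "pb A (f - g) = pb A f - pb A g"
  and pb_uminus [simp]: "pb A (- f) = - pb A f"
  and pb_0 [simp]: "pb A 0 = 0"
  and pb_1 [simp]: "pb A 1 = 1"
  and pb_sc [simp]: "pb A (sc c) = sc c"
  and pb_ginv: "pb A (ginv f) = ginv (pb A f)"
  by (rule mform_eqI; simp)+

lemma pb_sum: "pb A (\<Sum>i\<in>I. f i) = (\<Sum>i\<in>I. pb A (f i))" by (rule mform_eqI) (simp add: app_sum)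

lemma pb_pb: "pb A (pb B f) = pb (\<lambda>v. B (A v)) f" by (rule mform_eqI) (simp add: comp_def)
lemma pb_ident: "pb (\<lambda>v. v) f = f" by (rule mform_eqI) simp

lemma pb_mult: "pb A (f * g) = pb A f * pb A g"
proof (rule mform_eqI)
  fix vs show "app (pb A (f * g)) vs = app (pb A f * pb A g) vs"
  proof (induction vs arbitrary: f g)
    case (Cons v vs)
    have "app (pb A (f * g)) (v # vs) = app (pb A (ctr (A v) f * g)) vs + app (pb A (ginv f * ctr (A v) g)) vs"
      by (simp add: app_mult_Cons)
    also have "\<dots> = app (pb A f * pb A g) (v # vs)"
      by (simp only: Cons app_mult_Cons ctr_pb pb_ginv)
    finally show ?case .
  qed simp
qed

lemma pb_power: "pb A (f ^ m) = pb A f ^ m"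
  by (induction m) (auto simp: pb_mult)

lemma pb_sc_mult: "pb A (sc c * f) = sc c * pb A f" by (simp add: pb_mult)

lemma alt_pb:
  assumes "linear A" "alt k f"
  shows "alt k (pb A f)"
  unfolding alt_def alternating_form_def
proof (intro conjI allI impI)
  show "app (pb A f) vs = 0" if "int (length vs) \<noteq> k" for vs
    using that alt_length[OF assms(2), of "map A vs"] by simp
  show "linear (\<lambda>v. app (pb A f) (vs[i := v]))" if "i < length vs" for vs i
  proof -
    have "\<forall>vs. \<forall>i<length vs. linear (\<lambda>v. app f (vs[i := v]))"
      using assms(2) by (simp add: alt_def alternating_form_def)
    then have "linear (\<lambda>v. app f ((map A vs)[i := v]))" using that by simp
    from linear_compose[OF assms(1) this] show ?thesis by (simp add: comp_def map_update)
  qed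
  have "\<forall>vs i j. i < j \<and> j < length vs \<and> vs ! i = vs ! j \<longrightarrow> app f vs = 0"
    using assms(2) by (simp add: alt_def alternating_form_def)
  then have "i < j \<and> j < length vs \<and> vs ! i = vs ! j \<Longrightarrow> app f vs = 0" for vs i j by blast
  note * = this
  show "app (pb A f) vs = 0" if "i < j \<and> j < length vs \<and> vs ! i = vs ! j" for vs i j
    using that *[of i j "map A vs"] by simp
qed

section \<open>Differential forms on open sets of the model space\<close>

definition sform :: "'v::real_normed_vector set \<Rightarrow> ('v \<Rightarrow> ('u, 'b::real_normed_field) mform) \<Rightarrow> bool" where
  "sform S p \<longleftrightarrow> (\<forall>vs. smooth_on (\<lambda>y. app (p y) vs) S)"

definition dird :: "'v \<Rightarrow> ('v::real_normed_vector \<Rightarrow> ('u, 'b::real_normed_field) mform) \<Rightarrow> 'v \<Rightarrow> ('u, 'b) mform" where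
  "dird v p y = mf (\<lambda>vs. frechet_derivative (\<lambda>z. app (p z) vs) (at y) v)"

definition ed :: "('v::real_normed_vector \<Rightarrow> ('v, 'b::real_normed_field) mform) \<Rightarrow> 'v \<Rightarrow> ('v, 'b) mform" where
  "ed p y = mf (euclidean_ext_deriv (\<lambda>z. app (p z)) y)"

lemma app_dird: "app (dird v p y) vs = frechet_derivative (\<lambda>z. app (p z) vs) (at y) v"
  by (simp add: dird_def)

lemma ctr_dird: "ctr w (dird v p y) = dird v (\<lambda>z. ctr w (p z)) y"
  by (rule mform_eqI) (simp add: app_dird)

lemma app_ed_Nil [simp]: "app (ed p y) [] = 0"
  by (simp add: ed_def euclidean_ext_deriv_def)

text \<open>Cartan's formula for a constant field, whose Lie derivative is \<open>dird\<close>.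
  Together with the vanishing on the empty list it determines \<open>ed\<close>, and all rules for
  \<open>ed\<close> are proved by this recursion over the arguments.\<close>

lemma ctr_ed: "ctr v (ed p y) = dird v p y - ed (\<lambda>z. ctr v (p z)) y"
proof (rule mform_eqI)
  fix vs
  show "app (ctr v (ed p y)) vs = app (dird v p y - ed (\<lambda>z. ctr v (p z)) y) vs"
    by (simp add: ed_def euclidean_ext_deriv_def app_dird sum.lessThan_Suc_shift sum_negf del: sum.lessThan_Suc)
qed

lemma sform_smooth: "sform S p \<Longrightarrow> smooth_on (\<lambda>y. app (p y) vs) S"
  by (simp add: sform_def)

lemma sform_subset: "sform S p \<Longrightarrow> T \<subseteq> S \<Longrightarrow> sform T p"
  unfolding sform_def by (auto intro: smooth_on_subset)

lemma sform_local: "(\<And>x. x \<in> S \<Longrightarrow> \<exists>T. open T \<and> x \<in> T \<and> sform T p) \<Longrightarrow> sform S p"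
  unfolding sform_def by (intro allI smooth_on_local) meson

lemma sform_const [simp]: "sform S (\<lambda>y. f)"
  by (simp add: sform_def)

lemma sform_sc: "smooth_on f S \<Longrightarrow> sform S (\<lambda>y. sc (f y))"
  unfolding sform_def
proof
  show "smooth_on f S \<Longrightarrow> smooth_on (\<lambda>y. app (sc (f y)) vs) S" for vs by (cases vs) simp_all
qed

lemma sform_ctr: "sform S p \<Longrightarrow> sform S (\<lambda>y. ctr v (p y))"
  by (simp add: sform_def)

context
  fixes S :: "'v::real_normed_vector set"
  assumes S: "open S"
begin

lemma sform_cong: "(\<And>y. y \<in> S \<Longrightarrow> p y = q y) \<Longrightarrow> sform S p \<longleftrightarrow> sform S q"
  unfolding sform_def by (intro all_cong1 smooth_on_cong[OF S]) simp

lemma sform_add: "sform S p \<Longrightarrow> sform S q \<Longrightarrow> sform S (\<lambda>y. p y + q y)"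
  by (simp add: sform_def smooth_on_add[OF S])

lemma sform_diff: "sform S p \<Longrightarrow> sform S q \<Longrightarrow> sform S (\<lambda>y. p y - q y)"
  by (simp add: sform_def smooth_on_diff[OF S])

lemma sform_uminus: "sform S p \<Longrightarrow> sform S (\<lambda>y. - p y)"
  by (simp add: sform_def smooth_on_uminus[OF S])

lemma sform_ginv: "sform S p \<Longrightarrow> sform S (\<lambda>y. ginv (p y))"
  by (auto simp: sform_def intro!: smooth_on_mult[OF S])

lemma sform_sum: "(\<And>i. i \<in> I \<Longrightarrow> sform S (p i)) \<Longrightarrow> sform S (\<lambda>y. \<Sum>i\<in>I. p i y)"
  by (simp add: sform_def app_sum smooth_on_sum[OF S])

lemma sform_mult: "sform S p \<Longrightarrow> sform S q \<Longrightarrow> sform S (\<lambda>y. p y * q y)"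
  unfolding sform_def
proof
  fix vs
  assume "\<forall>vs. smooth_on (\<lambda>y. app (p y) vs) S" "\<forall>vs. smooth_on (\<lambda>y. app (q y) vs) S"
  then show "smooth_on (\<lambda>y. app (p y * q y) vs) S"
  proof (induction vs arbitrary: p q)
    case Nil
    then show ?case by (simp add: smooth_on_mult[OF S])
  next
    case (Cons v vs)
    have "smooth_on (\<lambda>y. app (ctr v (p y) * q y) vs) S"
      by (rule Cons.IH) (use Cons.prems in auto)
    moreover have "smooth_on (\<lambda>y. app (ginv (p y) * ctr v (q y)) vs) S"
      by (rule Cons.IH) (use Cons.prems in \<open>auto intro!: smooth_on_mult[OF S]\<close>)
    ultimately show ?case by (simp add: app_mult_Cons smooth_on_add[OF S])
  qed
qed

lemma sform_power: "sform S p \<Longrightarrow> sform S (\<lambda>y. p y ^ m)"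
  by (induction m) (auto intro: sform_mult)

lemma sform_sc_mult: "smooth_on f S \<Longrightarrow> sform S p \<Longrightarrow> sform S (\<lambda>y. sc (f y) * p y)"
  by (rule sform_mult[OF sform_sc])

lemma sform_dird: "sform S p \<Longrightarrow> sform S (dird v p)"
  by (simp add: sform_def app_dird smooth_on_frechet_derivative)

lemma dird_cong:
  assumes "y \<in> S" "\<And>z. z \<in> S \<Longrightarrow> p z = q z"
  shows "dird v p y = dird v q y"
  by (rule mform_eqI)
    (simp add: app_dird frechet_derivative_cong_open[OF S assms(1), of "\<lambda>z. app (p z) _" "\<lambda>z. app (q z) _"] assms(2))

lemma ed_cong:
  assumes "y \<in> S" "\<And>z. z \<in> S \<Longrightarrow> p z = q z"
  shows "ed p y = ed q y"
proof (rule mform_eqI)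
  fix vs show "app (ed p y) vs = app (ed q y) vs"
    using assms(2)
  proof (induction vs arbitrary: p q)
    case (Cons v vs)
    have "app (ed (\<lambda>z. ctr v (p z)) y) vs = app (ed (\<lambda>z. ctr v (q z)) y) vs"
      using Cons.prems by (intro Cons.IH) simp
    then show ?case
      using dird_cong[OF assms(1) Cons.prems, where v = v] by (simp flip: app_ctr add: ctr_ed)
  qed simp
qed

context
  fixes y
  assumes y: "y \<in> S"
begin

lemma sform_has_derivative:
  "sform S p \<Longrightarrow> ((\<lambda>z. app (p z) vs) has_derivative (\<lambda>v. app (dird v p y) vs)) (at y)"
  using smooth_on_has_derivative[OF sform_smooth y] by (simp add: app_dird)

lemma dird_eqI:
  assumes "\<And>vs. ((\<lambda>z. app (p z) vs) has_derivative (\<lambda>v. app (f v) vs)) (at y)"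
  shows "dird v p y = f v"
  by (rule mform_eqI) (simp add: app_dird frechet_derivative_at[OF assms, symmetric])

lemma dird_add: "sform S p \<Longrightarrow> sform S q \<Longrightarrow> dird v (\<lambda>z. p z + q z) y = dird v p y + dird v q y"
  by (rule dird_eqI) (auto intro!: has_derivative_add sform_has_derivative)

lemma dird_diff: "sform S p \<Longrightarrow> sform S q \<Longrightarrow> dird v (\<lambda>z. p z - q z) y = dird v p y - dird v q y"
  by (rule dird_eqI) (auto intro!: has_derivative_diff sform_has_derivative)

lemma dird_const: "dird v (\<lambda>z. f) y = 0"
  by (rule mform_eqI) (simp add: app_dird)

lemma dird_ginv: "sform S p \<Longrightarrow> dird v (\<lambda>z. ginv (p z)) y = ginv (dird v p y)"
  by (rule dird_eqI) (auto intro!: has_derivative_mult_right sform_has_derivative)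

lemma dird_mult:
  assumes "sform S p" "sform S q"
  shows "dird v (\<lambda>z. p z * q z) y = dird v p y * q y + p y * dird v q y"
proof (rule mform_eqI)
  fix vs show "app (dird v (\<lambda>z. p z * q z) y) vs = app (dird v p y * q y + p y * dird v q y) vs"
    using assms
  proof (induction vs arbitrary: p q)
    case Nil
    have "((\<lambda>z. app (p z * q z) []) has_derivative
        (\<lambda>v. app (p y) [] * app (dird v q y) [] + app (dird v p y) [] * app (q y) [])) (at y)"
      unfolding app_mult_Nil by (intro has_derivative_mult sform_has_derivative Nil)
    from frechet_derivative_at[OF this, symmetric] show ?case by (simp add: app_dird add.commute)
  next
    case (Cons w vs)
    have c: "ctr w (p z * q z) = ctr w (p z) * q z + ginv (p z) * ctr w (q z)" for z
      by (rule ctr_mult)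
    have "app (dird v (\<lambda>z. p z * q z) y) (w # vs) =
        app (dird v (\<lambda>z. ctr w (p z) * q z + ginv (p z) * ctr w (q z)) y) vs"
      by (simp only: app_ctr[symmetric] ctr_dird c)
    also have "\<dots> = app (dird v (\<lambda>z. ctr w (p z) * q z) y) vs + app (dird v (\<lambda>z. ginv (p z) * ctr w (q z)) y) vs"
      using Cons.prems by (subst dird_add) (auto intro: sform_mult sform_ctr sform_ginv)
    also have "app (dird v (\<lambda>z. ctr w (p z) * q z) y) vs =
        app (dird v (\<lambda>z. ctr w (p z)) y * q y + ctr w (p y) * dird v q y) vs"
      using Cons.prems by (intro Cons.IH sform_ctr)
    also have "app (dird v (\<lambda>z. ginv (p z) * ctr w (q z)) y) vs =
        app (ginv (dird v p y) * ctr w (q y) + ginv (p y) * dird v (\<lambda>z. ctr w (q z)) y) vs"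
      using Cons.prems by (simp only: Cons.IH[OF sform_ginv sform_ctr] dird_ginv)
    finally show ?case
      by (simp add: app_mult_Cons ctr_dird algebra_simps)
  qed
qed

lemma ed_add: "sform S p \<Longrightarrow> sform S q \<Longrightarrow> ed (\<lambda>z. p z + q z) y = ed p y + ed q y"
proof (rule mform_eqI)
  fix vs assume "sform S p" "sform S q"
  then show "app (ed (\<lambda>z. p z + q z) y) vs = app (ed p y + ed q y) vs"
  proof (induction vs arbitrary: p q)
    case (Cons v vs)
    have "app (ed (\<lambda>z. p z + q z) y) (v # vs) =
      app (dird v (\<lambda>z. p z + q z) y) vs - app (ed (\<lambda>z. ctr v (p z) + ctr v (q z)) y) vs"
      by (simp only: app_ctr[symmetric] ctr_ed ctr_add app_diff)
    then show ?case
      using Cons.IH[OF Cons.prems[THEN sform_ctr[of S _ v]]] dird_add[OF Cons.prems]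
      by (simp flip: app_ctr add: ctr_ed)
  qed simp
qed

lemma ed_const: "ed (\<lambda>z. f) y = 0"
proof (rule mform_eqI)
  fix vs show "app (ed (\<lambda>z. f) y) vs = app 0 vs"
    by (induction vs arbitrary: f) (simp_all flip: app_ctr add: ctr_ed dird_const)
qed

lemma ed_uminus: "sform S p \<Longrightarrow> ed (\<lambda>z. - p z) y = - ed p y"
proof -
  assume a: "sform S p"
  have "ed (\<lambda>z. - p z) y + ed p y = ed (\<lambda>z. - p z + p z) y"
    by (rule ed_add[OF sform_uminus[OF a] a, symmetric])
  then have "ed (\<lambda>z. - p z) y + ed p y = 0"
    by (simp add: ed_const)
  then show ?thesis by (simp add: eq_neg_iff_add_eq_0)
qed

lemma ed_diff: "sform S p \<Longrightarrow> sform S q \<Longrightarrow> ed (\<lambda>z. p z - q z) y = ed p y - ed q y"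
  using ed_add[OF _ sform_uminus, of p q] by (simp add: ed_uminus)

lemma ed_sum: "(\<And>i. i \<in> I \<Longrightarrow> sform S (p i)) \<Longrightarrow> ed (\<lambda>z. \<Sum>i\<in>I. p i z) y = (\<Sum>i\<in>I. ed (p i) y)"
  by (induction I rule: infinite_finite_induct) (auto simp: ed_const ed_add sform_sum)

lemma ed_ginv: "sform S p \<Longrightarrow> ed (\<lambda>z. ginv (p z)) y = - ginv (ed p y)"
proof (rule mform_eqI)
  fix vs assume "sform S p"
  then show "app (ed (\<lambda>z. ginv (p z)) y) vs = app (- ginv (ed p y)) vs"
  proof (induction vs arbitrary: p)
    case (Cons v vs)
    have "app (ed (\<lambda>z. ginv (p z)) y) (v # vs) =
        app (dird v (\<lambda>z. ginv (p z)) y) vs - app (ed (\<lambda>z. - ginv (ctr v (p z))) y) vs"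
      by (simp only: app_ctr[symmetric] ctr_ed ctr_ginv app_diff)
    also have "app (ed (\<lambda>z. - ginv (ctr v (p z))) y) vs = app (ginv (ed (\<lambda>z. ctr v (p z)) y)) vs"
      using Cons.IH[OF sform_ctr[OF Cons.prems]] ed_uminus[OF sform_ginv[OF sform_ctr[OF Cons.prems]]] by simp
    finally show ?case
      by (simp only: app_ctr[symmetric] ctr_uminus ctr_ginv ctr_ed dird_ginv[OF Cons.prems]) simp
  qed simp
qed

text \<open>With \<open>ginv\<close> in place of the sign of a degree, the Leibniz rule holds for
  arbitrary list functions, so no degree has to be carried through the induction.\<close>

lemma ed_mult:
  assumes "sform S p" "sform S q"
  shows "ed (\<lambda>z. p z * q z) y = ed p y * q y + ginv (p y) * ed q y"
proof (rule mform_eqI)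
  fix vs show "app (ed (\<lambda>z. p z * q z) y) vs = app (ed p y * q y + ginv (p y) * ed q y) vs"
    using assms
  proof (induction vs arbitrary: p q)
    case (Cons v vs)
    note s = Cons.prems sform_ctr[OF Cons.prems(1)] sform_ctr[OF Cons.prems(2)] sform_ginv[OF Cons.prems(1)]
    have "app (ed (\<lambda>z. p z * q z) y) (v # vs) = app (dird v p y * q y + p y * dird v q y) vs
        - app (ed (\<lambda>z. ctr v (p z) * q z + ginv (p z) * ctr v (q z)) y) vs"
      by (simp only: app_ctr[symmetric] ctr_ed ctr_mult app_diff dird_mult[OF Cons.prems])
    also have "app (ed (\<lambda>z. ctr v (p z) * q z + ginv (p z) * ctr v (q z)) y) vs =
        app (ed (\<lambda>z. ctr v (p z)) y * q y + ginv (ctr v (p y)) * ed q y) vs +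
        app (ed (\<lambda>z. ginv (p z)) y * ctr v (q y) + ginv (ginv (p y)) * ed (\<lambda>z. ctr v (q z)) y) vs"
      using s by (subst ed_add) (simp_all only: sform_mult app_add Cons.IH)
    finally show ?case
      by (simp only: app_ctr[symmetric] ctr_add ctr_mult ctr_ed ctr_ginv ed_ginv[OF s(1)])
         (simp add: algebra_simps ginv_mult)
  qed simp
qed

end

lemma dird_dird_commute:
  fixes p :: "'v \<Rightarrow> ('u, 'b::{real_normed_field,euclidean_space}) mform"
  assumes "sform S p" "y \<in> S"
  shows "dird v (dird w p) y = dird w (dird v p) y"
  by (rule mform_eqI)
    (simp add: app_dird symmetric_second_derivative[OF sform_smooth[OF assms(1)] S assms(2)])

lemma sform_ed: "sform S p \<Longrightarrow> sform S (ed p)"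
  unfolding sform_def[of S "ed p"]
proof
  fix vs assume "sform S p"
  then show "smooth_on (\<lambda>y. app (ed p y) vs) S"
  proof (induction vs arbitrary: p)
    case (Cons v vs)
    have "smooth_on (\<lambda>y. app (dird v p y) vs - app (ed (\<lambda>z. ctr v (p z)) y) vs) S"
      by (intro smooth_on_diff[OF S] Cons.IH sform_ctr Cons.prems sform_smooth[OF sform_dird])
    then show ?case by (simp flip: app_ctr add: ctr_ed)
  qed simp
qed

lemma dird_ed:
  fixes p :: "'v \<Rightarrow> ('v, 'b::{real_normed_field,euclidean_space}) mform"
  assumes "sform S p" "y \<in> S"
  shows "dird v (ed p) y = ed (dird v p) y"
proof (rule mform_eqI)
  fix vs show "app (dird v (ed p) y) vs = app (ed (dird v p) y) vs" using assms(1)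
  proof (induction vs arbitrary: p)
    case Nil
    then show ?case by (simp add: app_dird)
  next
    case (Cons w vs)
    have "app (dird v (ed p) y) (w # vs) = app (dird v (\<lambda>z. dird w p z - ed (\<lambda>z. ctr w (p z)) z) y) vs"
      by (simp only: app_ctr[symmetric] ctr_dird ctr_ed)
    also have "\<dots> = app (dird v (dird w p) y) vs - app (dird v (ed (\<lambda>z. ctr w (p z))) y) vs"
      using Cons.prems by (subst dird_diff[OF assms(2)]) (auto intro: sform_dird sform_ed sform_ctr)
    also have "\<dots> = app (dird w (dird v p) y) vs - app (ed (dird v (\<lambda>z. ctr w (p z))) y) vs"
      by (simp only: Cons.IH[OF sform_ctr[OF Cons.prems]] dird_dird_commute[OF Cons.prems assms(2), of v w])
    also have "\<dots> = app (ed (dird v p) y) (w # vs)"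
      by (simp only: app_ctr[symmetric] ctr_dird ctr_ed app_diff)
    finally show ?case .
  qed
qed

text \<open>By Cartan's formula the contraction of the second differential consists of
  \<open>dird v (ed p)\<close> and \<open>ed (dird v p)\<close>, which cancel by symmetry of second
  derivatives, and the second differential of a contraction, covered by induction on the
  arguments.\<close>

lemma ed_ed:
  fixes p :: "'v \<Rightarrow> ('v, 'b::{real_normed_field,euclidean_space}) mform"
  assumes "sform S p" "y \<in> S"
  shows "ed (ed p) y = 0"
proof (rule mform_eqI)
  fix vs show "app (ed (ed p) y) vs = app 0 vs" using assms(1)
  proof (induction vs arbitrary: p)
    case (Cons v vs)
    have "app (ed (ed p) y) (v # vs) = app (dird v (ed p) y) vs
        - app (ed (\<lambda>z. dird v p z - ed (\<lambda>z. ctr v (p z)) z) y) vs"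
      by (simp only: app_ctr[symmetric] ctr_ed app_diff)
    also have "app (ed (\<lambda>z. dird v p z - ed (\<lambda>z. ctr v (p z)) z) y) vs =
        app (ed (dird v p) y) vs - app (ed (ed (\<lambda>z. ctr v (p z))) y) vs"
      using Cons.prems by (subst ed_diff[OF assms(2)]) (auto intro: sform_dird sform_ed sform_ctr)
    finally show ?case
      using Cons.IH[OF sform_ctr[OF Cons.prems]] by (simp add: dird_ed[OF Cons.prems assms(2)])
  qed simp
qed

lemma alt_dird:
  assumes "sform S p" "y \<in> S" "\<And>z. z \<in> S \<Longrightarrow> alt k (p z)"
  shows "alt k (dird v p y)"
  unfolding alt_def alternating_form_def
proof (intro conjI allI impI)
  have zero: "app (dird v p y) vs = 0" if "\<And>z. z \<in> S \<Longrightarrow> app (p z) vs = 0" for vs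
    unfolding app_dird by (subst frechet_derivative_cong_open[OF S assms(2), of _ "\<lambda>z. 0"]) (auto simp: that)
  show "app (dird v p y) vs = 0" if "int (length vs) \<noteq> k" for vs
    by (rule zero) (use assms(3) that in \<open>auto intro: alt_length\<close>)
  show "app (dird v p y) vs = 0" if "i < j \<and> j < length vs \<and> vs ! i = vs ! j" for vs i j
  proof (rule zero)
    fix z assume "z \<in> S"
    then have "\<forall>vs i j. i < j \<and> j < length vs \<and> vs ! i = vs ! j \<longrightarrow> app (p z) vs = 0"
      using assms(3) by (simp add: alt_def alternating_form_def)
    from this[THEN spec[of _ vs], THEN spec[of _ i], THEN spec[of _ j]] that
    show "app (p z) vs = 0" by simp
  qed
  show "linear (\<lambda>w. app (dird v p y) (vs[i := w]))" if i: "i < length vs" for vs i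
  proof -
    have l: "linear (\<lambda>w. app (p z) (vs[i := w]))" if "z \<in> S" for z
      using assms(3)[OF that] i by (simp add: alt_def alternating_form_def)
    note hd = sform_has_derivative[OF assms(2,1)]
    show ?thesis
    proof (rule linearI)
      fix w w' and c :: real
      have "((\<lambda>z. app (p z) (vs[i := w + w'])) has_derivative
        (\<lambda>v. app (dird v p y) (vs[i := w]) + app (dird v p y) (vs[i := w']))) (at y)"
        by (subst has_derivative_cong_open[OF S assms(2), of _
              "\<lambda>z. app (p z) (vs[i := w]) + app (p z) (vs[i := w'])"])
          (auto simp: linear_add[OF l] intro!: has_derivative_add hd)
      from frechet_derivative_at[OF this, symmetric]
      show "app (dird v p y) (vs[i := w + w']) = app (dird v p y) (vs[i := w]) + app (dird v p y) (vs[i := w'])"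
        by (simp add: app_dird)
      have "((\<lambda>z. app (p z) (vs[i := c *\<^sub>R w])) has_derivative
        (\<lambda>v. c *\<^sub>R app (dird v p y) (vs[i := w]))) (at y)"
        by (subst has_derivative_cong_open[OF S assms(2), of _ "\<lambda>z. c *\<^sub>R app (p z) (vs[i := w])"])
          (auto simp: linear_cmul[OF l] intro!: has_derivative_scaleR_right hd)
      from frechet_derivative_at[OF this, symmetric]
      show "app (dird v p y) (vs[i := c *\<^sub>R w]) = c *\<^sub>R app (dird v p y) (vs[i := w])"
        by (simp add: app_dird)
    qed
  qed
qed

lemma alt_ed:
  assumes "sform S p" "y \<in> S" "\<And>z. z \<in> S \<Longrightarrow> alt k (p z)"
  shows "alt (k + 1) (ed p y)"
proof -
  have "alt (k + 1) (ed p y)" if "sform S p" "\<And>z. z \<in> S \<Longrightarrow> alt k (p z)" "k < int n" for n k p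
    using that
  proof (induction n arbitrary: k p)
    case 0
    have "p z = 0" if "z \<in> S" for z using alt_neg[OF 0(2)[OF that]] 0(3) by simp
    then have "ed p y = ed (\<lambda>z. 0) y" by (rule ed_cong[OF assms(2)])
    then show ?case by (simp add: ed_const[OF assms(2)])
  next
    case (Suc n)
    let ?c = "\<lambda>v. ed (\<lambda>z. ctr v (p z)) y"
    note s = sform_ctr[OF Suc.prems(1)]
    have IH: "alt k (?c v)" for v
      using Suc.IH[OF s, of "k - 1" v] alt_ctr[OF Suc.prems(2)] Suc.prems(3) by simp
    have D: "alt k (dird v p y)" for v by (rule alt_dird[OF Suc.prems(1) assms(2) Suc.prems(2)])
    show ?case
    proof (rule altI)
      show "alt (k + 1 - 1) (ctr v (ed p y))" for v using alt_diff[OF D IH] by (simp add: ctr_ed)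
      show "ctr v (ctr v (ed p y)) = 0" for v
      proof -
        have "ed (\<lambda>z. ctr v (ctr v (p z))) y = ed (\<lambda>z. 0) y"
          by (rule ed_cong[OF assms(2) alt_ctr_self[OF Suc.prems(2)]])
        then show ?thesis by (simp add: ctr_ed ctr_dird ed_const[OF assms(2)])
      qed
      fix vs
      have "linear (\<lambda>v. app (dird v p y) vs)"
        unfolding app_dird
        by (rule linear_frechet_derivative[OF smooth_on_imp_differentiable[OF sform_smooth[OF Suc.prems(1)] assms(2)]])
      moreover have "linear (\<lambda>v. app (?c v) vs)"
      proof (rule linearI)
        fix v w and c :: real
        have "?c (v + w) = ed (\<lambda>z. ctr v (p z) + ctr w (p z)) y"
          by (rule ed_cong[OF assms(2) alt_ctr_add[OF Suc.prems(2)]])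
        then show "app (?c (v + w)) vs = app (?c v) vs + app (?c w) vs" by (simp add: ed_add[OF assms(2) s s])
        have "?c (c *\<^sub>R v) = ed (\<lambda>z. sc (of_real c) * ctr v (p z)) y"
          by (rule ed_cong[OF assms(2) alt_ctr_scaleR[OF Suc.prems(2)]])
        then show "app (?c (c *\<^sub>R v)) vs = c *\<^sub>R app (?c v) vs"
          by (simp add: ed_mult[OF assms(2) sform_const s] ed_const[OF assms(2)] scaleR_conv_of_real)
      qed
      ultimately show "linear (\<lambda>v. app (ed p y) (v # vs))"
        using linear_compose_sub by (simp flip: app_ctr add: ctr_ed)
    qed simp
  qed
  from this[OF assms(1,3), of "Suc (nat k)"] show ?thesis by simp
qed

end

lemma ed_sc:
  fixes f :: "'v::real_normed_vector \<Rightarrow> 'b::real_normed_field"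
  assumes "open S" "y \<in> S" "smooth_on f S"
  shows "ctr v (ed (\<lambda>z. sc (f z)) y) = sc (frechet_derivative f (at y) v)"
proof -
  have "dird v (\<lambda>z. sc (f z)) y = (sc (frechet_derivative f (at y) v) :: ('v, 'b) mform)"
  proof (rule mform_eqI)
    fix vs :: "'v list"
    show "app (dird v (\<lambda>z. sc (f z)) y) vs = app (sc (frechet_derivative f (at y) v)) vs"
      by (cases vs) (simp_all add: app_dird)
  qed
  then show ?thesis by (simp add: ctr_ed ed_const[OF assms(1,2)])
qed

text \<open>The contracting vector varies with the point; linearity in the first argument splits it
  into smooth coefficients and constant basis vectors.\<close>

lemma sform_ctr_field:
  fixes S :: "'u::real_normed_vector set" and X :: "'u \<Rightarrow> 'v::euclidean_space"
  assumes "open S" "sform S p" "\<And>y. y \<in> S \<Longrightarrow> alt k (p y)" "smooth_on X S"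
  shows "sform S (\<lambda>y. ctr (X y) (p y))"
proof -
  have "ctr (X y) (p y) = (\<Sum>b\<in>Basis. sc (of_real (X y \<bullet> b)) * ctr b (p y))" if "y \<in> S" for y
  proof -
    have "ctr (X y) (p y) = ctr (\<Sum>b\<in>Basis. (X y \<bullet> b) *\<^sub>R b) (p y)"
      by (simp add: euclidean_representation)
    then show ?thesis
      by (simp only: alt_ctr_sum[OF assms(3)[OF that]] alt_ctr_scaleR[OF assms(3)[OF that]])
  qed
  moreover have "sform S (\<lambda>y. \<Sum>b\<in>Basis. sc (of_real (X y \<bullet> b)) * ctr b (p y))"
    by (intro sform_sum[OF assms(1)] sform_sc_mult[OF assms(1)] sform_ctr assms(2)
        smooth_on_linear[OF assms(1) bounded_linear_of_real] smooth_on_linear[OF assms(1) bounded_linear_inner_left assms(4)])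
  ultimately show ?thesis by (subst sform_cong[OF assms(1)])
qed

lemma sform_pb:
  fixes S :: "'u::real_normed_vector set" and A :: "'u \<Rightarrow> 'w \<Rightarrow> 'v::euclidean_space"
  assumes "open S" "sform S p" "\<And>y. y \<in> S \<Longrightarrow> alt k (p y)" "\<And>v. smooth_on (\<lambda>y. A y v) S"
  shows "sform S (\<lambda>y. pb (A y) (p y))"
  unfolding sform_def
proof
  fix vs show "smooth_on (\<lambda>y. app (pb (A y) (p y)) vs) S" using assms(2,3)
  proof (induction vs arbitrary: p k)
    case Nil
    then show ?case by (simp add: sform_smooth)
  next
    case (Cons v vs)
    have "smooth_on (\<lambda>y. app (pb (A y) (ctr (A y v) (p y))) vs) S"
      using Cons.prems alt_ctr by (intro Cons.IH sform_ctr_field[OF assms(1)] assms(4)) blast+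
    then show ?case by simp
  qed
qed

lemma sform_compose:
  fixes \<phi> :: "'w::real_normed_vector \<Rightarrow> 'v::euclidean_space"
  assumes "open S" "open T" "\<phi> ` S \<subseteq> T" "smooth_on \<phi> S" "sform T p"
  shows "sform S (\<lambda>y. p (\<phi> y))"
  unfolding sform_def by (intro allI smooth_on_compose[OF assms(1,2,3) sform_smooth[OF assms(5)] assms(4)])

context
  fixes S :: "(real^'m) set" and T :: "(real^'l) set" and \<phi> :: "real^'m \<Rightarrow> real^'l"
  assumes S: "open S" and T: "open T" and \<phi>: "\<phi> ` S \<subseteq> T" "smooth_on \<phi> S"
begin

abbreviation (input) pull :: "(real^'l \<Rightarrow> (real^'l, 'b::real_normed_field) mform) \<Rightarrow> real^'m \<Rightarrow> (real^'m, 'b) mform" where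
  "pull p y \<equiv> pb (frechet_derivative \<phi> (at y)) (p (\<phi> y))"

lemma sform_pull:
  "sform T p \<Longrightarrow> (\<And>z. z \<in> T \<Longrightarrow> alt k (p z)) \<Longrightarrow> sform S (\<lambda>y. pull p y)"
  using \<phi> by (intro sform_pb[OF S, where k = k] sform_compose[OF S T] smooth_on_frechet_derivative) auto

lemma pull_cov:
  fixes y :: "real^'m"
  assumes "y \<in> S"
  shows "pull (\<lambda>y. cov i) y = (ed (\<lambda>z. sc (of_real (\<phi> z $ i))) y :: (real^'m, 'b::real_normed_field) mform)"
proof (subst mform_eq_iff, intro conjI allI)
  fix v
  have "((\<lambda>z. of_real (\<phi> z $ i) :: 'b) has_derivative (\<lambda>v. of_real (frechet_derivative \<phi> (at y) v $ i))) (at y)"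
    by (intro bounded_linear.has_derivative[OF bounded_linear_of_real]
        bounded_linear.has_derivative[OF bounded_linear_vec_nth] smooth_on_has_derivative[OF \<phi>(2) assms])
  from frechet_derivative_at[OF this, symmetric]
  have "frechet_derivative (\<lambda>z. of_real (\<phi> z $ i) :: 'b) (at y) v = of_real (frechet_derivative \<phi> (at y) v $ i)"
    by simp
  moreover have "smooth_on (\<lambda>z. of_real (\<phi> z $ i) :: 'b) S"
    by (intro smooth_on_linear[OF S bounded_linear_of_real] smooth_on_vec_nth S \<phi>)
  ultimately show "ctr v (pull (\<lambda>y. cov i) y) = ctr v (ed (\<lambda>z. sc (of_real (\<phi> z $ i) :: 'b)) y)"
    by (simp add: ed_sc[OF S assms] ctr_pb)
qed simp

text \<open>By Euler's formula a form of positive degree is a combination of products of coordinate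
  differentials with forms of smaller degree, so naturality reduces to the chain rule for functions
  and to the vanishing of the second derivative of coordinate functions.\<close>

lemma ed_pull:
  fixes p :: "real^'l \<Rightarrow> (real^'l, 'b::{real_normed_field,euclidean_space}) mform"
  assumes "y \<in> S" "sform T p" "\<And>z. z \<in> T \<Longrightarrow> alt k (p z)"
  shows "ed (\<lambda>y. pull p y) y = pb (frechet_derivative \<phi> (at y)) (ed p (\<phi> y))"
proof -
  let ?D = "frechet_derivative \<phi> (at y)"
  have y': "\<phi> y \<in> T" using \<phi> assms(1) by auto
  have cov: "sform S (\<lambda>y. pull (\<lambda>y. cov i :: (real^'l, 'b) mform) y)" for i
    by (rule sform_pull[where k = 1]) (simp_all add: alt_cov)
  have edcov: "ed (\<lambda>y. pull (\<lambda>y. cov i :: (real^'l, 'b) mform) y) y = 0" for i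
  proof -
    have s: "smooth_on (\<lambda>z. of_real (\<phi> z $ i) :: 'b) S"
      by (intro smooth_on_linear[OF S bounded_linear_of_real] smooth_on_vec_nth S \<phi>)
    have "ed (\<lambda>y. pull (\<lambda>y. cov i :: (real^'l, 'b) mform) y) y = ed (ed (\<lambda>z. sc (of_real (\<phi> z $ i)))) y"
      by (intro ed_cong[OF S assms(1)] pull_cov)
    then show ?thesis using ed_ed[OF S sform_sc[OF s] assms(1)] by simp
  qed
  have "ed (\<lambda>y. pull p y) y = pb ?D (ed p (\<phi> y))"
    if "sform T p" "\<And>z. z \<in> T \<Longrightarrow> alt k (p z)" "k < int n"
    for n k and p :: "real^'l \<Rightarrow> (real^'l, 'b) mform"
    using that
  proof (induction n arbitrary: k p)
    case 0
    have z: "p z = 0" if "z \<in> T" for z using alt_neg[OF 0(2)[OF that]] 0(3) by simp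
    have "ed (\<lambda>y. pull p y) y = ed (\<lambda>y. 0) y" using z \<phi> by (intro ed_cong[OF S assms(1)]) auto
    moreover have "ed p (\<phi> y) = ed (\<lambda>y. 0) (\<phi> y)" using z by (intro ed_cong[OF T y']) auto
    ultimately show ?case by (simp add: ed_const[OF S assms(1)] ed_const[OF T y'])
  next
    case (Suc n)
    show ?case
    proof (cases "k = 0")
      case True
      define f where "f z = app (p z) []" for z
      have f: "smooth_on f T" unfolding f_def by (rule sform_smooth[OF Suc.prems(1)])
      have p: "p z = sc (f z)" if "z \<in> T" for z using alt_0_eq_sc Suc.prems(2)[OF that] True by (simp add: f_def)
      have "ed (\<lambda>y. pull p y) y = ed (\<lambda>y. sc (f (\<phi> y))) y"
        using p \<phi> by (intro ed_cong[OF S assms(1)]) auto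
      also have "\<dots> = pb ?D (ed (\<lambda>z. sc (f z)) (\<phi> y))"
      proof (subst mform_eq_iff, intro conjI allI)
        fix v
        have "((\<lambda>y. f (\<phi> y)) has_derivative (\<lambda>v. frechet_derivative f (at (\<phi> y)) (?D v))) (at y)"
          by (rule has_derivative_compose[of \<phi> _ y UNIV f])
            (use smooth_on_has_derivative[OF \<phi>(2) assms(1)] smooth_on_has_derivative[OF f y'] in auto)
        from frechet_derivative_at[OF this, THEN fun_cong, of v]
        show "ctr v (ed (\<lambda>y. sc (f (\<phi> y))) y) = ctr v (pb ?D (ed (\<lambda>z. sc (f z)) (\<phi> y)))"
          by (simp add: ed_sc[OF S assms(1) smooth_on_compose[OF S T \<phi>(1) f \<phi>(2)]] ed_sc[OF T y' f] ctr_pb)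
      qed simp
      also have "ed (\<lambda>z. sc (f z)) (\<phi> y) = ed p (\<phi> y)"
        using p by (intro ed_cong[OF T y']) auto
      finally show ?thesis .
    next
      case False
      let ?k = "sc (of_int k)" and ?q = "\<lambda>i z. ctr (axis i 1) (p z)"
      have q: "sform T (?q i)" "\<And>z. z \<in> T \<Longrightarrow> alt (k - 1) (?q i z)" for i
        using Suc.prems alt_ctr[OF Suc.prems(2)] by (auto intro: sform_ctr)
      have kn: "k - 1 < int n" using Suc.prems(3) by simp
      have IH: "ed (\<lambda>y. pull (?q i) y) y = pb ?D (ed (?q i) (\<phi> y))" for i
        by (rule Suc.IH[OF q kn])
      note eul = euler[OF Suc.prems(2), symmetric]
      have "?k * ed (\<lambda>y. pull p y) y = ed (\<lambda>y. ?k * pull p y) y"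
        by (subst ed_mult[OF S assms(1)]) (auto simp: ed_const[OF S assms(1)] intro: sform_pull Suc.prems)
      also have "\<dots> = ed (\<lambda>y. \<Sum>i\<in>UNIV. pull (\<lambda>z. cov i) y * pull (?q i) y) y"
        using \<phi> by (intro ed_cong[OF S assms(1)])
          (auto simp: eul pb_sum pb_mult simp flip: pb_sc_mult pb_mult)
      also have "\<dots> = (\<Sum>i\<in>UNIV. ed (\<lambda>y. pull (\<lambda>z. cov i) y * pull (?q i) y) y)"
        by (intro ed_sum[OF S assms(1)] sform_mult[OF S] cov sform_pull[OF q])
      also have "\<dots> = (\<Sum>i\<in>UNIV. - (pb ?D (cov i) * pb ?D (ed (?q i) (\<phi> y))))"
      proof (intro sum.cong refl)
        fix i
        show "ed (\<lambda>y. pull (\<lambda>z. cov i) y * pull (?q i) y) y = - (pb ?D (cov i) * pb ?D (ed (?q i) (\<phi> y)))"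
          by (subst ed_mult[OF S assms(1) cov sform_pull[OF q]])
            (simp_all add: edcov IH alt_ginv[OF alt_cov] flip: pb_ginv)
      qed
      finally have left: "?k * ed (\<lambda>y. pull p y) y = - (\<Sum>i\<in>UNIV. pb ?D (cov i * ed (?q i) (\<phi> y)))"
        by (simp add: sum_negf pb_mult)
      have "?k * ed p (\<phi> y) = ed (\<lambda>z. ?k * p z) (\<phi> y)"
        by (subst ed_mult[OF T y']) (auto simp: ed_const[OF T y'] intro: Suc.prems)
      also have "\<dots> = ed (\<lambda>z. \<Sum>i\<in>UNIV. cov i * ?q i z) (\<phi> y)"
        by (intro ed_cong[OF T y'] eul)
      also have "\<dots> = (\<Sum>i\<in>UNIV. ed (\<lambda>z. cov i * ?q i z) (\<phi> y))"
        by (intro ed_sum[OF T y'] sform_mult[OF T] q sform_const)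
      also have "\<dots> = (\<Sum>i\<in>UNIV. - (cov i * ed (?q i) (\<phi> y)))"
        by (intro sum.cong refl) (simp add: ed_mult[OF T y'] q ed_const[OF T y'] alt_ginv[OF alt_cov])
      finally have "?k * ed (\<lambda>y. pull p y) y = ?k * pb ?D (ed p (\<phi> y))"
        unfolding left pb_sc_mult[symmetric] by (simp add: sum_negf pb_sum)
      \<comment> \<open>Euler's formula yields \<open>k\<close> times the claim, and
        \<open>k\<close> is nonzero in this case.\<close>
      then have "sc (inverse (of_int k)) * (?k * ed (\<lambda>y. pull p y) y) =
          sc (inverse (of_int k)) * (?k * pb ?D (ed p (\<phi> y)))"
        by simp
      then show ?thesis using False by (simp add: sc_mult_mult)
    qed
  qed
  from this[OF assms(2,3), of "Suc (nat k)"] show ?thesis by simp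
qed

end

subsection \<open>Changing coefficients\<close>

text \<open>Used with the embedding of the reals, with \<open>Re\<close> and \<open>Im\<close>, and
  with complex conjugation.\<close>

definition cmap :: "('b \<Rightarrow> 'c) \<Rightarrow> ('v, 'b) mform \<Rightarrow> ('v, 'c) mform" where
  "cmap h f = mf (\<lambda>vs. h (app f vs))"

lemma app_cmap [simp]: "app (cmap h f) vs = h (app f vs)" by (simp add: cmap_def)
lemma ctr_cmap: "ctr v (cmap h f) = cmap h (ctr v f)"
  and pb_cmap: "pb A (cmap h f) = cmap h (pb A f)"
  by (rule mform_eqI; simp)+

lemma cmap_diff: "linear h \<Longrightarrow> cmap h (f - g) = cmap h f - cmap h g"
  by (rule mform_eqI) (simp add: linear_diff)
lemma cmap_0: "linear h \<Longrightarrow> cmap h 0 = 0"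
  by (rule mform_eqI) (simp add: linear_0)

lemma cmap_ginv: "linear h \<Longrightarrow> cmap h (ginv f) = ginv (cmap h f)"
  by (rule mform_eqI) (simp add: linear_neg uminus_power_if)

lemma alt_cmap: "linear h \<Longrightarrow> alt k f \<Longrightarrow> alt k (cmap h f)"
  unfolding alt_def alternating_form_def
  by (auto simp: linear_0 intro: linear_compose[of _ h, unfolded comp_def])

text \<open>The hypothesis covers ring homomorphisms, but also the real part when \<open>f\<close> has real coefficients.\<close>

lemma cmap_mult:
  fixes f :: "('v, 'a::real_normed_field) mform" and e :: "('v, 'b::real_normed_field) mform"
    and h :: "'b \<Rightarrow> 'c::real_normed_field"
  assumes "linear h" "\<And>a b. h (g a * b) = g' a * h b" "linear g" "linear g'"
  shows "cmap h (cmap g f * e) = cmap g' f * cmap h e"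
proof (rule mform_eqI)
  fix vs show "app (cmap h (cmap g f * e)) vs = app (cmap g' f * cmap h e) vs"
  proof (induction vs arbitrary: f e)
    case (Cons v vs)
    have "app (cmap h (cmap g f * e)) (v # vs) =
        app (cmap h (cmap g (ctr v f) * e)) vs + app (cmap h (cmap g (ginv f) * ctr v e)) vs"
      by (simp add: app_mult_Cons ctr_cmap linear_add[OF assms(1)] cmap_ginv[OF assms(3)])
    also have "\<dots> = app (cmap g' f * cmap h e) (v # vs)"
      by (simp only: Cons app_mult_Cons ctr_cmap cmap_ginv[OF assms(4)])
    finally show ?case .
  qed (simp add: assms)
qed

lemma dird_cmap:
  assumes "bounded_linear h" "open S" "y \<in> S" "sform S p"
  shows "dird v (\<lambda>z. cmap h (p z)) y = cmap h (dird v p y)"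
proof (rule mform_eqI)
  fix vs
  have "((\<lambda>z. h (app (p z) vs)) has_derivative (\<lambda>v. h (app (dird v p y) vs))) (at y)"
    by (rule bounded_linear.has_derivative[OF assms(1) sform_has_derivative[OF assms(2-4)]])
  from frechet_derivative_at[OF this, THEN fun_cong, of v]
  show "app (dird v (\<lambda>z. cmap h (p z)) y) vs = app (cmap h (dird v p y)) vs"
    by (simp add: app_dird)
qed

lemma ed_cmap:
  assumes "bounded_linear h" "open S" "y \<in> S" "sform S p"
  shows "ed (\<lambda>z. cmap h (p z)) y = cmap h (ed p y)"
proof (rule mform_eqI)
  note lin = bounded_linear.linear[OF assms(1)]
  fix vs show "app (ed (\<lambda>z. cmap h (p z)) y) vs = app (cmap h (ed p y)) vs"
    using assms(4)
  proof (induction vs arbitrary: p)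
    case (Cons v vs)
    have "app (ed (\<lambda>z. cmap h (p z)) y) (v # vs) =
        app (cmap h (dird v p y)) vs - app (ed (\<lambda>z. cmap h (ctr v (p z))) y) vs"
      by (simp only: app_ctr[symmetric] ctr_ed ctr_cmap app_diff dird_cmap[OF assms(1-3) Cons.prems])
    also have "\<dots> = app (cmap h (ctr v (ed p y))) vs"
      by (simp only: Cons.IH[OF sform_ctr[OF Cons.prems]] ctr_ed cmap_diff[OF lin] app_diff)
    finally show ?case by simp
  qed (simp add: linear_0[OF lin])
qed

lemma sform_cmap: "bounded_linear h \<Longrightarrow> open S \<Longrightarrow> sform S p \<Longrightarrow> sform S (\<lambda>y. cmap h (p y))"
  unfolding sform_def by (auto intro: smooth_on_linear)

section \<open>Differential forms on manifolds\<close>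

locale smooth_manifold = atlas charts for charts :: "('a::topological_space, real^'m) chart set" +
  assumes smooth_atlas: "smooth_atlas charts"
begin

lemma chart_at: "chart_at x \<in> charts" "x \<in> fst (chart_at x)"
proof -
  have "\<exists>c. c \<in> charts \<and> x \<in> fst c"
    using smooth_atlas unfolding smooth_atlas_def by blast
  from someI_ex[OF this] show "chart_at x \<in> charts" "x \<in> fst (chart_at x)"
    unfolding chart_at_def by blast+
qed

context
  fixes c :: "('a, real^'m) chart" assumes c: "c \<in> charts"
begin

lemma chart_open: "open (fst c)" "open (snd c ` fst c)"
  using smooth_atlas c unfolding smooth_atlas_def by blast+

lemma chart_homeo: "homeomorphism (fst c) (snd c ` fst c) (snd c) (chart_inv c)"
  using smooth_atlas c unfolding smooth_atlas_def by blast

lemma chart_inv_snd [simp]: "x \<in> fst c \<Longrightarrow> chart_inv c (snd c x) = x"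
  by (rule homeomorphism_apply1[OF chart_homeo])

lemma open_chart_image: "open U \<Longrightarrow> open (snd c ` (fst c \<inter> U))"
proof -
  assume "open U"
  then have "openin (top_of_set (fst c)) (fst c \<inter> U)" by (rule openin_open_Int)
  from homeomorphism_imp_open_map[OF chart_homeo this] show ?thesis
    by (rule openin_open_trans[OF _ chart_open(2)])
qed

end

lemma smooth_transition:
  "c \<in> charts \<Longrightarrow> c' \<in> charts \<Longrightarrow> smooth_on (snd c' \<circ> chart_inv c) (snd c ` (fst c \<inter> fst c'))"
  using smooth_atlas unfolding smooth_atlas_def by blast

lemma tc_has_derivative:
  assumes "c \<in> charts" "c' \<in> charts" "x \<in> fst c" "x \<in> fst c'"
  shows "((snd c' \<circ> chart_inv c) has_derivative tangent_change c c' x) (at (snd c x))"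
  unfolding tangent_change_def using smooth_transition[OF assms(1,2)] assms(3,4)
  by (intro smooth_on_has_derivative) auto

lemma tc_linear:
  "c \<in> charts \<Longrightarrow> c' \<in> charts \<Longrightarrow> x \<in> fst c \<Longrightarrow> x \<in> fst c' \<Longrightarrow> linear (tangent_change c c' x)"
  by (rule has_derivative_linear[OF tc_has_derivative])

lemma tc_compose:
  assumes "c \<in> charts" "c' \<in> charts" "c'' \<in> charts" "x \<in> fst c" "x \<in> fst c'" "x \<in> fst c''"
  shows "tangent_change c' c'' x (tangent_change c c' x v) = tangent_change c c'' x v"
proof -
  let ?S = "snd c ` (fst c \<inter> (fst c' \<inter> fst c''))"
  have op: "open ?S" using assms by (intro open_chart_image open_Int chart_open)
  have x: "snd c x \<in> ?S" using assms by auto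
  have "(snd c' \<circ> chart_inv c) (snd c x) = snd c' x" using assms by simp
  then have "((snd c'' \<circ> chart_inv c') has_derivative tangent_change c' c'' x) (at ((snd c' \<circ> chart_inv c) (snd c x)))"
    using tc_has_derivative[OF assms(2,3,5,6)] by (simp only:)
  from has_derivative_compose[OF tc_has_derivative[OF assms(1,2,4,5)] this]
  have "((\<lambda>y. (snd c'' \<circ> chart_inv c') ((snd c' \<circ> chart_inv c) y)) has_derivative
      (\<lambda>v. tangent_change c' c'' x (tangent_change c c' x v))) (at (snd c x))" .
  then have "((snd c'' \<circ> chart_inv c) has_derivative
      (\<lambda>v. tangent_change c' c'' x (tangent_change c c' x v))) (at (snd c x))"
    by (rule has_derivative_cong_open[OF op x, THEN iffD1, rotated]) (use assms(1,2) in auto)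
  from has_derivative_unique[OF this tc_has_derivative[OF assms(1,3,4,6)]]
  show ?thesis by (rule fun_cong)
qed

lemma tc_ident [simp]:
  assumes "c \<in> charts" "x \<in> fst c"
  shows "tangent_change c c x = (\<lambda>v. v)"
proof -
  have "((snd c \<circ> chart_inv c) has_derivative (\<lambda>v. v)) (at (snd c x))"
    by (rule has_derivative_cong_open[OF chart_open(2)[OF assms(1)], THEN iffD1, OF _ _ has_derivative_ident])
      (use assms in auto)
  from has_derivative_unique[OF this tc_has_derivative[OF assms(1,1,2,2)]] show ?thesis by simp
qed

lemma tc_inverse [simp]:
  "c \<in> charts \<Longrightarrow> c' \<in> charts \<Longrightarrow> x \<in> fst c \<Longrightarrow> x \<in> fst c' \<Longrightarrow>
    tangent_change c' c x (tangent_change c c' x v) = v"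
  by (simp add: tc_compose)

text \<open>\<open>lform\<close>, \<open>smf\<close> and \<open>dm\<close> are the counterparts of
  \<open>form_in_chart\<close>, \<open>forms_on\<close> and \<open>ext_deriv\<close> for functions
  with values in the ring of list functions; \<open>forms_on_iff\<close> and
  \<open>dm_ext_deriv\<close> give the translation.\<close>

definition lform :: "('a, real^'m) chart \<Rightarrow> ('a \<Rightarrow> (real^'m, 'b) mform) \<Rightarrow> real^'m \<Rightarrow> (real^'m, 'b) mform" where
  "lform c g y = pb (tangent_change c (chart_at (chart_inv c y)) (chart_inv c y)) (g (chart_inv c y))"

definition smf :: "'a set \<Rightarrow> int \<Rightarrow> ('a \<Rightarrow> (real^'m, 'b::real_normed_field) mform) \<Rightarrow> bool" where
  "smf U k g \<longleftrightarrow> (\<forall>x\<in>U. alt k (g x)) \<and> (\<forall>c\<in>charts. sform (snd c ` (fst c \<inter> U)) (lform c g))"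

definition dm :: "('a \<Rightarrow> (real^'m, 'b::real_normed_field) mform) \<Rightarrow> 'a \<Rightarrow> (real^'m, 'b) mform" where
  "dm g x = ed (lform (chart_at x) g) (snd (chart_at x) x)"

lemma app_lform: "app (lform c (\<lambda>x. mf (\<omega> x)) y) = form_in_chart c \<omega> y"
  by (rule ext) (simp add: lform_def form_in_chart_def Let_def)

lemma forms_on_iff: "\<omega> \<in> forms_on U k \<longleftrightarrow> smf U k (\<lambda>x. mf (\<omega> x))"
  by (simp add: forms_on_def smf_def alt_def sform_def app_lform)

lemma dm_ext_deriv: "dm (\<lambda>x. mf (\<omega> x)) x = mf (ext_deriv \<omega> x)"
  by (simp add: dm_def ext_deriv_def ed_def app_lform)

lemma lform_snd: "c \<in> charts \<Longrightarrow> x \<in> fst c \<Longrightarrow> lform c g (snd c x) = pb (tangent_change c (chart_at x) x) (g x)"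
  by (simp add: lform_def)

lemma lform_chart_at: "lform (chart_at x) g (snd (chart_at x) x) = g x"
  using chart_at[of x] by (simp add: lform_def pb_ident)

lemma pb_lform:
  "c \<in> charts \<Longrightarrow> x \<in> fst c \<Longrightarrow> pb (tangent_change (chart_at x) c x) (lform c g (snd c x)) = g x"
  using chart_at[of x] by (simp add: lform_snd pb_pb pb_ident)

lemma lform_add: "lform c (\<lambda>x. g x + \<eta> x) = (\<lambda>y. lform c g y + lform c \<eta> y)"
  and lform_diff: "lform c (\<lambda>x. g x - \<eta> x) = (\<lambda>y. lform c g y - lform c \<eta> y)"
  and lform_uminus: "lform c (\<lambda>x. - g x) = (\<lambda>y. - lform c g y)"
  by (simp_all add: lform_def fun_eq_iff)

lemma lform_mult: "lform c (\<lambda>x. g x * \<eta> x) = (\<lambda>y. lform c g y * lform c \<eta> y)" by (simp add: lform_def fun_eq_iff pb_mult)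
lemma lform_power: "lform c (\<lambda>x. g x ^ m) = (\<lambda>y. lform c g y ^ m)" by (simp add: lform_def fun_eq_iff pb_power)
lemma lform_sum: "lform c (\<lambda>x. \<Sum>i\<in>I. g i x) = (\<lambda>y. \<Sum>i\<in>I. lform c (g i) y)" by (simp add: lform_def fun_eq_iff pb_sum)
lemma lform_sc: "lform c (\<lambda>x. sc (f x)) = (\<lambda>y. sc (f (chart_inv c y)))"
  and lform_0: "lform c (\<lambda>x. 0) = (\<lambda>y. 0)"
  by (simp_all add: lform_def fun_eq_iff)

lemma lform_ginv: "lform c (\<lambda>x. ginv (g x)) = (\<lambda>y. ginv (lform c g y))" by (simp add: lform_def fun_eq_iff pb_ginv)
lemma lform_cmap: "lform c (\<lambda>x. cmap h (g x)) = (\<lambda>y. cmap h (lform c g y))" by (simp add: lform_def fun_eq_iff pb_cmap)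

lemma smf_alt: "smf U k g \<Longrightarrow> x \<in> U \<Longrightarrow> alt k (g x)" by (simp add: smf_def)
lemma smf_sform: "smf U k g \<Longrightarrow> c \<in> charts \<Longrightarrow> sform (snd c ` (fst c \<inter> U)) (lform c g)" by (simp add: smf_def)

lemma alt_lform: "smf U k g \<Longrightarrow> c \<in> charts \<Longrightarrow> y \<in> snd c ` (fst c \<inter> U) \<Longrightarrow> alt k (lform c g y)"
  using chart_at by (auto simp: lform_def smf_def intro!: alt_pb tc_linear)

lemma smf_subset: "smf U k g \<Longrightarrow> V \<subseteq> U \<Longrightarrow> smf V k g"
  unfolding smf_def by (meson Int_mono image_mono order_refl sform_subset subsetD)

lemma lform_change:
  assumes "c \<in> charts" "c' \<in> charts" "y \<in> snd c ` (fst c \<inter> fst c')"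
  shows "lform c g y = pb (frechet_derivative (snd c' \<circ> chart_inv c) (at y)) (lform c' g ((snd c' \<circ> chart_inv c) y))"
proof -
  obtain x where x: "x \<in> fst c" "x \<in> fst c'" "y = snd c x" using assms(3) by auto
  have "lform c g y = pb (tangent_change c c' x) (lform c' g (snd c' x))"
    using x assms chart_at[of x] by (simp add: lform_snd pb_pb tc_compose)
  then show ?thesis using x assms by (simp add: tangent_change_def)
qed

text \<open>It suffices to test one chart near each point: in any other chart the coordinate
  expression is the pullback under the transition map, on the open set that this map sends into
  \<open>N\<close>.\<close>

lemma smfI_local:
  assumes U: "open U" and a: "\<And>x. x \<in> U \<Longrightarrow> alt k (g x)"
    and s: "\<And>x. x \<in> U \<Longrightarrow> \<exists>c N. c \<in> charts \<and> x \<in> fst c \<and> open N \<and> snd c x \<in> N \<and> sform N (lform c g)"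
  shows "smf U k g"
  unfolding smf_def
proof (intro conjI ballI a)
  fix c assume c: "c \<in> charts"
  show "sform (snd c ` (fst c \<inter> U)) (lform c g)"
  proof (rule sform_local)
    fix y assume "y \<in> snd c ` (fst c \<inter> U)"
    then obtain x where x: "x \<in> fst c" "x \<in> U" "y = snd c x" by auto
    from s[OF x(2)] obtain c' N where c': "c' \<in> charts" "x \<in> fst c'" "open N" "snd c' x \<in> N" "sform N (lform c' g)"
      by blast
    define \<phi> where "\<phi> = snd c' \<circ> chart_inv c"
    define W where "W = snd c ` (fst c \<inter> (fst c' \<inter> U))"
    have W: "open W" unfolding W_def by (intro open_chart_image c open_Int U chart_open c')
    have sm: "smooth_on \<phi> W"
      unfolding \<phi>_def W_def by (rule smooth_on_subset[OF smooth_transition[OF c c'(1)]]) auto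
    define V where "V = {y \<in> W. \<phi> y \<in> N}"
    have V: "open V"
      using continuous_open_preimage[OF smooth_on_imp_continuous_on[OF sm] W c'(3)]
      by (simp add: V_def vimage_def Int_def)
    have "y \<in> V" using x c c' by (auto simp: V_def W_def \<phi>_def)
    moreover have "sform V (\<lambda>z. pb (frechet_derivative \<phi> (at z)) (lform c' g (\<phi> z)))"
    proof (rule sform_pb[OF V, where k = k])
      show "smooth_on (\<lambda>y. frechet_derivative \<phi> (at y) v) V" for v
        by (rule smooth_on_subset[OF smooth_on_frechet_derivative[OF sm]]) (auto simp: V_def)
      show "sform V (\<lambda>z. lform c' g (\<phi> z))"
        by (rule sform_compose[OF V c'(3) _ smooth_on_subset[OF sm] c'(5)]) (auto simp: V_def)
      show "alt k (lform c' g (\<phi> z))" if "z \<in> V" for z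
      proof -
        from that have "z \<in> W" by (simp add: V_def)
        then obtain x' where "x' \<in> fst c" "x' \<in> fst c'" "x' \<in> U" "z = snd c x'" unfolding W_def by blast
        then show ?thesis
          using c c'(1) a[of x'] chart_at[of x'] by (auto simp: \<phi>_def lform_snd intro!: alt_pb tc_linear)
      qed
    qed
    moreover have "lform c g z = pb (frechet_derivative \<phi> (at z)) (lform c' g (\<phi> z))" if "z \<in> V" for z
      unfolding \<phi>_def using that by (intro lform_change c c') (auto simp: V_def W_def)
    ultimately show "\<exists>T. open T \<and> y \<in> T \<and> sform T (lform c g)"
      using V sform_cong[OF V, of "lform c g" "\<lambda>z. pb (frechet_derivative \<phi> (at z)) (lform c' g (\<phi> z))"] by blast
  qed
qed

lemma smf_local:
  assumes "open U" "\<And>x. x \<in> U \<Longrightarrow> \<exists>V. open V \<and> x \<in> V \<and> smf V k g"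
  shows "smf U k g"
proof (rule smfI_local[OF assms(1)])
  fix x assume "x \<in> U"
  from assms(2)[OF this] obtain V where V: "open V" "x \<in> V" "smf V k g" by blast
  then show "alt k (g x)" by (simp add: smf_alt)
  show "\<exists>c N. c \<in> charts \<and> x \<in> fst c \<and> open N \<and> snd c x \<in> N \<and> sform N (lform c g)"
    using V chart_at[of x] smf_sform[OF V(3) chart_at(1)]
    by (intro exI[of _ "chart_at x"] exI[of _ "snd (chart_at x) ` (fst (chart_at x) \<inter> V)"])
       (auto intro: open_chart_image)
qed

lemma smf_cong: "open U \<Longrightarrow> (\<And>x. x \<in> U \<Longrightarrow> g x = \<eta> x) \<Longrightarrow> smf U k g \<longleftrightarrow> smf U k \<eta>"
proof -
  assume U: "open U" and eq: "\<And>x. x \<in> U \<Longrightarrow> g x = \<eta> x"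
  have "sform (snd c ` (fst c \<inter> U)) (lform c g) \<longleftrightarrow> sform (snd c ` (fst c \<inter> U)) (lform c \<eta>)" if "c \<in> charts" for c
    using eq by (intro sform_cong open_chart_image that U) (auto simp: lform_snd that)
  then show ?thesis using eq by (simp add: smf_def)
qed

lemma dm_cong:
  assumes "open U" "x \<in> U" "\<And>x. x \<in> U \<Longrightarrow> g x = \<eta> x"
  shows "dm g x = dm \<eta> x"
  unfolding dm_def
  using assms chart_at[of x]
  by (intro ed_cong[OF open_chart_image[OF chart_at(1) assms(1)]]) (auto simp: lform_snd)

context
  fixes U :: "'a set" assumes U: "open U"
begin

lemma smf_add: "smf U k g \<Longrightarrow> smf U k \<eta> \<Longrightarrow> smf U k (\<lambda>x. g x + \<eta> x)"
  unfolding smf_def by (auto intro: alt_add simp: lform_add sform_add open_chart_image U)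

lemma smf_diff: "smf U k g \<Longrightarrow> smf U k \<eta> \<Longrightarrow> smf U k (\<lambda>x. g x - \<eta> x)"
  unfolding smf_def by (auto intro: alt_diff simp: lform_diff sform_diff open_chart_image U)

lemma smf_ginv: "smf U k g \<Longrightarrow> smf U k (\<lambda>x. ginv (g x))"
  unfolding smf_def by (auto intro: alt_ginv_alt simp: lform_ginv sform_ginv open_chart_image U)

lemma smf_mult: "smf U k g \<Longrightarrow> smf U l \<eta> \<Longrightarrow> smf U (k + l) (\<lambda>x. g x * \<eta> x)"
  unfolding smf_def by (auto intro: alt_mult simp: lform_mult sform_mult open_chart_image U)

lemma smf_power: "smf U k g \<Longrightarrow> smf U (int m * k) (\<lambda>x. g x ^ m)"
  unfolding smf_def by (auto intro: alt_power simp: lform_power sform_power open_chart_image U)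

lemma smf_0: "smf U k (\<lambda>x. 0)"
  by (simp add: smf_def lform_0)

lemma smf_sum: "(\<And>i. i \<in> I \<Longrightarrow> smf U k (g i)) \<Longrightarrow> smf U k (\<lambda>x. \<Sum>i\<in>I. g i x)"
  by (induction I rule: infinite_finite_induct) (auto intro: smf_add smf_0)

lemma smf_sc: "smf U 0 (\<lambda>x. sc c)"
  by (simp add: smf_def alt_sc lform_sc)

lemma smf_sc_mult: "smf U k g \<Longrightarrow> smf U k (\<lambda>x. sc c * g x)"
  using smf_mult[OF smf_sc, of k g c] by simp

lemma smf_cmap: "bounded_linear h \<Longrightarrow> smf U k g \<Longrightarrow> smf U k (\<lambda>x. cmap h (g x))"
  unfolding smf_def
  by (auto intro: alt_cmap bounded_linear.linear simp: lform_cmap sform_cmap open_chart_image U)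

context
  fixes x :: 'a assumes x: "x \<in> U"
begin

lemma chart_image_at: "open (snd (chart_at x) ` (fst (chart_at x) \<inter> U))"
    "snd (chart_at x) x \<in> snd (chart_at x) ` (fst (chart_at x) \<inter> U)"
  using open_chart_image[OF chart_at(1) U] chart_at(2) x by auto

lemma dm_add: "smf U k g \<Longrightarrow> smf U k \<eta> \<Longrightarrow> dm (\<lambda>x. g x + \<eta> x) x = dm g x + dm \<eta> x"
  unfolding dm_def lform_add by (intro ed_add[OF chart_image_at] smf_sform chart_at)

lemma dm_diff: "smf U k g \<Longrightarrow> smf U k \<eta> \<Longrightarrow> dm (\<lambda>x. g x - \<eta> x) x = dm g x - dm \<eta> x"
  unfolding dm_def lform_diff by (intro ed_diff[OF chart_image_at] smf_sform chart_at)

lemma dm_mult: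
  "smf U k g \<Longrightarrow> smf U l \<eta> \<Longrightarrow> dm (\<lambda>x. g x * \<eta> x) x = dm g x * \<eta> x + ginv (g x) * dm \<eta> x"
  unfolding dm_def lform_mult
  by (subst ed_mult[OF chart_image_at smf_sform[OF _ chart_at(1)] smf_sform[OF _ chart_at(1)]])
    (simp_all only: lform_chart_at)

lemma dm_const: "dm (\<lambda>x. sc c) x = 0"
  unfolding dm_def lform_sc by (rule ed_const[OF chart_image_at])

lemma dm_0: "dm (\<lambda>x. 0) x = 0"
  unfolding dm_def lform_0 by (rule ed_const[OF chart_image_at])

lemma dm_sc_mult: "smf U k g \<Longrightarrow> dm (\<lambda>x. sc c * g x) x = sc c * dm g x"
  using dm_mult[OF smf_sc, of k g c] by (simp add: dm_const)

lemma dm_sum: "(\<And>i. i \<in> I \<Longrightarrow> smf U k (g i)) \<Longrightarrow> dm (\<lambda>x. \<Sum>i\<in>I. g i x) x = (\<Sum>i\<in>I. dm (g i) x)"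
  unfolding dm_def lform_sum by (intro ed_sum[OF chart_image_at] smf_sform chart_at)

lemma dm_cmap: "bounded_linear h \<Longrightarrow> smf U k g \<Longrightarrow> dm (\<lambda>x. cmap h (g x)) x = cmap h (dm g x)"
  unfolding dm_def lform_cmap by (intro ed_cmap[OF _ chart_image_at] smf_sform chart_at)

end

text \<open>\<open>dm\<close> is computed at each point in the chart chosen for that point, and this
  chart may jump. Naturality of \<open>ed\<close> under transition maps shows that a fixed chart
  computes it as well, which gives smoothness of \<open>dm g\<close> and its second
  differential.\<close>

lemma lform_dm:
  fixes g :: "'a \<Rightarrow> (real^'m, 'b::{real_normed_field,euclidean_space}) mform"
  assumes g: "smf U k g" and c: "c \<in> charts" and y: "y \<in> snd c ` (fst c \<inter> U)"
  shows "lform c (dm g) y = ed (lform c g) y"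
proof -
  obtain x where x: "x \<in> fst c" "x \<in> U" "y = snd c x" using y by auto
  let ?c = "chart_at x"
  let ?\<phi> = "snd ?c \<circ> chart_inv c"
  let ?S = "snd c ` (fst c \<inter> (fst ?c \<inter> U))"
  let ?T = "snd ?c ` (fst ?c \<inter> U)"
  have S: "open ?S" by (intro open_chart_image c open_Int U chart_open chart_at)
  have yS: "y \<in> ?S" using x chart_at by auto
  have T: "open ?T" by (intro open_chart_image U chart_at)
  have \<phi>: "?\<phi> ` ?S \<subseteq> ?T" using c by auto
  have sm: "smooth_on ?\<phi> ?S"
    by (rule smooth_on_subset[OF smooth_transition[OF c chart_at(1)]]) auto
  have "ed (lform c g) y = ed (\<lambda>z. pb (frechet_derivative ?\<phi> (at z)) (lform ?c g (?\<phi> z))) y"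
    by (intro ed_cong[OF S yS] lform_change c chart_at) auto
  also have "\<dots> = pb (frechet_derivative ?\<phi> (at y)) (ed (lform ?c g) (?\<phi> y))"
    by (rule ed_pull[OF S T \<phi> sm yS smf_sform[OF g chart_at(1)] alt_lform[OF g chart_at(1)]])
  also have "\<dots> = lform c (dm g) y"
    using x c by (simp add: lform_snd dm_def tangent_change_def)
  finally show ?thesis by simp
qed

lemma smf_dm:
  fixes g :: "'a \<Rightarrow> (real^'m, 'b::{real_normed_field,euclidean_space}) mform"
  assumes g: "smf U k g"
  shows "smf U (k + 1) (dm g)"
  unfolding smf_def
proof (intro conjI ballI)
  show "alt (k + 1) (dm g x)" if "x \<in> U" for x
    unfolding dm_def
    by (rule alt_ed[OF chart_image_at(1)[OF that] smf_sform[OF g chart_at(1)] chart_image_at(2)[OF that]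
          alt_lform[OF g chart_at(1)]])
  fix c assume c: "c \<in> charts"
  note op = open_chart_image[OF c U]
  show "sform (snd c ` (fst c \<inter> U)) (lform c (dm g))"
  proof (subst sform_cong[OF op])
    show "lform c (dm g) y = ed (lform c g) y" if "y \<in> snd c ` (fst c \<inter> U)" for y
      by (rule lform_dm[OF g c that])
    show "sform (snd c ` (fst c \<inter> U)) (ed (lform c g))"
      using sform_ed[OF op smf_sform[OF g c]] .
  qed
qed

lemma dm_dm:
  fixes g :: "'a \<Rightarrow> (real^'m, 'b::{real_normed_field,euclidean_space}) mform"
  assumes g: "smf U k g" and x: "x \<in> U"
  shows "dm (dm g) x = 0"
proof -
  have "dm (dm g) x = ed (ed (lform (chart_at x) g)) (snd (chart_at x) x)"
    unfolding dm_def[of "dm g"]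
    by (intro ed_cong[OF chart_image_at[OF x]] lform_dm[OF g chart_at(1)])
  then show ?thesis using ed_ed[OF chart_image_at(1)[OF x] smf_sform[OF g chart_at(1)] chart_image_at(2)[OF x]] by simp
qed

end

end

section \<open>Contraction with complex vectors\<close>

type_synonym 'm cform = "(real^'m, complex) mform"

text \<open>Contraction extended complex linearly in the vector. Forms remain functions of real
  vectors with complex values, and complex arguments enter only through this operator.\<close>

definition cctr :: "complex^'m \<Rightarrow> 'm cform \<Rightarrow> 'm cform" where
  "cctr Z f = ctr (vec_Re Z) f + sc \<i> * ctr (vec_Im Z) f"

lemma vec_Re_simps [simp]:
  "vec_Re 0 = 0" "vec_Re (Z + W) = vec_Re Z + vec_Re W" "vec_Re (vec_of_real v) = v"
  "vec_Re (a *s Z) = Re a *\<^sub>R vec_Re Z - Im a *\<^sub>R vec_Im Z" "vec_Re (- Z) = - vec_Re Z"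
  "vec_Re (Z - W) = vec_Re Z - vec_Re W" "vec_Re (vec_cnj Z) = vec_Re Z"
  by (simp_all add: vec_eq_iff vec_Re_def vec_Im_def vec_of_real_def vec_cnj_def)

lemma vec_Im_simps [simp]:
  "vec_Im 0 = 0" "vec_Im (Z + W) = vec_Im Z + vec_Im W" "vec_Im (vec_of_real v) = 0"
  "vec_Im (a *s Z) = Re a *\<^sub>R vec_Im Z + Im a *\<^sub>R vec_Re Z" "vec_Im (- Z) = - vec_Im Z"
  "vec_Im (Z - W) = vec_Im Z - vec_Im W" "vec_Im (vec_cnj Z) = - vec_Im Z"
  by (simp_all add: vec_eq_iff vec_Re_def vec_Im_def vec_of_real_def vec_cnj_def)

lemma vec_of_real_simps [simp]:
  "vec_of_real 0 = 0" "vec_of_real (v + w) = vec_of_real v + vec_of_real w"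
  "vec_of_real (- v) = - vec_of_real v" "vec_of_real (v - w) = vec_of_real v - vec_of_real w"
  "vec_of_real (r *\<^sub>R v) = complex_of_real r *s vec_of_real v"
  by (simp_all add: vec_eq_iff vec_of_real_def)

lemma vec_Re_Im: "Z = vec_of_real (vec_Re Z) + \<i> *s vec_of_real (vec_Im Z)"
  by (simp add: vec_eq_iff vec_Re_def vec_Im_def vec_of_real_def complex_eq)

lemma cctr_add_right [simp]: "cctr Z (f + g) = cctr Z f + cctr Z g" by (simp add: cctr_def algebra_simps)
lemma cctr_diff_right [simp]: "cctr Z (f - g) = cctr Z f - cctr Z g" by (simp add: cctr_def algebra_simps)
lemma cctr_uminus_right [simp]: "cctr Z (- f) = - cctr Z f"
  and cctr_0_right [simp]: "cctr Z 0 = 0"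
  and cctr_1_right [simp]: "cctr Z 1 = 0"
  and cctr_sc [simp]: "cctr Z (sc c) = 0"
  by (simp_all add: cctr_def)

lemma cctr_mult: "cctr Z (f * g) = cctr Z f * g + ginv f * cctr Z g"
  by (simp add: cctr_def ctr_mult algebra_simps sc_left_commute)

lemma cctr_sc_mult: "cctr Z (sc c * f) = sc c * cctr Z f" by (simp add: cctr_mult)

lemma cctr_ginv: "cctr Z (ginv f) = - ginv (cctr Z f)"
  by (simp add: cctr_def ctr_ginv ginv_sc_mult)

lemma alt_cctr: "alt k f \<Longrightarrow> alt (k - 1) (cctr Z f)"
  by (simp add: cctr_def alt_add alt_sc_mult alt_ctr)

lemma cctr_of_real: "alt k f \<Longrightarrow> cctr (vec_of_real v) f = ctr v f"
  by (simp add: cctr_def alt_ctr_zero)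

lemma cctr_add_left: "alt k f \<Longrightarrow> cctr (Z + W) f = cctr Z f + cctr W f"
  by (simp add: cctr_def alt_ctr_add algebra_simps)

lemma cctr_scale_left: "alt k f \<Longrightarrow> cctr (a *s Z) f = sc a * cctr Z f"
proof -
  assume f: "alt k f"
  let ?x = "ctr (vec_Re Z) f" and ?y = "ctr (vec_Im Z) f" and ?r = "complex_of_real (Re a)" and ?s = "complex_of_real (Im a)"
  have "sc a * cctr Z f = sc (?r + ?s * \<i>) * (?x + sc \<i> * ?y)"
  proof -
    have "a = ?r + ?s * \<i>" by (simp add: complex_eq_iff)
    then show ?thesis by (simp only: cctr_def)
  qed
  also have "\<dots> = sc ?r * ?x + sc (?r * \<i>) * ?y + sc (?s * \<i>) * ?x + sc (?s * \<i> * \<i>) * ?y"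
    by (simp only: sc_add distrib_left distrib_right sc_mult_mult add.assoc add.left_commute)
  also have "?s * \<i> * \<i> = - ?s" by (simp add: mult.assoc)
  also have "sc ?r * ?x + sc (?r * \<i>) * ?y + sc (?s * \<i>) * ?x + sc (- ?s) * ?y =
      (sc ?r * ?x - sc ?s * ?y) + sc \<i> * (sc ?r * ?y + sc ?s * ?x)"
    by (simp only: sc_uminus distrib_left sc_mult_mult mult.commute[of \<i>]) simp
  also have "\<dots> = cctr (a *s Z) f"
    by (simp add: cctr_def alt_ctr_add[OF f] alt_ctr_diff[OF f] alt_ctr_scaleR[OF f])
  finally show ?thesis by simp
qed

lemma cctr_zero_left: "alt k f \<Longrightarrow> cctr 0 f = 0"
  by (simp add: cctr_def alt_ctr_zero)

lemma cctr_diff_left: "alt k f \<Longrightarrow> cctr (Z - W) f = cctr Z f - cctr W f"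
  by (simp add: cctr_def alt_ctr_diff algebra_simps)

lemma cctr_ctr_swap: "alt k f \<Longrightarrow> cctr Z (ctr w f) = - ctr w (cctr Z f)"
  by (simp add: cctr_def ctr_sc_mult alt_ctr_swap[of k f _ w])

lemma cctr_swap: "alt k f \<Longrightarrow> cctr Z (cctr W f) = - cctr W (cctr Z f)"
proof -
  assume f: "alt k f"
  have "cctr Z (cctr W f) = cctr Z (ctr (vec_Re W) f) + sc \<i> * cctr Z (ctr (vec_Im W) f)"
    by (simp add: cctr_def[of W] cctr_sc_mult)
  also have "\<dots> = - cctr W (cctr Z f)"
    by (simp add: cctr_ctr_swap[OF f] cctr_def[of W])
  finally show ?thesis .
qed

lemma cctr_self: "alt k f \<Longrightarrow> cctr Z (cctr Z f) = 0"
proof -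
  assume f: "alt k f"
  have "cctr Z (cctr Z f) = - cctr Z (cctr Z f)" by (rule cctr_swap[OF f])
  then have "app (cctr Z (cctr Z f)) vs = - app (cctr Z (cctr Z f)) vs" for vs by (metis app_uminus)
  then show ?thesis by (intro mform_eqI) (simp add: equal_neg_zero)
qed

lemma cctr_two_form_power: "alt 2 b \<Longrightarrow> cctr Z (b ^ Suc m) = sc (of_nat (Suc m)) * (cctr Z b * b ^ m)"
  unfolding cctr_def
  by (simp only: ctr_two_form_power distrib_left distrib_right mult.assoc sc_mult_mult mult.commute[of \<i>])

lemma zero_if_ctr_zero: "alt k f \<Longrightarrow> k \<noteq> 0 \<Longrightarrow> (\<And>v. ctr v f = 0) \<Longrightarrow> f = 0"
  by (subst mform_eq_iff) (simp add: alt_Nil)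

lemma multi_extension_linear:
  "multi_extension (\<lambda>vs. f vs + a * g vs) Zs = multi_extension f Zs + a * multi_extension g Zs"
  by (induction Zs arbitrary: f g) (auto simp: algebra_simps)

text \<open>The bridge between the multilinear extension used to define types and the Levi form, and
  iterated contraction with complex vectors.\<close>

lemma multi_extension_Cons:
  "multi_extension (app f) (Z # Zs) = multi_extension (app (cctr Z f)) Zs"
proof -
  have "app (cctr Z f) = (\<lambda>vs. app f (vec_Re Z # vs) + \<i> * app f (vec_Im Z # vs))"
    by (rule ext) (simp add: cctr_def)
  then show ?thesis by (simp add: multi_extension_linear)
qed

declare multi_extension.simps(2) [simp del]

lemma multi_extension_move:
  "alt k f \<Longrightarrow> multi_extension (app f) (Zs @ W # Ws) = (- 1) ^ length Zs * multi_extension (app f) (W # Zs @ Ws)"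
proof (induction Zs arbitrary: k f)
  case (Cons Z Zs)
  have neg: "multi_extension (app (- g)) Zs = - multi_extension (app g) Zs" for g :: "'a cform" and Zs
    using multi_extension_linear[of "\<lambda>_. 0" "-1" "app g" Zs] multi_extension_linear[of "\<lambda>_. 0" "-1" "\<lambda>_. 0" Zs]
    by (simp add: fun_eq_iff[of "app (- g)"] ext[of "app (- g)" "\<lambda>vs. - app g vs"])
  have "multi_extension (app f) ((Z # Zs) @ W # Ws) = (- 1) ^ length Zs * multi_extension (app (cctr W (cctr Z f))) (Zs @ Ws)"
    using Cons.IH[OF alt_cctr[OF Cons.prems]] by (simp add: multi_extension_Cons)
  then show ?case
    by (simp add: cctr_swap[OF Cons.prems, of W Z] neg multi_extension_Cons)
qed simp

text \<open>With \<open>S\<close> the space T01 at a point, \<open>kills S a\<close> is membership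
  in the filtration step F \<open>a\<close> there.\<close>

primrec kills :: "(complex^'m) set \<Rightarrow> nat \<Rightarrow> 'm cform \<Rightarrow> bool" where
  "kills S 0 f \<longleftrightarrow> f = 0"
| "kills S (Suc a) f \<longleftrightarrow> (\<forall>W\<in>S. kills S a (cctr W f))"

lemma kills_0 [simp]: "kills S a 0"
  by (induction a) auto

lemma kills_add: "kills S a f \<Longrightarrow> kills S a g \<Longrightarrow> kills S a (f + g)"
  by (induction a arbitrary: f g) auto

lemma kills_uminus: "kills S a f \<Longrightarrow> kills S a (- f)"
  by (induction a arbitrary: f) auto

lemma kills_diff: "kills S a f \<Longrightarrow> kills S a g \<Longrightarrow> kills S a (f - g)"
  using kills_add[of S a f "- g"] kills_uminus by fastforce

lemma kills_sc_mult: "kills S a f \<Longrightarrow> kills S a (sc c * f)"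
  by (induction a arbitrary: f) (auto simp: cctr_sc_mult)

lemma kills_sum: "(\<And>i. i \<in> I \<Longrightarrow> kills S a (f i)) \<Longrightarrow> kills S a (\<Sum>i\<in>I. f i)"
  by (induction I rule: infinite_finite_induct) (auto intro: kills_add)

lemma kills_ginv: "kills S a f \<Longrightarrow> kills S a (ginv f)"
  by (induction a arbitrary: f) (auto simp: cctr_ginv intro: kills_uminus)

lemma kills_Suc: "kills S a f \<Longrightarrow> kills S (Suc a) f"
  by (induction a arbitrary: f) auto

lemma kills_mono: "kills S a f \<Longrightarrow> a \<le> b \<Longrightarrow> kills S b f"
  by (induction b) (auto simp: le_Suc_eq simp del: kills.simps intro: kills_Suc)

lemma kills_cctr: "alt k f \<Longrightarrow> kills S a f \<Longrightarrow> kills S a (cctr Z f)"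
proof (induction a arbitrary: k f)
  case (Suc a)
  have "kills S a (cctr W (cctr Z f))" if "W \<in> S" for W
    using Suc.IH[OF alt_cctr[OF Suc.prems(1)]] Suc.prems that
    by (simp add: cctr_swap[OF Suc.prems(1), of W] kills_uminus)
  then show ?case by simp
qed simp

text \<open>By the Leibniz rule, of \<open>a + b + 1\<close> contractions either more than
  \<open>a\<close> fall on \<open>f\<close> or more than \<open>b\<close> on
  \<open>g\<close>.\<close>

lemma kills_mult: "kills S (Suc a) f \<Longrightarrow> kills S (Suc b) g \<Longrightarrow> kills S (Suc (a + b)) (f * g)"
proof (induction "a + b" arbitrary: a b f g rule: less_induct)
  case less
  have "kills S (a + b) (cctr W (f * g))" if W: "W \<in> S" for W
  proof -
    have "kills S (a + b) (cctr W f * g)"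
    proof (cases a)
      case (Suc a')
      then show ?thesis using less.hyps[of a' b "cctr W f" g] less.prems W by simp
    qed (use less.prems W in simp)
    moreover have "kills S (a + b) (ginv f * cctr W g)"
    proof (cases b)
      case (Suc b')
      then show ?thesis using less.hyps[of a b' "ginv f" "cctr W g"] less.prems(2) kills_ginv[OF less.prems(1)] W by simp
    qed (use less.prems W in simp)
    ultimately show ?thesis by (simp add: cctr_mult kills_add)
  qed
  then show ?case by simp
qed

lemma kills_mult_le:
  assumes "kills S a f" "kills S b g" "a + b \<le> Suc c"
  shows "kills S c (f * g)"
proof (cases a)
  case (Suc a')
  show ?thesis
  proof (cases b)
    case (Suc b')
    have "kills S (Suc (a' + b')) (f * g)"
      using kills_mult assms(1,2) Suc \<open>a = Suc a'\<close> by (simp only:)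
    then show ?thesis by (rule kills_mono) (use assms(3) Suc \<open>a = Suc a'\<close> in simp)
  qed (use assms in simp)
qed (use assms in simp)

lemma kills_power: "kills S (Suc a) f \<Longrightarrow> kills S (Suc (m * a)) (f ^ m)"
proof (induction m)
  case 0
  show ?case by simp
next
  case (Suc m)
  then show ?case using kills_mult[OF Suc.prems Suc.IH[OF Suc.prems]] by simp
qed

lemma kills_UNIV_zero: "alt k f \<Longrightarrow> kills UNIV a f \<Longrightarrow> k \<ge> int a \<Longrightarrow> f = 0"
proof (induction a arbitrary: k f)
  case (Suc a)
  show ?case
  proof (rule zero_if_ctr_zero[OF Suc.prems(1)])
    show "ctr v f = 0" for v
    proof (rule Suc.IH[OF alt_ctr[OF Suc.prems(1)]])
      have "kills UNIV a (cctr (vec_of_real v) f)" using Suc.prems(2) by auto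
      then show "kills UNIV a (ctr v f)" by (simp only: cctr_of_real[OF Suc.prems(1)])
    qed (use Suc.prems in simp)
  qed (use Suc.prems in simp)
qed simp

text \<open>Pigeonhole: split each of \<open>a + b - 1\<close> vectors along \<open>Q\<close> and
  \<open>F\<close>; in every resulting term at least \<open>a\<close> vectors lie in
  \<open>F\<close> or at least \<open>b\<close> in \<open>Q\<close>.\<close>

lemma kills_UNIV:
  assumes "\<And>v. \<exists>q w. q \<in> Q \<and> w \<in> F \<and> v = q + w"
  shows "alt k f \<Longrightarrow> kills F a f \<Longrightarrow> kills Q b f \<Longrightarrow> kills UNIV (a + b - 1) f"
proof (induction "a + b" arbitrary: a b k f rule: less_induct)
  case less
  show ?case
  proof (cases "a = 0 \<or> b = 0")
    case True
    then show ?thesis using less.prems by auto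
  next
    case False
    then obtain a' b' where ab: "a = Suc a'" "b = Suc b'" by (metis not0_implies_Suc)
    have "kills UNIV (a' + b') (cctr v f)" for v
    proof -
      obtain q w where qw: "q \<in> Q" "w \<in> F" "v = q + w" using assms by blast
      have 1: "kills UNIV (a' + b') (cctr q f)"
        using less.hyps[of a b' "k - 1" "cctr q f"] alt_cctr[OF less.prems(1)]
          kills_cctr[OF less.prems(1,2)] less.prems(3) qw ab by simp
      have 2: "kills UNIV (a' + b') (cctr w f)"
        using less.hyps[of a' b "k - 1" "cctr w f"] alt_cctr[OF less.prems(1)]
          kills_cctr[OF less.prems(1,3)] less.prems(2) qw ab by simp
      show ?thesis unfolding qw(3) cctr_add_left[OF less.prems(1)] using 1 2 by (rule kills_add)
    qed
    then show ?thesis using ab by simp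
  qed
qed

lemma kills_span_insert_aux:
  assumes b: "\<And>v. v \<in> Q' \<Longrightarrow> \<exists>u\<in>Q. \<exists>c. v = u + c *s b"
  shows "alt k f \<Longrightarrow> kills Q a f \<Longrightarrow> cctr b f = 0 \<Longrightarrow> kills Q' a f"
proof (induction a arbitrary: k f)
  case (Suc a)
  have "kills Q' a (cctr v f)" if "v \<in> Q'" for v
  proof -
    obtain u c where v: "u \<in> Q" "v = u + c *s b" using b[OF \<open>v \<in> Q'\<close>] by blast
    have "cctr v f = cctr u f"
      unfolding v(2) using Suc.prems by (simp add: cctr_add_left cctr_scale_left)
    moreover have "cctr b (cctr u f) = 0" using Suc.prems by (simp add: cctr_swap[of k f b u])
    ultimately show ?thesis
      using Suc.IH[OF alt_cctr[OF Suc.prems(1), of u]] Suc.prems v by simp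
  qed
  then show ?case by simp
qed simp

text \<open>By alternation the additional generator \<open>b\<close> fills at most one argument. If
  it fills one, \<open>a\<close> arguments from \<open>Q\<close> remain; otherwise all
  \<open>Suc a\<close> come from \<open>Q\<close>.\<close>

lemma kills_span_insert:
  assumes b: "\<And>v. v \<in> Q' \<Longrightarrow> \<exists>u\<in>Q. \<exists>c. v = u + c *s b"
  shows "alt k f \<Longrightarrow> kills Q a (cctr b f) \<Longrightarrow> kills Q (Suc a) f \<Longrightarrow> kills Q' (Suc a) f"
proof (induction a arbitrary: k f)
  case (0 k f)
  have "cctr v f = 0" if v': "v \<in> Q'" for v
  proof -
    obtain u c where "u \<in> Q" "v = u + c *s b" using b[OF v'] by blast
    then show ?thesis using 0 by (simp add: cctr_add_left cctr_scale_left)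
  qed
  then show ?case by simp
next
  case (Suc a)
  have "kills Q' (Suc a) (cctr v f)" if v': "v \<in> Q'" for v
  proof -
    obtain u c where v: "u \<in> Q" "v = u + c *s b" using b[OF v'] by blast
    have "kills Q' (Suc a) (cctr b f)"
      by (rule kills_span_insert_aux[OF b alt_cctr[OF Suc.prems(1)] Suc.prems(2)])
        (simp_all add: cctr_self[OF Suc.prems(1)])
    moreover have "kills Q' (Suc a) (cctr u f)"
    proof (rule Suc.IH[OF alt_cctr[OF Suc.prems(1)]])
      show "kills Q a (cctr b (cctr u f))"
        using Suc.prems(2) v by (simp add: cctr_swap[OF Suc.prems(1), of b u] kills_uminus)
      show "kills Q (Suc a) (cctr u f)" using Suc.prems(3) v by simp
    qed
    ultimately show ?thesis
      unfolding v(2) using Suc.prems(1)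
      by (simp add: cctr_add_left cctr_scale_left kills_add kills_sc_mult del: kills.simps)
  qed
  then show ?case by simp
qed

text \<open>Alternating forms vanish on more vectors than there are generators; adding generators
  one at a time makes linear independence irrelevant to the induction.\<close>

lemma kills_span: "alt k f \<Longrightarrow> kills (vec.span (b ` {..<N})) (Suc N) f"
proof (induction N arbitrary: k f)
  case 0
  then show ?case by (auto simp: cctr_zero_left)
next
  case (Suc N)
  have "\<exists>u\<in>vec.span (b ` {..<N}). \<exists>c. v = u + c *s b N" if "v \<in> vec.span (b ` {..<Suc N})" for v
  proof -
    have "v \<in> vec.span (insert (b N) (b ` {..<N}))"
      using that by (simp add: lessThan_Suc)
    then obtain c where c: "v - c *s b N \<in> vec.span (b ` {..<N})"
      unfolding vec.span_insert by blast
    show ?thesis by (rule bexI[OF _ c], rule exI[of _ c]) simp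
  qed
  from kills_span_insert[OF this Suc.prems Suc.IH[OF alt_cctr[OF Suc.prems]] kills_Suc[OF Suc.IH[OF Suc.prems]]]
  show ?case .
qed

subsection \<open>Counting arguments in a subspace\<close>

primrec nlist :: "(real^'m \<Rightarrow> complex^'m) \<Rightarrow> (real^'m) list \<Rightarrow> 'm cform \<Rightarrow> complex" where
  "nlist P [] f = 0"
| "nlist P (v # vs) f = app (cctr (P v) f) vs + nlist P vs (ctr v f)"

text \<open>The derivation of the exterior algebra that replaces one argument \<open>v\<close> by \<open>P v\<close>; if \<open>P\<close> is a
  projection, it counts the arguments lying in the range of \<open>P\<close>.\<close>

definition nop :: "(real^'m \<Rightarrow> complex^'m) \<Rightarrow> 'm cform \<Rightarrow> 'm cform" where
  "nop P f = mf (\<lambda>vs. nlist P vs f)"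

lemma app_nop_Nil [simp]: "app (nop P f) [] = 0" by (simp add: nop_def)

lemma ctr_nop: "ctr v (nop P f) = cctr (P v) f + nop P (ctr v f)"
  by (rule mform_eqI) (simp add: nop_def)

lemma nop_0 [simp]: "nop P 0 = 0"
proof (rule mform_eqI)
  show "app (nop P 0) vs = app 0 vs" for vs by (induction vs) (simp_all flip: app_ctr add: ctr_nop)
qed

lemma nop_add [simp]: "nop P (f + g) = nop P f + nop P g"
proof (rule mform_eqI)
  show "app (nop P (f + g)) vs = app (nop P f + nop P g) vs" for vs
    by (induction vs arbitrary: f g) (simp_all flip: app_ctr add: ctr_nop)
qed

lemma nop_sc_mult: "nop P (sc c * f) = sc c * nop P f"
proof (rule mform_eqI)
  show "app (nop P (sc c * f)) vs = app (sc c * nop P f) vs" for vs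
    by (induction vs arbitrary: f) (simp_all flip: app_ctr add: ctr_nop ctr_sc_mult cctr_sc_mult distrib_left)
qed

lemma nop_uminus [simp]: "nop P (- f) = - nop P f"
  using nop_sc_mult[of P "-1" f] by (simp add: sc_uminus)

lemma nop_diff [simp]: "nop P (f - g) = nop P f - nop P g"
  using nop_add[of P f "- g"] by simp

lemma nop_sum: "nop P (\<Sum>i\<in>I. f i) = (\<Sum>i\<in>I. nop P (f i))"
  by (induction I rule: infinite_finite_induct) auto

lemma nop_ginv: "nop P (ginv f) = ginv (nop P f)"
proof (rule mform_eqI)
  show "app (nop P (ginv f)) vs = app (ginv (nop P f)) vs" for vs
  proof (induction vs arbitrary: f)
    case (Cons v vs)
    have "app (nop P (ginv f)) (v # vs) = - app (ginv (cctr (P v) f)) vs + - app (ginv (nop P (ctr v f))) vs"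
      by (simp only: app_ctr[symmetric] ctr_nop cctr_ginv ctr_ginv nop_uminus app_add app_uminus Cons)
    also have "\<dots> = app (ginv (nop P f)) (v # vs)"
      by (simp only: app_ctr[symmetric] ctr_ginv ctr_nop ginv_add app_add app_uminus minus_add_distrib)
    finally show ?case .
  qed simp
qed

lemma nop_mult: "nop P (f * g) = nop P f * g + f * nop P g"
proof (rule mform_eqI)
  show "app (nop P (f * g)) vs = app (nop P f * g + f * nop P g) vs" for vs
  proof (induction vs arbitrary: f g)
    case (Cons v vs)
    have "app (nop P (f * g)) (v # vs) = app (cctr (P v) f * g + ginv f * cctr (P v) g) vs
        + app (nop P (ctr v f) * g + ctr v f * nop P g) vs
        + app (nop P (ginv f) * ctr v g + ginv f * nop P (ctr v g)) vs"
      by (simp only: app_ctr[symmetric] ctr_nop ctr_mult cctr_mult nop_add app_add Cons add.assoc)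
    also have "\<dots> = app (nop P f * g + f * nop P g) (v # vs)"
      by (simp only: app_ctr[symmetric] ctr_add ctr_mult ctr_nop nop_ginv)
        (simp add: algebra_simps)
    finally show ?case .
  qed simp
qed

lemma nop_power_two_form:
  assumes "alt 2 b" "nop P b = sc c * b"
  shows "nop P (b ^ m) = sc (of_nat m * c) * b ^ m"
proof (induction m)
  case 0
  have "nop P (1 * 1) = nop P 1 * 1 + 1 * nop P 1" by (rule nop_mult)
  then show ?case by simp
next
  case (Suc m)
  have "nop P (b ^ Suc m) = sc c * b * b ^ m + b * (sc (of_nat m * c) * b ^ m)"
    by (simp add: nop_mult assms(2) Suc)
  also have "\<dots> = sc c * b ^ Suc m + sc (of_nat m * c) * b ^ Suc m"
    by (simp only: sc_left_commute mult.assoc power_Suc)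
  also have "\<dots> = sc (of_nat (Suc m) * c) * b ^ Suc m"
    by (simp only: of_nat_Suc distrib_right mult_1_left sc_add)
  finally show ?case .
qed

lemma alt_nop:
  assumes P: "linear P"
  shows "alt k f \<Longrightarrow> alt k (nop P f)"
proof -
  have "alt (int n) f \<Longrightarrow> alt (int n) (nop P f)" for n
  proof (induction n arbitrary: f)
    case (0 f)
    then have "ctr v f = 0" "cctr Z f = 0" for v Z
      using alt_neg[OF alt_ctr[OF 0]] alt_neg[OF alt_cctr[OF 0]] by simp_all
    then have "nop P f = 0" by (subst mform_eq_iff) (simp add: ctr_nop)
    then show ?case by simp
  next
    case (Suc n)
    note f = Suc.prems
    have IH: "alt (int n) (nop P (ctr v f))" for v
      using Suc.IH[of "ctr v f"] alt_ctr[OF f, of v] by simp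
    show ?case
    proof (rule altI)
      show "alt (int (Suc n) - 1) (ctr v (nop P f))" for v
        using IH alt_cctr[OF f] by (simp add: ctr_nop alt_add)
      show "ctr v (ctr v (nop P f)) = 0" for v
        by (simp add: ctr_nop alt_ctr_self[OF f] cctr_ctr_swap[OF f])
      show "linear (\<lambda>v. app (nop P f) (v # vs))" for vs
      proof (rule linearI)
        fix v w and c :: real
        show "app (nop P f) ((v + w) # vs) = app (nop P f) (v # vs) + app (nop P f) (w # vs)"
          by (simp flip: app_ctr add: ctr_nop linear_add[OF P] cctr_add_left[OF f] alt_ctr_add[OF f])
        have "P (c *\<^sub>R v) = complex_of_real c *s P v"
          using linear_cmul[OF P] by (simp add: vec_eq_iff scaleR_conv_of_real[where 'a = complex])
        then show "app (nop P f) ((c *\<^sub>R v) # vs) = c *\<^sub>R app (nop P f) (v # vs)"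
          by (simp flip: app_ctr add: ctr_nop cctr_scale_left[OF f] alt_ctr_scaleR[OF f] nop_sc_mult
              scaleR_conv_of_real[where 'a = complex] distrib_left)
      qed
    qed simp
  qed
  then show "alt k f \<Longrightarrow> alt k (nop P f)"
    using alt_neg[of k f] by (cases "k < 0") (auto, metis int_nat_eq not_less)
qed

lemma cctr_nop:
  assumes "alt k f"
  shows "cctr Z (nop P f) = cctr (P (vec_Re Z) + \<i> *s P (vec_Im Z)) f + nop P (cctr Z f)"
  by (simp add: cctr_def[of Z] ctr_nop nop_sc_mult cctr_add_left[OF assms] cctr_scale_left[OF assms] algebra_simps)

lemma kills_one_nop:
  assumes P: "\<And>v. P v \<in> F"
  shows "alt k f \<Longrightarrow> kills F 1 f \<Longrightarrow> nop P f = 0"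
proof (rule mform_eqI)
  fix vs assume "alt k f" "kills F 1 f"
  then show "app (nop P f) vs = app 0 vs"
  proof (induction vs arbitrary: k f)
    case (Cons v vs)
    have "kills F 1 (ctr v f)"
      using kills_cctr[OF Cons.prems, of "vec_of_real v"] by (simp add: cctr_of_real[OF Cons.prems(1)])
    then have "app (nop P (ctr v f)) vs = app 0 vs"
      by (rule Cons.IH[OF alt_ctr[OF Cons.prems(1)]])
    moreover have "cctr (P v) f = 0" using Cons.prems(2) P by simp
    ultimately show ?case by (simp flip: app_ctr add: ctr_nop)
  qed simp
qed

section \<open>The linear algebra of a CR structure at a point\<close>

text \<open>With \<open>s = n + 1 - k\<close> and \<open>t = k - (n + 1)\<close>, one of which vanishes, the two cases
  in the definition of \<open>\<Gamma>\<close> on forms of degree \<open>k\<close> take the same shape.\<close>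

definition gam_rel :: "nat \<Rightarrow> 'm::finite cform \<Rightarrow> 'm cform \<Rightarrow> nat \<Rightarrow> 'm cform \<Rightarrow> 'm cform \<Rightarrow> bool" where
  "gam_rel n th Om k f g \<longleftrightarrow> (\<exists>\<xi>. alt (int n - int (n + 1 - k) - int (k - (n + 1)) - 1) \<xi> \<and>
     th * f * Om ^ (n + 1 - k) = th * \<xi> * Om ^ (n + 1 - k + (k - (n + 1)) + 1) \<and>
     g = th * \<xi> * Om ^ (k - (n + 1)))"

lemma multi_extension_sc:
  "multi_extension (app (sc c * f)) Zs = c * multi_extension (app f) Zs"
  using multi_extension_linear[of "\<lambda>_. 0" c "app f" Zs] multi_extension_linear[of "\<lambda>_. 0" "-1" "\<lambda>_. 0" Zs]
  by (simp add: ext[of "app (sc c * f)" "\<lambda>vs. c * app f vs"])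

lemma multi_extension_add:
  "multi_extension (app (f + g)) Zs = multi_extension (app f) Zs + multi_extension (app g) Zs"
  using multi_extension_linear[of "app f" 1 "app g" Zs]
  by (simp add: ext[of "app (f + g)" "\<lambda>vs. app f vs + app g vs"])

lemma multi_extension_0: "multi_extension (app 0) Zs = 0"
  using multi_extension_sc[of 0 0 Zs] by simp

text \<open>\<open>E\<close> and \<open>F\<close> play the roles of T10 and T01 at one point,
  \<open>T\<close> is the Reeb vector, \<open>th\<close> the contact form and \<open>Om\<close> its
  differential. Integrability is present only as \<open>OmE\<close> and \<open>OmF\<close>, that is,
  \<open>Om\<close> is of type (1,1) on the horizontal space; the Levi condition is present as
  nondegeneracy of the pairing of \<open>E\<close> with \<open>F\<close>.\<close>

locale cr_point =
  fixes n :: nat and E F :: "(complex^'m::finite) set" and T :: "complex^'m" and th Om :: "'m cform"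
  assumes card: "CARD('m) = 2 * n + 1"
    and th: "alt 1 th" and Om: "alt 2 Om"
    and subE: "vec.subspace E" and subF: "vec.subspace F"
    and genE: "\<exists>b. E = vec.span (b ` {..<n})" and genF: "\<exists>b. F = vec.span (b ` {..<n})"
    and decomp: "\<And>v. \<exists>a Z W. Z \<in> E \<and> W \<in> F \<and> v = a *s T + Z + W"
    and thT: "cctr T th = 1" and thE: "\<And>Z. Z \<in> E \<Longrightarrow> cctr Z th = 0" and thF: "\<And>W. W \<in> F \<Longrightarrow> cctr W th = 0"
    and OmT: "cctr T Om = 0"
    and OmE: "\<And>Z Z'. Z \<in> E \<Longrightarrow> Z' \<in> E \<Longrightarrow> cctr Z (cctr Z' Om) = 0"
    and OmF: "\<And>W W'. W \<in> F \<Longrightarrow> W' \<in> F \<Longrightarrow> cctr W (cctr W' Om) = 0"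
    and ndE: "\<And>Z. Z \<in> E \<Longrightarrow> (\<And>W. W \<in> F \<Longrightarrow> cctr W (cctr Z Om) = 0) \<Longrightarrow> Z = 0"
    and ndF: "\<And>W. W \<in> F \<Longrightarrow> (\<And>Z. Z \<in> E \<Longrightarrow> cctr Z (cctr W Om) = 0) \<Longrightarrow> W = 0"
begin

lemma th_ginv [simp]: "ginv th = - th" by (simp add: alt_ginv[OF th])
lemma Om_ginv [simp]: "ginv Om = Om" by (simp add: alt_ginv[OF Om])
lemma th_th: "th * th = 0" by (rule one_form_square[OF th])
lemma th_th_left: "th * (th * f) = 0" by (simp add: mult.assoc[symmetric] th_th)
lemma Om_commute: "Om * f = f * Om" by (rule two_form_commute[OF Om])

lemma Om_power_commute: "Om ^ m * f = f * Om ^ m"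
proof (induction m)
  case (Suc m)
  have "Om ^ Suc m * f = Om * (f * Om ^ m)" by (simp add: mult.assoc Suc)
  also have "\<dots> = f * Om ^ m * Om" by (rule Om_commute)
  finally show ?case by (simp add: mult.assoc power_commutes)
qed simp

lemma Om_power_ginv [simp]: "ginv (Om ^ m) = Om ^ m"
  by (induction m) (auto simp: ginv_mult)

lemma alt_Om_power: "alt (int m * 2) (Om ^ m)" by (rule alt_power[OF Om])

lemma cctr_zero:
  assumes "alt k f" "cctr T f = 0" "\<And>Z. Z \<in> E \<Longrightarrow> cctr Z f = 0" "\<And>W. W \<in> F \<Longrightarrow> cctr W f = 0"
  shows "cctr v f = 0"
proof -
  obtain a Z W where "Z \<in> E" "W \<in> F" "v = a *s T + Z + W" using decomp[of v] by blast
  then show ?thesis using assms by (simp add: cctr_add_left cctr_scale_left)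
qed

lemma zero_if_cctr_zero:
  assumes "alt k f" "k \<noteq> 0" "cctr T f = 0" "\<And>Z. Z \<in> E \<Longrightarrow> cctr Z f = 0" "\<And>W. W \<in> F \<Longrightarrow> cctr W f = 0"
  shows "f = 0"
proof (rule zero_if_ctr_zero[OF assms(1,2)])
  show "ctr v f = 0" for v
    using cctr_zero[OF assms(1,3,4,5), of "vec_of_real v"] by (simp add: cctr_of_real[OF assms(1)])
qed

text \<open>The musical isomorphism from vectors to covectors: \<open>Om\<close> is nondegenerate
  horizontally and the square of \<open>th\<close> takes care of the Reeb direction.\<close>

definition mu :: "complex^'m \<Rightarrow> 'm cform" where
  "mu v = cctr v Om + sc (app (cctr v th) []) * th"

lemma alt_mu: "alt 1 (mu v)"
  using alt_cctr[OF Om, of v] by (simp add: mu_def alt_add alt_sc_mult th)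

lemma cctr_th: "cctr v th = sc (app (cctr v th) [])"
  using alt_cctr[OF th, of v] by (simp add: alt_0_eq_sc)

lemma mu_zero: "mu v = 0 \<Longrightarrow> v = 0"
proof -
  assume mu: "mu v = 0"
  have "cctr T (mu v) = - cctr v (cctr T Om) + sc (app (cctr v th) [])"
    by (simp add: mu_def cctr_sc_mult thT cctr_swap[OF Om, of T])
  then have a: "app (cctr v th) [] = 0"
    using arg_cong[OF mu, of "\<lambda>f. app (cctr T f) []"] by (simp add: OmT)
  then have Omv: "cctr v Om = 0" using mu by (simp add: mu_def)
  obtain a Z W where v: "Z \<in> E" "W \<in> F" "v = a *s T + Z + W" using decomp[of v] by blast
  have "cctr v th = sc a"
    unfolding v(3) using v(1,2) by (simp add: cctr_add_left[OF th] cctr_scale_left[OF th] thT thE thF)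
  then have "a = 0" using a by simp
  then have ZW: "cctr Z Om + cctr W Om = 0"
    using Omv v(3) by (simp add: cctr_add_left[OF Om])
  have "Z = 0"
  proof (rule ndE[OF v(1)])
    fix W' assume W': "W' \<in> F"
    have "cctr W' (cctr Z Om + cctr W Om) = 0" using ZW by simp
    then show "cctr W' (cctr Z Om) = 0" using OmF[OF W' v(2)] by simp
  qed
  moreover have "W = 0"
  proof (rule ndF[OF v(2)])
    fix Z' assume Z': "Z' \<in> E"
    have "cctr Z' (cctr Z Om + cctr W Om) = 0" using ZW by simp
    then show "cctr Z' (cctr W Om) = 0" using OmE[OF Z' v(1)] by simp
  qed
  ultimately show "v = 0" using v(3) \<open>a = 0\<close> by simp
qed

text \<open>\<open>mu\<close> is complex linear and injective, and vectors and covectors have the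
  same finite dimension; \<open>L\<close> reads off the coordinates of the covector.\<close>

lemma mu_surj: "\<exists>v. mu v = cov i"
proof -
  define L where "L v = (\<chi> j. app (mu v) [axis j 1])" for v
  have mu_add: "mu (v + w) = mu v + mu w" for v w
    by (simp add: mu_def cctr_add_left[OF Om] cctr_add_left[OF th] sc_add algebra_simps)
  have mu_scale: "mu (c *s v) = sc c * mu v" for c v
    by (simp add: mu_def cctr_scale_left[OF Om] cctr_scale_left[OF th] sc_mult algebra_simps)
  have "Vector_Spaces.linear (*s) (*s) L"
    by unfold_locales (simp_all add: L_def mu_add mu_scale vec_eq_iff)
  moreover have "inj L"
  proof (rule injI)
    fix v w assume vw: "L v = L w"
    have "mu v = mu w"
      using vw by (intro one_form_eqI alt_mu) (simp add: L_def vec_eq_iff)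
    then have "mu v + sc (-1) * mu w = 0" by (simp add: sc_uminus)
    then have "mu (v + (-1) *s w) = 0" by (simp only: mu_add mu_scale)
    then have "v + (-1) *s w = 0" by (rule mu_zero)
    then show "v = w" by (simp add: vec_eq_iff)
  qed
  ultimately have "surj L" by (rule vec.linear_inj_imp_surj)
  then obtain v where v: "(\<chi> j. if j = i then 1 else 0) = L v" unfolding surj_def by blast
  have "mu v = cov i"
  proof (rule one_form_eqI[OF alt_mu alt_cov])
    fix j
    have "L v $ j = (if j = i then 1 else 0)" by (simp flip: v)
    moreover have "app (cov i) [axis j 1 :: real^'m] = of_real (axis j 1 $ i)" by (simp add: cov_def)
    ultimately show "app (mu v) [axis j 1] = app (cov i) [axis j 1]" by (auto simp: L_def axis_def)
  qed
  then show ?thesis by blast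
qed

text \<open>Contracting \<open>\<theta> \<and> d\<theta>\<^sup>r = 0\<close> with horizontal vectors gives \<open>\<lambda> \<and> \<theta> \<and> d\<theta>\<^sup>r\<^sup>-\<^sup>1 = 0\<close> for all
  covectors \<open>\<lambda>\<close>, which forces \<open>\<theta> \<and> d\<theta>\<^sup>r\<^sup>-\<^sup>1 = 0\<close> by the dual Euler formula.\<close>

lemma th_Om_power_nonzero: "r \<le> n \<Longrightarrow> th * Om ^ r \<noteq> 0"
proof (induction r)
  case 0
  have "cctr T th \<noteq> 0" unfolding thT by simp
  then show ?case by auto
next
  case (Suc r)
  show ?case
  proof
    assume z: "th * Om ^ Suc r = 0"
    have "cov i * (th * Om ^ r) = 0" for i
    proof -
      obtain v where v: "mu v = cov i" using mu_surj by blast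
      define c where "c = app (cctr v th) []"
      \<comment> \<open>Removing the Reeb component makes \<open>X\<close> horizontal without
        changing its contraction with \<open>Om\<close>; the covector \<open>cov i\<close> is then
        met up to a multiple of \<open>th\<close>, which the factor \<open>th\<close>
        absorbs.\<close>
      define X where "X = v - c *s T"
      have X1: "cctr X th = 0"
        using cctr_th[of v] by (simp add: X_def cctr_diff_left[OF th] cctr_scale_left[OF th] thT c_def)
      have X2: "cctr X Om = cov i - sc c * th"
        using v by (simp add: X_def cctr_diff_left[OF Om] cctr_scale_left[OF Om] OmT mu_def c_def eq_diff_eq)
      have "0 = cctr X (th * Om ^ Suc r)" by (simp only: z cctr_0_right)
      also have "\<dots> = - (th * (sc (of_nat (Suc r)) * ((cov i - sc c * th) * Om ^ r)))"
        by (simp only: cctr_mult X1 cctr_two_form_power[OF Om] X2 th_ginv) simp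
      also have "th * (sc (of_nat (Suc r)) * ((cov i - sc c * th) * Om ^ r)) =
          sc (of_nat (Suc r)) * ((th * (cov i - sc c * th)) * Om ^ r)"
        by (simp only: sc_left_commute[of th] mult.assoc)
      also have "th * (cov i - sc c * th) = th * cov i"
        by (simp only: right_diff_distrib sc_left_commute[of th] th_th) simp
      also have "th * cov i = - (cov i * th)"
        by (simp add: one_form_commute[OF th] alt_ginv[OF alt_cov])
      finally have "sc (of_nat (Suc r)) * (cov i * th * Om ^ r) = 0" by simp
      then have "sc (inverse (of_nat (Suc r))) * (sc (of_nat (Suc r)) * (cov i * th * Om ^ r)) = 0" by simp
      then show ?thesis by (simp only: sc_mult_mult) (simp del: of_nat_Suc add: mult.assoc)
    qed
    moreover have "alt (1 + int r * 2) (th * Om ^ r)" by (intro alt_mult th alt_Om_power)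
    ultimately have "sc (of_int (int CARD('m) - (1 + int r * 2))) * (th * Om ^ r) = 0"
      using euler_dual by force
    \<comment> \<open>The factor of the dual Euler formula; it is nonzero because
      \<open>Suc r \<le> n\<close>.\<close>
    moreover have "int CARD('m) - (1 + int r * 2) = 2 * (int n - int r)" using card by simp
    moreover have "(of_int (2 * (int n - int r)) :: complex) \<noteq> 0" using Suc.prems by simp
    ultimately have "sc (inverse (of_int (2 * (int n - int r)))) *
        (sc (of_int (2 * (int n - int r))) * (th * Om ^ r)) = 0" by simp
    then have "th * Om ^ r = 0"
      using \<open>(of_int (2 * (int n - int r)) :: complex) \<noteq> 0\<close> by (simp only: sc_mult_mult) simp
    then show False using Suc by simp
  qed
qed

lemma kills_F_all: "alt k f \<Longrightarrow> kills F (Suc n) f"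
  using genF kills_span by blast

text \<open>\<open>E\<close> and \<open>T\<close> lie in a complement \<open>Q\<close> of
  \<open>F\<close> generated by \<open>n + 1\<close> vectors, so \<open>f\<close> vanishes on
  \<open>n + 2\<close> vectors of \<open>Q\<close>. Combined with \<open>a\<close> vectors of
  \<open>F\<close>, it vanishes on any \<open>a + n + 1\<close> vectors, which its degree does not
  allow unless it is zero.\<close>

lemma kills_degree_zero:
  assumes "alt k f" "kills F a f" "k \<ge> int (a + n + 1)"
  shows "f = 0"
proof -
  obtain b where b: "E = vec.span (b ` {..<n})" using genE by blast
  define b' where "b' = (\<lambda>i. if i < n then b i else T)"
  define Q where "Q = vec.span (b' ` {..<Suc n})"
  have im: "b' ` {..<n} = b ` {..<n}" by (auto simp: b'_def)
  have EQ: "E \<subseteq> Q"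
    unfolding Q_def b im[symmetric] by (rule vec.span_mono) auto
  have TQ: "T \<in> Q" unfolding Q_def by (rule vec.span_base) (auto simp: b'_def intro!: image_eqI[of _ _ n])
  have "\<exists>q w. q \<in> Q \<and> w \<in> F \<and> v = q + w" for v
  proof -
    obtain c Z W where v: "Z \<in> E" "W \<in> F" "v = c *s T + Z + W" using decomp[of v] by blast
    have "c *s T + Z \<in> Q"
      using EQ TQ v(1) unfolding Q_def by (intro vec.span_add vec.span_scale) auto
    then show ?thesis using v by blast
  qed
  from kills_UNIV[OF this assms(1,2) kills_span[OF assms(1), of b' "Suc n", folded Q_def]]
  show ?thesis by (rule kills_UNIV_zero[OF assms(1)]) (use assms(3) in simp)
qed

lemma kills_th: "kills F 1 th" using thF by simp
lemma kills_Om: "kills F 2 Om" using OmF by (simp add: numeral_2_eq_2)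
lemma kills_Om_power: "kills F (Suc m) (Om ^ m)"
  using kills_power[of F 1 Om m] kills_Om by (simp add: numeral_2_eq_2 del: kills.simps)

text \<open>The key step: contract with \<open>X\<close>, multiply by \<open>d\<theta>\<close>, and use induction on the degree of \<open>\<beta>\<close>.
  For \<open>a = 0\<close> this is injectivity of the Lefschetz operator.\<close>

lemma lefschetz_kills:
  "alt (int d) \<beta> \<Longrightarrow> d + r = n \<Longrightarrow> kills F a (th * \<beta> * Om ^ r) \<Longrightarrow> kills F (a - r) (th * \<beta>)"
proof (induction d arbitrary: \<beta> r a)
  case 0
  define b where "b = app \<beta> []"
  have \<beta>: "\<beta> = sc b" unfolding b_def using 0(1) by (simp add: alt_0_eq_sc)
  show ?case
  \<comment> \<open>In degree 0 the exponent is \<open>r = n\<close>, and the product has the top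
    degree \<open>2 * n + 1\<close>. For \<open>a \<le> n\<close> this is at least
    \<open>a + n + 1\<close>, so the product vanishes; for larger \<open>a\<close> the claim only
    needs that \<open>th\<close> annihilates \<open>F\<close>.\<close>
  proof (cases "a \<le> n")
    case True
    have "th * \<beta> * Om ^ r = 0"
    proof (rule kills_degree_zero[OF _ 0(3)])
      show "alt (1 + int 0 + int r * 2) (th * \<beta> * Om ^ r)" by (intro alt_mult th alt_Om_power 0)
      show "1 + int 0 + int r * 2 \<ge> int (a + n + 1)" using True 0 by simp
    qed
    then have z: "sc b * (th * Om ^ n) = 0" using 0 by (simp add: \<beta> sc_commute mult.assoc)
    have "b = 0"
    proof (rule ccontr)
      assume "b \<noteq> 0"
      have "sc (inverse b) * (sc b * (th * Om ^ n)) = 0" by (simp add: z)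
      then have "th * Om ^ n = 0" using \<open>b \<noteq> 0\<close> by (simp only: sc_mult_mult) simp
      then show False using th_Om_power_nonzero[of n] by simp
    qed
    then show ?thesis by (simp add: \<beta>)
  next
    case False
    have "kills F 1 (th * \<beta>)" using kills_sc_mult[OF kills_th] by (simp add: \<beta> sc_commute del: kills.simps)
    then show ?thesis by (rule kills_mono) (use False 0 in simp)
  qed
next
  case (Suc d)
  note \<beta> = Suc.prems(1)
  let ?X = "th * \<beta> * Om ^ r"
  \<comment> \<open>Contracting \<open>?X\<close> and multiplying by \<open>Om\<close> produces the
    form with one more power of \<open>Om\<close>; the contraction of the old power contributes only
    a multiple of \<open>?X * cctr v Om\<close>.\<close>
  have key: "kills F c (th * cctr v \<beta> * Om ^ Suc r)"
    if v: "cctr v th = 0" and 1: "kills F c (Om * cctr v ?X)" and 2: "kills F c (?X * cctr v Om)" for v c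
  proof -
    have "cctr v ?X = - (th * (cctr v \<beta> * Om ^ r + ginv \<beta> * cctr v (Om ^ r)))"
      by (simp add: mult.assoc cctr_mult v)
    then have "cctr v ?X * Om = - (th * (cctr v \<beta> * (Om ^ r * Om))) - th * (ginv \<beta> * (cctr v (Om ^ r) * Om))"
      by (simp only: distrib_left distrib_right mult.assoc minus_mult_left[symmetric]) simp
    then have "Om * cctr v ?X = - (th * (cctr v \<beta> * Om ^ Suc r)) - th * (ginv \<beta> * (cctr v (Om ^ r) * Om))"
      by (simp only: Om_commute power_Suc2)
    moreover have "kills F c (th * (ginv \<beta> * (cctr v (Om ^ r) * Om)))"
    proof (cases r)
      case (Suc m)
      have "cctr v (Om ^ r) * Om = sc (of_nat r) * (cctr v Om * Om ^ r)"
        unfolding Suc cctr_two_form_power[OF Om] by (simp add: mult.assoc power_commutes)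
      also have "\<dots> = sc (of_nat r) * (Om ^ r * cctr v Om)" by (simp add: Om_power_commute)
      finally have "th * (ginv \<beta> * (cctr v (Om ^ r) * Om)) = sc (of_nat r) * (th * ginv \<beta> * Om ^ r * cctr v Om)"
        by (simp only: sc_left_commute mult.assoc)
      moreover have "kills F c (th * ginv \<beta> * Om ^ r * cctr v Om)"
        using 2 kills_uminus[OF 2] by (simp add: alt_ginv[OF \<beta>])
      ultimately show ?thesis by (simp add: kills_sc_mult)
    qed simp
    moreover have "th * cctr v \<beta> * Om ^ Suc r =
        - (Om * cctr v ?X + th * (ginv \<beta> * (cctr v (Om ^ r) * Om)))"
      using calculation(1) by (simp add: mult.assoc)
    ultimately show ?thesis using 1 by (simp only:) (intro kills_uminus kills_add)
  qed
  have altX: "alt (1 + int (Suc d) + int r * 2) ?X" by (intro alt_mult th alt_Om_power \<beta>)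
  \<comment> \<open>Contraction with \<open>W\<close> gains one filtration step and multiplication
    by \<open>Om\<close> loses it again, so the index stays \<open>a\<close>.\<close>
  have stepF: "kills F (a - Suc r) (th * cctr W \<beta>)" if W: "W \<in> F" for W
  proof (rule Suc.IH)
    show "alt (int d) (cctr W \<beta>)" using alt_cctr[OF \<beta>] by simp
    show "d + Suc r = n" using Suc.prems by simp
    show "kills F a (th * cctr W \<beta> * Om ^ Suc r)"
    proof (rule key[OF thF[OF W]])
      show "kills F a (Om * cctr W ?X)"
      proof (cases a)
        case (Suc a')
        then have "kills F a' (cctr W ?X)" using Suc.prems(3) W by simp
        then show ?thesis by (rule kills_mult_le[OF kills_Om]) (simp add: Suc)
      qed (use Suc.prems in simp)
      have "kills F 1 (cctr W Om)" using OmF W by simp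
      then show "kills F a (?X * cctr W Om)" by (rule kills_mult_le[OF Suc.prems(3)]) simp
    qed
  qed
  \<comment> \<open>Contraction with \<open>Z\<close> gains nothing, so multiplication by
    \<open>Om\<close> raises the index to \<open>Suc a\<close>; the larger exponent
    \<open>Suc r\<close> compensates.\<close>
  have stepE: "kills F (Suc a - Suc r) (th * cctr Z \<beta>)" if Z: "Z \<in> E" for Z
  proof (rule Suc.IH)
    show "alt (int d) (cctr Z \<beta>)" using alt_cctr[OF \<beta>] by simp
    show "d + Suc r = n" using Suc.prems by simp
    show "kills F (Suc a) (th * cctr Z \<beta> * Om ^ Suc r)"
    proof (rule key[OF thE[OF Z]])
      show "kills F (Suc a) (Om * cctr Z ?X)"
        by (rule kills_mult_le[OF kills_Om kills_cctr[OF altX Suc.prems(3)]]) simp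
      show "kills F (Suc a) (?X * cctr Z Om)"
        by (rule kills_mult_le[OF Suc.prems(3) kills_cctr[OF Om kills_Om]]) simp
    qed
  qed
  have cF: "cctr W (th * \<beta>) = - (th * cctr W \<beta>)" if "cctr W th = 0" for W
    using that by (simp add: cctr_mult)
  show ?case
  proof (cases "a \<le> r")
    case False
    then obtain c where c: "a - r = Suc c" by (cases "a - r") auto
    have "kills F c (cctr W (th * \<beta>))" if "W \<in> F" for W
    proof -
      have "a - Suc r = c" using c by simp
      then show ?thesis using kills_uminus[OF stepF[OF that]] by (simp add: cF thF that)
    qed
    then show ?thesis by (simp add: c)
  next
    \<comment> \<open>Now the claim is \<open>th * \<beta> = 0\<close>. Both index differences above
      are 0, so all contractions with \<open>E\<close> and \<open>F\<close> vanish, and then also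
      the contraction with \<open>T\<close>, which is a form of positive degree killed by
      everything.\<close>
    case True
    let ?g = "th * \<beta>"
    have alt_g: "alt (1 + int (Suc d)) ?g" by (intro alt_mult th \<beta>)
    have F0: "cctr W ?g = 0" if "W \<in> F" for W using stepF[OF that] True by (simp add: cF thF that)
    have E0: "cctr Z ?g = 0" if "Z \<in> E" for Z using stepE[OF that] True by (simp add: cF thE that)
    have "cctr T ?g = 0"
    proof (rule zero_if_cctr_zero[OF alt_cctr[OF alt_g]])
      show "cctr T (cctr T ?g) = 0" by (rule cctr_self[OF alt_g])
      show "cctr Z (cctr T ?g) = 0" if "Z \<in> E" for Z
        using E0[OF that] by (simp add: cctr_swap[OF alt_g, of Z])
      show "cctr W (cctr T ?g) = 0" if "W \<in> F" for W
        using F0[OF that] by (simp add: cctr_swap[OF alt_g, of W])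
    qed simp
    then have "?g = 0" using E0 F0 by (intro zero_if_cctr_zero[OF alt_g]) auto
    then show ?thesis by simp
  qed
qed

lemma lefschetz_injective:
  assumes "alt (int n - int r) \<beta>" "th * \<beta> * Om ^ r = 0"
  shows "th * \<beta> = 0"
proof (cases "r \<le> n")
  case True
  then show ?thesis using lefschetz_kills[of "n - r" \<beta> r 0] assms by (simp add: of_nat_diff)
qed (use alt_neg[OF assms(1)] in simp)

lemma gam_rel_unique:
  assumes "gam_rel n th Om k f g" "gam_rel n th Om k f g'"
  shows "g = g'"
proof -
  let ?s = "n + 1 - k" and ?t = "k - (n + 1)"
  obtain \<xi> where 1: "alt (int n - int ?s - int ?t - 1) \<xi>"
      "th * f * Om ^ ?s = th * \<xi> * Om ^ (?s + ?t + 1)" "g = th * \<xi> * Om ^ ?t"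
    using assms(1) unfolding gam_rel_def by blast
  obtain \<xi>' where 2: "alt (int n - int ?s - int ?t - 1) \<xi>'"
      "th * f * Om ^ ?s = th * \<xi>' * Om ^ (?s + ?t + 1)" "g' = th * \<xi>' * Om ^ ?t"
    using assms(2) unfolding gam_rel_def by blast
  have "alt (int n - int (?s + ?t + 1)) (\<xi> - \<xi>')"
    using alt_diff[OF 1(1) 2(1)] by (simp add: algebra_simps)
  moreover have "th * (\<xi> - \<xi>') * Om ^ (?s + ?t + 1) = 0"
    using 1(2) 2(2) by (simp add: left_diff_distrib right_diff_distrib)
  ultimately have "th * (\<xi> - \<xi>') = 0" by (rule lefschetz_injective)
  then show ?thesis using 1(3) 2(3) by (simp add: right_diff_distrib)
qed

lemma gam_rel_th: "gam_rel n th Om k f g \<Longrightarrow> th * g = 0"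
  unfolding gam_rel_def by (auto simp: mult.assoc th_th_left)

lemma gam_rel_0: "th * f * Om ^ (n + 1 - k) = 0 \<Longrightarrow> gam_rel n th Om k f 0"
  unfolding gam_rel_def by (intro exI[of _ 0]) simp

text \<open>The right side is the first condition in the definition of Rumin forms; applied to the
  differential in degree \<open>k + 1\<close> it is the second. Rumin forms are thus the common
  kernel of \<Gamma> and \<Gamma>d.\<close>

lemma gam_rel_0_iff: "gam_rel n th Om k f 0 \<longleftrightarrow> th * f * Om ^ (n + 1 - k) = 0"
proof
  let ?s = "n + 1 - k" and ?t = "k - (n + 1)"
  assume "gam_rel n th Om k f 0"
  then obtain \<xi> where "th * f * Om ^ ?s = th * \<xi> * Om ^ (?s + ?t + 1)" "0 = th * \<xi> * Om ^ ?t"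
    unfolding gam_rel_def by blast
  moreover have "th * \<xi> * Om ^ (?s + ?t + 1) = th * \<xi> * Om ^ ?t * Om ^ (?s + 1)"
    by (simp only: mult.assoc power_add[symmetric] add.assoc add.commute add.left_commute)
  ultimately show "th * f * Om ^ ?s = 0" by simp
qed (rule gam_rel_0)

text \<open>Here \<eta> stands for d\<omega>: differentiating \<theta> \<and> \<omega> = 0 gives the
  last hypothesis. The outcome is \<Gamma>d\<omega> = \<omega> for multiples of \<theta> of degree
  at most \<open>n\<close>, with the contraction of \<omega> by \<open>T\<close> as
  primitive.\<close>

lemma gam_rel_d:
  assumes "alt (int k) \<omega>" "k \<le> n" "th * \<omega> = 0" "th * \<eta> = Om * \<omega>"
  shows "gam_rel n th Om (k + 1) \<eta> \<omega>"
  unfolding gam_rel_def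
proof (intro exI conjI)
  have "cctr T (th * \<omega>) = 0" using assms(3) by simp
  then have \<omega>: "\<omega> = th * cctr T \<omega>" by (simp add: cctr_mult thT)
  have s: "n + 1 - (k + 1) + (k + 1 - (n + 1)) + 1 = Suc (n - k)" "k + 1 - (n + 1) = 0"
    using assms(2) by auto
  show "alt (int n - int (n + 1 - (k + 1)) - int (k + 1 - (n + 1)) - 1) (cctr T \<omega>)"
    using alt_cctr[OF assms(1)] assms(2) by (simp add: of_nat_diff)
  show "th * \<eta> * Om ^ (n + 1 - (k + 1)) =
      th * cctr T \<omega> * Om ^ (n + 1 - (k + 1) + (k + 1 - (n + 1)) + 1)"
    unfolding s \<omega>[symmetric] assms(4) by (simp add: Om_commute[of \<omega>] mult.assoc)
  show "\<omega> = th * cctr T \<omega> * Om ^ (k + 1 - (n + 1))"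
    unfolding s using \<omega> by simp
qed

text \<open>The pointwise content of \<Gamma>d\<Gamma> = \<Gamma>, with \<eta> standing for the
  differential of \<open>g\<close>.\<close>

lemma gam_rel_gam:
  assumes "gam_rel n th Om k f g" "th * \<eta> = Om * g"
  shows "gam_rel n th Om k \<eta> g"
proof -
  let ?s = "n + 1 - k" and ?t = "k - (n + 1)"
  obtain \<xi> where 1: "alt (int n - int ?s - int ?t - 1) \<xi>" "g = th * \<xi> * Om ^ ?t"
    using assms(1) unfolding gam_rel_def by blast
  have "th * \<eta> * Om ^ ?s = th * \<xi> * Om ^ ?t * Om * Om ^ ?s"
    unfolding assms(2) Om_commute 1(2) ..
  also have "\<dots> = th * \<xi> * Om ^ (?s + ?t + 1)"
    by (simp only: mult.assoc power_Suc[symmetric] power_add[symmetric] Suc_eq_plus1 add.assoc add.commute add.left_commute)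
  finally show ?thesis unfolding gam_rel_def using 1 by blast
qed

text \<open>Bookkeeping of the index: multiplying \<open>f\<close> by \<open>th\<close> and
  \<open>Om ^ ?s\<close> adds \<open>?s\<close>, undoing the Lefschetz operator subtracts
  \<open>?s + ?t + 1\<close>, and multiplying by \<open>Om ^ ?t\<close> adds \<open>?t\<close>. The
  total loss is one.\<close>

lemma gam_rel_kills:
  assumes "gam_rel n th Om k f g" "kills F a f"
  shows "kills F (a - 1) g"
proof -
  let ?s = "n + 1 - k" and ?t = "k - (n + 1)"
  let ?r = "?s + ?t + 1"
  obtain \<xi> where \<xi>: "alt (int n - int ?s - int ?t - 1) \<xi>"
      "th * f * Om ^ ?s = th * \<xi> * Om ^ ?r" "g = th * \<xi> * Om ^ ?t"
    using assms(1) unfolding gam_rel_def by blast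
  have "kills F a (th * f)" by (rule kills_mult_le[OF kills_th assms(2)]) simp
  then have "kills F (a + ?s) (th * \<xi> * Om ^ ?r)"
    unfolding \<xi>(2)[symmetric] by (rule kills_mult_le[OF _ kills_Om_power]) simp
  have *: "kills F (a + ?s - ?r) (th * \<xi>)"
  proof (cases "?r \<le> n")
    case True
    then have "alt (int (n - ?r)) \<xi>" using \<xi>(1) by (simp add: of_nat_diff algebra_simps)
    then show ?thesis
      by (rule lefschetz_kills[OF _ _ \<open>kills F (a + ?s) (th * \<xi> * Om ^ ?r)\<close>]) (use True in simp)
  next
    case False
    then have "\<xi> = 0" by (intro alt_neg[OF \<xi>(1)]) simp
    then show ?thesis by simp
  qed
  show ?thesis
  \<comment> \<open>Here the index of \<open>th * \<xi>\<close> is 0 after truncated subtraction, so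
    the form vanishes outright and the bookkeeping need not be continued.\<close>
  proof (cases "a \<le> ?t")
    case True
    then have "th * \<xi> = 0" using * by simp
    then show ?thesis using \<xi>(3) by simp
  next
    case False
    then show ?thesis unfolding \<xi>(3) by (intro kills_mult_le[OF * kills_Om_power]) simp
  qed
qed

subsection \<open>Types and weights\<close>

definition PF :: "complex^'m \<Rightarrow> complex^'m" where
  "PF v = (THE W. W \<in> F \<and> (\<exists>a Z. Z \<in> E \<and> v = a *s T + Z + W))"

text \<open>\<open>th\<close> detects the coefficient of \<open>T\<close>. Afterwards the
  contractions of \<open>Om\<close> with \<open>Z\<close> and \<open>W\<close> are opposite; pairing
  with \<open>F\<close> isolates the one with \<open>Z\<close>, and nondegeneracy gives
  \<open>Z = 0\<close>.\<close>

lemma decomp_unique: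
  assumes "Z \<in> E" "W \<in> F" "a *s T + Z + W = 0"
  shows "a = 0" "Z = 0" "W = 0"
proof -
  have z: "cctr (a *s T + Z + W) f = 0" if "alt k f" for k f
    using that assms(3) by (simp add: cctr_zero_left)
  have "sc a = (0 :: 'm cform)"
    using z[OF th] assms(1,2) by (simp add: cctr_add_left[OF th] cctr_scale_left[OF th] thT thE thF)
  then have "app (sc a :: 'm cform) [] = 0" by (simp only: app_0)
  then show a: "a = 0" by simp
  have ZW: "cctr Z Om + cctr W Om = 0"
    using z[OF Om] by (simp add: cctr_add_left[OF Om] a)
  show "Z = 0"
  proof (rule ndE[OF assms(1)])
    fix W' assume W': "W' \<in> F"
    have "cctr W' (cctr Z Om + cctr W Om) = 0" using ZW by simp
    then show "cctr W' (cctr Z Om) = 0" using OmF[OF W' assms(2)] by simp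
  qed
  then show "W = 0" using assms(3) a by simp
qed

lemma PF_eq:
  assumes "Z \<in> E" "W \<in> F"
  shows "PF (a *s T + Z + W) = W"
  unfolding PF_def
proof (rule the_equality)
  show "W \<in> F \<and> (\<exists>b Z'. Z' \<in> E \<and> a *s T + Z + W = b *s T + Z' + W)" using assms by blast
  fix W' assume "W' \<in> F \<and> (\<exists>b Z'. Z' \<in> E \<and> a *s T + Z + W = b *s T + Z' + W')"
  then obtain b Z' where W': "W' \<in> F" "Z' \<in> E" "a *s T + Z + W = b *s T + Z' + W'" by blast
  have "(a - b) *s T + (Z - Z') + (W - W') = 0"
    using W'(3) by (simp add: vec_eq_iff algebra_simps)
  from decomp_unique(3)[OF _ _ this] W' assms subE subF
  have "W - W' = 0" by (simp add: vec.subspace_diff)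
  then show "W' = W" by simp
qed

lemma PF_in: "PF v \<in> F"
  using decomp[of v] PF_eq by metis

lemma PF_F: "W \<in> F \<Longrightarrow> PF W = W" using PF_eq[of 0 W 0] subE by (simp add: vec.subspace_0)
lemma PF_E: "Z \<in> E \<Longrightarrow> PF Z = 0" using PF_eq[of Z 0 0] subF by (simp add: vec.subspace_0)
lemma PF_T: "PF T = 0" using PF_eq[of 0 0 1] subE subF by (simp add: vec.subspace_0)

lemma PF_add: "PF (v + w) = PF v + PF w"
proof -
  obtain a Z W where v: "Z \<in> E" "W \<in> F" "v = a *s T + Z + W" using decomp[of v] by blast
  obtain b Z' W' where w: "Z' \<in> E" "W' \<in> F" "w = b *s T + Z' + W'" using decomp[of w] by blast
  have vw: "v + w = (a + b) *s T + (Z + Z') + (W + W')" using v w by (simp add: vec_eq_iff algebra_simps)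
  have "PF (v + w) = W + W'"
    unfolding vw by (rule PF_eq) (use v w subE subF in \<open>auto intro: vec.subspace_add\<close>)
  moreover have "PF v = W" "PF w = W'" unfolding v(3) w(3) by (rule PF_eq; fact)+
  ultimately show ?thesis by simp
qed

lemma PF_scale: "PF (c *s v) = c *s PF v"
proof -
  obtain a Z W where v: "Z \<in> E" "W \<in> F" "v = a *s T + Z + W" using decomp[of v] by blast
  have cv: "c *s v = (c * a) *s T + c *s Z + c *s W" using v by (simp add: vec_eq_iff algebra_simps)
  have "PF (c *s v) = c *s W"
    unfolding cv by (rule PF_eq) (use v subE subF in \<open>auto intro: vec.subspace_scale\<close>)
  moreover have "PF v = W" unfolding v(3) by (rule PF_eq; fact)
  ultimately show ?thesis by simp
qed

definition P :: "real^'m \<Rightarrow> complex^'m" where "P v = PF (vec_of_real v)"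

lemma P_linear: "linear P"
  by (rule linearI) (simp_all add: P_def PF_add PF_scale vec_eq_iff scaleR_conv_of_real[where 'a = complex])

lemma P_in: "P v \<in> F" by (simp add: P_def PF_in)

lemma cctr_nop_P: "alt k f \<Longrightarrow> cctr Z (nop P f) = cctr (PF Z) f + nop P (cctr Z f)"
  by (simp add: cctr_nop P_def flip: PF_scale PF_add vec_Re_Im)

lemma cctr_nop_F: "alt k f \<Longrightarrow> W \<in> F \<Longrightarrow> cctr W (nop P f) = cctr W f + nop P (cctr W f)"
  by (simp add: cctr_nop_P PF_F)
lemma cctr_nop_E: "alt k f \<Longrightarrow> Z \<in> E \<Longrightarrow> cctr Z (nop P f) = nop P (cctr Z f)"
  by (simp add: cctr_nop_P PF_E cctr_zero_left)
lemma cctr_nop_T: "alt k f \<Longrightarrow> cctr T (nop P f) = nop P (cctr T f)"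
  by (simp add: cctr_nop_P PF_T cctr_zero_left)

lemma nop_th: "nop P th = 0"
  by (rule kills_one_nop[OF P_in th kills_th])

text \<open>\<open>Om\<close> pairs \<open>E\<close> with \<open>F\<close> and nothing else, so
  exactly one of its two arguments is counted.\<close>

lemma nop_Om: "nop P Om = Om"
proof -
  let ?g = "nop P Om - Om"
  \<comment> \<open>Covectors annihilating \<open>T\<close> and \<open>E\<close> have their single
    argument in \<open>F\<close>.\<close>
  have one: "nop P l = l" if l: "alt 1 l" "cctr T l = 0" "\<And>Z. Z \<in> E \<Longrightarrow> cctr Z l = 0" for l
  proof -
    have "nop P l - l = 0"
    proof (rule zero_if_cctr_zero[OF alt_diff[OF alt_nop[OF P_linear l(1)] l(1)]])
      have 0: "nop P (cctr v l) = 0" for v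
        using alt_cctr[OF l(1), of v] kills_F_all
        by (subst alt_0_eq_sc[of "cctr v l"], simp, subst mform_eq_iff) (simp add: ctr_nop)
      show "cctr T (nop P l - l) = 0" by (simp add: cctr_nop_T[OF l(1)] 0 l)
      show "cctr Z (nop P l - l) = 0" if "Z \<in> E" for Z using that by (simp add: cctr_nop_E[OF l(1)] 0 l)
      show "cctr W (nop P l - l) = 0" if "W \<in> F" for W using that by (simp add: cctr_nop_F[OF l(1)] 0)
    qed simp
    then show ?thesis by simp
  qed
  have "?g = 0"
  proof (rule zero_if_cctr_zero[OF alt_diff[OF alt_nop[OF P_linear Om] Om]])
    show "cctr T ?g = 0" by (simp add: cctr_nop_T[OF Om] OmT)
    show "cctr W ?g = 0" if W: "W \<in> F" for W
    proof -
      have "nop P (cctr W Om) = 0"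
        using OmF W by (intro kills_one_nop[OF P_in alt_cctr[OF Om]]) simp
      then show ?thesis by (simp add: cctr_nop_F[OF Om W])
    qed
    show "cctr Z ?g = 0" if Z: "Z \<in> E" for Z
    proof -
      have "nop P (cctr Z Om) = cctr Z Om"
      proof (rule one)
        show "alt 1 (cctr Z Om)" using alt_cctr[OF Om] by simp
        show "cctr T (cctr Z Om) = 0" by (simp add: cctr_swap[OF Om, of T] OmT)
      qed (use OmE Z in auto)
      then show ?thesis by (simp add: cctr_nop_E[OF Om Z])
    qed
  qed simp
  then show ?thesis by simp
qed

lemma nop_Om_power: "nop P (Om ^ m) = sc (of_nat m) * Om ^ m"
  using nop_power_two_form[OF Om, of P 1 m] nop_Om by simp

text \<open>The leading part of a form in F (q + 1) has exactly \<open>q\<close> arguments in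
  \<open>F\<close>; subtracting \<open>q\<close> from the counting operator removes it.\<close>

lemma kills_nop: "alt k f \<Longrightarrow> kills F (Suc q) f \<Longrightarrow> kills F q (nop P f - sc (of_nat q) * f)"
proof (induction q arbitrary: k f)
  case 0
  then have "nop P f = 0" using kills_one_nop[OF P_in 0(1)] by simp
  then show ?case by simp
next
  case (Suc q)
  have "kills F q (cctr W (nop P f - sc (of_nat (Suc q)) * f))" if W: "W \<in> F" for W
  proof -
    have "cctr W (nop P f - sc (of_nat (Suc q)) * f) = nop P (cctr W f) - sc (of_nat q) * cctr W f"
      by (simp add: cctr_nop_F[OF Suc.prems(1) W] cctr_sc_mult sc_add distrib_right)
    then show ?thesis using Suc.IH[OF alt_cctr[OF Suc.prems(1)], of W] Suc.prems(2) W by simp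
  qed
  then show ?case by simp
qed

text \<open>Each descent from \<open>Suc j + Suc m\<close> to \<open>Suc j + m\<close> divides by
  the difference between the eigenvalue \<open>j\<close> and the leading weight
  \<open>Suc j + m\<close>, which is nonzero.\<close>

lemma nop_eigen_kills:
  assumes f: "alt k f" "nop P f = sc (of_nat j) * f"
  shows "kills F (Suc j) f"
proof -
  have "kills F (Suc j) f" if "kills F (Suc j + m) f" for m
    using that
  proof (induction m)
    case (Suc m)
    let ?c = "of_nat j - of_nat (Suc j + m) :: complex"
    have c: "?c \<noteq> 0" by (simp add: complex_eq_iff)
    have "kills F (Suc j + m) (nop P f - sc (of_nat (Suc j + m)) * f)"
      using kills_nop[OF f(1), of "Suc j + m"] Suc.prems by simp
    then have "kills F (Suc j + m) (sc ?c * f)"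
      by (simp only: f(2) left_diff_distrib[symmetric] sc_diff[symmetric])
    from kills_sc_mult[OF this, of "inverse ?c"] have "kills F (Suc j + m) f"
      using c by (simp only: sc_mult_mult) simp
    then show ?case by (rule Suc.IH)
  qed simp
  moreover have "kills F (Suc j + n) f" by (rule kills_mono[OF kills_F_all[OF f(1)]]) simp
  ultimately show ?thesis by blast
qed

text \<open>Weights cannot exceed \<open>n\<close>, since \<open>F\<close> is generated by
  \<open>n\<close> vectors, and at most \<open>n + 1\<close> arguments can lie in the complement
  spanned by \<open>E\<close> and \<open>T\<close>.\<close>

lemma nop_eigen_zero:
  assumes f: "alt k f" "nop P f = sc (of_nat j) * f" and "j > n \<or> k \<ge> int (j + n + 2)"
  shows "f = 0"
proof (cases "j > n")
  case True
  have "f = 0" if "kills F m f" "m \<le> j" for m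
    using that
  proof (induction m)
    case (Suc m)
    let ?c = "of_nat j - of_nat m :: complex"
    have c: "?c \<noteq> 0" using Suc.prems by simp
    have "kills F m (nop P f - sc (of_nat m) * f)"
      using kills_nop[OF f(1)] Suc.prems by simp
    then have "kills F m (sc ?c * f)"
      by (simp only: f(2) left_diff_distrib[symmetric] sc_diff[symmetric])
    from kills_sc_mult[OF this, of "inverse ?c"] have "kills F m f"
      using c by (simp only: sc_mult_mult) simp
    then show ?case using Suc by simp
  qed simp
  from this[OF kills_F_all[OF f(1)]] True show ?thesis by simp
next
  case False
  then show ?thesis
    using assms(3) by (intro kills_degree_zero[OF f(1) nop_eigen_kills[OF f]]) auto
qed

lemma multi_extension_nop_F:
  "alt k f \<Longrightarrow> set Ws \<subseteq> F \<Longrightarrow> multi_extension (app (nop P f)) Ws = of_nat (length Ws) * multi_extension (app f) Ws"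
proof (induction Ws arbitrary: k f)
  case (Cons W Ws)
  then show ?case
    using Cons.IH[OF alt_cctr[OF Cons.prems(1)], of W]
    by (simp add: multi_extension_Cons cctr_nop_F multi_extension_add algebra_simps)
qed simp

lemma multi_extension_nop:
  "alt k f \<Longrightarrow> set Zs \<subseteq> E \<Longrightarrow> set Ws \<subseteq> F \<Longrightarrow>
    multi_extension (app (nop P f)) (Zs @ Ws) = of_nat (length Ws) * multi_extension (app f) (Zs @ Ws)"
proof (induction Zs arbitrary: k f)
  case (Cons Z Zs)
  then show ?case
    using Cons.IH[OF alt_cctr[OF Cons.prems(1)], of Z]
    by (simp add: multi_extension_Cons cctr_nop_E)
qed (simp add: multi_extension_nop_F)

text \<open>On arguments from \<open>E\<close> and \<open>F\<close> the counting operator multiplies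
  by the number of those in \<open>F\<close>. An eigenform therefore has a pure type on the
  horizontal space.\<close>

lemma eigen_multi_extension:
  assumes f: "alt k f" "nop P f = sc (of_nat j) * f" and "set Zs \<subseteq> E" "set Ws \<subseteq> F" "length Ws \<noteq> j"
  shows "multi_extension (app f) (Zs @ Ws) = 0"
  using multi_extension_nop[OF f(1) assms(3,4)] assms(5) by (simp add: f(2) multi_extension_sc)

lemma zero_if_multi_extension:
  "alt (int d) g \<Longrightarrow> cctr T g = 0 \<Longrightarrow>
    (\<And>Zs Ws. set Zs \<subseteq> E \<Longrightarrow> set Ws \<subseteq> F \<Longrightarrow> length Zs + length Ws = d \<Longrightarrow> multi_extension (app g) (Zs @ Ws) = 0) \<Longrightarrow>
    g = 0"
proof (induction d arbitrary: g)
  case 0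
  have "app g [] = 0" using 0(3)[of "[]" "[]"] by simp
  then show ?case using alt_0_eq_sc[of g] 0(1) by simp
next
  case (Suc d)
  note g = Suc.prems(1)
  have alt_c: "alt (int d) (cctr v g)" for v using alt_cctr[OF g, of v] by simp
  have Tc: "cctr T (cctr v g) = 0" for v using Suc.prems(2) by (simp add: cctr_swap[OF g, of T])
  show ?case
  proof (rule zero_if_cctr_zero[OF g _ Suc.prems(2)])
    show "cctr Z g = 0" if Z: "Z \<in> E" for Z
    proof (rule Suc.IH[OF alt_c Tc])
      fix Zs Ws assume "set Zs \<subseteq> E" "set Ws \<subseteq> F" "length Zs + length Ws = d"
      then show "multi_extension (app (cctr Z g)) (Zs @ Ws) = 0"
        using Suc.prems(3)[of "Z # Zs" Ws] Z by (simp add: multi_extension_Cons)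
    qed
    show "cctr W g = 0" if W: "W \<in> F" for W
    proof (rule Suc.IH[OF alt_c Tc])
      fix Zs Ws assume "set Zs \<subseteq> E" "set Ws \<subseteq> F" "length Zs + length Ws = d"
      then show "multi_extension (app (cctr W g)) (Zs @ Ws) = 0"
        using Suc.prems(3)[of Zs "W # Ws"] W by (simp add: multi_extension_move[OF g] multi_extension_Cons)
    qed
  qed simp
qed

text \<open>For forms without \<theta>-component, membership in the filtration can be read off from
  horizontal arguments sorted into \<open>E\<close> first and \<open>F\<close> last.\<close>

lemma kills_if_multi_extension:
  "alt (int d) g \<Longrightarrow> cctr T g = 0 \<Longrightarrow>
    (\<And>Zs Ws. set Zs \<subseteq> E \<Longrightarrow> set Ws \<subseteq> F \<Longrightarrow> length Zs + length Ws = d \<Longrightarrow> a \<le> length Ws \<Longrightarrow>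
       multi_extension (app g) (Zs @ Ws) = 0) \<Longrightarrow>
    kills F a g"
proof (induction a arbitrary: d g)
  case 0
  then show ?case using zero_if_multi_extension[OF 0(1,2)] by simp
next
  case (Suc a)
  note g = Suc.prems(1)
  show ?case
  proof (cases d)
    case 0
    then have "cctr W g = 0" for W using alt_neg[OF alt_cctr[OF g]] by simp
    then show ?thesis by simp
  next
    case d: (Suc d')
    have "kills F a (cctr W g)" if W: "W \<in> F" for W
    proof (rule Suc.IH)
      show "alt (int d') (cctr W g)" using alt_cctr[OF g] d by simp
      show "cctr T (cctr W g) = 0" using Suc.prems(2) by (simp add: cctr_swap[OF g, of T])
      fix Zs Ws assume "set Zs \<subseteq> E" "set Ws \<subseteq> F" "length Zs + length Ws = d'" "a \<le> length Ws"
      then show "multi_extension (app (cctr W g)) (Zs @ Ws) = 0"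
        using Suc.prems(3)[of Zs "W # Ws"] W d by (simp add: multi_extension_move[OF g] multi_extension_Cons)
    qed
    then show ?thesis by simp
  qed
qed

end

section \<open>Smooth solutions of the Lefschetz equation\<close>

lemma sc_cancel:
  "c \<noteq> (0::'b::field) \<Longrightarrow> sc c * f = sc c * g \<Longrightarrow> f = (g :: ('v, 'b) mform)"
proof -
  assume c: "c \<noteq> 0" and "sc c * f = sc c * g"
  then have "sc (inverse c) * (sc c * f) = sc (inverse c) * (sc c * g)" by simp
  then show "f = g" using c by (simp add: sc_mult_mult)
qed

text \<open>Downward induction on \<open>r\<close>: by the dual Euler formula \<open>\<gamma>\<close> is, modulo \<open>\<theta>\<close>, a sum of contractions of
  the forms \<open>\<lambda>\<^sub>i \<and> \<gamma>\<close> with horizontal vectors, and contracting \<open>\<beta> \<and> d\<theta>\<^sup>r\<^sup>+\<^sup>1\<close> leaves a factor \<open>d\<theta>\<^sup>r\<close>.\<close>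

lemma lefschetz_surjective_smooth:
  fixes \<theta> \<Omega> \<gamma> :: "real^'m \<Rightarrow> (real^'m, complex) mform" and T :: "real^'m \<Rightarrow> real^'m"
  assumes S: "open S" and card: "CARD('m) = 2 * n + 1"
    and \<theta>: "sform S \<theta>" "\<And>y. y \<in> S \<Longrightarrow> alt 1 (\<theta> y)"
    and \<Omega>: "sform S \<Omega>" "\<And>y. y \<in> S \<Longrightarrow> alt 2 (\<Omega> y)"
    and T: "smooth_on T S" "\<And>y. y \<in> S \<Longrightarrow> ctr (T y) (\<theta> y) = 1"
    and nz: "\<And>y. y \<in> S \<Longrightarrow> \<theta> y * \<Omega> y ^ n \<noteq> 0"
  shows "sform S \<gamma> \<Longrightarrow> (\<And>y. y \<in> S \<Longrightarrow> alt (int n + int r) (\<gamma> y)) \<Longrightarrow> d + r = n \<Longrightarrow>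
    \<exists>\<beta>. sform S \<beta> \<and> (\<forall>y\<in>S. alt (int d) (\<beta> y) \<and> \<theta> y * \<gamma> y = \<theta> y * \<beta> y * \<Omega> y ^ r)"
proof (induction d arbitrary: r \<gamma>)
  case 0
  obtain E :: "'m list" where E: "set E = UNIV" "distinct E" using finite_distinct_list[OF finite[of "UNIV :: 'm set"]] by blast
  define tp where "tp = (\<lambda>f :: (real^'m, complex) mform. app f (map (\<lambda>i. axis i 1) E))"
  have alt_top: "alt (int CARD('m)) (\<theta> y * \<Omega> y ^ n)" "alt (int CARD('m)) (\<theta> y * \<gamma> y)" if y: "y \<in> S" for y
    using alt_mult[OF \<theta>(2)[OF y] alt_power[OF \<Omega>(2)[OF y], of n]]
      alt_mult[OF \<theta>(2)[OF y] 0(2)[OF y]] 0(3) card by (simp_all add: algebra_simps)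
  have nz': "tp (\<theta> y * \<Omega> y ^ n) \<noteq> 0" if y: "y \<in> S" for y
    using top_degree_zero[OF alt_top(1)[OF y] E] nz[OF y] by (auto simp: tp_def)
  \<comment> \<open>In top degree the equation asks for a ratio of two forms of a line, evaluated on
    the ordered basis \<open>E\<close>; the denominator is nonzero by \<open>nz\<close>.\<close>
  define f where "f y = tp (\<theta> y * \<gamma> y) / tp (\<theta> y * \<Omega> y ^ n)" for y
  have "smooth_on f S"
    unfolding f_def tp_def using nz' unfolding tp_def
    by (intro smooth_on_divide[OF S] sform_smooth sform_mult[OF S] sform_power[OF S] \<theta> \<Omega> 0) auto
  moreover have "\<theta> y * \<gamma> y = \<theta> y * sc (f y) * \<Omega> y ^ r" if y: "y \<in> S" for y
  proof (rule sc_cancel[OF nz'[OF y]])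
    have "sc (tp (\<theta> y * \<Omega> y ^ n)) * (\<theta> y * \<gamma> y) = sc (tp (\<theta> y * \<gamma> y)) * (\<theta> y * \<Omega> y ^ n)"
      unfolding tp_def by (rule top_degree_proportional[OF alt_top[OF y] E])
    also have "\<dots> = sc (tp (\<theta> y * \<Omega> y ^ n)) * (sc (f y) * (\<theta> y * \<Omega> y ^ n))"
      using nz'[OF y] by (simp add: sc_mult_mult f_def)
    also have "sc (f y) * (\<theta> y * \<Omega> y ^ n) = \<theta> y * sc (f y) * \<Omega> y ^ r"
      using 0(3) by (simp add: sc_commute[of "\<theta> y"] mult.assoc)
    finally show "sc (tp (\<theta> y * \<Omega> y ^ n)) * (\<theta> y * \<gamma> y) =
        sc (tp (\<theta> y * \<Omega> y ^ n)) * (\<theta> y * sc (f y) * \<Omega> y ^ r)" .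
  qed
  ultimately show ?case by (intro exI[of _ "\<lambda>y. sc (f y)"]) (simp add: sform_sc alt_sc)
next
  case (Suc d)
  \<comment> \<open>Contraction with the horizontal part of the i-th basis vector, obtained by
    subtracting its \<theta>-value times \<open>T\<close>. It annihilates \<theta> and obeys the
    graded Leibniz rule.\<close>
  define I where "I i y f = ctr (axis i 1) f - sc (app (\<theta> y) [axis i 1]) * ctr (T y) f"
    for i y and f :: "(real^'m, complex) mform"
  have I_mult: "I i y (f * g) = I i y f * g + ginv f * I i y g" for i y f g
    by (simp add: I_def ctr_mult algebra_simps sc_left_commute)
  have I_\<theta>: "I i y (\<theta> y) = 0" if y: "y \<in> S" for i y
    using alt_0_eq_sc[OF alt_ctr[OF \<theta>(2)[OF y], simplified], of "axis i 1"] by (simp add: I_def T(2)[OF y])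
  have alt_I: "alt (k - 1) (I i y f)" if "alt k f" for i y f k
    unfolding I_def by (intro alt_diff alt_sc_mult alt_ctr that)
  have smooth_I: "sform S (\<lambda>y. I i y (\<alpha> y))" if "sform S \<alpha>" "\<And>y. y \<in> S \<Longrightarrow> alt k (\<alpha> y)" for i \<alpha> k
    unfolding I_def
    by (intro sform_diff[OF S] sform_sc_mult[OF S] sform_ctr that sform_smooth[OF \<theta>(1)]
        sform_ctr_field[OF S that T(1)])
  have \<theta>I: "I i y (\<theta> y * f) = - (\<theta> y * I i y f)" if y: "y \<in> S" for i y f
    by (simp add: I_mult I_\<theta>[OF y] alt_ginv[OF \<theta>(2)[OF y]])
  have I_power: "I i y (\<Omega> y ^ Suc m) = sc (of_nat (Suc m)) * (I i y (\<Omega> y) * \<Omega> y ^ m)" if y: "y \<in> S" for i y m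
    unfolding I_def ctr_two_form_power[OF \<Omega>(2)[OF y]]
    by (simp only: right_diff_distrib left_diff_distrib mult.assoc sc_mult_mult mult.commute[of "app _ _"])
  have "\<exists>\<beta>. sform S \<beta> \<and> (\<forall>y\<in>S. alt (int d) (\<beta> y) \<and> \<theta> y * (cov i * \<gamma> y) = \<theta> y * \<beta> y * \<Omega> y ^ Suc r)" for i
  proof (rule Suc.IH)
    show "sform S (\<lambda>y. cov i * \<gamma> y)" by (intro sform_mult[OF S] Suc.prems) simp
    show "alt (int n + int (Suc r)) (cov i * \<gamma> y)" if "y \<in> S" for y
      using alt_mult[OF alt_cov Suc.prems(2)[OF that]] by (simp add: add.commute add.left_commute)
  qed (use Suc.prems in simp)
  then obtain \<beta> where \<beta>: "\<And>i. sform S (\<beta> i)" "\<And>i y. y \<in> S \<Longrightarrow> alt (int d) (\<beta> i y)"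
    "\<And>i y. y \<in> S \<Longrightarrow> \<theta> y * (cov i * \<gamma> y) = \<theta> y * \<beta> i y * \<Omega> y ^ Suc r"
    by metis
  \<comment> \<open>The factor that remains after one power of \<Omega> is split off from the
    contraction of \<open>\<beta> i y * \<Omega> y ^ Suc r\<close>.\<close>
  define \<xi> where "\<xi> i y = I i y (\<beta> i y) * \<Omega> y + sc (of_nat (Suc r)) * (ginv (\<beta> i y) * I i y (\<Omega> y))" for i y
  \<comment> \<open>The dual Euler formula has the factor \<open>Suc d + 1\<close>; removing the
    Reeb direction from the contractions costs one, modulo \<theta>.\<close>
  define c where "c = complex_of_nat (Suc d)"
  have c: "c \<noteq> 0" by (simp add: c_def del: of_nat_Suc)
  have \<xi>: "\<theta> y * I i y (cov i * \<gamma> y) = \<theta> y * \<xi> i y * \<Omega> y ^ r" if y: "y \<in> S" for i y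
  proof -
    have "- (\<theta> y * I i y (cov i * \<gamma> y)) = I i y (\<theta> y * (\<beta> i y * \<Omega> y ^ Suc r))"
      using \<beta>(3)[OF y, of i] \<theta>I[OF y, of i "cov i * \<gamma> y"] by (simp only: mult.assoc)
    also have "\<dots> = - (\<theta> y * (I i y (\<beta> i y) * \<Omega> y ^ Suc r + ginv (\<beta> i y) * (sc (of_nat (Suc r)) * (I i y (\<Omega> y) * \<Omega> y ^ r))))"
      by (simp only: \<theta>I[OF y] I_mult[of _ _ "\<beta> i y"] I_power[OF y])
    also have "\<dots> = - (\<theta> y * \<xi> i y * \<Omega> y ^ r)"
      by (simp only: \<xi>_def sc_left_commute distrib_left distrib_right mult.assoc power_Suc)
    finally show ?thesis by simp
  qed
  have sum: "\<theta> y * (\<Sum>i\<in>UNIV. I i y (cov i * \<gamma> y)) = sc c * (\<theta> y * \<gamma> y)" if y: "y \<in> S" for y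
  proof -
    have \<theta>_cov: "(\<Sum>i\<in>UNIV. sc (app (\<theta> y) [axis i 1]) * (cov i * f)) = \<theta> y * f" for f
    proof -
      have e: "cov i * ctr (axis i 1) (\<theta> y) = sc (app (\<theta> y) [axis i 1]) * cov i" for i
        using alt_0_eq_sc[OF alt_ctr[OF \<theta>(2)[OF y], simplified], of "axis i 1"] by (simp add: sc_commute)
      have "(\<Sum>i\<in>UNIV. sc (app (\<theta> y) [axis i 1]) * cov i) = \<theta> y"
        using euler[OF \<theta>(2)[OF y]] by (simp add: e)
      then have "(\<Sum>i\<in>UNIV. sc (app (\<theta> y) [axis i 1]) * cov i) * f = \<theta> y * f" by simp
      then show ?thesis by (simp add: sum_distrib_right mult.assoc)
    qed
    have "(\<Sum>i\<in>UNIV. I i y (cov i * \<gamma> y)) =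
        (\<Sum>i\<in>UNIV. ctr (axis i 1) (cov i * \<gamma> y)) - ctr (T y) (\<Sum>i\<in>UNIV. sc (app (\<theta> y) [axis i 1]) * (cov i * \<gamma> y))"
      by (simp add: I_def sum_subtractf ctr_sum ctr_sc_mult)
    also have "\<dots> = sc (of_int (int CARD('m) - (int n + int r))) * \<gamma> y - (\<gamma> y - \<theta> y * ctr (T y) (\<gamma> y))"
      unfolding \<theta>_cov euler_dual[OF Suc.prems(2)[OF y]]
      by (simp add: ctr_mult T(2)[OF y] alt_ginv[OF \<theta>(2)[OF y]])
    also have "int CARD('m) - (int n + int r) = int (Suc d) + 1" using card Suc.prems(3) by simp
    also have "of_int (int (Suc d) + 1) = c + 1" by (simp add: c_def)
    finally show ?thesis
      by (simp add: sc_add distrib_left distrib_right sc_commute[of "\<theta> y"]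
          mult.assoc[symmetric] one_form_square[OF \<theta>(2)[OF y]])
  qed
  define \<beta>' where "\<beta>' y = sc (inverse c) * (\<Sum>i\<in>UNIV. \<xi> i y)" for y
  have "sform S \<beta>'"
    unfolding \<beta>'_def \<xi>_def
    by (intro sform_sc_mult[OF S] sform_sum[OF S] sform_add[OF S] sform_mult[OF S] sform_ginv[OF S]
        smooth_I[OF \<beta>(1,2)] smooth_I[OF \<Omega>] \<Omega> \<beta> smooth_on_const)
  moreover have "alt (int (Suc d)) (\<beta>' y)" if y: "y \<in> S" for y
  proof -
    have "alt (int (Suc d)) (I i y (\<beta> i y) * \<Omega> y)" for i
      using alt_mult[OF alt_I[OF \<beta>(2)[OF y]] \<Omega>(2)[OF y]] by (simp add: add.commute)
    moreover have "alt (int (Suc d)) (ginv (\<beta> i y) * I i y (\<Omega> y))" for i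
      using alt_mult[OF alt_ginv_alt[OF \<beta>(2)[OF y]] alt_I[OF \<Omega>(2)[OF y]]] by (simp add: add.commute)
    ultimately show ?thesis unfolding \<beta>'_def \<xi>_def by (intro alt_sc_mult alt_sum alt_add)
  qed
  moreover have "\<theta> y * \<gamma> y = \<theta> y * \<beta>' y * \<Omega> y ^ r" if y: "y \<in> S" for y
  proof (rule sc_cancel[OF c])
    have "sc c * (\<theta> y * \<gamma> y) = \<theta> y * (\<Sum>i\<in>UNIV. \<xi> i y) * \<Omega> y ^ r"
      unfolding sum[OF y, symmetric] by (simp add: sum_distrib_left sum_distrib_right \<xi>[OF y])
    also have "(\<Sum>i\<in>UNIV. \<xi> i y) = sc c * \<beta>' y" using c by (simp add: \<beta>'_def sc_mult_mult)
    finally show "sc c * (\<theta> y * \<gamma> y) = sc c * (\<theta> y * \<beta>' y * \<Omega> y ^ r)"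
      by (simp only: sc_left_commute[of "\<theta> y"] mult.assoc)
  qed
  ultimately show ?case by blast
qed

section \<open>Complex fields and counting operators in charts\<close>

definition ce :: "(real^'m \<Rightarrow> real^'l) \<Rightarrow> complex^'m \<Rightarrow> complex^'l" where
  "ce A Z = vec_of_real (A (vec_Re Z)) + \<i> *s vec_of_real (A (vec_Im Z))"

lemma vec_Re_ce [simp]: "vec_Re (ce A Z) = A (vec_Re Z)" by (simp add: ce_def)
lemma vec_Im_ce [simp]: "vec_Im (ce A Z) = A (vec_Im Z)" by (simp add: ce_def)

lemma cvec_eqI: "vec_Re Z = vec_Re W \<Longrightarrow> vec_Im Z = vec_Im W \<Longrightarrow> Z = W"
  by (subst vec_Re_Im[of Z], subst vec_Re_Im[of W]) simp

lemma ce_add: "linear A \<Longrightarrow> ce A (Z + W) = ce A Z + ce A W"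
  by (rule cvec_eqI) (simp_all add: linear_add)
lemma ce_scale: "linear A \<Longrightarrow> ce A (a *s Z) = a *s ce A Z"
  by (rule cvec_eqI) (simp_all add: linear_add linear_diff linear_cmul)
lemma ce_0: "linear A \<Longrightarrow> ce A 0 = 0"
  by (rule cvec_eqI) (simp_all add: linear_0)
lemma ce_sum: "linear A \<Longrightarrow> ce A (\<Sum>j\<in>J. f j) = (\<Sum>j\<in>J. ce A (f j))"
  by (induction J rule: infinite_finite_induct) (simp_all add: ce_0 ce_add)

lemma ce_ce: "ce A (ce B Z) = ce (\<lambda>v. A (B v)) Z"
  by (rule cvec_eqI) simp_all
lemma ce_ident [simp]: "ce (\<lambda>v. v) Z = Z" by (rule cvec_eqI) simp_all
lemma ce_of_real: "linear A \<Longrightarrow> ce A (vec_of_real v) = vec_of_real (A v)"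
  by (rule cvec_eqI) (simp_all add: linear_0)
lemma ce_cnj: "linear A \<Longrightarrow> ce A (vec_cnj Z) = vec_cnj (ce A Z)"
  by (rule cvec_eqI) (simp_all add: linear_neg)

lemma complex_extension_ce: "complex_extension (vec_of_real \<circ> A) = ce A"
  by (rule ext) (simp add: complex_extension_def ce_def)

lemma cctr_pb: "cctr Z (pb A f) = pb A (cctr (ce A Z) f)"
  by (simp add: cctr_def ctr_pb pb_sc_mult)

lemma sform_cctr:
  fixes S :: "'u::real_normed_vector set" and \<alpha> :: "'u \<Rightarrow> 'm::finite cform"
  assumes "open S" "sform S \<alpha>" "\<And>y. y \<in> S \<Longrightarrow> alt k (\<alpha> y)"
    "smooth_on (\<lambda>y. vec_Re (X y)) S" "smooth_on (\<lambda>y. vec_Im (X y)) S"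
  shows "sform S (\<lambda>y. cctr (X y) (\<alpha> y))"
  unfolding cctr_def
  by (intro sform_add[OF assms(1)] sform_sc_mult[OF assms(1)] smooth_on_const
      sform_ctr_field[OF assms(1,2,3)] assms(4,5))

lemma sform_nop:
  fixes S :: "'u::real_normed_vector set" and \<alpha> :: "'u \<Rightarrow> 'm::finite cform"
  assumes "open S" "sform S \<alpha>" "\<And>y. y \<in> S \<Longrightarrow> alt k (\<alpha> y)"
    "\<And>v. smooth_on (\<lambda>y. vec_Re (P y v)) S" "\<And>v. smooth_on (\<lambda>y. vec_Im (P y v)) S"
  shows "sform S (\<lambda>y. nop (P y) (\<alpha> y))"
  unfolding sform_def
proof
  fix vs show "smooth_on (\<lambda>y. app (nop (P y) (\<alpha> y)) vs) S" using assms(2,3)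
  proof (induction vs arbitrary: \<alpha> k)
    case (Cons v vs)
    have "smooth_on (\<lambda>y. app (cctr (P y v) (\<alpha> y)) vs) S"
      by (intro sform_smooth sform_cctr[OF assms(1) Cons.prems] assms(4,5))
    moreover have "smooth_on (\<lambda>y. app (nop (P y) (ctr v (\<alpha> y))) vs) S"
      by (rule Cons.IH[OF sform_ctr[OF Cons.prems(1)] alt_ctr[OF Cons.prems(2)]])
    ultimately show ?case by (simp flip: app_ctr add: ctr_nop smooth_on_add[OF assms(1)])
  qed simp
qed

lemma pb_nop:
  assumes "\<And>v. P (A v) = ce A (P' v)"
  shows "pb A (nop P f) = nop P' (pb A f)"
proof (rule mform_eqI)
  fix vs show "app (pb A (nop P f)) vs = app (nop P' (pb A f)) vs"
    by (induction vs arbitrary: f) (simp_all flip: app_ctr add: ctr_pb ctr_nop cctr_pb assms del: app_pb, simp)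
qed

text \<open>A form expressed by a dual pair of bases; \<open>P = id\<close> would give Euler's formula again.\<close>

lemma euler_nop:
  fixes l :: "'i::finite \<Rightarrow> 'm::finite cform"
  assumes l: "\<And>i. alt 1 (l i)"
    and dual: "\<And>k g v. alt k g \<Longrightarrow> ctr v g = (\<Sum>i\<in>UNIV. sc (app (l i) [v]) * ctr (e i) g)"
  shows "alt k f \<Longrightarrow> (\<Sum>i\<in>UNIV. nop P (l i) * ctr (e i) f) = nop P f"
proof (rule mform_eqI)
  fix vs assume "alt k f"
  then show "app (\<Sum>i\<in>UNIV. nop P (l i) * ctr (e i) f) vs = app (nop P f) vs"
  proof (induction vs arbitrary: k f)
    case (Cons v vs)
    note f = Cons.prems
    have cl: "cctr Z (l i) = sc (app (cctr Z (l i)) [])" for Z i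
      using alt_cctr[OF l, of Z i] by (simp add: alt_0_eq_sc)
    have ncl: "nop P (ctr v (l i)) = 0" for i
    proof -
      have "ctr v (l i) = sc (app (l i) [v])" using alt_0_eq_sc[OF alt_ctr[OF l, simplified]] by simp
      then show ?thesis by (subst mform_eq_iff) (simp add: ctr_nop)
    qed
    have cdual: "cctr Z f = (\<Sum>i\<in>UNIV. cctr Z (l i) * ctr (e i) f)" for Z
    proof -
      have "cctr Z f = (\<Sum>i\<in>UNIV. sc (app (l i) [vec_Re Z]) * ctr (e i) f)
          + sc \<i> * (\<Sum>i\<in>UNIV. sc (app (l i) [vec_Im Z]) * ctr (e i) f)"
        unfolding cctr_def by (simp only: dual[OF f, symmetric])
      also have "\<dots> = (\<Sum>i\<in>UNIV. sc (app (cctr Z (l i)) []) * ctr (e i) f)"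
        by (simp add: cctr_def sum_distrib_left sc_add sc_mult distrib_right sum.distrib mult.assoc)
      finally show ?thesis by (simp flip: cl)
    qed
    have g: "ginv (nop P (l i)) = - nop P (l i)" for i
      by (simp flip: nop_ginv add: alt_ginv[OF l])
    have "ctr v (\<Sum>i\<in>UNIV. nop P (l i) * ctr (e i) f) =
        (\<Sum>i\<in>UNIV. cctr (P v) (l i) * ctr (e i) f) + (\<Sum>i\<in>UNIV. nop P (l i) * ctr (e i) (ctr v f))"
      by (simp add: ctr_sum ctr_mult ctr_nop ncl g alt_ctr_swap[OF f, of v] sum.distrib)
    then have "app (\<Sum>i\<in>UNIV. nop P (l i) * ctr (e i) f) (v # vs) =
        app (cctr (P v) f) vs + app (\<Sum>i\<in>UNIV. nop P (l i) * ctr (e i) (ctr v f)) vs"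
      by (simp flip: app_ctr cdual)
    also have "\<dots> = app (nop P f) (v # vs)"
      by (simp only: Cons.IH[OF alt_ctr[OF f]]) (simp flip: app_ctr add: ctr_nop)
    finally show ?case .
  qed (simp add: app_sum)
qed

context smooth_manifold
begin

text \<open>The coordinate coframe of the chart \<open>c\<close>, expressed in the chart chosen for
  the point; \<open>frm\<close> is the dual coordinate frame.\<close>

definition lam :: "('a, real^'m) chart \<Rightarrow> 'm \<Rightarrow> 'a \<Rightarrow> (real^'m, 'b::real_normed_field) mform" where
  "lam c i x = pb (tangent_change (chart_at x) c x) (cov i)"

definition frm :: "('a, real^'m) chart \<Rightarrow> 'm \<Rightarrow> 'a \<Rightarrow> real^'m" where
  "frm c i x = tangent_change c (chart_at x) x (axis i 1)"

context
  fixes c :: "('a, real^'m) chart" assumes c: "c \<in> charts"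
begin

lemma smf_chart:
  assumes "open U" "U \<subseteq> fst c" "\<And>x. x \<in> U \<Longrightarrow> alt k (\<psi> x)" "sform (snd c ` (fst c \<inter> U)) \<alpha>"
    "\<And>x. x \<in> U \<Longrightarrow> lform c \<psi> (snd c x) = \<alpha> (snd c x)"
  shows "smf U k \<psi>"
proof (rule smfI_local[OF assms(1,3)])
  note op = open_chart_image[OF c assms(1)]
  have "sform (snd c ` (fst c \<inter> U)) (lform c \<psi>)"
    using assms(4) by (subst sform_cong[OF op, of _ \<alpha>]) (use assms(5) in auto)
  then show "\<exists>c N. c \<in> charts \<and> x \<in> fst c \<and> open N \<and> snd c x \<in> N \<and> sform N (lform c \<psi>)" if "x \<in> U" for x
    using c op assms(2) that by (intro exI[of _ c] exI[of _ "snd c ` (fst c \<inter> U)"]) auto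
qed

lemma tc_chart: "x \<in> fst c \<Longrightarrow> linear (tangent_change (chart_at x) c x)"
    "x \<in> fst c \<Longrightarrow> linear (tangent_change c (chart_at x) x)"
    "x \<in> fst c \<Longrightarrow> tangent_change (chart_at x) c x (tangent_change c (chart_at x) x v) = v"
    "x \<in> fst c \<Longrightarrow> tangent_change c (chart_at x) x (tangent_change (chart_at x) c x v) = v"
  using c chart_at[of x] by (simp_all add: tc_linear)

lemma alt_lam: "x \<in> fst c \<Longrightarrow> alt 1 (lam c i x)"
  unfolding lam_def by (intro alt_pb alt_cov tc_chart)

lemma smf_lam: "open U \<Longrightarrow> U \<subseteq> fst c \<Longrightarrow> smf U 1 (lam c i)"
proof (rule smf_chart[where \<alpha> = "\<lambda>y. cov i"])
  assume "open U" "U \<subseteq> fst c"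
  then have U: "x \<in> U \<Longrightarrow> x \<in> fst c" for x by blast
  show "alt 1 (lam c i x)" if "x \<in> U" for x by (rule alt_lam[OF U[OF that]])
  show "lform c (lam c i) (snd c x) = cov i" if "x \<in> U" for x
    using U[OF that] by (simp add: lform_snd c lam_def pb_pb tc_chart pb_ident)
qed auto

lemma smf_ctr_frm:
  assumes "open U" "U \<subseteq> fst c" "smf U k \<psi>"
  shows "smf U (k - 1) (\<lambda>x. ctr (frm c i x) (\<psi> x))"
proof (rule smf_chart[OF assms(1,2)])
  show "alt (k - 1) (ctr (frm c i x) (\<psi> x))" if "x \<in> U" for x by (intro alt_ctr smf_alt[OF assms(3) that])
  show "sform (snd c ` (fst c \<inter> U)) (\<lambda>y. ctr (axis i 1) (lform c \<psi> y))"
    by (intro sform_ctr smf_sform[OF assms(3) c])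
  show "lform c (\<lambda>x. ctr (frm c i x) (\<psi> x)) (snd c x) = ctr (axis i 1) (lform c \<psi> (snd c x))" if "x \<in> U" for x
    using that assms(2) c by (auto simp: lform_snd frm_def ctr_pb)
qed

lemma frm_dual:
  assumes "x \<in> fst c" "alt k g"
  shows "ctr v g = (\<Sum>i\<in>UNIV. sc (app (lam c i x) [v]) * ctr (frm c i x) g)"
proof -
  let ?A = "tangent_change c (chart_at x) x" and ?B = "tangent_change (chart_at x) c x"
  have "ctr (?B v) (pb ?A g) = (\<Sum>i\<in>UNIV. sc (of_real (?B v $ i)) * ctr (axis i 1) (pb ?A g))"
    by (rule ctr_axis_sum[OF alt_pb[OF tc_chart(2)[OF assms(1)] assms(2)]])
  then have "pb ?A (ctr v g) = pb ?A (\<Sum>i\<in>UNIV. sc (of_real (?B v $ i)) * ctr (frm c i x) g)"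
    by (simp add: ctr_pb tc_chart assms(1) pb_sum pb_sc_mult frm_def)
  then have "pb ?B (pb ?A (ctr v g)) = pb ?B (pb ?A (\<Sum>i\<in>UNIV. sc (of_real (?B v $ i)) * ctr (frm c i x) g))"
    by simp
  then show ?thesis by (simp add: pb_pb tc_chart assms(1) pb_ident lam_def cov_def)
qed

end

definition sfield :: "'a set \<Rightarrow> ('a \<Rightarrow> real^'m) \<Rightarrow> bool" where
  "sfield U X \<longleftrightarrow> (\<forall>c\<in>charts. smooth_on
     (\<lambda>y. tangent_change (chart_at (chart_inv c y)) c (chart_inv c y) (X (chart_inv c y))) (snd c ` (fst c \<inter> U)))"

lemma sfield_subset: "sfield U X \<Longrightarrow> V \<subseteq> U \<Longrightarrow> sfield V X"
  unfolding sfield_def by (meson Int_mono image_mono order_refl smooth_on_subset)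

lemma smf_ctr:
  assumes "open U" "sfield U X" "smf U k \<psi>"
  shows "smf U (k - 1) (\<lambda>x. ctr (X x) (\<psi> x))"
  unfolding smf_def
proof (intro conjI ballI)
  show "alt (k - 1) (ctr (X x) (\<psi> x))" if "x \<in> U" for x by (intro alt_ctr smf_alt[OF assms(3) that])
  fix c assume c: "c \<in> charts"
  note op = open_chart_image[OF c assms(1)]
  let ?X = "\<lambda>y. tangent_change (chart_at (chart_inv c y)) c (chart_inv c y) (X (chart_inv c y))"
  have "sform (snd c ` (fst c \<inter> U)) (\<lambda>y. ctr (?X y) (lform c \<psi> y))"
    using assms(2) c unfolding sfield_def
    by (intro sform_ctr_field[OF op smf_sform[OF assms(3) c] alt_lform[OF assms(3) c]]) auto
  moreover have "lform c (\<lambda>x. ctr (X x) (\<psi> x)) y = ctr (?X y) (lform c \<psi> y)" if "y \<in> snd c ` (fst c \<inter> U)" for y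
    using that c by (auto simp: lform_snd ctr_pb tc_chart)
  ultimately show "sform (snd c ` (fst c \<inter> U)) (lform c (\<lambda>x. ctr (X x) (\<psi> x)))"
    by (subst sform_cong[OF op])
qed

lemma field_in_chart_ce:
  "field_in_chart c Z y = ce (tangent_change (chart_at (chart_inv c y)) c (chart_inv c y)) (Z (chart_inv c y))"
  by (simp add: field_in_chart_def Let_def complex_extension_ce)

end

section \<open>Contact forms and frames on CR manifolds\<close>

lemma vec_cnj_simps [simp]:
  "vec_cnj 0 = 0" "vec_cnj (Z + W) = vec_cnj Z + vec_cnj W" "vec_cnj (a *s Z) = cnj a *s vec_cnj Z"
  "vec_cnj (vec_cnj Z) = Z" "vec_cnj (vec_of_real v) = vec_of_real v"
  by (simp_all add: vec_eq_iff vec_cnj_def vec_of_real_def)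

lemma vec_cnj_span: "vec_cnj ` vec.span S = vec.span (vec_cnj ` S)"
proof -
  have sub: "vec_cnj ` vec.span S \<subseteq> vec.span (vec_cnj ` S)" for S :: "(complex^'n) set"
  proof
    fix z assume "z \<in> vec_cnj ` vec.span S"
    then obtain y where y: "y \<in> vec.span S" "z = vec_cnj y" by blast
    have "vec_cnj y \<in> vec.span (vec_cnj ` S)"
      using y(1)
    proof (induction rule: vec.span_induct_alt)
      case base
      show ?case using vec.span_zero by simp
    next
      case (step c x y)
      then show ?case
        unfolding vec_cnj_simps by (intro vec.span_add vec.span_scale) (auto intro: vec.span_base)
    qed
    then show "z \<in> vec.span (vec_cnj ` S)" using y by simp
  qed
  show ?thesis
  proof
    show "vec.span (vec_cnj ` S) \<subseteq> vec_cnj ` vec.span S"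
    proof
      fix y assume "y \<in> vec.span (vec_cnj ` S)"
      then have "vec_cnj y \<in> vec.span (vec_cnj ` vec_cnj ` S)" using sub[of "vec_cnj ` S"] by blast
      moreover have "vec_cnj ` vec_cnj ` S = S" by (simp add: image_image)
      ultimately have "vec_cnj y \<in> vec.span S" by simp
      then have "vec_cnj (vec_cnj y) \<in> vec_cnj ` vec.span S" by (rule imageI)
      then show "y \<in> vec_cnj ` vec.span S" by simp
    qed
  qed (rule sub)
qed

lemma cctr_cmap_cnj: "cctr (vec_cnj Z) (cmap cnj f) = cmap cnj (cctr Z f)" if "alt k f" for f :: "'n::finite cform"
  by (rule mform_eqI) (simp add: cctr_def ctr_cmap linear_neg[OF alt_linear[OF that]])

context CR_manifold
begin

sublocale smooth_manifold charts
  by unfold_locales (rule atlas)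

subsection \<open>The distribution at a point\<close>

lemma T10_subspace: "vec.subspace (T10 x)" and T10_dim: "vec.dim (T10 x) = n"
  using T10_distribution unfolding complex_distribution_def by blast+

lemma frame:
  "\<exists>U Z. open U \<and> x \<in> U \<and> (\<forall>i<n. smooth_field_on U (Z i)) \<and>
    (\<forall>y\<in>U. T10 y = vec.span ((\<lambda>i. Z i y) ` {..<n}))"
  using T10_distribution unfolding complex_distribution_def by blast

lemma T10_gen: "\<exists>b. T10 x = vec.span (b ` {..<n})"
  using frame[of x] by auto

lemma T01_gen: "\<exists>b. T01 x = vec.span (b ` {..<n})"
proof -
  obtain b where "T10 x = vec.span (b ` {..<n})" using T10_gen by blast
  then have "T01 x = vec.span ((\<lambda>i. vec_cnj (b i)) ` {..<n})"
    by (simp add: T01_def vec_cnj_span image_image)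
  then show ?thesis by blast
qed

lemma T01_subspace: "vec.subspace (T01 x)"
  using T01_gen[of x] by (auto simp: vec.subspace_span)

lemma cnj_T10: "Z \<in> T10 x \<Longrightarrow> vec_cnj Z \<in> T01 x" by (simp add: T01_def)
lemma cnj_T01: "W \<in> T01 x \<Longrightarrow> vec_cnj W \<in> T10 x" by (auto simp: T01_def)

lemma T01_dim: "vec.dim (T01 x) = n"
proof -
  have le: "vec.dim (vec_cnj ` V) \<le> vec.dim V" for V :: "(complex^'m) set"
  proof -
    obtain B where B: "B \<subseteq> V" "vec.independent B" "V \<subseteq> vec.span B" "card B = vec.dim V"
      by (rule vec.basis_exists)
    have fin: "finite B" using B(2) by (rule vec.finiteI_independent)
    have "vec_cnj ` V \<subseteq> vec.span (vec_cnj ` B)" using B(3) vec_cnj_span[of B] by blast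
    then have "vec.dim (vec_cnj ` V) \<le> card (vec_cnj ` B)" by (rule vec.dim_le_card) (simp add: fin)
    also have "\<dots> \<le> card B" using fin by (rule card_image_le)
    finally show ?thesis using B(4) by simp
  qed
  have "vec.dim (T10 x) \<le> vec.dim (T01 x)"
    using le[of "T01 x"] by (simp add: T01_def image_image)
  then show ?thesis using le[of "T10 x"] T10_dim[of x] by (simp add: T01_def)
qed

definition HC :: "'a \<Rightarrow> (complex^'m) set" where
  "HC x = {Z + W |Z W. Z \<in> T10 x \<and> W \<in> T01 x}"

lemma HC_subspace: "vec.subspace (HC x)"
  unfolding HC_def by (rule vec.subspace_sums[OF T10_subspace T01_subspace])

lemma HC_dim: "vec.dim (HC x) = 2 * n"
proof -
  have "vec.dim (HC x) + vec.dim (T10 x \<inter> T01 x) = vec.dim (T10 x) + vec.dim (T01 x)"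
    unfolding HC_def by (rule vec.dim_sums_Int[OF T10_subspace T01_subspace])
  then show ?thesis by (simp add: T10_dim T01_dim T10_T01_disjoint)
qed

lemma decomposition_at:
  assumes "T \<notin> HC x"
  shows "\<exists>a Z W. Z \<in> T10 x \<and> W \<in> T01 x \<and> v = a *s T + Z + W"
proof -
  have sp: "vec.span (HC x) = HC x" using HC_subspace by (rule vec.span_eq_iff[THEN iffD2])
  have "vec.dim (insert T (HC x)) = 2 * n + 1"
    using assms by (simp add: vec.dim_insert sp HC_dim)
  then have "vec.dim (vec.span (insert T (HC x))) = CARD('m)" using dimension by simp
  then have "vec.span (insert T (HC x)) = UNIV"
    by (intro vec.subspace_dim_equal) (simp_all add: vec.subspace_span card_cart_basis)
  then have "v \<in> vec.span (insert T (HC x))" by simp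
  then obtain a where "v - a *s T \<in> HC x" unfolding vec.span_insert sp by blast
  then obtain Z W where "Z \<in> T10 x" "W \<in> T01 x" "v - a *s T = Z + W" unfolding HC_def by blast
  then show ?thesis by (intro exI[of _ a] exI[of _ Z] exI[of _ W]) (simp add: algebra_simps)
qed

lemma decomposition_at_unique:
  assumes "T \<notin> HC x" "Z \<in> T10 x" "W \<in> T01 x" "a *s T + Z + W = 0"
  shows "a = 0" "Z = 0" "W = 0"
proof -
  show a: "a = 0"
  proof (rule ccontr)
    assume "a \<noteq> 0"
    have "a *s T = - (Z + W)" using assms(4) by (simp only: add.assoc eq_neg_iff_add_eq_0)
    then have "inverse a *s (a *s T) = (- inverse a) *s (Z + W)"
      by (simp only: vec.scale_minus_right vec.scale_minus_left)
    then have "T = (- inverse a) *s (Z + W)" using \<open>a \<noteq> 0\<close> by simp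
    moreover have "Z + W \<in> HC x" using assms unfolding HC_def by blast
    ultimately show False using assms(1) HC_subspace vec.subspace_scale by metis
  qed
  have "Z = - W" using assms(4) a by (simp add: eq_neg_iff_add_eq_0)
  then have "Z \<in> T01 x" using vec.subspace_neg[OF T01_subspace assms(3)] by simp
  then show "Z = 0" using assms(2) T10_T01_disjoint[of x] by blast
  then show "W = 0" using \<open>Z = - W\<close> by simp
qed

lemma real_in_HC_iff: "vec_of_real v \<in> HC x \<longleftrightarrow> v \<in> H x"
proof
  assume "vec_of_real v \<in> HC x"
  then obtain Z W where "Z \<in> T10 x" "W \<in> T01 x" "vec_of_real v = Z + W" unfolding HC_def by blast
  then show "v \<in> H x" unfolding H_def by (metis (mono_tags, lifting) mem_Collect_eq vec_Re_simps(3))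
next
  assume "v \<in> H x"
  then obtain Z W where ZW: "Z \<in> T10 x" "W \<in> T01 x" "v = vec_Re (Z + W)" unfolding H_def by blast
  \<comment> \<open>Averaging \<open>Z\<close> with the conjugate of \<open>W\<close> keeps the real
    part of the sum and makes the two components conjugate.\<close>
  define Z' where "Z' = (1/2) *s (Z + vec_cnj W)"
  have Z': "Z' \<in> T10 x"
    unfolding Z'_def using ZW cnj_T01 T10_subspace by (intro vec.subspace_scale vec.subspace_add)
  have "vec_of_real v = Z' + vec_cnj Z'"
    by (rule cvec_eqI) (simp_all add: Z'_def ZW(3) vec_eq_iff)
  then show "vec_of_real v \<in> HC x" unfolding HC_def using Z' cnj_T10 by blast
qed

lemma H_split:
  assumes "v \<in> H x"
  obtains Z where "Z \<in> T10 x" "vec_of_real v = Z + vec_cnj Z"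
proof -
  have "vec_of_real v \<in> HC x" using assms by (simp add: real_in_HC_iff)
  then obtain Z W where ZW: "Z \<in> T10 x" "W \<in> T01 x" "vec_of_real v = Z + W" unfolding HC_def by blast
  define Z' where "Z' = (1/2) *s (Z + vec_cnj W)"
  have "Z' \<in> T10 x"
    unfolding Z'_def using ZW cnj_T01 T10_subspace by (intro vec.subspace_scale vec.subspace_add)
  moreover have "vec_of_real v = Z' + vec_cnj Z'"
  proof (rule cvec_eqI)
    have "v = vec_Re Z + vec_Re W" using arg_cong[OF ZW(3), of vec_Re] by simp
    then show "vec_Re (vec_of_real v) = vec_Re (Z' + vec_cnj Z')"
      by (simp add: Z'_def vec_eq_iff)
  qed (simp add: Z'_def)
  ultimately show ?thesis by (rule that)
qed

lemma T10_H: "Z \<in> T10 x \<Longrightarrow> vec_Re Z \<in> H x" "Z \<in> T10 x \<Longrightarrow> vec_Im Z \<in> H x"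
proof -
  have z: "0 \<in> T01 x" using T01_subspace by (rule vec.subspace_0)
  show re: "vec_Re Z \<in> H x" if "Z \<in> T10 x" for Z
    unfolding H_def mem_Collect_eq using that z by (intro exI[of _ Z] exI[of _ 0]) simp
  assume "Z \<in> T10 x"
  then have "(- \<i>) *s Z \<in> T10 x" using T10_subspace by (intro vec.subspace_scale)
  from re[OF this] show "vec_Im Z \<in> H x" by simp
qed

text \<open>\<open>A\<close> is onto because it has the right inverse \<open>B\<close>. If all
  images of basis vectors were horizontal, the complexified horizontal space would be everything,
  against its dimension \<open>2 * n\<close>.\<close>

lemma axis_transversal:
  fixes A B :: "real^'m \<Rightarrow> real^'m"
  shows "linear A \<Longrightarrow> (\<And>v. A (B v) = v) \<Longrightarrow> \<exists>i. vec_of_real (A (axis i 1)) \<notin> HC x"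
proof (rule ccontr)
  assume A: "linear A" "\<And>v. A (B v) = v" and "\<nexists>i. vec_of_real (A (axis i 1)) \<notin> HC x"
  then have ax: "vec_of_real (A (axis i 1)) \<in> HC x" for i by blast
  have re: "vec_of_real v \<in> HC x" for v
  proof -
    have "B v = (\<Sum>i\<in>UNIV. (B v $ i) *\<^sub>R axis i 1)"
      by (simp add: vec_eq_iff axis_def if_distrib[of "\<lambda>x. _ * x"] cong: if_cong)
    then have "v = A (\<Sum>i\<in>UNIV. (B v $ i) *\<^sub>R axis i 1)" using A(2)[of v] by simp
    also have "\<dots> = (\<Sum>i\<in>UNIV. (B v $ i) *\<^sub>R A (axis i 1))"
      by (simp add: linear_sum[OF A(1)] linear_cmul[OF A(1)])
    finally have "vec_of_real v = vec_of_real (\<Sum>i\<in>UNIV. (B v $ i) *\<^sub>R A (axis i 1))" by simp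
    also have "vec_of_real (\<Sum>i\<in>J. (B v $ i) *\<^sub>R A (axis i 1)) =
        (\<Sum>i\<in>J. complex_of_real (B v $ i) *s vec_of_real (A (axis i 1)))" for J
      by (induction J rule: infinite_finite_induct) auto
    finally show ?thesis
      using HC_subspace ax by (auto intro!: vec.subspace_sum vec.subspace_scale)
  qed
  have "HC x = UNIV"
  proof (intro equalityI subset_UNIV subsetI)
    fix v :: "complex^'m"
    show "v \<in> HC x"
      by (subst vec_Re_Im) (intro vec.subspace_add[OF HC_subspace] vec.subspace_scale[OF HC_subspace] re)
  qed
  then show False using HC_dim[of x] dimension by (simp add: card_cart_basis)
qed

subsection \<open>Smooth projections in a frame\<close>

text \<open>Records, in the coordinates of \<open>c\<close>, the decomposition of a constant vector
  \<open>v\<close> along the transversal field \<open>Tc\<close>, T10 and T01: \<open>a\<close> is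
  the transversal coefficient and \<open>p\<close> the T01-component, both smooth. Only the
  existence of the T10-component is kept.\<close>

definition smooth_splitting ::
    "('a, real^'m) chart \<Rightarrow> (real^'m \<Rightarrow> real^'m) \<Rightarrow> 'a set \<Rightarrow> complex^'m \<Rightarrow> (real^'m \<Rightarrow> complex) \<Rightarrow> (real^'m \<Rightarrow> complex^'m) \<Rightarrow> bool" where
  "smooth_splitting c Tc V v a p \<longleftrightarrow> smooth_on a (snd c ` V) \<and> smooth_on (\<lambda>y. vec_Re (p y)) (snd c ` V) \<and>
     smooth_on (\<lambda>y. vec_Im (p y)) (snd c ` V) \<and>
     (\<forall>y\<in>V. let A = tangent_change c (chart_at y) y in ce A (p (snd c y)) \<in> T01 y \<and>
       (\<exists>Z\<in>T10 y. ce A v = a (snd c y) *s vec_of_real (A (Tc (snd c y))) + Z + ce A (p (snd c y))))"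

text \<open>A transversal field together with a frame of \<open>T10\<close> and its conjugate is a frame of the complexified
  tangent bundle; by Cramer's rule the coefficients of a constant vector are smooth.\<close>

lemma frame_coefficients:
  assumes U: "open U" "x \<in> U" and c: "c \<in> charts" and x: "x \<in> fst c"
    and T: "smooth_on Tc (snd c ` (fst c \<inter> U))"
    and transversal: "vec_of_real (tangent_change c (chart_at x) x (Tc (snd c x))) \<notin> HC x"
  obtains V where "open V" "x \<in> V" "V \<subseteq> U" "V \<subseteq> fst c"
    "\<And>y. y \<in> V \<Longrightarrow> vec_of_real (tangent_change c (chart_at y) y (Tc (snd c y))) \<notin> HC y"
    "\<And>v. \<exists>a p. smooth_splitting c Tc V v a p"
proof -
  from frame[of x] obtain U' Z where Z: "open U'" "x \<in> U'" "\<forall>i<n. smooth_field_on U' (Z i)"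
    "\<forall>y\<in>U'. T10 y = vec.span ((\<lambda>i. Z i y) ` {..<n})"
    by blast
  define O' where "O' = snd c ` (fst c \<inter> (U \<inter> U'))"
  have O': "open O'" unfolding O'_def using U Z by (intro open_chart_image c open_Int)
  obtain h :: "'m \<Rightarrow> nat" where h: "bij_betw h UNIV {..<2 * n + 1}"
    using ex_bij_betw_finite_nat[of "UNIV :: 'm set"] dimension by (auto simp: atLeast0LessThan)
  \<comment> \<open>\<open>h\<close> numbers the columns: 0 is the transversal field, 1 to
    \<open>n\<close> are the frame of T10, and \<open>n + 1\<close> to \<open>2 * n\<close> its
    conjugates.\<close>
  define col where "col j y = (if h j = 0 then vec_of_real (Tc y)
      else if h j \<le> n then field_in_chart c (Z (h j - 1)) y
      else vec_cnj (field_in_chart c (Z (h j - n - 1)) y))" for j y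
  define M where "M y = (\<chi> i j. col j y $ i)" for y
  have hj: "h j < 2 * n + 1" for j using h by (auto simp: bij_betw_def)
  have Zs: "smooth_on (field_in_chart c (Z i)) O'" if "i < n" for i
    using Z(3)[rule_format, OF that] c unfolding smooth_field_on_def O'_def by (auto intro: smooth_on_subset)
  have col: "smooth_on (\<lambda>y. col j y $ i) O'" for i j
  proof -
    have 1: "smooth_on (\<lambda>y. vec_of_real (Tc y) $ i) O'"
      unfolding vec_of_real_def vec_lambda_beta
      by (intro smooth_on_linear[OF O' bounded_linear_of_real] smooth_on_vec_nth[OF O'] smooth_on_subset[OF T])
        (auto simp: O'_def)
    have 2: "smooth_on (\<lambda>y. field_in_chart c (Z k) y $ i) O'" if "k < n" for k
      by (rule smooth_on_vec_nth[OF O' Zs[OF that]])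
    have 3: "smooth_on (\<lambda>y. vec_cnj (field_in_chart c (Z k) y) $ i) O'" if "k < n" for k
      unfolding vec_cnj_def vec_lambda_beta
      by (intro smooth_on_linear[OF O' bounded_linear_cnj] 2 that)
    show ?thesis
    proof (cases "h j = 0")
      case False
      show ?thesis
      proof (cases "h j \<le> n")
        case True
        then have "h j - 1 < n" using False by simp
        then show ?thesis using 2 True False by (simp add: col_def)
      next
        case F: False
        then have "h j - n - 1 < n" using hj[of j] by simp
        then show ?thesis using 3 F False by (simp add: col_def)
      qed
    qed (simp add: col_def 1)
  qed
  have M: "smooth_on (\<lambda>y. M y $ i $ j) O'" for i j by (simp add: M_def col)
  have Mv: "M y *v f = (\<Sum>j\<in>UNIV. f $ j *s col j y)" for y f
    by (simp add: vec_eq_iff matrix_vector_mult_def M_def mult.commute)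
  define A where "A y = tangent_change c (chart_at y) y" for y
  have lin: "linear (A y)" if "y \<in> fst c" for y unfolding A_def by (rule tc_chart[OF c that])
  have ce_field: "ce (A y) (field_in_chart c (Z k) (snd c y)) = Z k y" if "y \<in> fst c" for y k
    using that c by (simp add: field_in_chart_ce ce_ce A_def tc_chart)
  have col10: "ce (A y) (col j (snd c y)) \<in> T10 y" if "y \<in> fst c" "y \<in> U'" "h j \<noteq> 0" "h j \<le> n" for y j
  proof -
    have "Z (h j - 1) y \<in> vec.span ((\<lambda>i. Z i y) ` {..<n})" using that by (intro vec.span_base) auto
    then show ?thesis using that by (simp add: col_def ce_field Z(4))
  qed
  have col01: "ce (A y) (col j (snd c y)) \<in> T01 y" if "y \<in> fst c" "y \<in> U'" "h j > n" for y j
  proof -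
    have "Z (h j - n - 1) y \<in> vec.span ((\<lambda>i. Z i y) ` {..<n})" using that hj[of j] by (intro vec.span_base) auto
    then show ?thesis using that by (simp add: col_def ce_cnj[OF lin] ce_field Z(4) cnj_T10)
  qed
  have col0: "ce (A y) (col j (snd c y)) = vec_of_real (A y (Tc (snd c y)))" if "y \<in> fst c" "h j = 0" for y j
    using that by (simp add: col_def ce_of_real[OF lin])
  \<comment> \<open>The columns of \<open>M\<close> span all of the complexified tangent space at
    \<open>x\<close>, so the square matrix is onto and hence invertible.\<close>
  have det_x: "det (M (snd c x)) \<noteq> 0"
  proof -
    define R where "R = range (\<lambda>f. ce (A x) (M (snd c x) *v f))"
    have sub: "vec.subspace R"
    proof -
      have "Vector_Spaces.linear (*s) (*s) (\<lambda>f. ce (A x) (M (snd c x) *v f))"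
        by unfold_locales (simp_all add: ce_add ce_scale lin[OF x] matrix_vector_right_distrib vector_scalar_commute vec_eq_iff algebra_simps)
      then show ?thesis unfolding R_def using module_hom.subspace_image[of "(*s)" "(*s)" _ UNIV] vec.subspace_UNIV
        unfolding Vector_Spaces.linear_iff_module_hom by blast
    qed
    have colR: "\<exists>j. h j = k \<and> ce (A x) (col j (snd c x)) \<in> R" if k: "k < 2 * n + 1" for k
    proof -
      have "k \<in> h ` UNIV" using h k by (simp add: bij_betw_def)
      then obtain j where j: "h j = k" by blast
      have "ce (A x) (M (snd c x) *v axis j 1) = ce (A x) (col j (snd c x))"
        unfolding Mv by (rule arg_cong[of _ _ "ce (A x)"]) (simp add: vec_eq_iff axis_def if_distrib[of "\<lambda>a. a * _"] cong: if_cong)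
      then show ?thesis using j unfolding R_def by (intro exI[of _ j]) (auto intro: range_eqI[OF sym])
    qed
    have "Z k x \<in> R" if "k < n" for k
      using colR[of "k + 1"] that ce_field[OF x, of k] by (auto simp: col_def)
    then have "vec.span ((\<lambda>i. Z i x) ` {..<n}) \<subseteq> R" by (intro vec.span_minimal sub) auto
    then have 10: "T10 x \<subseteq> R" using Z(4)[rule_format, OF Z(2)] by simp
    have "vec_cnj (Z k x) \<in> R" if "k < n" for k
      using colR[of "k + n + 1"] that ce_field[OF x, of k] by (auto simp: col_def ce_cnj[OF lin[OF x]])
    then have "vec.span (vec_cnj ` (\<lambda>i. Z i x) ` {..<n}) \<subseteq> R" by (intro vec.span_minimal sub) auto
    then have 01: "T01 x \<subseteq> R" using Z(4)[rule_format, OF Z(2)] by (simp add: T01_def vec_cnj_span)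
    have 00: "vec_of_real (A x (Tc (snd c x))) \<in> R" using colR[of 0] col0[OF x] by auto
    have "\<exists>f. v = M (snd c x) *v f" for v
    proof -
      obtain a Z' W' where d: "Z' \<in> T10 x" "W' \<in> T01 x" "ce (A x) v = a *s vec_of_real (A x (Tc (snd c x))) + Z' + W'"
        using decomposition_at[OF transversal, of "ce (A x) v"] unfolding A_def by blast
      have "ce (A x) v \<in> R"
        unfolding d(3) using d(1,2) 00 01 10 by (intro vec.subspace_add vec.subspace_scale sub) auto
      then obtain f where "ce (A x) v = ce (A x) (M (snd c x) *v f)" unfolding R_def by blast
      from arg_cong[OF this, of "ce (tangent_change (chart_at x) c x)"] have "v = M (snd c x) *v f"
        by (simp add: ce_ce A_def tc_chart[OF c x])
      then show ?thesis by blast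
    qed
    then have "surj ((*v) (M (snd c x)))" unfolding surj_def by blast
    then show ?thesis
      by (simp add: invertible_det_nz[symmetric] invertible_right_inverse matrix_right_invertible_surjective)
  qed
  \<comment> \<open>Invertibility at the point \<open>x\<close> spreads to an open set by continuity
    of the determinant.\<close>
  define N where "N = {y \<in> O'. det (M y) \<noteq> 0}"
  have N: "open N"
    using continuous_open_preimage[OF smooth_on_imp_continuous_on[OF smooth_on_det[OF O' M]] O', of "- {0}"]
    by (simp add: N_def vimage_def Int_def open_Compl)
  define V where "V = {y \<in> fst c \<inter> (U \<inter> U'). snd c y \<in> N}"
  have VN: "snd c ` V = N" unfolding V_def N_def O'_def by auto
  have V: "open V"
  proof -
    have "continuous_on (fst c \<inter> (U \<inter> U')) (snd c)"
      using homeomorphism_cont1[OF chart_homeo[OF c]] by (rule continuous_on_subset) auto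
    moreover have "open (fst c \<inter> (U \<inter> U'))" using U Z chart_open[OF c] by (intro open_Int)
    ultimately have "open ((fst c \<inter> (U \<inter> U')) \<inter> snd c -` N)" by (rule continuous_open_preimage[OF _ _ N])
    moreover have "V = (fst c \<inter> (U \<inter> U')) \<inter> snd c -` N" by (auto simp: V_def)
    ultimately show ?thesis by simp
  qed
  have xV: "x \<in> V" using x U Z det_x by (auto simp: V_def N_def O'_def)
  have split: "\<exists>a p. smooth_splitting c Tc V v a p" for v
  proof -
    define f where "f y = (SOME f. M y *v f = v)" for y
    have f: "M y *v f y = v" if "y \<in> N" for y
    proof -
      have "surj ((*v) (M y))"
        using that by (simp add: N_def invertible_det_nz[symmetric] invertible_right_inverse matrix_right_invertible_surjective)
      then have "\<exists>f. M y *v f = v" unfolding surj_def by metis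
      then show ?thesis unfolding f_def by (rule someI_ex)
    qed
    have sub: "N \<subseteq> O'" by (auto simp: N_def)
    have fs: "smooth_on (\<lambda>y. f y $ j) N" for j
      by (rule smooth_on_linear_solve[OF N smooth_on_subset[OF M sub] _ _ f]) (auto simp: N_def)
    define a where "a y = (\<Sum>j\<in>{j. h j = 0}. f y $ j)" for y
    define p where "p y = (\<Sum>j\<in>{j. n < h j}. f y $ j *s col j y)" for y
    have ps: "smooth_on (\<lambda>y. p y $ i) N" for i
      unfolding p_def sum_component vector_smult_component
      by (intro smooth_on_sum[OF N] smooth_on_mult[OF N] fs smooth_on_subset[OF col sub])
    have "smooth_on a N" unfolding a_def by (intro smooth_on_sum[OF N] fs)
    moreover have "smooth_on (\<lambda>y. vec_Re (p y)) N"
      unfolding vec_Re_def by (rule smooth_on_vec[OF N]) (simp add: smooth_on_linear[OF N bounded_linear_Re ps])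
    moreover have "smooth_on (\<lambda>y. vec_Im (p y)) N"
      unfolding vec_Im_def by (rule smooth_on_vec[OF N]) (simp add: smooth_on_linear[OF N bounded_linear_Im ps])
    moreover have "ce (A y) (p (snd c y)) \<in> T01 y \<and>
       (\<exists>Z\<in>T10 y. ce (A y) v = a (snd c y) *s vec_of_real (A y (Tc (snd c y))) + Z + ce (A y) (p (snd c y)))"
      if yV: "y \<in> V" for y
    proof -
      have y: "y \<in> fst c" "y \<in> U'" "snd c y \<in> N" using yV by (auto simp: V_def)
      note sumA = ce_sum[OF lin[OF y(1)]] ce_scale[OF lin[OF y(1)]]
      have "ce (A y) (p (snd c y)) \<in> T01 y"
        unfolding p_def sumA using T01_subspace col01[OF y(1,2)] by (intro vec.subspace_sum vec.subspace_scale) auto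
      moreover define Z' where "Z' = (\<Sum>j\<in>{j. 0 < h j \<and> h j \<le> n}. f (snd c y) $ j *s ce (A y) (col j (snd c y)))"
      have "Z' \<in> T10 y"
        unfolding Z'_def using T10_subspace col10[OF y(1,2)] by (intro vec.subspace_sum vec.subspace_scale) auto
      moreover have "ce (A y) v = a (snd c y) *s vec_of_real (A y (Tc (snd c y))) + Z' + ce (A y) (p (snd c y))"
      proof -
        let ?g = "\<lambda>j. f (snd c y) $ j *s ce (A y) (col j (snd c y))"
        have "ce (A y) v = (\<Sum>j\<in>UNIV. ?g j)"
          using f[OF y(3)] by (simp add: Mv flip: sumA)
        also have "UNIV = {j. h j = 0} \<union> {j. 0 < h j \<and> h j \<le> n} \<union> {j. n < h j}" by auto
        also have "sum ?g \<dots> = sum ?g {j. h j = 0} + sum ?g {j. 0 < h j \<and> h j \<le> n} + sum ?g {j. n < h j}"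
          by (subst sum.union_disjoint, simp_all, force)+
        also have "sum ?g {j. h j = 0} = a (snd c y) *s vec_of_real (A y (Tc (snd c y)))"
          by (simp add: a_def col0[OF y(1)] vec.scale_sum_left)
        finally show ?thesis by (simp add: Z'_def p_def sumA)
      qed
      ultimately show ?thesis by blast
    qed
    ultimately show ?thesis unfolding smooth_splitting_def VN Let_def A_def by blast
  qed
  \<comment> \<open>Transversality persists wherever the splitting exists: a horizontal
    \<open>Tc\<close> would make every constant vector horizontal.\<close>
  have "vec_of_real (A y (Tc (snd c y))) \<notin> HC y" if yV: "y \<in> V" for y
  proof
    assume T: "vec_of_real (A y (Tc (snd c y))) \<in> HC y"
    have y: "y \<in> fst c" using yV by (simp add: V_def)
    have "ce (A y) v \<in> HC y" for v
    proof -
      from split[of v] obtain a p where "smooth_splitting c Tc V v a p" by blast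
      then obtain Z W where d: "Z \<in> T10 y" "W \<in> T01 y" "ce (A y) v = a (snd c y) *s vec_of_real (A y (Tc (snd c y))) + (Z + W)"
        using yV unfolding smooth_splitting_def Let_def A_def add.assoc by blast
      have ZW: "Z + W \<in> HC y" using d(1,2) unfolding HC_def by blast
      show ?thesis
        unfolding d(3) by (rule vec.subspace_add[OF HC_subspace vec.subspace_scale[OF HC_subspace T] ZW])
    qed
    then have "vec_of_real (A y (axis i 1)) \<in> HC y" for i
      using ce_of_real[OF lin[OF y]] by metis
    then show False
      using axis_transversal[OF lin[OF y], of "tangent_change (chart_at y) c y" y] tc_chart[OF c y]
      by (auto simp: A_def)
  qed
  then show ?thesis
    by (intro that[OF V xV _ _ _ split]) (auto simp: V_def A_def)
qed

end

section \<open>Integrability expressed by one-forms that annihilate T10 or T01\<close>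

lemma one_form_ctr: "alt 1 f \<Longrightarrow> ctr v f = sc (app f [v])"
  using alt_0_eq_sc[of "ctr v f"] alt_ctr[of 1 f v] by simp

lemma one_form_cctr: "alt 1 f \<Longrightarrow> cctr Z f = sc (app (cctr Z f) [])"
  using alt_0_eq_sc[of "cctr Z f"] alt_cctr[of 1 f Z] by simp

lemma one_form_cctr_sum:
  assumes "alt 1 f"
  shows "app (cctr Z f) [] = (\<Sum>j\<in>UNIV. Z $ j * app f [axis j 1])"
proof -
  have "app (ctr v f) [] = (\<Sum>j\<in>UNIV. of_real (v $ j) * app f [axis j 1])" for v
    using arg_cong[OF ctr_axis_sum[OF assms, of v], of "\<lambda>f. app f []"] by (simp add: app_sum)
  then have "app (cctr Z f) [] = (\<Sum>j\<in>UNIV. (of_real (Re (Z $ j)) + \<i> * of_real (Im (Z $ j))) * app f [axis j 1])"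
    by (simp del: app_ctr add: cctr_def vec_Re_def vec_Im_def sum_distrib_left distrib_right sum.distrib mult.assoc)
  then show ?thesis by (simp flip: complex_eq)
qed

text \<open>In the Cartan formula for d\<alpha>(Y, X) the two terms that differentiate \<alpha>(X)
  and \<alpha>(Y) vanish identically, and only \<alpha> on the bracket survives.\<close>

lemma cartan_annihilated:
  fixes \<alpha> :: "real^'m \<Rightarrow> 'm::finite cform" and X Y :: "real^'m \<Rightarrow> complex^'m"
  assumes S: "open S" "y \<in> S" and \<alpha>: "sform S \<alpha>" "\<And>z. z \<in> S \<Longrightarrow> alt 1 (\<alpha> z)"
    and X: "smooth_on X S" "\<And>z. z \<in> S \<Longrightarrow> cctr (X z) (\<alpha> z) = 0"
    and Y: "smooth_on Y S" "\<And>z. z \<in> S \<Longrightarrow> cctr (Y z) (\<alpha> z) = 0"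
  shows "cctr (X y) (cctr (Y y) (ed \<alpha> y)) =
    cctr (complex_extension (frechet_derivative Y (at y)) (X y)
        - complex_extension (frechet_derivative X (at y)) (Y y)) (\<alpha> y)"
proof -
  let ?d = "\<lambda>w. dird w \<alpha> y"
  let ?al = "\<lambda>Z. app (cctr Z (\<alpha> y)) []"
  have alt_d: "alt 1 (?d w)" for w by (rule alt_dird[OF S(1) \<alpha>(1) S(2) \<alpha>(2)])
  \<comment> \<open>Differentiating the identity \<alpha>(X) = 0 moves the derivative from the
    coefficients of \<alpha> to the field, at the price of a sign.\<close>
  have D: "app (cctr (X y) (?d w)) [] = - ?al (frechet_derivative X (at y) w)"
    if X: "smooth_on X S" "\<And>z. z \<in> S \<Longrightarrow> cctr (X z) (\<alpha> z) = 0" for X w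
  proof -
    have "((\<lambda>z. \<Sum>j\<in>UNIV. X z $ j * app (\<alpha> z) [axis j 1]) has_derivative
        (\<lambda>w. \<Sum>j\<in>UNIV. X y $ j * app (?d w) [axis j 1] + frechet_derivative X (at y) w $ j * app (\<alpha> y) [axis j 1])) (at y)"
      by (intro has_derivative_sum has_derivative_mult sform_has_derivative[OF S \<alpha>(1)]
          bounded_linear.has_derivative[OF bounded_linear_vec_nth] smooth_on_has_derivative[OF X(1) S(2)])
    moreover have "(\<Sum>j\<in>UNIV. X z $ j * app (\<alpha> z) [axis j 1]) = 0" if "z \<in> S" for z
      using X(2)[OF that] by (simp flip: one_form_cctr_sum[OF \<alpha>(2)[OF that]])
    ultimately have "((\<lambda>z. 0) has_derivative
        (\<lambda>w. \<Sum>j\<in>UNIV. X y $ j * app (?d w) [axis j 1] + frechet_derivative X (at y) w $ j * app (\<alpha> y) [axis j 1])) (at y)"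
      using has_derivative_cong_open[OF S, of "\<lambda>z. \<Sum>j\<in>UNIV. X z $ j * app (\<alpha> z) [axis j 1]" "\<lambda>z. 0"] by simp
    from has_derivative_unique[OF this has_derivative_const, THEN fun_cong, of w]
    have "app (cctr (X y) (?d w)) [] + ?al (frechet_derivative X (at y) w) = 0"
      by (simp add: one_form_cctr_sum[OF alt_d] one_form_cctr_sum[OF \<alpha>(2)[OF S(2)]] sum.distrib)
    then show ?thesis by (simp only: eq_neg_iff_add_eq_0)
  qed
  have R: "app (ed \<alpha> y) [v, u] = app (?d v) [u] - app (?d u) [v]" for u v
  proof -
    have z: "ctr u (ctr v (\<alpha> z)) = 0" if "z \<in> S" for z
      using one_form_ctr[OF \<alpha>(2)[OF that], of v] by simp
    have "ed (\<lambda>z. ctr u (ctr v (\<alpha> z))) y = ed (\<lambda>z. 0) y" by (intro ed_cong[OF S] z)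
    then have "ctr u (ctr v (ed \<alpha> y)) = ctr u (?d v) - ctr v (?d u)"
      by (simp add: ctr_ed ed_const[OF S] ctr_dird)
    then have "app (ctr u (ctr v (ed \<alpha> y))) [] = app (ctr u (?d v) - ctr v (?d u)) []" by simp
    then show ?thesis by simp
  qed
  have lin: "app (?d (vec_Re Z)) [vec_Re W] = app (ctr (vec_Re W) (?d (vec_Re Z))) []" for Z W by simp
  have "app (cctr (X y) (cctr (Y y) (ed \<alpha> y))) [] =
      (app (cctr (X y) (?d (vec_Re (Y y)))) [] + \<i> * app (cctr (X y) (?d (vec_Im (Y y)))) [])
      - (app (cctr (Y y) (?d (vec_Re (X y)))) [] + \<i> * app (cctr (Y y) (?d (vec_Im (X y)))) [])"
    by (simp add: cctr_def R algebra_simps)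
  also have "\<dots> = ?al (complex_extension (frechet_derivative Y (at y)) (X y)
        - complex_extension (frechet_derivative X (at y)) (Y y))"
    unfolding D[OF X(1) X(2), simplified] D[OF Y(1) Y(2), simplified] complex_extension_def
    by (simp add: cctr_add_left[OF \<alpha>(2)[OF S(2)]] cctr_diff_left[OF \<alpha>(2)[OF S(2)]] cctr_scale_left[OF \<alpha>(2)[OF S(2)]])
  finally have "app (cctr (X y) (cctr (Y y) (ed \<alpha> y))) [] = \<dots>" .
  moreover have "alt 0 (cctr (X y) (cctr (Y y) (ed \<alpha> y)))"
    using alt_cctr[OF alt_cctr[OF alt_ed[OF S(1) \<alpha>(1) S(2) \<alpha>(2)]]] by simp
  ultimately show ?thesis
    using alt_0_eq_sc one_form_cctr[OF \<alpha>(2)[OF S(2)]] by metis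
qed

context CR_manifold
begin

text \<open>Cartan's formula and involutivity settle the case of two frame fields; both sides are
  linear in each argument at the point, so the span follows.\<close>

lemma T10_closed:
  assumes U: "open U" "x \<in> U" and \<nu>: "smf U 1 \<nu>" "\<And>x Z. x \<in> U \<Longrightarrow> Z \<in> T10 x \<Longrightarrow> cctr Z (\<nu> x) = 0"
    and "Z \<in> T10 x" "W \<in> T10 x"
  shows "cctr Z (cctr W (dm \<nu> x)) = 0"
proof -
  from frame[of x] obtain U' F where F: "open U'" "x \<in> U'" "\<forall>i<n. smooth_field_on U' (F i)"
    "\<forall>y\<in>U'. T10 y = vec.span ((\<lambda>i. F i y) ` {..<n})" by blast
  let ?c = "chart_at x"
  let ?V = "U \<inter> U'"
  define S where "S = snd ?c ` (fst ?c \<inter> ?V)"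
  have S: "open S" "snd ?c x \<in> S" unfolding S_def using open_chart_image[OF chart_at(1)[of x] open_Int[OF U(1) F(1)]] U F chart_at(2) by auto
  have FT: "F i y \<in> T10 y" if "i < n" "y \<in> U'" for i y
    using F(4) that by (auto intro!: vec.span_base)
  have sF: "smooth_field_on ?V (F i)" if "i < n" for i
    using F(3) that unfolding smooth_field_on_def by (auto intro: smooth_on_subset)
  have alt_d: "alt 2 (dm \<nu> x)" using smf_alt[OF smf_dm[OF U(1) \<nu>(1)] U(2)] by simp
  have frames: "cctr (F i x) (cctr (F j x) (dm \<nu> x)) = 0" if ij: "i < n" "j < n" for i j
  proof -
    have sm: "smooth_on (field_in_chart ?c (F k)) S" if "k < n" for k
      using sF[OF that] chart_at(1) unfolding smooth_field_on_def S_def by blast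
    have ann: "cctr (field_in_chart ?c (F k) z) (lform ?c \<nu> z) = 0" if "k < n" "z \<in> S" for k z
    proof -
      from that(2) obtain y where y: "y \<in> fst ?c" "y \<in> U" "y \<in> U'" "z = snd ?c y" unfolding S_def by blast
      then show ?thesis
        using \<nu>(2)[OF y(2) FT[OF \<open>k < n\<close> y(3)]]
        by (simp add: field_in_chart_ce lform_snd chart_at cctr_pb ce_ce tc_chart)
    qed
    have at: "field_in_chart ?c (F k) (snd ?c x) = F k x" for k
      using chart_at[of x] by (simp add: field_in_chart_ce)
    have al: "sform S (lform ?c \<nu>)" "\<And>z. z \<in> S \<Longrightarrow> alt 1 (lform ?c \<nu> z)"
      unfolding S_def using \<nu>(1) chart_at(1)
      by (auto intro: smf_sform[OF smf_subset] alt_lform)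
    have "cctr (F i x) (cctr (F j x) (dm \<nu> x)) = cctr (lie_bracket (F i) (F j) x) (\<nu> x)"
      using cartan_annihilated[OF S al sm[OF ij(1)] ann[OF ij(1)] sm[OF ij(2)] ann[OF ij(2)]]
      by (simp add: at dm_def lie_bracket_def Let_def lform_chart_at)
    moreover have "lie_bracket (F i) (F j) x \<in> T10 x"
      using T10_involutive[unfolded involutive_def, rule_format, of ?V "F i" "F j" x] sF ij U F FT by blast
    ultimately show ?thesis using \<nu>(2)[OF U(2)] by simp
  qed
  note T10x = F(4)[rule_format, OF F(2)]
  have sub1: "vec.subspace {Z. cctr Z (cctr W (dm \<nu> x)) = 0}" for W
    using alt_cctr[OF alt_d, of W]
    by (auto simp: vec.subspace_def cctr_zero_left cctr_add_left cctr_scale_left)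
  have "vec.span ((\<lambda>i. F i x) ` {..<n}) \<subseteq> {Z. cctr Z (cctr (F j x) (dm \<nu> x)) = 0}" if "j < n" for j
    by (rule vec.span_minimal[OF _ sub1]) (use frames that in auto)
  then have "cctr (F j x) (cctr Z (dm \<nu> x)) = 0" if "j < n" for j
    using that assms(5) cctr_swap[OF alt_d, of "F j x" Z] by (auto simp: T10x)
  then have "vec.span ((\<lambda>i. F i x) ` {..<n}) \<subseteq> {W. cctr W (cctr Z (dm \<nu> x)) = 0}"
    by (intro vec.span_minimal[OF _ sub1]) auto
  then show ?thesis using assms(6) cctr_swap[OF alt_d, of Z W] by (auto simp: T10x)
qed

text \<open>Complex conjugation exchanges T10 and T01, commutes with the differential and turns
  \<nu> into a form annihilating T10.\<close>

lemma T01_closed: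
  assumes U: "open U" "x \<in> U" and \<nu>: "smf U 1 \<nu>" "\<And>x W. x \<in> U \<Longrightarrow> W \<in> T01 x \<Longrightarrow> cctr W (\<nu> x) = 0"
    and "Z \<in> T01 x" "W \<in> T01 x"
  shows "cctr Z (cctr W (dm \<nu> x)) = 0"
proof -
  let ?\<nu> = "\<lambda>x. cmap cnj (\<nu> x)"
  note cnj = bounded_linear_cnj bounded_linear.linear[OF bounded_linear_cnj]
  have d: "dm ?\<nu> x = cmap cnj (dm \<nu> x)" by (rule dm_cmap[OF U cnj(1) \<nu>(1)])
  have alt_d: "alt 2 (dm \<nu> x)" using smf_alt[OF smf_dm[OF U(1) \<nu>(1)] U(2)] by simp
  have "cctr (vec_cnj Z) (cctr (vec_cnj W) (dm ?\<nu> x)) = 0"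
  proof (rule T10_closed[OF U smf_cmap[OF U(1) cnj(1) \<nu>(1)]])
    fix y Y assume y: "y \<in> U" "Y \<in> T10 y"
    then have "cctr (vec_cnj (vec_cnj Y)) (cmap cnj (\<nu> y)) = cmap cnj (cctr (vec_cnj Y) (\<nu> y))"
      by (intro cctr_cmap_cnj[where k = 1] smf_alt[OF \<nu>(1)])
    then show "cctr Y (cmap cnj (\<nu> y)) = 0" using \<nu>(2)[OF y(1) cnj_T10[OF y(2)]] by (simp add: cmap_0[OF cnj(2)])
  qed (use assms(5,6) cnj_T01 in auto)
  then have "cmap cnj (cctr Z (cctr W (dm \<nu> x))) = 0"
    unfolding d by (simp add: cctr_cmap_cnj[OF alt_d] cctr_cmap_cnj[OF alt_cctr[OF alt_d]])
  then have "app (cmap cnj (cctr Z (cctr W (dm \<nu> x)))) vs = 0" for vs by simp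
  then show ?thesis by (intro mform_eqI) simp
qed

subsection \<open>Contact forms\<close>

text \<open>The contact form and, in \<open>OmC\<close>, its differential with complex coefficients,
  so that complex vectors can be contracted with them.\<close>

definition thC :: "('a, real^'m, real) form \<Rightarrow> 'a \<Rightarrow> 'm cform" where
  "thC \<theta> x = cmap complex_of_real (mf (\<theta> x))"

definition OmC :: "('a, real^'m, real) form \<Rightarrow> 'a \<Rightarrow> 'm cform" where
  "OmC \<theta> x = cmap complex_of_real (mf (ext_deriv \<theta> x))"

text \<open>Some coordinate direction is transversal at \<open>x\<close> and hence nearby. The
  coefficient of a vector along it, modulo T10 and T01, is a smooth one-form with kernel H.\<close>

lemma contact_form_exists: "\<exists>U \<theta>. contact_form U \<theta> \<and> x \<in> U"
proof -
  let ?c = "chart_at x"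
  have "\<exists>i. vec_of_real (tangent_change ?c (chart_at x) x (axis i 1)) \<notin> HC x"
    by (rule axis_transversal[where B = "\<lambda>v. v"]) (use chart_at[of x] in \<open>auto simp: linear_iff\<close>)
  then obtain i where i: "vec_of_real (tangent_change ?c (chart_at x) x (axis i 1)) \<notin> HC x" by blast
  obtain V where V: "open V" "x \<in> V" "V \<subseteq> fst ?c"
    and tr: "\<And>y. y \<in> V \<Longrightarrow> vec_of_real (frm ?c i y) \<notin> HC y"
    and ap: "\<And>v. \<exists>a p. smooth_splitting ?c (\<lambda>_. axis i 1) V v a p"
  proof (rule frame_coefficients[where Tc = "\<lambda>_. axis i 1", OF open_UNIV UNIV_I chart_at(1)[of x] chart_at(2)[of x] smooth_on_const i], goal_cases)
    case (1 V)
    show ?case by (rule 1(1)[OF 1(2,3,5) 1(6)[folded frm_def] 1(7)])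
  qed
  let ?T = "\<lambda>y. vec_of_real (frm ?c i y)"
  define coef where "coef y v = (THE a. \<exists>Z\<in>T10 y. \<exists>W\<in>T01 y. v = a *s ?T y + Z + W)" for y v
  have coef: "coef y v = a"
    if y: "y \<in> V" and ZW: "Z \<in> T10 y" "W \<in> T01 y" and v: "v = a *s ?T y + Z + W" for y v a Z W
    unfolding coef_def
  proof (rule the_equality)
    fix b assume "\<exists>Z'\<in>T10 y. \<exists>W'\<in>T01 y. v = b *s ?T y + Z' + W'"
    then obtain Z' W' where ZW': "Z' \<in> T10 y" "W' \<in> T01 y" "v = b *s ?T y + Z' + W'" by blast
    have "(a - b) *s ?T y + (Z - Z') + (W - W') = 0"
      using ZW'(3) unfolding v by (simp add: vec_eq_iff algebra_simps)
    from decomposition_at_unique(1)[OF tr[OF y] _ _ this]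
    have "a - b = 0" using ZW ZW' T10_subspace T01_subspace by (simp add: vec.subspace_diff)
    then show "b = a" by simp
  qed (use ZW v in blast)
  have split: "\<exists>Z W. Z \<in> T10 y \<and> W \<in> T01 y \<and> v = coef y v *s ?T y + Z + W" if y: "y \<in> V" for y v
  proof -
    obtain a Z W where "Z \<in> T10 y" "W \<in> T01 y" "v = a *s ?T y + Z + W"
      using decomposition_at[OF tr[OF y], of v] by blast
    with coef[OF y this] show ?thesis by blast
  qed
  have coef_add: "coef y (v + w) = coef y v + coef y w" if y: "y \<in> V" for y v w
  proof -
    obtain Z W where v: "Z \<in> T10 y" "W \<in> T01 y" "v = coef y v *s ?T y + Z + W" using split[OF y] by blast
    obtain Z' W' where w: "Z' \<in> T10 y" "W' \<in> T01 y" "w = coef y w *s ?T y + Z' + W'" using split[OF y] by blast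
    show ?thesis
    proof (rule coef[OF y])
      show "Z + Z' \<in> T10 y" "W + W' \<in> T01 y" using v w T10_subspace T01_subspace by (auto intro: vec.subspace_add)
      show "v + w = (coef y v + coef y w) *s ?T y + (Z + Z') + (W + W')"
        using v(3) w(3) by (simp add: vec_eq_iff algebra_simps)
    qed
  qed
  have coef_scale: "coef y (r *s v) = r * coef y v" if y: "y \<in> V" for y v r
  proof -
    obtain Z W where v: "Z \<in> T10 y" "W \<in> T01 y" "v = coef y v *s ?T y + Z + W" using split[OF y] by blast
    show ?thesis
    proof (rule coef[OF y])
      show "r *s Z \<in> T10 y" "r *s W \<in> T01 y" using v T10_subspace T01_subspace by (auto intro: vec.subspace_scale)
      show "r *s v = (r * coef y v) *s ?T y + r *s Z + r *s W" using v(3) by (simp add: vec_eq_iff algebra_simps)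
    qed
  qed
  \<comment> \<open>The transversal direction is real and conjugation swaps T10 and T01, so the
    coefficient is real on real vectors; taking \<open>Re\<close> below loses nothing.\<close>
  have coef_cnj: "coef y (vec_cnj v) = cnj (coef y v)" if y: "y \<in> V" for y v
  proof -
    obtain Z W where v: "Z \<in> T10 y" "W \<in> T01 y" "v = coef y v *s ?T y + Z + W" using split[OF y] by blast
    from arg_cong[OF v(3), of vec_cnj] have "vec_cnj v = cnj (coef y v) *s ?T y + vec_cnj W + vec_cnj Z"
      by (simp add: add_ac)
    then show ?thesis by (rule coef[OF y cnj_T01[OF v(2)] cnj_T10[OF v(1)]])
  qed
  define \<theta> :: "('a, real^'m, real) form" where
    "\<theta> y vs = (case vs of [v] \<Rightarrow> Re (coef y (vec_of_real v)) | _ \<Rightarrow> 0)" for y vs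
  have coef_real: "coef y (vec_of_real v) = of_real (\<theta> y [v])" if "y \<in> V" for y v
    using coef_cnj[OF that, of "vec_of_real v"] by (simp add: \<theta>_def complex_eq_iff)
  have alt\<theta>: "alt 1 (mf (\<theta> y))" if y: "y \<in> V" for y
  proof (rule altI)
    show "linear (\<lambda>v. app (mf (\<theta> y)) (v # vs))" for vs
      by (rule linearI) (auto simp: \<theta>_def coef_add[OF y] coef_scale[OF y] split: list.split)
    have c: "ctr v (mf (\<theta> y)) = sc (\<theta> y [v])" for v
    proof (rule mform_eqI)
      fix vs show "app (ctr v (mf (\<theta> y))) vs = app (sc (\<theta> y [v])) vs" by (cases vs) (auto simp: \<theta>_def)
    qed
    show "alt (1 - 1) (ctr v (mf (\<theta> y)))" "ctr v (ctr v (mf (\<theta> y))) = 0" for v by (simp_all add: c alt_sc)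
    show "app (mf (\<theta> y)) [] = 0" by (simp add: \<theta>_def)
  qed
  define \<alpha> where "\<alpha> z = mf (\<lambda>vs. case vs of [v] \<Rightarrow> Re (coef (chart_inv ?c z)
      (ce (tangent_change ?c (chart_at (chart_inv ?c z)) (chart_inv ?c z)) (vec_of_real v))) | _ \<Rightarrow> 0)" for z
  have "smf V 1 (\<lambda>y. mf (\<theta> y))"
  proof (rule smf_chart[OF chart_at(1) V(1,3) alt\<theta>])
    have eq: "snd ?c ` (fst ?c \<inter> V) = snd ?c ` V" using V(3) by blast
    have op: "open (snd ?c ` V)" using open_chart_image[OF chart_at(1)[of x] V(1)] unfolding eq .
    show "sform (snd ?c ` (fst ?c \<inter> V)) \<alpha>"
      unfolding eq sform_def
    proof
      fix vs
      show "smooth_on (\<lambda>z. app (\<alpha> z) vs) (snd ?c ` V)"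
      proof (cases "\<exists>v. vs = [v]")
        case True
        then obtain v where vs: "vs = [v]" by blast
        obtain a p where ap: "smooth_splitting ?c (\<lambda>_. axis i 1) V (vec_of_real v) a p"
          using ap[of "vec_of_real v"] by blast
        then have a: "smooth_on a (snd ?c ` V)" by (simp add: smooth_splitting_def)
        note d = ap[unfolded smooth_splitting_def, THEN conjunct2, THEN conjunct2, THEN conjunct2]
        have "app (\<alpha> z) vs = Re (a z)" if "z \<in> snd ?c ` V" for z
        proof -
          obtain y where y: "y \<in> V" "z = snd ?c y" using \<open>z \<in> snd ?c ` V\<close> by blast
          have yc: "y \<in> fst ?c" using V(3) y by blast
          have "coef y (ce (tangent_change ?c (chart_at y) y) (vec_of_real v)) = a z"
            using d[rule_format, OF y(1)] coef[OF y(1)] unfolding Let_def frm_def y(2) by blast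
          then show ?thesis using yc y chart_at(1)[of x] by (simp add: \<alpha>_def vs)
        qed
        moreover have "smooth_on (\<lambda>z. Re (a z)) (snd ?c ` V)"
          by (rule smooth_on_linear[OF op bounded_linear_Re a])
        ultimately show ?thesis by (subst smooth_on_cong[OF op])
      next
        case False
        then have "app (\<alpha> z) vs = 0" for z by (auto simp: \<alpha>_def split: list.split)
        then show ?thesis by simp
      qed
    qed
    show "lform ?c (\<lambda>y. mf (\<theta> y)) (snd ?c y) = \<alpha> (snd ?c y)" if "y \<in> V" for y
    proof (rule mform_eqI)
      fix vs
      have yc: "y \<in> fst ?c" using V(3) that by blast
      show "app (lform ?c (\<lambda>y. mf (\<theta> y)) (snd ?c y)) vs = app (\<alpha> (snd ?c y)) vs"
        using yc chart_at(1) ce_of_real[OF tc_chart(2)[OF chart_at(1) yc]]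
        by (auto simp: lform_snd \<alpha>_def \<theta>_def split: list.split)
    qed
  qed
  then have "\<theta> \<in> forms_on V 1" by (simp add: forms_on_iff)
  moreover have "{v. \<theta> y [v] = 0} = H y" if y: "y \<in> V" for y
  proof (intro set_eqI, unfold mem_Collect_eq)
    fix v
    let ?a = "coef y (vec_of_real v)"
    obtain Z W where d: "Z \<in> T10 y" "W \<in> T01 y" "vec_of_real v = ?a *s ?T y + Z + W"
      using split[OF y] by blast
    have "\<theta> y [v] = 0 \<longleftrightarrow> ?a = 0" using coef_real[OF y] by auto
    also have "?a = 0 \<longleftrightarrow> vec_of_real v \<in> HC y"
    proof
      assume "?a = 0"
      then show "vec_of_real v \<in> HC y" using d unfolding HC_def by auto
    next
      assume "vec_of_real v \<in> HC y"
      then obtain Z' W' where ZW': "Z' \<in> T10 y" "W' \<in> T01 y" "vec_of_real v = 0 *s ?T y + Z' + W'"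
        unfolding HC_def by auto
      then show "?a = 0" by (rule coef[OF y])
    qed
    finally show "\<theta> y [v] = 0 \<longleftrightarrow> v \<in> H y" by (simp add: real_in_HC_iff)
  qed
  ultimately have "contact_form V \<theta>" using V by (simp add: contact_form_def)
  then show ?thesis using V by blast
qed

definition reebf :: "('a, real^'m, real) form \<Rightarrow> 'a \<Rightarrow> real^'m" where
  "reebf \<theta> x = (SOME T. reeb_vector \<theta> x T)"

text \<open>The coordinate matrix of the real map sending v to its contraction with d\<theta> plus
  \<theta>(v)\<theta>. It is invertible, and the Reeb vector is the preimage of \<theta> itself,
  which makes the Reeb field accessible to Cramer's rule.\<close>

definition reebm :: "('a, real^'m, real) form \<Rightarrow> ('a, real^'m) chart \<Rightarrow> real^'m \<Rightarrow> real^'m^'m" where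
  "reebm \<theta> c y = (\<chi> i j. app (lform c (\<lambda>x. mf (ext_deriv \<theta> x)) y) [axis j 1, axis i 1]
     + app (lform c (\<lambda>x. mf (\<theta> x)) y) [axis i 1] * app (lform c (\<lambda>x. mf (\<theta> x)) y) [axis j 1])"

context
  fixes U :: "'a set" and \<theta> :: "('a, real^'m, real) form"
  assumes contact: "contact_form U \<theta>"
begin

lemma contact_open: "open U" using contact by (simp add: contact_form_def)

lemma smf_contact: "smf U 1 (\<lambda>x. mf (\<theta> x))" using contact by (simp add: contact_form_def forms_on_iff)

lemma smf_dcontact: "smf U 2 (\<lambda>x. mf (ext_deriv \<theta> x))"
proof -
  have "dm (\<lambda>x. mf (\<theta> x)) = (\<lambda>x. mf (ext_deriv \<theta> x))" by (rule ext) (rule dm_ext_deriv)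
  then show ?thesis using smf_dm[OF contact_open smf_contact] by simp
qed

lemma smf_thC: "smf U 1 (thC \<theta>)"
  using smf_cmap[OF contact_open bounded_linear_of_real smf_contact] by (simp add: thC_def[abs_def])

lemma smf_OmC: "smf U 2 (OmC \<theta>)"
  using smf_cmap[OF contact_open bounded_linear_of_real smf_dcontact] by (simp add: OmC_def[abs_def])

lemma dm_thC: "x \<in> U \<Longrightarrow> dm (thC \<theta>) x = OmC \<theta> x"
  using dm_cmap[OF contact_open _ bounded_linear_of_real smf_contact]
  by (simp add: thC_def[abs_def] OmC_def dm_ext_deriv)

lemma contact_kernel: "x \<in> U \<Longrightarrow> \<theta> x [v] = 0 \<longleftrightarrow> v \<in> H x"
  using contact unfolding contact_form_def by blast

context
  fixes x assumes x: "x \<in> U"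
begin

lemma alt_thC: "alt 1 (thC \<theta> x)" and alt_OmC: "alt 2 (OmC \<theta> x)"
  using smf_alt[OF smf_thC x] smf_alt[OF smf_OmC x] by auto

lemma cctr_thC_H: "vec_Re Z \<in> H x \<Longrightarrow> vec_Im Z \<in> H x \<Longrightarrow> cctr Z (thC \<theta> x) = 0"
  unfolding cctr_def one_form_ctr[OF alt_thC] by (simp add: thC_def contact_kernel[OF x, THEN iffD2])

lemma cctr_thC_T10: "Z \<in> T10 x \<Longrightarrow> cctr Z (thC \<theta> x) = 0"
  by (intro cctr_thC_H T10_H)

lemma cctr_thC_T01: "W \<in> T01 x \<Longrightarrow> cctr W (thC \<theta> x) = 0"
proof -
  assume "W \<in> T01 x"
  then obtain Z where Z: "Z \<in> T10 x" "W = vec_cnj Z" by (auto simp: T01_def)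
  have "- \<i> *s vec_cnj Z = vec_cnj (\<i> *s Z)" by (simp add: vec_eq_iff vec_cnj_def)
  have "(- 1) *s Z \<in> T10 x" using Z(1) T10_subspace vec.subspace_scale by blast
  from T10_H(2)[OF this] show ?thesis using T10_H(1)[OF Z(1)] Z(2) by (intro cctr_thC_H) simp_all
qed

end

lemma OmC_T10: "x \<in> U \<Longrightarrow> Z \<in> T10 x \<Longrightarrow> Z' \<in> T10 x \<Longrightarrow> cctr Z (cctr Z' (OmC \<theta> x)) = 0"
  using T10_closed[OF contact_open _ smf_thC cctr_thC_T10] by (simp add: dm_thC)

lemma OmC_T01: "x \<in> U \<Longrightarrow> W \<in> T01 x \<Longrightarrow> W' \<in> T01 x \<Longrightarrow> cctr W (cctr W' (OmC \<theta> x)) = 0"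
  using T01_closed[OF contact_open _ smf_thC cctr_thC_T01] by (simp add: dm_thC)

context
  fixes x assumes x: "x \<in> U"
begin

lemma Levi_nondegenerate:
  assumes "Z \<in> T10 x" "\<And>W. W \<in> T01 x \<Longrightarrow> cctr W (cctr Z (OmC \<theta> x)) = 0"
  shows "Z = 0"
proof -
  have "levi_form \<theta> x Z W = 0" if W: "W \<in> T10 x" for W
  proof -
    have "(\<lambda>vs. complex_of_real (ext_deriv \<theta> x vs)) = app (OmC \<theta> x)" by (simp add: OmC_def fun_eq_iff)
    then have "multi_extension (\<lambda>vs. complex_of_real (ext_deriv \<theta> x vs)) [Z, vec_cnj W] =
        app (cctr (vec_cnj W) (cctr Z (OmC \<theta> x))) []"
      by (simp only: multi_extension_Cons multi_extension.simps(1))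
    then show ?thesis using assms(2)[OF cnj_T10[OF W]] by (simp add: levi_form_def)
  qed
  then show ?thesis
    using nondegenerate[unfolded levi_nondegenerate_def, rule_format, OF contact x] assms(1) by blast
qed

text \<open>A real horizontal vector is Z plus its conjugate. Contracting further with T01 removes
  the multiple of \<theta> and, by type, the conjugate term, so the Levi form annihilates Z. The
  multiplier \<open>r\<close> is 0 for invertibility of \<open>reebm\<close> and 1 for the existence
  of the Reeb vector.\<close>

lemma horizontal_nondegenerate:
  assumes v: "\<theta> x [v] = 0" "ctr v (mf (ext_deriv \<theta> x)) = sc r * mf (\<theta> x)"
  shows "v = 0"
proof -
  have "v \<in> H x" using v(1) contact_kernel[OF x] by simp
  then obtain Z where Z: "Z \<in> T10 x" "vec_of_real v = Z + vec_cnj Z" by (rule H_split)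
  have "ctr v (OmC \<theta> x) = cmap complex_of_real (sc r * mf (\<theta> x))" by (simp add: OmC_def ctr_cmap v(2))
  also have "\<dots> = sc (complex_of_real r) * thC \<theta> x" by (rule mform_eqI) (simp add: thC_def)
  finally have s: "cctr Z (OmC \<theta> x) + cctr (vec_cnj Z) (OmC \<theta> x) = sc (complex_of_real r) * thC \<theta> x"
    using cctr_of_real[OF alt_OmC[OF x], of v] unfolding Z(2) by (simp add: cctr_add_left[OF alt_OmC[OF x]])
  have "Z = 0"
  proof (rule Levi_nondegenerate[OF Z(1)])
    fix W assume W: "W \<in> T01 x"
    from arg_cong[OF s, of "cctr W"] show "cctr W (cctr Z (OmC \<theta> x)) = 0"
      using OmC_T01[OF x W cnj_T10[OF Z(1)]] cctr_thC_T01[OF x W] by (simp add: cctr_sc_mult)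
  qed
  then have "vec_Re (vec_of_real v) = 0" using Z(2) by simp
  then show "v = 0" by simp
qed

lemma ext_deriv_self: "ext_deriv \<theta> x [v, v] = 0"
  using arg_cong[OF alt_ctr_self[OF smf_alt[OF smf_dcontact x], of v], of "\<lambda>f. app f []"] by simp

lemma theta_nonzero: "mf (\<theta> x) \<noteq> 0"
proof
  assume z: "mf (\<theta> x) = 0"
  have "\<theta> x [v] = 0" for v using arg_cong[OF z, of "\<lambda>f. app f [v]"] by simp
  then have "vec_of_real v \<in> HC x" for v using contact_kernel[OF x] by (simp add: real_in_HC_iff)
  then show False using axis_transversal[of "\<lambda>v. v" "\<lambda>v. v" x] by (auto simp: linear_iff)
qed

context
  fixes c assumes c: "c \<in> charts" "x \<in> fst c"
begin

abbreviation (input) "A \<equiv> tangent_change c (chart_at x) x"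

lemma reebm_mult: "(reebm \<theta> c (snd c x) *v w) $ i =
    app (pb A (ctr (A w) (mf (ext_deriv \<theta> x)) + sc (\<theta> x [A w]) * mf (\<theta> x))) [axis i 1]"
proof -
  let ?Om = "lform c (\<lambda>x. mf (ext_deriv \<theta> x)) (snd c x)" and ?th = "lform c (\<lambda>x. mf (\<theta> x)) (snd c x)"
  have m: "snd c x \<in> snd c ` (fst c \<inter> U)" using c x by auto
  have Om: "alt 2 ?Om" and th: "alt 1 ?th"
    by (rule alt_lform[OF smf_dcontact c(1) m] alt_lform[OF smf_contact c(1) m])+
  have "app ?Om [w, axis i 1] = (\<Sum>j\<in>UNIV. w $ j * app ?Om [axis j 1, axis i 1])"
    using arg_cong[OF ctr_axis_sum[OF Om, of w], of "\<lambda>f. app f [axis i 1]"] by (simp add: app_sum)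
  moreover have "app ?th [w] = (\<Sum>j\<in>UNIV. w $ j * app ?th [axis j 1])"
    using arg_cong[OF ctr_axis_sum[OF th, of w], of "\<lambda>f. app f []"] by (simp add: app_sum)
  ultimately have "(reebm \<theta> c (snd c x) *v w) $ i = app ?Om [w, axis i 1] + app ?th [w] * app ?th [axis i 1]"
    by (simp add: matrix_vector_mult_def reebm_def sum.distrib sum_distrib_left algebra_simps)
  then show ?thesis using c by (simp add: lform_snd)
qed

lemma reebm_det: "det (reebm \<theta> c (snd c x)) \<noteq> 0"
proof -
  have "w = 0" if w: "reebm \<theta> c (snd c x) *v w = 0" for w
  proof -
    let ?mu = "ctr (A w) (mf (ext_deriv \<theta> x)) + sc (\<theta> x [A w]) * mf (\<theta> x)"
    have "alt 1 ?mu"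
      using alt_ctr[OF smf_alt[OF smf_dcontact x], of "A w"] smf_alt[OF smf_contact x]
      by (simp add: alt_add alt_sc_mult)
    then have "pb A ?mu = 0"
      using reebm_mult[of w] w by (intro one_form_eqI alt_pb tc_chart[OF c]) simp_all
    then have "pb (tangent_change (chart_at x) c x) (pb A ?mu) = 0" by simp
    then have z: "?mu = 0" using c by (simp only: pb_pb tc_chart[OF c] pb_ident)
    \<comment> \<open>Evaluating \<open>?mu\<close> on \<open>A w\<close> itself leaves the square
      of the \<theta>-value, since d\<theta> vanishes on a repeated argument.\<close>
    have "\<theta> x [A w] = 0" using arg_cong[OF z, of "\<lambda>f. app f [A w]"] by (simp add: ext_deriv_self)
    then have "A w = 0" by (rule horizontal_nondegenerate[where r = 0]) (use z \<open>\<theta> x [A w] = 0\<close> in simp)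
    then have "tangent_change (chart_at x) c x (A w) = 0" using tc_chart(1)[OF c] by (simp add: linear_0)
    then show "w = 0" by (simp add: tc_chart[OF c])
  qed
  then show ?thesis
    by (simp add: invertible_det_nz[symmetric] invertible_left_inverse matrix_left_invertible_ker)
qed

lemma reebm_reeb:
  assumes "reeb_vector \<theta> x T"
  shows "reebm \<theta> c (snd c x) *v (tangent_change (chart_at x) c x T) = (\<chi> i. app (lform c (\<lambda>x. mf (\<theta> x)) (snd c x)) [axis i 1])"
  using assms c unfolding reeb_vector_def
  by (simp add: vec_eq_iff reebm_mult tc_chart lform_snd)

end

lemma reeb_exists: "\<exists>T. reeb_vector \<theta> x T"
proof -
  let ?c = "chart_at x"
  let ?M = "reebm \<theta> ?c (snd ?c x)"
  have "surj ((*v) ?M)"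
    using reebm_det[OF chart_at]
    by (simp add: invertible_det_nz[symmetric] invertible_right_inverse matrix_right_invertible_surjective)
  then obtain T where T: "?M *v T = (\<chi> i. \<theta> x [axis i 1])" unfolding surj_def by metis
  let ?mu = "ctr T (mf (ext_deriv \<theta> x)) + sc (\<theta> x [T]) * mf (\<theta> x)"
  have alt1: "alt 1 ?mu"
    using alt_ctr[OF smf_alt[OF smf_dcontact x], of T] smf_alt[OF smf_contact x]
    by (simp add: alt_add alt_sc_mult)
  have mu: "?mu = mf (\<theta> x)"
  proof (rule one_form_eqI[OF alt1 smf_alt[OF smf_contact x]])
    fix j
    show "app ?mu [axis j 1] = app (mf (\<theta> x)) [axis j 1]"
      using reebm_mult[OF chart_at, of T j] T chart_at[of x] by simp
  qed
  \<comment> \<open>Evaluation on \<open>T\<close> makes the \<theta>-value idempotent. The value 0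
    would make d\<theta>(T, .) equal to \<theta> for a horizontal T, forcing T and then \<theta> to
    vanish.\<close>
  have "\<theta> x [T] * \<theta> x [T] = \<theta> x [T]" using arg_cong[OF mu, of "\<lambda>f. app f [T]"] by (simp add: ext_deriv_self)
  then have "\<theta> x [T] = 0 \<or> \<theta> x [T] = 1" by simp
  then show ?thesis
  proof
    assume T0: "\<theta> x [T] = 0"
    then have Om: "ctr T (mf (ext_deriv \<theta> x)) = mf (\<theta> x)" using mu by simp
    then have "T = 0" by (intro horizontal_nondegenerate[OF T0, of 1]) simp
    then have "mf (\<theta> x) = 0" using Om alt_ctr_zero[OF smf_alt[OF smf_dcontact x]] by simp
    then show ?thesis using theta_nonzero by simp
  next
    assume T1: "\<theta> x [T] = 1"
    then have z: "ctr T (mf (ext_deriv \<theta> x)) = 0" using mu by simp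
    have "ext_deriv \<theta> x [T, v] = 0" for v
      using arg_cong[OF z, of "\<lambda>f. app f [v]"] by simp
    then show ?thesis using T1 by (auto simp: reeb_vector_def)
  qed
qed

lemma reebf: "reeb_vector \<theta> x (reebf \<theta> x)"
  unfolding reebf_def using reeb_exists by (rule someI_ex)

lemma reebf_not_HC: "vec_of_real (reebf \<theta> x) \<notin> HC x"
proof
  assume "vec_of_real (reebf \<theta> x) \<in> HC x"
  then have "\<theta> x [reebf \<theta> x] = 0" using contact_kernel[OF x] by (simp add: real_in_HC_iff)
  then show False using reebf by (simp add: reeb_vector_def)
qed

lemma cr_point_contact: "cr_point n (T10 x) (T01 x) (vec_of_real (reebf \<theta> x)) (thC \<theta> x) (OmC \<theta> x)"
proof
  show "CARD('m) = 2 * n + 1" by (rule dimension)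
  show "alt 1 (thC \<theta> x)" "alt 2 (OmC \<theta> x)" by (rule alt_thC[OF x] alt_OmC[OF x])+
  show "vec.subspace (T10 x)" "vec.subspace (T01 x)" by (rule T10_subspace T01_subspace)+
  show "\<exists>b. T10 x = vec.span (b ` {..<n})" "\<exists>b. T01 x = vec.span (b ` {..<n})" by (rule T10_gen T01_gen)+
  show "\<exists>a Z W. Z \<in> T10 x \<and> W \<in> T01 x \<and> v = a *s vec_of_real (reebf \<theta> x) + Z + W" for v
    by (rule decomposition_at[OF reebf_not_HC])
  show "cctr (vec_of_real (reebf \<theta> x)) (thC \<theta> x) = 1"
    using reebf unfolding cctr_of_real[OF alt_thC[OF x]] one_form_ctr[OF alt_thC[OF x]]
    by (simp add: thC_def reeb_vector_def)
  show "cctr (vec_of_real (reebf \<theta> x)) (OmC \<theta> x) = 0"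
    unfolding cctr_of_real[OF alt_OmC[OF x]]
  proof (rule one_form_eqI)
    show "alt 1 (ctr (reebf \<theta> x) (OmC \<theta> x))" using alt_ctr[OF alt_OmC[OF x]] by simp
    show "app (ctr (reebf \<theta> x) (OmC \<theta> x)) [axis j 1] = app 0 [axis j 1]" for j
      using reebf by (simp add: OmC_def reeb_vector_def)
  qed simp
  show "cctr Z (thC \<theta> x) = 0" if "Z \<in> T10 x" for Z by (rule cctr_thC_T10[OF x that])
  show "cctr Z (thC \<theta> x) = 0" if "Z \<in> T01 x" for Z by (rule cctr_thC_T01[OF x that])
  show "cctr Z (cctr Z' (OmC \<theta> x)) = 0" if "Z \<in> T10 x" "Z' \<in> T10 x" for Z Z' by (rule OmC_T10[OF x that])
  show "cctr Z (cctr Z' (OmC \<theta> x)) = 0" if "Z \<in> T01 x" "Z' \<in> T01 x" for Z Z' by (rule OmC_T01[OF x that])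
  show "Z = 0" if "Z \<in> T10 x" "\<And>W. W \<in> T01 x \<Longrightarrow> cctr W (cctr Z (OmC \<theta> x)) = 0" for Z
    by (rule Levi_nondegenerate[OF that])
  show "W = 0" if W: "W \<in> T01 x" "\<And>Z. Z \<in> T10 x \<Longrightarrow> cctr Z (cctr W (OmC \<theta> x)) = 0" for W
  proof -
    have real: "cmap cnj (OmC \<theta> x) = OmC \<theta> x" by (rule mform_eqI) (simp add: OmC_def)
    have "vec_cnj W = 0"
    proof (rule Levi_nondegenerate[OF cnj_T01[OF W(1)]])
      fix V assume V: "V \<in> T01 x"
      have "cctr V (cctr (vec_cnj W) (OmC \<theta> x)) = cctr (vec_cnj (vec_cnj V)) (cctr (vec_cnj W) (cmap cnj (OmC \<theta> x)))"
        by (simp add: real)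
      also have "\<dots> = cmap cnj (cctr (vec_cnj V) (cctr W (OmC \<theta> x)))"
        by (simp only: cctr_cmap_cnj[OF alt_OmC[OF x]] cctr_cmap_cnj[OF alt_cctr[OF alt_OmC[OF x]]])
      finally show "cctr V (cctr (vec_cnj W) (OmC \<theta> x)) = 0"
        using W(2)[OF cnj_T01[OF V]] by (simp add: cmap_0 bounded_linear.linear[OF bounded_linear_cnj])
    qed
    then have "vec_cnj (vec_cnj W) = 0" by simp
    then show "W = 0" by simp
  qed
qed

end

lemma sfield_reebf: "sfield U (reebf \<theta>)"
  unfolding sfield_def
proof
  fix c assume c: "c \<in> charts"
  let ?S = "snd c ` (fst c \<inter> U)"
  let ?T = "\<lambda>y. tangent_change (chart_at (chart_inv c y)) c (chart_inv c y) (reebf \<theta> (chart_inv c y))"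
  have S: "open ?S" by (rule open_chart_image[OF c contact_open])
  have "smooth_on (\<lambda>y. ?T y $ i) ?S" for i
  proof (rule smooth_on_linear_solve[OF S])
    show "smooth_on (\<lambda>y. reebm \<theta> c y $ i $ j) ?S" for i j
      unfolding reebm_def vec_lambda_beta
      by (intro smooth_on_add[OF S] smooth_on_mult[OF S] sform_smooth smf_sform[OF smf_dcontact c] smf_sform[OF smf_contact c])
    show "smooth_on (\<lambda>y. (\<chi> i. app (lform c (\<lambda>x. mf (\<theta> x)) y) [axis i 1]) $ i) ?S" for i
      unfolding vec_lambda_beta by (intro sform_smooth smf_sform[OF smf_contact c])
    fix y assume "y \<in> ?S"
    then obtain x where x: "x \<in> fst c" "x \<in> U" "y = snd c x" by blast
    show "det (reebm \<theta> c y) \<noteq> 0" unfolding x(3) by (rule reebm_det[OF x(2) c x(1)])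
    show "reebm \<theta> c y *v ?T y = (\<chi> i. app (lform c (\<lambda>x. mf (\<theta> x)) y) [axis i 1])"
      using reebm_reeb[OF x(2) c x(1) reebf[OF x(2)]] c x by simp
  qed
  then show "smooth_on ?T ?S" by (rule smooth_on_vec[OF S])
qed

abbreviation (input) Pm :: "'a \<Rightarrow> real^'m \<Rightarrow> complex^'m" where
  "Pm x \<equiv> cr_point.P (T10 x) (T01 x) (vec_of_real (reebf \<theta> x))"

text \<open>The projection depends on the point. With the Reeb field as transversal field, the
  T01-component supplied by \<open>frame_coefficients\<close> is this projection in coordinates, and
  its smoothness passes to the counting operator.\<close>

lemma smf_nop:
  assumes \<omega>: "smf V k \<omega>" and V: "open V" "V \<subseteq> U"
  shows "smf V k (\<lambda>x. nop (Pm x) (\<omega> x))"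
proof (rule smfI_local[OF V(1)])
  fix x assume x: "x \<in> V"
  then have xU: "x \<in> U" using V by blast
  show "alt k (nop (Pm x) (\<omega> x))"
    by (intro alt_nop cr_point.P_linear[OF cr_point_contact[OF xU]] smf_alt[OF \<omega> x])
  let ?c = "chart_at x"
  define T where "T y = tangent_change (chart_at (chart_inv ?c y)) ?c (chart_inv ?c y) (reebf \<theta> (chart_inv ?c y))" for y
  have Ts: "smooth_on T (snd ?c ` (fst ?c \<inter> V))"
    using sfield_subset[OF sfield_reebf V(2)] chart_at(1)[of x] unfolding sfield_def T_def by blast
  have Tr: "tangent_change ?c (chart_at y) y (T (snd ?c y)) = reebf \<theta> y" if "y \<in> fst ?c" for y
    using that chart_at(1)[of x] by (simp add: tc_chart T_def)
  have tr: "vec_of_real (tangent_change ?c (chart_at x) x (T (snd ?c x))) \<notin> HC x"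
    unfolding Tr[OF chart_at(2)] by (rule reebf_not_HC[OF xU])
  obtain N where N: "open N" "x \<in> N" "N \<subseteq> V" "N \<subseteq> fst ?c"
    and ap: "\<And>v. \<exists>a p. smooth_splitting ?c T N v a p"
    by (rule frame_coefficients[of V x ?c T, OF V(1) x chart_at(1)[of x] chart_at(2)[of x] Ts tr]) (rule that)
  from ap have "\<forall>v. \<exists>a p. smooth_splitting ?c T N (vec_of_real v) a p" by blast
  from choice[OF this] obtain a where "\<forall>v. \<exists>p. smooth_splitting ?c T N (vec_of_real v) (a v) p" by blast
  from choice[OF this] obtain p where ap: "\<And>v. smooth_splitting ?c T N (vec_of_real v) (a v) (p v)" by blast
  have p: "smooth_on (\<lambda>y. vec_Re (p v y)) (snd ?c ` N)" "smooth_on (\<lambda>y. vec_Im (p v y)) (snd ?c ` N)" for v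
    using ap[of v] by (simp_all add: smooth_splitting_def)
  have P: "Pm y (tangent_change ?c (chart_at y) y v) = ce (tangent_change ?c (chart_at y) y) (p v (snd ?c y))"
    if y: "y \<in> N" for y v
  proof -
    have yU: "y \<in> U" "y \<in> fst ?c" using y N V by auto
    interpret cr: cr_point n "T10 y" "T01 y" "vec_of_real (reebf \<theta> y)" "thC \<theta> y" "OmC \<theta> y"
      by (rule cr_point_contact[OF yU(1)])
    let ?A = "tangent_change ?c (chart_at y) y"
    obtain Z where Z: "ce ?A (p v (snd ?c y)) \<in> T01 y" "Z \<in> T10 y"
      "ce ?A (vec_of_real v) = a v (snd ?c y) *s vec_of_real (reebf \<theta> y) + Z + ce ?A (p v (snd ?c y))"
      using ap[of v, unfolded smooth_splitting_def Let_def] y Tr[OF yU(2)] by metis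
    have "cr.PF (ce ?A (vec_of_real v)) = ce ?A (p v (snd ?c y))"
      unfolding Z(3) by (rule cr.PF_eq[OF Z(2,1)])
    then show ?thesis
      unfolding cr.P_def by (simp add: ce_of_real[OF tc_chart(2)[OF chart_at(1) yU(2)]])
  qed
  have eq: "snd ?c ` (fst ?c \<inter> N) = snd ?c ` N" using N by blast
  have op: "open (snd ?c ` N)" unfolding eq[symmetric] by (rule open_chart_image[OF chart_at(1) N(1)])
  have "sform (snd ?c ` N) (\<lambda>y. nop (\<lambda>v. p v y) (lform ?c \<omega> y))"
  proof (rule sform_nop[OF op _ _ p(1,2)])
    show "sform (snd ?c ` N) (lform ?c \<omega>)"
      unfolding eq[symmetric] by (rule smf_sform[OF smf_subset[OF \<omega> N(3)] chart_at(1)])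
    show "alt k (lform ?c \<omega> y)" if "y \<in> snd ?c ` N" for y
      using that unfolding eq[symmetric] by (rule alt_lform[OF smf_subset[OF \<omega> N(3)] chart_at(1)])
  qed
  moreover have "lform ?c (\<lambda>x. nop (Pm x) (\<omega> x)) y = nop (\<lambda>v. p v y) (lform ?c \<omega> y)" if "y \<in> snd ?c ` N" for y
  proof -
    obtain z where z: "z \<in> N" "y = snd ?c z" using \<open>y \<in> snd ?c ` N\<close> by blast
    have zc: "z \<in> fst ?c" using z N by blast
    show ?thesis
      unfolding z(2) lform_snd[OF chart_at(1)[of x] zc]
      by (rule pb_nop) (rule P[OF z(1)])
  qed
  ultimately have "sform (snd ?c ` N) (lform ?c (\<lambda>x. nop (Pm x) (\<omega> x)))"
    by (subst sform_cong[OF op])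
  then show "\<exists>c N. c \<in> charts \<and> x \<in> fst c \<and> open N \<and> snd c x \<in> N \<and> sform N (lform c (\<lambda>x. nop (Pm x) (\<omega> x)))"
    using chart_at[of x] op N(2) by (intro exI[of _ ?c] exI[of _ "snd ?c ` N"]) auto
qed

end

end

section \<open>Weight decomposition and the effect of the differential on the filtration\<close>

lemma kills_if_degree_less: "alt k f \<Longrightarrow> k < int a \<Longrightarrow> kills S a f"
proof (induction a arbitrary: k f)
  case 0
  then show ?case using alt_neg by simp
next
  case (Suc a)
  have "kills S a (cctr W f)" for W using Suc.IH[OF alt_cctr[OF Suc.prems(1)]] Suc.prems(2) by simp
  then show ?case by simp
qed

lemma kills_ctr: "alt k f \<Longrightarrow> kills S a f \<Longrightarrow> kills S a (ctr v f)"
  using kills_cctr[of k f S a "vec_of_real v"] by (simp add: cctr_of_real)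

text \<open>With the inclusion of real vectors in place of the projection, every argument is
  counted.\<close>

lemma nop_vec_of_real: "alt k f \<Longrightarrow> nop vec_of_real f = sc (of_int k) * f"
proof (rule mform_eqI)
  fix vs show "alt k f \<Longrightarrow> app (nop vec_of_real f) vs = app (sc (of_int k) * f) vs"
  proof (induction vs arbitrary: k f)
    case Nil
    then show ?case using alt_Nil[of k f] by (cases "k = 0") simp_all
  next
    case (Cons v vs)
    have "app (nop vec_of_real f) (v # vs) = app (ctr v (nop vec_of_real f)) vs" by simp
    also have "\<dots> = app (ctr v f) vs + app (nop vec_of_real (ctr v f)) vs"
      by (simp only: ctr_nop cctr_of_real[OF Cons.prems] app_add)
    finally show ?case using Cons.IH[OF alt_ctr[OF Cons.prems], of v] by (simp add: algebra_simps)
  qed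
qed

context CR_manifold
begin

context
  fixes U :: "'a set" and \<theta> :: "('a, real^'m, real) form"
  assumes contact: "contact_form U \<theta>"
begin

text \<open>Subtracting \<open>a\<close> times \<omega> from the counting operator lands in the next
  smaller filtration step, where the decomposition exists by induction. Only the counting operator
  and constant scalars are used, so smoothness is preserved.\<close>

lemma eigen_decomposition:
  assumes V: "open V" "V \<subseteq> U"
  shows "smf V k \<omega> \<Longrightarrow> (\<And>x. x \<in> V \<Longrightarrow> kills (T01 x) a (\<omega> x)) \<Longrightarrow>
    \<exists>f. (\<forall>j. smf V k (f j)) \<and> (\<forall>x\<in>V. \<omega> x = (\<Sum>j<a. f j x) \<and>
      (\<forall>j<a. nop (Pm \<theta> x) (f j x) = sc (of_nat j) * f j x))"
proof (induction a arbitrary: \<omega>)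
  case 0
  then show ?case using smf_0[OF V(1)] by (intro exI[of _ "\<lambda>j x. 0"]) simp
next
  case (Suc a)
  define g where "g x = nop (Pm \<theta> x) (\<omega> x) - sc (of_nat a) * \<omega> x" for x
  have g: "smf V k g"
    unfolding g_def by (intro smf_diff[OF V(1)] smf_nop[OF contact Suc.prems(1) V] smf_sc_mult[OF V(1)] Suc.prems(1))
  have "kills (T01 x) a (g x)" if x: "x \<in> V" for x
    unfolding g_def
    by (rule cr_point.kills_nop[OF cr_point_contact[OF contact subsetD[OF V(2) x]] smf_alt[OF Suc.prems(1) x] Suc.prems(2)[OF x]])
  from Suc.IH[OF g this] obtain h where h: "\<And>j. smf V k (h j)"
      "\<And>x. x \<in> V \<Longrightarrow> g x = (\<Sum>j<a. h j x)"
      "\<And>x j. x \<in> V \<Longrightarrow> j < a \<Longrightarrow> nop (Pm \<theta> x) (h j x) = sc (of_nat j) * h j x" by blast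
  \<comment> \<open>The component of weight \<open>j\<close> in \<open>g\<close> is that of \<omega>
    multiplied by \<open>j - a\<close>; dividing recovers it. What is left of \<omega> has weight
    \<open>a\<close>.\<close>
  define l where "l j x = sc (inverse (of_nat j - of_nat a)) * h j x" for j x
  define f where "f j = (if j < a then l j else (\<lambda>x. \<omega> x - (\<Sum>j<a. l j x)))" for j
  have l: "smf V k (l j)" for j unfolding l_def by (intro smf_sc_mult[OF V(1)] h(1))
  have f: "smf V k (f j)" for j
    unfolding f_def by (simp add: l smf_diff[OF V(1) Suc.prems(1) smf_sum[OF V(1) l]])
  have nl: "nop (Pm \<theta> x) (l j x) = sc (of_nat j) * l j x" if "x \<in> V" "j < a" for x j
    by (simp only: l_def nop_sc_mult h(3)[OF that] sc_left_commute[of "sc (inverse _)"] sc_mult_mult mult.commute)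
  have hl: "h j x = sc (of_nat j - of_nat a) * l j x" if "j < a" for x j
    using that by (simp add: l_def sc_mult_mult)
  have nf: "nop (Pm \<theta> x) (f a x) = sc (of_nat a) * f a x" if x: "x \<in> V" for x
  proof -
    have "nop (Pm \<theta> x) (\<omega> x) = sc (of_nat a) * \<omega> x + (\<Sum>j<a. sc (of_nat j - of_nat a) * l j x)"
      using h(2)[OF x] hl by (simp add: g_def algebra_simps)
    then show ?thesis
      by (simp add: f_def nop_sum nl[OF x] sc_diff left_diff_distrib right_diff_distrib sum_subtractf sum_distrib_left)
  qed
  have "\<omega> x = (\<Sum>j<Suc a. f j x) \<and> (\<forall>j<Suc a. nop (Pm \<theta> x) (f j x) = sc (of_nat j) * f j x)" if x: "x \<in> V" for x
    using nf[OF x] nl[OF x] by (auto simp: f_def less_Suc_eq)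
  then show ?case using f by blast
qed

end

text \<open>The difference of the Euler formulas for the inclusion and for the projection onto T01;
  the factor counts the arguments outside T01.\<close>

lemma lam_split:
  assumes contact: "contact_form U \<theta>" and x: "x \<in> U" and c: "c \<in> charts" "x \<in> fst c"
    and f: "alt k f" "nop (Pm \<theta> x) f = sc (of_nat j) * f"
  shows "sc (of_int k - of_nat j) * f = (\<Sum>i\<in>UNIV. (lam c i x - nop (Pm \<theta> x) (lam c i x)) * ctr (frm c i x) f)"
proof -
  have l: "alt 1 (lam c i x :: 'm cform)" for i by (rule alt_lam[OF c])
  have dual: "ctr v g = (\<Sum>i\<in>UNIV. sc (app (lam c i x) [v]) * ctr (frm c i x) g)" if "alt k g" for k v and g :: "'m cform"
    by (rule frm_dual[OF c that])
  have e: "(\<Sum>i\<in>UNIV. nop P (lam c i x) * ctr (frm c i x) f) = nop P f" for P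
    by (rule euler_nop[of "\<lambda>i. lam c i x" "\<lambda>i. frm c i x", OF l dual f(1)])
  have "(\<Sum>i\<in>UNIV. lam c i x * ctr (frm c i x) f) = sc (of_int k) * f"
    using e[of vec_of_real] by (simp add: nop_vec_of_real[OF l] nop_vec_of_real[OF f(1)])
  then show ?thesis
    using e[of "Pm \<theta> x"] f(2) by (simp add: left_diff_distrib sum_subtractf sc_diff)
qed

text \<open>The forms \<open>\<nu>\<^sub>i = \<lambda>\<^sub>i - \<lambda>\<^sub>i \<circ> P\<close> annihilate \<open>T01\<close>, and a form of weight \<open>j\<close> less than its degree is a
  combination of products of the \<open>\<nu>\<^sub>i\<close> with forms of smaller degree.\<close>

lemma dm_kills:
  fixes \<omega> :: "'a \<Rightarrow> 'm cform"
  shows "open U \<Longrightarrow> smf U (int k) \<omega> \<Longrightarrow> (\<And>x. x \<in> U \<Longrightarrow> kills (T01 x) a (\<omega> x)) \<Longrightarrow> x \<in> U \<Longrightarrow>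
    kills (T01 x) (Suc a) (dm \<omega> x)"
proof (induction k arbitrary: U \<omega> a x rule: less_induct)
  case (less k)
  obtain U0 \<theta> where contact: "contact_form U0 \<theta>" and x0: "x \<in> U0" using contact_form_exists[of x] by blast
  let ?c = "chart_at x"
  note c = chart_at(1)[of x]
  define V where "V = U \<inter> U0 \<inter> fst ?c"
  have V: "open V" "x \<in> V" "V \<subseteq> U" "V \<subseteq> U0" "V \<subseteq> fst ?c"
    unfolding V_def using less.prems contact_open[OF contact] chart_open(1)[OF c] x0 chart_at(2) by auto
  have \<omega>V: "smf V (int k) \<omega>" by (rule smf_subset[OF less.prems(2) V(3)])
  have "kills (T01 y) a (\<omega> y)" if "y \<in> V" for y using less.prems(3) V(3) that by blast
  from eigen_decomposition[OF contact V(1,4) \<omega>V this]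
  obtain f where f: "\<And>j. smf V (int k) (f j)" "\<And>y. y \<in> V \<Longrightarrow> \<omega> y = (\<Sum>j<a. f j y)"
    "\<And>y j. y \<in> V \<Longrightarrow> j < a \<Longrightarrow> nop (Pm \<theta> y) (f j y) = sc (of_nat j) * f j y" by blast
  have main: "kills (T01 x) (Suc a) (dm (f j) x)" if j: "j < a" for j
  proof (cases "j < k")
    case False
    \<comment> \<open>Here \<open>k \<le> j < a\<close>, so the differential has degree below
      \<open>Suc a\<close> and the claim holds by degree alone.\<close>
    have "alt (int k + 1) (dm (f j) x)" by (rule smf_alt[OF smf_dm[OF V(1) f(1)] V(2)])
    then show ?thesis by (rule kills_if_degree_less) (use False j in simp)
  next
    case True
    define \<nu> where "\<nu> i y = (lam ?c i y - nop (Pm \<theta> y) (lam ?c i y) :: 'm cform)" for i y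
    define g where "g i y = ctr (frm ?c i y) (f j y)" for i y
    have l: "smf V 1 (lam ?c i :: 'a \<Rightarrow> 'm cform)" for i by (rule smf_lam[OF c V(1,5)])
    have \<nu>: "smf V 1 (\<nu> i)" for i
      unfolding \<nu>_def by (intro smf_diff[OF V(1)] l smf_nop[OF contact l V(1,4)])
    have \<nu>k: "kills (T01 y) 1 (\<nu> i y)" if y: "y \<in> V" for i y
    proof -
      have al: "alt 1 (lam ?c i y :: 'm cform)" by (rule smf_alt[OF l y])
      have "y \<in> U0" using y V(4) by blast
      from cr_point.kills_nop[OF cr_point_contact[OF contact this] al kills_if_degree_less[OF al], of 1]
      have "kills (T01 y) 1 (- (nop (Pm \<theta> y) (lam ?c i y) - lam ?c i y))" by (intro kills_uminus) simp
      then show ?thesis by (simp add: \<nu>_def)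
    qed
    have g: "smf V (int (k - 1)) (g i)" for i
      using smf_ctr_frm[OF c V(1,5) f(1), of i j] True unfolding g_def by (simp add: of_nat_diff)
    have fk: "kills (T01 y) (Suc j) (f j y)" if y: "y \<in> V" for y
    proof (rule cr_point.nop_eigen_kills[OF cr_point_contact[OF contact]])
      show "y \<in> U0" using y V(4) by blast
    qed (rule smf_alt[OF f(1) y] f(3)[OF y j])+
    have gk: "kills (T01 y) (Suc j) (g i y)" if y: "y \<in> V" for i y
      unfolding g_def by (rule kills_ctr[OF smf_alt[OF f(1) y] fk[OF y]])
    have dg: "kills (T01 x) (Suc (Suc j)) (dm (g i) x)" for i
      by (rule less.IH[OF _ V(1) g gk V(2)]) (use True in simp)
    \<comment> \<open>The only place in this induction where integrability enters.\<close>
    have d\<nu>: "kills (T01 x) (Suc 1) (dm (\<nu> i) x)" for i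
      using T01_closed[OF V(1,2) \<nu>] \<nu>k by simp
    have "kills (T01 x) (Suc (Suc j)) (dm (\<lambda>y. \<nu> i y * g i y) x)" for i
    proof -
      have "kills (T01 x) (Suc (1 + j)) (dm (\<nu> i) x * g i x)" by (rule kills_mult[OF d\<nu> gk[OF V(2)]])
      moreover have "kills (T01 x) (Suc (0 + Suc j)) (ginv (\<nu> i x) * dm (g i) x)"
        by (rule kills_mult[OF _ dg]) (use kills_ginv[OF \<nu>k[OF V(2)]] in simp)
      ultimately show ?thesis by (simp add: dm_mult[OF V(1,2) \<nu> g] kills_add del: kills.simps)
    qed
    then have "kills (T01 x) (Suc (Suc j)) (\<Sum>i\<in>UNIV. dm (\<lambda>y. \<nu> i y * g i y) x)" by (rule kills_sum)
    also have "(\<Sum>i\<in>UNIV. dm (\<lambda>y. \<nu> i y * g i y) x) = dm (\<lambda>y. \<Sum>i\<in>UNIV. \<nu> i y * g i y) x"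
      by (rule dm_sum[OF V(1,2) smf_mult[OF V(1) \<nu> g], symmetric])
    also have "\<dots> = dm (\<lambda>y. sc (of_int (int k) - of_nat j) * f j y) x"
    proof (rule dm_cong[OF V(1,2)])
      fix y assume y: "y \<in> V"
      then have y': "y \<in> U0" "y \<in> fst ?c" using V by auto
      show "(\<Sum>i\<in>UNIV. \<nu> i y * g i y) = sc (of_int (int k) - of_nat j) * f j y"
        unfolding \<nu>_def g_def by (rule lam_split[OF contact y'(1) c y'(2) smf_alt[OF f(1) y] f(3)[OF y j], symmetric])
    qed
    also have "\<dots> = sc (of_int (int k) - of_nat j) * dm (f j) x" by (rule dm_sc_mult[OF V(1,2) f(1)])
    finally have "kills (T01 x) (Suc (Suc j)) (sc (inverse (of_int (int k) - of_nat j)) * (sc (of_int (int k) - of_nat j) * dm (f j) x))"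
      by (rule kills_sc_mult)
    then have "kills (T01 x) (Suc (Suc j)) (dm (f j) x)"
      \<comment> \<open>The factor \<open>k - j\<close> is nonzero because \<open>j < k\<close>, so
        it can be cancelled.\<close>
      using True by (simp add: sc_mult_mult del: kills.simps)
    then show ?thesis by (rule kills_mono) (use j in simp)
  qed
  have "dm \<omega> x = dm (\<lambda>y. \<Sum>j<a. f j y) x" by (rule dm_cong[OF V(1,2) f(2)])
  also have "\<dots> = (\<Sum>j<a. dm (f j) x)" by (rule dm_sum[OF V(1,2) f(1)])
  finally show ?case using kills_sum[of "{..<a}", OF main] by (simp del: kills.simps)
qed

end

section \<open>Change of contact form, smooth primitives and the operator \<Gamma>\<close>

text \<open>Rescaling a contact form changes its differential by a multiple of \<theta> besides the
  scalar factor; the leading \<theta> kills that multiple.\<close>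

lemma th_Om_power_change:
  fixes th Om \<mu> :: "'m::finite cform"
  assumes th: "alt 1 th" and Om': "Om' = sc c * Om + \<mu> * th"
  shows "th * f * Om' ^ m = sc (c ^ m) * (th * f * Om ^ m)"
proof (induction m)
  case (Suc m)
  have z: "th * y * (\<mu> * th) = 0" for y
    using arg_cong[OF one_form_commute[OF th, of "y * \<mu>"], of "\<lambda>f. f * th"]
    by (simp only: mult.assoc one_form_square[OF th] mult_zero_right)
  have "th * y * Om' = sc c * (th * y * Om)" for y
    by (simp add: Om' distrib_left z) (simp only: mult.assoc sc_left_commute[of y] sc_left_commute[of th])
  from this[of "f * Om' ^ m"] have "th * f * Om' ^ Suc m = sc c * (th * f * Om' ^ m * Om)"
    by (simp only: power_Suc2 mult.assoc)
  also have "th * f * Om' ^ m * Om = sc (c ^ m) * (th * f * Om ^ Suc m)"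
    unfolding Suc by (simp only: power_Suc2 mult.assoc)
  finally show ?case by (simp only: sc_mult_mult power_Suc)
qed simp

lemma gam_rel_change:
  fixes th Om \<mu> :: "'m::finite cform"
  assumes th: "alt 1 th" and c: "c \<noteq> 0" "th' = sc c * th" "Om' = sc c * Om + \<mu> * th"
    and g: "gam_rel n th Om k f g"
  shows "gam_rel n th' Om' k f g"
proof -
  let ?s = "n + 1 - k" and ?t = "k - (n + 1)"
  obtain \<xi> where \<xi>: "alt (int n - int ?s - int ?t - 1) \<xi>"
      "th * f * Om ^ ?s = th * \<xi> * Om ^ (?s + ?t + 1)" "g = th * \<xi> * Om ^ ?t"
    using g unfolding gam_rel_def by blast
  \<comment> \<open>The scaling is dictated by the formula for \<open>g\<close>, whose new factors
    contribute \<open>c ^ (?t + 1)\<close>. The first equation then balances, since both sides carry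
    \<open>c ^ (?s + 1)\<close>.\<close>
  let ?\<xi> = "sc (inverse c ^ (?t + 1)) * \<xi>"
  have E: "th' * h * Om' ^ m = sc (c ^ Suc m) * (th * h * Om ^ m)" for h m
    unfolding c(2) by (simp only: mult.assoc[of "sc c"] th_Om_power_change[OF th c(3)] sc_mult_mult power_Suc)
  have F: "th * ?\<xi> * Om ^ m = sc (inverse c ^ (?t + 1)) * (th * \<xi> * Om ^ m)" for m
    by (simp only: mult.assoc sc_left_commute[of th])
  have s1: "c ^ Suc (s + t + 1) * inverse c ^ (t + 1) = c ^ Suc s"
    and s2: "c ^ Suc t * inverse c ^ (t + 1) = 1" for s t
    using c(1) by (simp_all add: power_add power_inverse field_simps)
  have "th' * f * Om' ^ ?s = th' * ?\<xi> * Om' ^ (?s + ?t + 1)"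
    unfolding E F \<xi>(2) sc_mult_mult s1 ..
  moreover have "g = th' * ?\<xi> * Om' ^ ?t"
    unfolding E F \<xi>(3) sc_mult_mult s2 by simp
  ultimately show ?thesis
    unfolding gam_rel_def using alt_sc_mult[OF \<xi>(1)] by blast
qed

lemma gam_rel_add: "gam_rel n th Om k f g \<Longrightarrow> gam_rel n th Om k f' g' \<Longrightarrow> gam_rel n th Om k (f + f') (g + g')"
  for th :: "'m::finite cform"
proof -
  assume "gam_rel n th Om k f g" "gam_rel n th Om k f' g'"
  then obtain \<xi> \<xi>' where \<xi>: "alt (int n - int (n + 1 - k) - int (k - (n + 1)) - 1) \<xi>"
     "th * f * Om ^ (n + 1 - k) = th * \<xi> * Om ^ (n + 1 - k + (k - (n + 1)) + 1)"
     "g = th * \<xi> * Om ^ (k - (n + 1))"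
     "alt (int n - int (n + 1 - k) - int (k - (n + 1)) - 1) \<xi>'"
     "th * f' * Om ^ (n + 1 - k) = th * \<xi>' * Om ^ (n + 1 - k + (k - (n + 1)) + 1)"
     "g' = th * \<xi>' * Om ^ (k - (n + 1))"
    unfolding gam_rel_def by blast
  then show ?thesis
    unfolding gam_rel_def by (intro exI[of _ "\<xi> + \<xi>'"] conjI alt_add) (simp_all only: distrib_left distrib_right)
qed

lemma gam_rel_sc: "gam_rel n th Om k f g \<Longrightarrow> gam_rel n th Om k (sc c * f) (sc c * g)"
  for th :: "'m::finite cform"
proof -
  assume "gam_rel n th Om k f g"
  then obtain \<xi> where \<xi>: "alt (int n - int (n + 1 - k) - int (k - (n + 1)) - 1) \<xi>"
     "th * f * Om ^ (n + 1 - k) = th * \<xi> * Om ^ (n + 1 - k + (k - (n + 1)) + 1)"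
     "g = th * \<xi> * Om ^ (k - (n + 1))"
    unfolding gam_rel_def by blast
  then show ?thesis
    unfolding gam_rel_def
    by (intro exI[of _ "sc c * \<xi>"] conjI alt_sc_mult) (simp_all only: sc_left_commute[of th] mult.assoc)
qed

context CR_manifold
begin

lemma contact_form_subset: "contact_form U \<theta> \<Longrightarrow> open V \<Longrightarrow> V \<subseteq> U \<Longrightarrow> contact_form V \<theta>"
  unfolding contact_form_def forms_on_iff using smf_subset by blast

lemma smf_from_chart:
  assumes c: "c \<in> charts" and V: "open V" "V \<subseteq> fst c"
    and \<beta>: "sform (snd c ` (fst c \<inter> V)) \<beta>" "\<And>y. y \<in> snd c ` (fst c \<inter> V) \<Longrightarrow> alt k (\<beta> y)"
  shows "\<exists>\<psi>. smf V k \<psi> \<and> (\<forall>x\<in>V. lform c \<psi> (snd c x) = \<beta> (snd c x))"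
proof -
  define \<psi> where "\<psi> x = pb (tangent_change (chart_at x) c x) (\<beta> (snd c x))" for x
  have l: "lform c \<psi> (snd c x) = \<beta> (snd c x)" if "x \<in> V" for x
    using that V(2) unfolding \<psi>_def
    by (subst lform_snd[OF c]) (auto simp: pb_pb tc_chart[OF c] pb_ident)
  have "alt k (\<psi> x)" if "x \<in> V" for x
    unfolding \<psi>_def using that V(2) by (intro alt_pb tc_chart(1)[OF c] \<beta>(2)) auto
  from smf_chart[OF c V this \<beta>(1) l] l show ?thesis by blast
qed

context
  fixes U :: "'a set" and \<theta> :: "('a, real^'m, real) form"
  assumes contact: "contact_form U \<theta>"
begin

lemma ctr_reebf_thC: "x \<in> U \<Longrightarrow> ctr (reebf \<theta> x) (thC \<theta> x) = 1"
  using cr_point.thT[OF cr_point_contact[OF contact]] by (simp add: cctr_of_real[OF alt_thC[OF contact]])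

text \<open>Besides the Lefschetz equation the primitive is required to have no Reeb component. This
  makes it unique and allows the charts to be glued.\<close>

lemma primitive_in_chart:
  assumes c: "c \<in> charts" and V: "open V" "V \<subseteq> U" "V \<subseteq> fst c"
    and \<gamma>: "smf V (int n + int r) \<gamma>" and d: "d + r = n"
  shows "\<exists>\<xi>. smf V (int d) \<xi> \<and> (\<forall>x\<in>V. ctr (reebf \<theta> x) (\<xi> x) = 0 \<and>
    thC \<theta> x * \<gamma> x = thC \<theta> x * \<xi> x * OmC \<theta> x ^ r)"
proof -
  let ?S = "snd c ` (fst c \<inter> V)"
  let ?T = "\<lambda>y. tangent_change (chart_at (chart_inv c y)) c (chart_inv c y) (reebf \<theta> (chart_inv c y))"
  have th: "smf V 1 (thC \<theta>)" and Om: "smf V 2 (OmC \<theta>)"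
    using smf_thC[OF contact] smf_OmC[OF contact] V(2) by (auto intro: smf_subset)
  have T: "sfield V (reebf \<theta>)" using sfield_reebf[OF contact] V(2) by (rule sfield_subset)
  have ctr1: "ctr (?T y) (lform c (thC \<theta>) y) = 1" if y: "y \<in> ?S" for y
  proof -
    obtain x where x: "x \<in> V" "y = snd c x" using y by blast
    have xc: "x \<in> fst c" "x \<in> U" using x V by auto
    show ?thesis
      unfolding x(2) lform_snd[OF c xc(1)]
      by (simp add: ctr_pb tc_chart[OF c] xc chart_inv_snd[OF c] ctr_reebf_thC)
  qed
  have nz: "lform c (thC \<theta>) y * lform c (OmC \<theta>) y ^ n \<noteq> 0" if y: "y \<in> ?S" for y
  proof
    obtain x where x: "x \<in> V" "y = snd c x" using y by blast
    have xc: "x \<in> fst c" "x \<in> U" using x V by auto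
    assume "lform c (thC \<theta>) y * lform c (OmC \<theta>) y ^ n = 0"
    then have "lform c (\<lambda>x. thC \<theta> x * OmC \<theta> x ^ n) (snd c x) = 0" by (simp add: lform_mult lform_power x)
    from arg_cong[OF this, of "pb (tangent_change (chart_at x) c x)"]
    have "thC \<theta> x * OmC \<theta> x ^ n = 0" by (simp add: pb_lform[OF c xc(1)])
    then show False using cr_point.th_Om_power_nonzero[OF cr_point_contact[OF contact xc(2)] order.refl] by blast
  qed
  have "\<exists>\<beta>. sform ?S \<beta> \<and> (\<forall>y\<in>?S. alt (int d) (\<beta> y) \<and>
      lform c (thC \<theta>) y * lform c \<gamma> y = lform c (thC \<theta>) y * \<beta> y * lform c (OmC \<theta>) y ^ r)"
    using T unfolding sfield_def
    by (intro lefschetz_surjective_smooth[OF open_chart_image[OF c V(1)] dimension smf_sform[OF th c] alt_lform[OF th c]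
          smf_sform[OF Om c] alt_lform[OF Om c] _ ctr1 nz smf_sform[OF \<gamma> c] alt_lform[OF \<gamma> c] d])
      (auto simp: c)
  then obtain \<beta> where \<beta>: "sform ?S \<beta>" "\<And>y. y \<in> ?S \<Longrightarrow> alt (int d) (\<beta> y)"
      "\<And>y. y \<in> ?S \<Longrightarrow> lform c (thC \<theta>) y * lform c \<gamma> y = lform c (thC \<theta>) y * \<beta> y * lform c (OmC \<theta>) y ^ r"
    by blast
  obtain \<psi> where \<psi>: "smf V (int d) \<psi>" "\<And>x. x \<in> V \<Longrightarrow> lform c \<psi> (snd c x) = \<beta> (snd c x)"
    using smf_from_chart[OF c V(1,3) \<beta>(1,2)] by blast
  \<comment> \<open>Removing the multiple of \<theta> does not affect the equation, in which
    \<theta> is a factor.\<close>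
  define \<xi> where "\<xi> x = \<psi> x - thC \<theta> x * ctr (reebf \<theta> x) (\<psi> x)" for x
  have "smf V (int d) \<xi>"
    using smf_diff[OF V(1) \<psi>(1), of "\<lambda>x. thC \<theta> x * ctr (reebf \<theta> x) (\<psi> x)"]
      smf_mult[OF V(1) th smf_ctr[OF V(1) T \<psi>(1)]] by (simp add: \<xi>_def[abs_def])
  moreover have "ctr (reebf \<theta> x) (\<xi> x) = 0 \<and> thC \<theta> x * \<gamma> x = thC \<theta> x * \<xi> x * OmC \<theta> x ^ r" if x: "x \<in> V" for x
  proof
    have xc: "x \<in> fst c" "x \<in> U" using x V by auto
    show "ctr (reebf \<theta> x) (\<xi> x) = 0"
      by (simp add: \<xi>_def ctr_mult ctr_reebf_thC[OF xc(2)] alt_ctr_self[OF smf_alt[OF \<psi>(1) x]])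
    have "snd c x \<in> ?S" using x xc by blast
    from \<beta>(3)[OF this] have "lform c (\<lambda>x. thC \<theta> x * \<gamma> x) (snd c x) = lform c (\<lambda>x. thC \<theta> x * \<psi> x * OmC \<theta> x ^ r) (snd c x)"
      by (simp add: lform_mult lform_power \<psi>(2)[OF x])
    from arg_cong[OF this, of "pb (tangent_change (chart_at x) c x)"]
    have "thC \<theta> x * \<gamma> x = thC \<theta> x * \<psi> x * OmC \<theta> x ^ r" by (simp only: pb_lform[OF c xc(1)])
    also have "thC \<theta> x * \<psi> x = thC \<theta> x * \<xi> x"
      by (simp add: \<xi>_def right_diff_distrib mult.assoc[symmetric] one_form_square[OF alt_thC[OF contact xc(2)]])
    finally show "thC \<theta> x * \<gamma> x = thC \<theta> x * \<xi> x * OmC \<theta> x ^ r" .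
  qed
  ultimately show ?thesis by blast
qed

lemma primitive_unique:
  assumes x: "x \<in> U" and d: "d + r = n" and \<xi>: "alt (int d) \<xi>" "alt (int d) \<xi>'"
    "ctr (reebf \<theta> x) \<xi> = 0" "ctr (reebf \<theta> x) \<xi>' = 0"
    "thC \<theta> x * \<xi> * OmC \<theta> x ^ r = thC \<theta> x * \<xi>' * OmC \<theta> x ^ r"
  shows "\<xi> = \<xi>'"
proof -
  have "thC \<theta> x * (\<xi> - \<xi>') * OmC \<theta> x ^ r = 0" using \<xi>(5) by (simp add: right_diff_distrib left_diff_distrib)
  then have z: "thC \<theta> x * (\<xi> - \<xi>') = 0"
    using alt_diff[OF \<xi>(1,2)] d by (intro cr_point.lefschetz_injective[OF cr_point_contact[OF contact x], of r]) auto
  show ?thesis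
    using arg_cong[OF z, of "ctr (reebf \<theta> x)"] \<xi>(3,4) by (simp add: ctr_mult ctr_reebf_thC[OF x])
qed

text \<open>Both cases in the definition of \<Gamma> ask for division of a form of degree n + r by
  the r-th power of d\<theta>, modulo \<theta>, with r = s + t + 1. Local normalized solutions agree
  on overlaps.\<close>

lemma primitive_exists:
  assumes \<omega>: "smf U (int k) \<omega>"
  shows "\<exists>\<xi>. smf U (int n - int (n + 1 - k) - int (k - (n + 1)) - 1) \<xi> \<and>
    (\<forall>x\<in>U. thC \<theta> x * \<omega> x * OmC \<theta> x ^ (n + 1 - k) =
       thC \<theta> x * \<xi> x * OmC \<theta> x ^ (n + 1 - k + (k - (n + 1)) + 1))"
proof -
  let ?s = "n + 1 - k" and ?t = "k - (n + 1)"
  define r where "r = ?s + ?t + 1"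
  note U = contact_open[OF contact]
  define \<gamma> where "\<gamma> x = \<omega> x * OmC \<theta> x ^ ?s" for x
  have deg: "int k + int ?s * 2 = int n + int r" unfolding r_def by (cases "k \<le> n") auto
  have \<gamma>: "smf U (int n + int r) \<gamma>"
    using smf_mult[OF U \<omega> smf_power[OF U smf_OmC[OF contact], of ?s]] unfolding deg \<gamma>_def[abs_def] .
  show ?thesis
  proof (cases "r \<le> n")
    \<comment> \<open>For \<open>r > n\<close> the product with \<theta> exceeds the dimension, and
      the primitive has negative degree.\<close>
    case False
    have "thC \<theta> x * \<gamma> x = 0" if x: "x \<in> U" for x
      by (rule alt_zero_if_degree_gt[OF alt_mult[OF alt_thC[OF contact x] smf_alt[OF \<gamma> x]]])
        (use False dimension in simp)
    then show ?thesis
      using smf_0[OF U] by (intro exI[of _ "\<lambda>x. 0"]) (simp add: \<gamma>_def mult.assoc)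
  next
    case True
    then have d: "(n - r) + r = n" by simp
    define R where "R x f \<longleftrightarrow> alt (int (n - r)) f \<and> ctr (reebf \<theta> x) f = 0 \<and>
      thC \<theta> x * \<gamma> x = thC \<theta> x * f * OmC \<theta> x ^ r" for x f
    define \<xi> where "\<xi> x = (SOME f. R x f)" for x
    have uniq: "f = f'" if "x \<in> U" "R x f" "R x f'" for x f f'
      by (rule primitive_unique[OF that(1) d]) (use that(2,3) in \<open>auto simp: R_def\<close>)
    have loc: "\<exists>V \<eta>. open V \<and> x \<in> V \<and> V \<subseteq> U \<and> smf V (int (n - r)) \<eta> \<and> (\<forall>y\<in>V. R y (\<eta> y))" if x: "x \<in> U" for x
    proof -
      let ?V = "U \<inter> fst (chart_at x)"
      have V: "open ?V" "?V \<subseteq> U" "?V \<subseteq> fst (chart_at x)" "x \<in> ?V"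
        using U chart_open(1)[OF chart_at(1)[of x]] x chart_at(2)[of x] by auto
      from primitive_in_chart[OF chart_at(1)[of x] V(1-3) smf_subset[OF \<gamma> V(2)] d]
      obtain \<eta> where \<eta>: "smf ?V (int (n - r)) \<eta>" "\<And>y. y \<in> ?V \<Longrightarrow> ctr (reebf \<theta> y) (\<eta> y) = 0 \<and>
          thC \<theta> y * \<gamma> y = thC \<theta> y * \<eta> y * OmC \<theta> y ^ r" by blast
      then have "R y (\<eta> y)" if "y \<in> ?V" for y using that smf_alt[OF \<eta>(1)] unfolding R_def by blast
      then show ?thesis using V \<eta>(1) by blast
    qed
    have R: "R x (\<xi> x)" if "x \<in> U" for x
      unfolding \<xi>_def using loc[OF that] by (metis someI_ex)
    have "smf U (int (n - r)) \<xi>"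
    proof (rule smf_local[OF U])
      fix x assume "x \<in> U"
      from loc[OF this] obtain V \<eta> where V: "open V" "x \<in> V" "V \<subseteq> U" "smf V (int (n - r)) \<eta>" "\<forall>y\<in>V. R y (\<eta> y)" by blast
      have eq: "\<xi> y = \<eta> y" if y: "y \<in> V" for y
        by (rule uniq[OF subsetD[OF V(3) y] R[OF subsetD[OF V(3) y]] V(5)[rule_format, OF y]])
      from iffD2[OF smf_cong[OF V(1) eq] V(4)] V(1,2) show "\<exists>V. open V \<and> x \<in> V \<and> smf V (int (n - r)) \<xi>" by blast
    qed
    moreover have "int (n - r) = int n - int ?s - int ?t - 1" using True by (simp add: r_def of_nat_diff)
    ultimately have "smf U (int n - int ?s - int ?t - 1) \<xi>" by (simp only:)
    moreover have "thC \<theta> x * \<omega> x * OmC \<theta> x ^ ?s = thC \<theta> x * \<xi> x * OmC \<theta> x ^ (?s + ?t + 1)" if "x \<in> U" for x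
      using R[OF that] by (simp only: R_def \<gamma>_def r_def mult.assoc)
    ultimately show ?thesis by blast
  qed
qed

end

text \<open>Both forms vanish on H, so on the overlap the second is \<phi> times the first, where
  \<phi> is its value on the Reeb field of the first. The Leibniz rule gives the differential, with
  \<mu> = d\<phi>.\<close>

lemma contact_form_change:
  assumes contact: "contact_form U \<theta>" "contact_form U' \<theta>'" and x: "x \<in> U" "x \<in> U'"
  shows "\<exists>c \<mu>. c \<noteq> 0 \<and> thC \<theta>' x = sc c * thC \<theta> x \<and> OmC \<theta>' x = sc c * OmC \<theta> x + \<mu> * thC \<theta> x"
proof -
  let ?W = "U \<inter> U'"
  have W: "open ?W" "x \<in> ?W" using contact_open[OF contact(1)] contact_open[OF contact(2)] x by auto
  define \<phi> where "\<phi> y = ctr (reebf \<theta> y) (thC \<theta>' y)" for y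
  have th: "smf ?W 1 (thC \<theta>)" "smf ?W 1 (thC \<theta>')"
    using smf_thC[OF contact(1)] smf_thC[OF contact(2)] by (auto intro: smf_subset)
  have \<phi>: "smf ?W 0 \<phi>"
    using smf_ctr[OF W(1) sfield_subset[OF sfield_reebf[OF contact(1)]] th(2)] by (simp add: \<phi>_def[abs_def])
  have eq: "thC \<theta>' y = \<phi> y * thC \<theta> y" if y: "y \<in> ?W" for y
  proof -
    have yU: "y \<in> U" "y \<in> U'" using y by auto
    note al = smf_alt[OF th(1) y] smf_alt[OF th(2) y]
    interpret cr: cr_point n "T10 y" "T01 y" "vec_of_real (reebf \<theta> y)" "thC \<theta> y" "OmC \<theta> y"
      by (rule cr_point_contact[OF contact(1) yU(1)])
    obtain b where b: "\<phi> y = sc b" using alt_0_eq_sc[OF smf_alt[OF \<phi> y]] by blast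
    have "thC \<theta>' y - \<phi> y * thC \<theta> y = 0"
    proof (rule cr.zero_if_cctr_zero[of 1])
      show "alt 1 (thC \<theta>' y - \<phi> y * thC \<theta> y)" unfolding b by (intro alt_diff alt_sc_mult al)
      show "cctr (vec_of_real (reebf \<theta> y)) (thC \<theta>' y - \<phi> y * thC \<theta> y) = 0"
        using b by (simp add: cctr_sc_mult cctr_of_real[OF al(1)] cctr_of_real[OF al(2)] ctr_reebf_thC[OF contact(1) yU(1)]) (simp add: \<phi>_def)
    qed (simp_all add: b cctr_sc_mult cctr_thC_T10[OF contact(1) yU(1)] cctr_thC_T10[OF contact(2) yU(2)]
        cctr_thC_T01[OF contact(1) yU(1)] cctr_thC_T01[OF contact(2) yU(2)])
    then show ?thesis by simp
  qed
  obtain c where c: "\<phi> x = sc c" using alt_0_eq_sc[OF smf_alt[OF \<phi> W(2)]] by blast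
  have "c \<noteq> 0"
  proof
    assume "c = 0"
    then have "thC \<theta>' x = 0" using eq[OF W(2)] c by simp
    then have "(1 :: 'm cform) = 0" using ctr_reebf_thC[OF contact(2) x(2)] by simp
    then show False by simp
  qed
  moreover have "OmC \<theta>' x = dm \<phi> x * thC \<theta> x + sc c * OmC \<theta> x"
  proof -
    have "OmC \<theta>' x = dm (thC \<theta>') x" by (rule dm_thC[OF contact(2) x(2), symmetric])
    also have "\<dots> = dm (\<lambda>y. \<phi> y * thC \<theta> y) x" by (rule dm_cong[OF W eq])
    finally show ?thesis by (simp add: dm_mult[OF W \<phi> th(1)] dm_thC[OF contact(1) x(1)] c)
  qed
  ultimately show ?thesis using eq[OF W(2)] c by (intro exI[of _ c] exI[of _ "dm \<phi> x"]) simp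
qed

subsection \<open>The operator \<open>\<Gamma>\<close> on complex forms\<close>

text \<open>The operator \<Gamma> on complex forms, defined at each point from the value of the form
  there. Any local contact form may be used, by \<open>gam_rel_change\<close>; comparison with the
  global real \<open>Gamma\<close> is made in \<open>Gamma_form_Re\<close>.\<close>

definition gamma :: "nat \<Rightarrow> ('a \<Rightarrow> 'm cform) \<Rightarrow> 'a \<Rightarrow> 'm cform" where
  "gamma k \<omega> x = (THE g. \<exists>U \<theta>. contact_form U \<theta> \<and> x \<in> U \<and> gam_rel n (thC \<theta> x) (OmC \<theta> x) k (\<omega> x) g)"

lemma gamma_cong: "\<omega> x = \<eta> x \<Longrightarrow> gamma k \<omega> x = gamma k \<eta> x"
  by (simp add: gamma_def)

lemma gamma_eqI:
  assumes "contact_form U \<theta>" "x \<in> U" "gam_rel n (thC \<theta> x) (OmC \<theta> x) k (\<omega> x) g"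
  shows "gamma k \<omega> x = g"
  unfolding gamma_def
proof (rule the_equality)
  show "\<exists>U \<theta>. contact_form U \<theta> \<and> x \<in> U \<and> gam_rel n (thC \<theta> x) (OmC \<theta> x) k (\<omega> x) g" using assms by blast
  fix g' assume "\<exists>U \<theta>. contact_form U \<theta> \<and> x \<in> U \<and> gam_rel n (thC \<theta> x) (OmC \<theta> x) k (\<omega> x) g'"
  then obtain U' \<theta>' where c': "contact_form U' \<theta>'" "x \<in> U'" "gam_rel n (thC \<theta>' x) (OmC \<theta>' x) k (\<omega> x) g'" by blast
  from contact_form_change[OF c'(1) assms(1) c'(2) assms(2)] obtain c \<mu> where
    "c \<noteq> 0" "thC \<theta> x = sc c * thC \<theta>' x" "OmC \<theta> x = sc c * OmC \<theta>' x + \<mu> * thC \<theta>' x" by blast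
  from gam_rel_change[OF alt_thC[OF c'(1,2)] this c'(3)]
  show "g' = g" by (rule cr_point.gam_rel_unique[OF cr_point_contact[OF assms(1,2)] _ assms(3)])
qed

context
  fixes V :: "'a set" and k :: nat and \<omega> :: "'a \<Rightarrow> 'm cform"
  assumes V: "open V" and \<omega>: "smf V (int k) \<omega>"
begin

lemma gamma_primitive:
  assumes contact: "contact_form U \<theta>"
  shows "\<exists>\<xi>. smf (U \<inter> V) (int n - int (n + 1 - k) - int (k - (n + 1)) - 1) \<xi> \<and> (\<forall>x\<in>U \<inter> V.
    thC \<theta> x * \<omega> x * OmC \<theta> x ^ (n + 1 - k) = thC \<theta> x * \<xi> x * OmC \<theta> x ^ (n + 1 - k + (k - (n + 1)) + 1) \<and>
    gamma k \<omega> x = thC \<theta> x * \<xi> x * OmC \<theta> x ^ (k - (n + 1)))"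
proof -
  have W: "open (U \<inter> V)" using contact_open[OF contact] V by blast
  have c: "contact_form (U \<inter> V) \<theta>" by (rule contact_form_subset[OF contact W]) simp
  have "smf (U \<inter> V) (int k) \<omega>" by (rule smf_subset[OF \<omega>]) simp
  from primitive_exists[OF c this] obtain \<xi> where
    \<xi>: "smf (U \<inter> V) (int n - int (n + 1 - k) - int (k - (n + 1)) - 1) \<xi>"
    "\<And>x. x \<in> U \<inter> V \<Longrightarrow> thC \<theta> x * \<omega> x * OmC \<theta> x ^ (n + 1 - k) = thC \<theta> x * \<xi> x * OmC \<theta> x ^ (n + 1 - k + (k - (n + 1)) + 1)"
    by blast
  have "gamma k \<omega> x = thC \<theta> x * \<xi> x * OmC \<theta> x ^ (k - (n + 1))" if x: "x \<in> U \<inter> V" for x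
    by (rule gamma_eqI[OF c x]) (use \<xi>(2)[OF x] smf_alt[OF \<xi>(1) x] in \<open>auto simp: gam_rel_def\<close>)
  then show ?thesis using \<xi> by blast
qed

lemma gamma_rel:
  assumes contact: "contact_form U \<theta>" "x \<in> U" and x: "x \<in> V"
  shows "gam_rel n (thC \<theta> x) (OmC \<theta> x) k (\<omega> x) (gamma k \<omega> x)"
proof -
  obtain \<xi> where \<xi>: "smf (U \<inter> V) (int n - int (n + 1 - k) - int (k - (n + 1)) - 1) \<xi>" "\<forall>x\<in>U \<inter> V.
    thC \<theta> x * \<omega> x * OmC \<theta> x ^ (n + 1 - k) = thC \<theta> x * \<xi> x * OmC \<theta> x ^ (n + 1 - k + (k - (n + 1)) + 1) \<and>
    gamma k \<omega> x = thC \<theta> x * \<xi> x * OmC \<theta> x ^ (k - (n + 1))"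
    using gamma_primitive[OF contact(1)] by blast
  have "x \<in> U \<inter> V" using contact x by blast
  with \<xi>(2) smf_alt[OF \<xi>(1) this] show ?thesis unfolding gam_rel_def by blast
qed

lemma smf_gamma: "smf V (int k - 1) (gamma k \<omega>)"
proof (rule smf_local[OF V])
  fix x assume x: "x \<in> V"
  obtain U \<theta> where contact: "contact_form U \<theta>" "x \<in> U" using contact_form_exists[of x] by blast
  let ?W = "U \<inter> V"
  have W: "open ?W" using contact_open[OF contact(1)] V by blast
  obtain \<xi> where \<xi>: "smf ?W (int n - int (n + 1 - k) - int (k - (n + 1)) - 1) \<xi>"
    "\<And>x. x \<in> ?W \<Longrightarrow> gamma k \<omega> x = thC \<theta> x * \<xi> x * OmC \<theta> x ^ (k - (n + 1))"
    using gamma_primitive[OF contact(1)] by blast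
  have "smf ?W (1 + (int n - int (n + 1 - k) - int (k - (n + 1)) - 1) + int (k - (n + 1)) * 2)
     (\<lambda>x. thC \<theta> x * \<xi> x * OmC \<theta> x ^ (k - (n + 1)))"
    by (intro smf_mult[OF W] smf_power[OF W] \<xi>(1) smf_subset[OF smf_thC[OF contact(1)]] smf_subset[OF smf_OmC[OF contact(1)]]) auto
  moreover have "1 + (int n - int (n + 1 - k) - int (k - (n + 1)) - 1) + int (k - (n + 1)) * 2 = int k - 1"
    by (cases "k \<le> n") auto
  ultimately have "smf ?W (int k - 1) (gamma k \<omega>)" using smf_cong[OF W \<xi>(2)] by simp
  then show "\<exists>W. open W \<and> x \<in> W \<and> smf W (int k - 1) (gamma k \<omega>)" using W contact(2) x by blast
qed

end

context
  fixes V :: "'a set" and k :: nat and \<omega> :: "'a \<Rightarrow> 'm cform" and x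
  assumes V: "open V" and \<omega>: "smf V (int k) \<omega>" and x: "x \<in> V"
begin

lemma th_gamma: "contact_form U \<theta> \<Longrightarrow> x \<in> U \<Longrightarrow> thC \<theta> x * gamma k \<omega> x = 0"
  by (rule cr_point.gam_rel_th[OF cr_point_contact gamma_rel[OF V \<omega> _ _ x]])

lemma gamma_eq_0_iff:
  assumes contact: "contact_form U \<theta>" "x \<in> U"
  shows "gamma k \<omega> x = 0 \<longleftrightarrow> thC \<theta> x * \<omega> x * OmC \<theta> x ^ (n + 1 - k) = 0"
  using gamma_rel[OF V \<omega> contact x] gamma_eqI[OF contact, of k \<omega> 0] cr_point.gam_rel_0_iff[OF cr_point_contact[OF contact]]
  by metis

lemma gamma_add:
  assumes "smf V (int k) \<eta>"
  shows "gamma k (\<lambda>x. \<omega> x + \<eta> x) x = gamma k \<omega> x + gamma k \<eta> x"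
proof -
  obtain U \<theta> where contact: "contact_form U \<theta>" "x \<in> U" using contact_form_exists[of x] by blast
  from gam_rel_add[OF gamma_rel[OF V \<omega> contact x] gamma_rel[OF V assms contact x]]
  show ?thesis by (rule gamma_eqI[OF contact])
qed

lemma gamma_sc_mult: "gamma k (\<lambda>x. sc c * \<omega> x) x = sc c * gamma k \<omega> x"
proof -
  obtain U \<theta> where contact: "contact_form U \<theta>" "x \<in> U" using contact_form_exists[of x] by blast
  from gam_rel_sc[OF gamma_rel[OF V \<omega> contact x]] show ?thesis by (rule gamma_eqI[OF contact])
qed

lemma gamma_kills: "kills (T01 x) a (\<omega> x) \<Longrightarrow> kills (T01 x) (a - 1) (gamma k \<omega> x)"
proof -
  assume a: "kills (T01 x) a (\<omega> x)"
  obtain U \<theta> where contact: "contact_form U \<theta>" "x \<in> U" using contact_form_exists[of x] by blast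
  show ?thesis by (rule cr_point.gam_rel_kills[OF cr_point_contact[OF contact] gamma_rel[OF V \<omega> contact x] a])
qed

lemma gamma_diff:
  assumes "smf V (int k) \<eta>"
  shows "gamma k (\<lambda>x. \<omega> x - \<eta> x) x = gamma k \<omega> x - gamma k \<eta> x"
proof -
  obtain U \<theta> where contact: "contact_form U \<theta>" "x \<in> U" using contact_form_exists[of x] by blast
  from gam_rel_add[OF gamma_rel[OF V \<omega> contact x] gam_rel_sc[OF gamma_rel[OF V assms contact x], of "- 1"]]
  have "gam_rel n (thC \<theta> x) (OmC \<theta> x) k (\<omega> x - \<eta> x) (gamma k \<omega> x - gamma k \<eta> x)" by (simp add: sc_uminus)
  then show ?thesis by (rule gamma_eqI[OF contact])
qed

text \<open>Differentiate the identity \<theta> \<and> g = 0.\<close>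

lemma th_dm:
  assumes contact: "contact_form U \<theta>" "x \<in> U" and g: "smf V l g"
    and z: "\<And>y. y \<in> U \<inter> V \<Longrightarrow> thC \<theta> y * g y = 0"
  shows "thC \<theta> x * dm g x = OmC \<theta> x * g x"
proof -
  have W: "open (U \<inter> V)" "x \<in> U \<inter> V" using contact_open[OF contact(1)] V contact x by auto
  have th: "smf (U \<inter> V) 1 (thC \<theta>)" and g': "smf (U \<inter> V) l g"
    using smf_thC[OF contact(1)] g by (auto intro: smf_subset)
  have "dm (\<lambda>y. thC \<theta> y * g y) x = dm (\<lambda>y. 0) x" by (rule dm_cong[OF W z])
  then have "OmC \<theta> x * g x + ginv (thC \<theta> x) * dm g x = 0"
    by (simp add: dm_mult[OF W th g'] dm_0[OF W] dm_thC[OF contact])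
  then show ?thesis by (simp add: cr_point.th_ginv[OF cr_point_contact[OF contact]])
qed

text \<open>\<Gamma>d is the identity on the image of \<Gamma>. This makes \<pi> map into the Rumin
  forms, and it lets \<Gamma>d correct the components of a decomposition.\<close>

lemma gamma_dm_gamma: "gamma k (dm (gamma k \<omega>)) x = gamma k \<omega> x"
proof -
  obtain U \<theta> where contact: "contact_form U \<theta>" "x \<in> U" using contact_form_exists[of x] by blast
  have "thC \<theta> x * dm (gamma k \<omega>) x = OmC \<theta> x * gamma k \<omega> x"
  proof (rule th_dm[OF contact smf_gamma[OF V \<omega>]])
    fix y assume y: "y \<in> U \<inter> V"
    then have "y \<in> U" "y \<in> V" by auto
    then show "thC \<theta> y * gamma k \<omega> y = 0"
      by (intro cr_point.gam_rel_th[OF cr_point_contact[OF contact(1)] gamma_rel[OF V \<omega> contact(1)]])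
  qed
  then show ?thesis
    by (rule gamma_eqI[OF contact cr_point.gam_rel_gam[OF cr_point_contact[OF contact] gamma_rel[OF V \<omega> contact x]]])
qed

text \<open>In degrees up to \<open>n\<close>, \<Gamma>d reproduces multiples of \<theta>. A Rumin
  form has \<Gamma>d equal to zero, so its \<theta>-part is determined by its horizontal
  part.\<close>

lemma gamma_dm_if_th_zero:
  assumes "k \<le> n" and contact: "contact_form U \<theta>" "x \<in> U"
    and z: "\<And>y. y \<in> U \<inter> V \<Longrightarrow> thC \<theta> y * \<omega> y = 0"
  shows "gamma (k + 1) (dm \<omega>) x = \<omega> x"
proof (rule gamma_eqI[OF contact], rule cr_point.gam_rel_d[OF cr_point_contact[OF contact] smf_alt[OF \<omega> x] assms(1)])
  show "thC \<theta> x * \<omega> x = 0" by (rule z) (use contact(2) x in blast)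
  show "thC \<theta> x * dm \<omega> x = OmC \<theta> x * \<omega> x" by (rule th_dm[OF contact \<omega> z])
qed

lemma gamma_if_zero: "\<omega> x = 0 \<Longrightarrow> gamma k \<omega> x = 0"
  using contact_form_exists[of x] gamma_eq_0_iff by force

end

lemma gamma_sum:
  assumes V: "open V" "x \<in> V" and "finite I" "\<And>i. i \<in> I \<Longrightarrow> smf V (int k) (\<omega> i)"
  shows "gamma k (\<lambda>x. \<Sum>i\<in>I. \<omega> i x) x = (\<Sum>i\<in>I. gamma k (\<omega> i) x)"
  using assms(3,4)
proof (induction I rule: finite_induct)
  case empty
  then show ?case using gamma_if_zero[OF V(1) smf_0[OF V(1)] V(2)] by simp
next
  case (insert i I)
  have "gamma k (\<lambda>x. \<omega> i x + (\<Sum>i\<in>I. \<omega> i x)) x = gamma k (\<omega> i) x + gamma k (\<lambda>x. \<Sum>i\<in>I. \<omega> i x) x"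
    by (rule gamma_add[OF V(1) insert.prems V(2) smf_sum[OF V(1) insert.prems]]) simp_all
  then show ?case using insert by simp
qed

end

section \<open>Types of Rumin forms: relation to the filtration, uniqueness and
  decomposition\<close>

lemma multi_extension_sum:
  "multi_extension (app (\<Sum>i\<in>I. f i)) Zs = (\<Sum>i\<in>I. multi_extension (app (f i)) Zs)"
  by (induction I rule: infinite_finite_induct) (simp_all only: sum.infinite sum.empty sum.insert multi_extension_0 multi_extension_add simp_thms)

context cr_point
begin

lemma th_factor: "th * f = 0 \<Longrightarrow> f = th * cctr T f"
proof -
  assume z: "th * f = 0"
  show ?thesis using arg_cong[OF z, of "cctr T"] by (simp add: cctr_mult thT)
qed

lemma multi_extension_th: "set Zs \<subseteq> E \<union> F \<Longrightarrow> multi_extension (app (th * g)) Zs = 0"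
proof (induction Zs arbitrary: g)
  case Nil
  then show ?case by (simp add: alt_Nil[OF th])
next
  case (Cons Z Zs)
  then have "cctr Z th = 0" using thE thF by auto
  then have e: "cctr Z (th * g) = th * (- cctr Z g)" by (simp add: cctr_mult)
  show ?case unfolding multi_extension_Cons e by (rule Cons.IH) (use Cons.prems in simp)
qed

lemma multi_extension_horizontal:
  assumes "set Zs \<subseteq> E \<union> F"
  shows "multi_extension (app (f - th * g)) Zs = multi_extension (app f) Zs"
proof -
  have "f - th * g = f + th * (- g)" by simp
  then show ?thesis by (simp only: multi_extension_add multi_extension_th[OF assms] add_0_right)
qed

text \<open>Subtracting \<theta> times the Reeb contraction leaves a form determined by its values
  on the horizontal space, without changing these values.\<close>

lemma kills_horizontal_part:
  assumes f: "alt (int k) f"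
    and z: "\<And>Zs Ws. set Zs \<subseteq> E \<Longrightarrow> set Ws \<subseteq> F \<Longrightarrow> length Zs + length Ws = k \<Longrightarrow> a \<le> length Ws \<Longrightarrow>
      multi_extension (app f) (Zs @ Ws) = 0"
  shows "kills F a (f - th * cctr T f)"
proof (rule kills_if_multi_extension)
  show "alt (int k) (f - th * cctr T f)" using alt_mult[OF th alt_cctr[OF f]] by (intro alt_diff f) simp
  show "cctr T (f - th * cctr T f) = 0" by (simp add: cctr_mult thT cctr_self[OF f])
  fix Zs Ws assume "set Zs \<subseteq> E" "set Ws \<subseteq> F" "length Zs + length Ws = k" "a \<le> length Ws"
  from z[OF this] show "multi_extension (app (f - th * cctr T f)) (Zs @ Ws) = 0"
    by (subst multi_extension_horizontal) (use \<open>set Zs \<subseteq> E\<close> \<open>set Ws \<subseteq> F\<close> in auto)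
qed

lemma kills_vertical:
  assumes f: "alt (int k) f" "k > 0" "th * f = 0"
    and z: "\<And>Zs Ws. set Zs \<subseteq> E \<Longrightarrow> set Ws \<subseteq> F \<Longrightarrow> length Zs + length Ws + 1 = k \<Longrightarrow> a \<le> length Ws \<Longrightarrow>
      multi_extension (app (cctr T f)) (Zs @ Ws) = 0"
  shows "kills F a f"
proof -
  have "kills F a (cctr T f)"
    by (rule kills_if_multi_extension[of "k - 1"]) (use alt_cctr[OF f(1)] f(2) cctr_self[OF f(1)] z in \<open>auto simp: of_nat_diff\<close>)
  then have "kills F a (th * cctr T f)" by (rule kills_mult_le[OF kills_th]) simp
  then show ?thesis using th_factor[OF f(3)] by simp
qed

text \<open>Such an \<open>f\<close> is \<theta> times its Reeb contraction. On horizontal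
  arguments, contracting it with any vector v is therefore \<theta>(v) times contracting with the
  Reeb vector, so types above the middle degree can be tested with all vectors.\<close>

lemma multi_extension_ctr:
  assumes "th * f = 0" "set Zs \<subseteq> E \<union> F"
  shows "multi_extension (app (ctr v f)) Zs = app th [v] * multi_extension (app (cctr T f)) Zs"
proof -
  have "ctr v f = ctr v (th * cctr T f)" using th_factor[OF assms(1)] by simp
  also have "\<dots> = sc (app th [v]) * cctr T f - th * ctr v (cctr T f)"
    by (simp add: ctr_mult one_form_ctr[OF th])
  finally show ?thesis by (simp only: multi_extension_horizontal[OF assms(2)] multi_extension_sc)
qed

text \<open>Eigenvectors for distinct eigenvalues. The shift \<open>s\<close> allows for a factor
  \<open>Om ^ s\<close>, which raises every weight by \<open>s\<close>.\<close>

lemma eigen_independent: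
  "(\<And>j. j < a \<Longrightarrow> nop P (g j) = sc (of_nat (j + s)) * g j) \<Longrightarrow> (\<Sum>j<a. g j) = 0 \<Longrightarrow> j < a \<Longrightarrow> g j = 0"
proof (induction a arbitrary: g j)
  case (Suc a)
  let ?h = "\<lambda>j. sc (of_nat j - of_nat a) * g j"
  have "nop P (?h j) = sc (of_nat (j + s)) * ?h j" if "j < a" for j
    using Suc.prems(1)[of j] that by (simp only: nop_sc_mult sc_mult_mult mult.commute less_SucI)
  moreover have "(\<Sum>j<a. ?h j) = 0"
  proof -
    have "nop P (\<Sum>j<Suc a. g j) = (\<Sum>j<Suc a. sc (of_nat (j + s)) * g j)"
      unfolding nop_sum by (intro sum.cong refl Suc.prems(1)) simp
    then have "0 = (\<Sum>j<Suc a. sc (of_nat (j + s)) * g j) - sc (of_nat (a + s)) * (\<Sum>j<Suc a. g j)"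
      by (simp add: Suc.prems(2) del: sum.lessThan_Suc)
    also have "\<dots> = (\<Sum>j<Suc a. ?h j)"
      unfolding sum_distrib_left sum_subtractf[symmetric] by (simp add: sc_add sc_diff algebra_simps)
    finally show ?thesis by simp
  qed
  ultimately have h: "?h j = 0" if "j < a" for j using Suc.IH[of ?h j] that by blast
  have g: "g j = 0" if "j < a" for j
    by (rule sc_cancel[of "of_nat j - of_nat a"]) (use h[OF that] that in simp_all)
  then have "g a = 0" using Suc.prems(2) by simp
  then show ?case using g Suc.prems(3) by (auto simp: less_Suc_eq)
qed simp

end

context CR_manifold
begin

text \<open>Type (k - j, j), indexed by degree and weight so that one family \<open>j\<close> covers
  a fixed degree. The first clause encodes that the spaces outside the range of bidegrees are zero;
  above the middle degree the Reeb vector is replaced by every vector, which frees the condition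
  from the contact form.\<close>

definition weight_type :: "nat \<Rightarrow> nat \<Rightarrow> 'a \<Rightarrow> 'm cform \<Rightarrow> bool" where
  "weight_type k j x f \<longleftrightarrow> (j > n \<or> k > j + n + 1 \<longrightarrow> f = 0) \<and>
     (\<forall>Zs Ws. set Zs \<subseteq> T10 x \<and> set Ws \<subseteq> T01 x \<and> length Ws \<noteq> j \<longrightarrow>
       (if k \<le> n then length Zs + length Ws = k \<longrightarrow> multi_extension (app f) (Zs @ Ws) = 0
        else length Zs + length Ws + 1 = k \<longrightarrow> (\<forall>v. multi_extension (app (ctr v f)) (Zs @ Ws) = 0)))"

text \<open>The kernel of \<Gamma> and \<Gamma>d, equivalent to the defining equations by
  \<open>gamma_eq_0_iff\<close> and free of contact forms.\<close>

definition rumin_on :: "'a set \<Rightarrow> nat \<Rightarrow> ('a \<Rightarrow> 'm cform) \<Rightarrow> bool" where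
  "rumin_on V k f \<longleftrightarrow> smf V (int k) f \<and> (\<forall>x\<in>V. gamma k f x = 0 \<and> gamma (k + 1) (dm f) x = 0)"

definition rumin_type_on :: "'a set \<Rightarrow> nat \<Rightarrow> nat \<Rightarrow> ('a \<Rightarrow> 'm cform) \<Rightarrow> bool" where
  "rumin_type_on V k j f \<longleftrightarrow> rumin_on V k f \<and> (\<forall>x\<in>V. weight_type k j x (f x))"

lemma weight_type_0: "weight_type k j x 0"
  unfolding weight_type_def ctr_0 multi_extension_0 by simp

lemma weight_type_add: "weight_type k j x f \<Longrightarrow> weight_type k j x g \<Longrightarrow> weight_type k j x (f + g)"
  unfolding weight_type_def ctr_add multi_extension_add by (cases "k \<le> n") simp_all

lemma weight_type_sc_mult: "weight_type k j x f \<Longrightarrow> weight_type k j x (sc c * f)"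
  unfolding weight_type_def ctr_sc_mult multi_extension_sc by (cases "k \<le> n") simp_all

lemma rumin_on_smf: "rumin_on V k f \<Longrightarrow> smf V (int k) f" by (simp add: rumin_on_def)

context
  fixes V :: "'a set" assumes V: "open V"
begin

lemma smf_dm_nat: "smf V (int k) f \<Longrightarrow> smf V (int (k + 1)) (dm f)"
  for f :: "'a \<Rightarrow> 'm cform"
  using smf_dm[OF V, of "int k" f] by (simp add: add.commute)

lemma rumin_on_th:
  assumes f: "rumin_on V k f" "k > n" and contact: "contact_form U \<theta>" "x \<in> U" and x: "x \<in> V"
  shows "thC \<theta> x * f x = 0" "thC \<theta> x * dm f x = 0"
proof -
  note s = rumin_on_smf[OF f(1)]
  have "gamma k f x = 0" "gamma (k + 1) (dm f) x = 0" using f(1) x unfolding rumin_on_def by auto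
  then show "thC \<theta> x * f x = 0" "thC \<theta> x * dm f x = 0"
    using gamma_eq_0_iff[OF V s x contact] gamma_eq_0_iff[OF V smf_dm_nat[OF s] x contact] f(2) by simp_all
qed

text \<open>Up to the middle degree the type controls only the horizontal part. Since \<Gamma>d
  vanishes on the form and reproduces its \<theta>-part, the \<theta>-part is minus \<Gamma>d of the
  horizontal part, and \<Gamma>d preserves the filtration. Above the middle degree the form is
  \<theta> times its Reeb contraction, which the type controls.\<close>

lemma rumin_type_on_kills:
  assumes e: "rumin_type_on V k j e" and x: "x \<in> V"
  shows "kills (T01 x) (Suc j) (e x)"
proof -
  obtain U \<theta> where contact: "contact_form U \<theta>" and xU: "x \<in> U" using contact_form_exists[of x] by blast
  define W where "W = U \<inter> V"
  have W: "open W" "x \<in> W" unfolding W_def using contact_open[OF contact] V xU x by auto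
  have r: "rumin_on V k e" and t: "\<And>y. y \<in> V \<Longrightarrow> weight_type k j y (e y)"
    using e unfolding rumin_type_on_def by auto
  have s: "smf W (int k) e" by (rule smf_subset[OF rumin_on_smf[OF r]]) (simp add: W_def)
  have cr: "cr_point n (T10 y) (T01 y) (vec_of_real (reebf \<theta> y)) (thC \<theta> y) (OmC \<theta> y)" if "y \<in> W" for y
    by (rule cr_point_contact[OF contact]) (use that in \<open>simp add: W_def\<close>)
  have cT: "ctr (reebf \<theta> y) (e y) = cctr (vec_of_real (reebf \<theta> y)) (e y)" if "y \<in> W" for y
    by (rule cctr_of_real[OF smf_alt[OF s that], symmetric])
  show ?thesis
  proof (cases "k \<le> n")
    case True
    define w where "w y = thC \<theta> y * ctr (reebf \<theta> y) (e y)" for y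
    have w: "smf W (int k) w"
    proof -
      have "smf W 1 (thC \<theta>)" "sfield W (reebf \<theta>)"
        using smf_thC[OF contact] sfield_reebf[OF contact] by (auto intro: smf_subset sfield_subset simp: W_def)
      from smf_mult[OF W(1) this(1) smf_ctr[OF W(1) this(2) s]] show ?thesis by (simp add: w_def[abs_def])
    qed
    let ?e0 = "\<lambda>y. e y - w y"
    have e0: "smf W (int k) ?e0" by (rule smf_diff[OF W(1) s w])
    have k0: "kills (T01 y) (Suc j) (?e0 y)" if y: "y \<in> W" for y
      unfolding w_def cT[OF y]
      by (rule cr_point.kills_horizontal_part[OF cr[OF y] smf_alt[OF s y]])
        (use t[of y] y True in \<open>auto simp: weight_type_def W_def\<close>)
    have "gamma (k + 1) (dm w) x = w x"
    proof (rule gamma_dm_if_th_zero[OF W(1) w W(2) True contact xU])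
      fix y assume y: "y \<in> U \<inter> W"
      show "thC \<theta> y * w y = 0"
        using one_form_square[OF alt_thC[OF contact, of y]] y by (simp add: w_def mult.assoc[symmetric])
    qed
    moreover have "gamma (k + 1) (dm e) x = gamma (k + 1) (\<lambda>y. dm ?e0 y + dm w y) x"
      by (rule gamma_cong) (simp add: dm_diff[OF W s w])
    moreover have "\<dots> = gamma (k + 1) (dm ?e0) x + gamma (k + 1) (dm w) x"
      using smf_dm[OF W(1) e0] smf_dm[OF W(1) w] by (intro gamma_add[OF W(1) _ W(2)]) (simp_all add: add.commute)
    moreover have "gamma (k + 1) (dm e) x = 0" using r x unfolding rumin_on_def by blast
    ultimately have wx: "w x = - gamma (k + 1) (dm ?e0) x" by (simp add: eq_neg_iff_add_eq_0 add.commute)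
    have "kills (T01 x) (Suc (Suc j) - 1) (gamma (k + 1) (dm ?e0) x)"
      using smf_dm[OF W(1) e0] by (intro gamma_kills[OF W(1) _ W(2)] dm_kills[OF W(1) e0 k0 W(2)]) (simp_all add: add.commute)
    then have "kills (T01 x) (Suc j) (w x)" unfolding wx by (intro kills_uminus) simp
    from kills_add[OF k0[OF W(2)] this] show ?thesis by simp
  next
    case False
    have "thC \<theta> x * e x = 0" using rumin_on_th(1)[OF r _ contact xU x] False by simp
    then show ?thesis
      by (rule cr_point.kills_vertical[OF cr[OF W(2)] smf_alt[OF s W(2)], rotated])
        (use t[OF x] False in \<open>auto simp: weight_type_def cT[OF W(2), symmetric]\<close>)
  qed
qed

text \<open>Up to the middle degree the types separate the horizontal parts, so each summand is a
  multiple of \<theta> and then equals its own \<Gamma>d, which is zero. Above it the same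
  separation applies to the Reeb contractions.\<close>

lemma rumin_type_unique:
  assumes e: "\<And>i. i \<le> k \<Longrightarrow> rumin_type_on V k i (e i)" and z: "\<And>x. x \<in> V \<Longrightarrow> (\<Sum>i\<le>k. e i x) = 0"
    and j: "j \<le> k" and x: "x \<in> V"
  shows "e j x = 0"
proof -
  obtain U \<theta> where contact: "contact_form U \<theta>" and xU: "x \<in> U" using contact_form_exists[of x] by blast
  have r: "rumin_on V k (e i)" and t: "\<And>y. y \<in> V \<Longrightarrow> weight_type k i y (e i y)" if "i \<le> k" for i
    using e[OF that] unfolding rumin_type_on_def by auto
  note s = rumin_on_smf[OF r[OF j]]
  have cr: "cr_point n (T10 y) (T01 y) (vec_of_real (reebf \<theta> y)) (thC \<theta> y) (OmC \<theta> y)" if "y \<in> U" for y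
    by (rule cr_point_contact[OF contact that])
  \<comment> \<open>An additive functional vanishing on all summands of other types must vanish on
    this one; it is applied to evaluation on arguments with exactly \<open>j\<close> entries in
    T01.\<close>
  have isolate: "F (e j y) = 0" if y: "y \<in> V" and F: "F 0 = 0" "\<And>I. F (\<Sum>i\<in>I. e i y) = (\<Sum>i\<in>I. F (e i y))"
    and o: "\<And>i. i \<le> k \<Longrightarrow> i \<noteq> j \<Longrightarrow> F (e i y) = (0 :: complex)" for F y
  proof -
    have "0 = (\<Sum>i\<le>k. F (e i y))" using z[OF y] F(1) F(2)[of "{..k}"] by simp
    also have "\<dots> = F (e j y)" using o j by (subst sum.mono_neutral_right[of _ "{j}"]) auto
    finally show ?thesis by simp
  qed
  show ?thesis
  proof (cases "k \<le> n")
    case True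
    have "thC \<theta> y * e j y = 0" if y: "y \<in> U \<inter> V" for y
    proof -
      have yU: "y \<in> U" "y \<in> V" using y by auto
      let ?w = "thC \<theta> y * cctr (vec_of_real (reebf \<theta> y)) (e j y)"
      have "kills (T01 y) 0 (e j y - ?w)"
      proof (rule cr_point.kills_horizontal_part[OF cr[OF yU(1)] smf_alt[OF s yU(2)]])
        fix Zs Ws assume *: "set Zs \<subseteq> T10 y" "set Ws \<subseteq> T01 y" "length Zs + length Ws = k"
        have o: "multi_extension (app (e i y)) (Zs @ Ws) = 0" if "i \<le> k" "length Ws \<noteq> i" for i
          using t[OF that(1) yU(2)] * that True unfolding weight_type_def by auto
        show "multi_extension (app (e j y)) (Zs @ Ws) = 0"
        proof (cases "length Ws = j")
          case True
          then show ?thesis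
            by (intro isolate[OF yU(2), of "\<lambda>f. multi_extension (app f) (Zs @ Ws)"] o multi_extension_sum multi_extension_0) auto
        qed (use o j in auto)
      qed
      then have "thC \<theta> y * e j y = (thC \<theta> y * thC \<theta> y) * cctr (vec_of_real (reebf \<theta> y)) (e j y)"
        by (simp add: mult.assoc)
      then show ?thesis using one_form_square[OF alt_thC[OF contact yU(1)]] by simp
    qed
    from gamma_dm_if_th_zero[OF V s x True contact xU this] r[OF j] x show ?thesis
      unfolding rumin_on_def by simp
  next
    case False
    have th: "thC \<theta> x * e j x = 0" using rumin_on_th(1)[OF r[OF j] _ contact xU x] False by simp
    have "kills (T01 x) 0 (e j x)"
    proof (rule cr_point.kills_vertical[OF cr[OF xU] smf_alt[OF s x] _ th])
      fix Zs Ws assume *: "set Zs \<subseteq> T10 x" "set Ws \<subseteq> T01 x" "length Zs + length Ws + 1 = k"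
      have o: "multi_extension (app (ctr v (e i x))) (Zs @ Ws) = 0" if "i \<le> k" "length Ws \<noteq> i" for i v
        using t[OF that(1) x] * that False unfolding weight_type_def by auto
      have "multi_extension (app (ctr (reebf \<theta> x) (e j x))) (Zs @ Ws) = 0"
      proof (cases "length Ws = j")
        case True
        then show ?thesis
          by (intro isolate[OF x, of "\<lambda>f. multi_extension (app (ctr (reebf \<theta> x) f)) (Zs @ Ws)"] o, unfold ctr_sum ctr_0)
            (auto intro: multi_extension_sum multi_extension_0)
      qed (use o j in auto)
      then show "multi_extension (app (cctr (vec_of_real (reebf \<theta> x)) (e j x))) (Zs @ Ws) = 0"
        by (simp only: cctr_of_real[OF smf_alt[OF s x]])
    qed (use False in simp)
    then show ?thesis by simp
  qed
qed

lemma rumin_type_on_0: "rumin_type_on V k j (\<lambda>x. 0)"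
proof -
  have "gamma k (\<lambda>x. 0) x = 0" "gamma (k + 1) (dm (\<lambda>x. 0)) x = 0" if x: "x \<in> V" for x
    by (rule gamma_if_zero[OF V smf_0[OF V] x], simp)
      (rule gamma_if_zero[OF V smf_dm_nat[OF smf_0[OF V]] x dm_0[OF V x]])
  then show ?thesis
    unfolding rumin_type_on_def rumin_on_def by (simp add: weight_type_0 smf_0[OF V])
qed

text \<open>The weight components \<open>g j\<close> of a Rumin form need not be Rumin; subtracting
  \<Gamma>d of each repairs this. The corrections are multiples of \<theta>, invisible to the type,
  up to the middle degree and vanish above it, and they sum to \<Gamma>d of the whole form, which is
  zero.\<close>

lemma rumin_decomposition_contact:
  assumes f: "rumin_on V k f" and kf: "\<And>x. x \<in> V \<Longrightarrow> kills (T01 x) a (f x)" and contact: "contact_form U \<theta>" "V \<subseteq> U"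
  shows "\<exists>e. (\<forall>j. rumin_type_on V k j (e j)) \<and> (\<forall>x\<in>V. f x = (\<Sum>j<a. e j x))"
proof -
  note s = rumin_on_smf[OF f]
  from eigen_decomposition[OF contact(1) V contact(2) s kf]
  obtain g where g: "\<And>j. smf V (int k) (g j)" "\<And>x. x \<in> V \<Longrightarrow> f x = (\<Sum>j<a. g j x)"
    "\<And>x j. x \<in> V \<Longrightarrow> j < a \<Longrightarrow> nop (Pm \<theta> x) (g j x) = sc (of_nat j) * g j x" by blast
  define h where "h j = gamma (k + 1) (dm (g j))" for j
  define e where "e j = (if j < a then (\<lambda>x. g j x - h j x) else (\<lambda>x. 0))" for j
  note dg = smf_dm_nat[OF g(1)]
  have h: "smf V (int k) (h j)" for j using smf_gamma[OF V dg[of j]] by (simp add: h_def)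
  have cr: "cr_point n (T10 x) (T01 x) (vec_of_real (reebf \<theta> x)) (thC \<theta> x) (OmC \<theta> x)" if "x \<in> V" for x
    by (rule cr_point_contact[OF contact(1) subsetD[OF contact(2) that]])
  note U = subsetD[OF contact(2)]
  have thh: "thC \<theta> x * h j x = 0" if x: "x \<in> V" for x j
    unfolding h_def by (rule th_gamma[OF V dg x contact(1) U[OF x]])
  \<comment> \<open>The products have the distinct weights \<open>i + (n + 1 - k)\<close> and sum to
    zero, so each vanishes.\<close>
  have thg: "thC \<theta> x * g j x * OmC \<theta> x ^ (n + 1 - k) = 0" if x: "x \<in> V" and j: "j < a" for x j
  proof (rule cr_point.eigen_independent[OF cr[OF x], of a "\<lambda>j. thC \<theta> x * g j x * OmC \<theta> x ^ (n + 1 - k)" "n + 1 - k"])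
    let ?s = "n + 1 - k"
    fix i assume i: "i < a"
    have "nop (Pm \<theta> x) (thC \<theta> x * g i x * OmC \<theta> x ^ ?s) =
        thC \<theta> x * (sc (of_nat i) * g i x) * OmC \<theta> x ^ ?s + thC \<theta> x * g i x * (sc (of_nat ?s) * OmC \<theta> x ^ ?s)"
      by (simp only: nop_mult cr_point.nop_th[OF cr[OF x]] cr_point.nop_Om_power[OF cr[OF x]] g(3)[OF x i] mult_zero_left add_0_left)
    also have "\<dots> = sc (of_nat (i + ?s)) * (thC \<theta> x * g i x * OmC \<theta> x ^ ?s)"
      by (simp only: sc_left_commute mult.assoc of_nat_add sc_add distrib_right)
    finally show "nop (Pm \<theta> x) (thC \<theta> x * g i x * OmC \<theta> x ^ ?s) = \<dots>" .
  next
    have "thC \<theta> x * f x * OmC \<theta> x ^ (n + 1 - k) = 0"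
      using f x gamma_eq_0_iff[OF V s x contact(1) U[OF x]] unfolding rumin_on_def by blast
    then show "(\<Sum>j<a. thC \<theta> x * g j x * OmC \<theta> x ^ (n + 1 - k)) = 0"
      by (simp only: g(2)[OF x] sum_distrib_left sum_distrib_right)
  qed (rule j)
  have gz: "g j x = 0" if "x \<in> V" "j < a" "j > n \<or> k > j + n + 1" for j x
    by (rule cr_point.nop_eigen_zero[OF cr[OF that(1)] smf_alt[OF g(1) that(1)] g(3)[OF that(1,2)]]) (use that(3) in auto)
  \<comment> \<open>Above the middle degree the condition \<Gamma>d = 0 becomes the vanishing of
    d\<theta> times the form, which again splits by weight, all weights being raised by one.\<close>
  have ht: "h j x = 0" if x: "x \<in> V" and j: "j < a" and k: "k > n" for x j
  proof -
    have tg: "thC \<theta> y * g j y = 0" if "y \<in> V" for y using thg[OF that j] k by simp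
    have "OmC \<theta> x * g j x = 0"
    proof (rule cr_point.eigen_independent[OF cr[OF x], of a "\<lambda>j. OmC \<theta> x * g j x" 1])
      fix i assume "i < a"
      then show "nop (Pm \<theta> x) (OmC \<theta> x * g i x) = sc (of_nat (i + 1)) * (OmC \<theta> x * g i x)"
        by (simp only: nop_mult cr_point.nop_Om[OF cr[OF x]] g(3)[OF x] sc_left_commute of_nat_add of_nat_1 sc_add sc_1 distrib_right mult_1_left add.commute)
    next
      have "thC \<theta> x * dm f x = OmC \<theta> x * f x"
        by (rule th_dm[OF V s x contact(1) U[OF x] s]) (use rumin_on_th(1)[OF f k contact(1)] in blast)
      then have "OmC \<theta> x * f x = 0" using rumin_on_th(2)[OF f k contact(1) U[OF x] x] by simp
      then show "(\<Sum>j<a. OmC \<theta> x * g j x) = 0" by (simp only: g(2)[OF x] sum_distrib_left)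
    qed (rule j)
    moreover have "thC \<theta> x * dm (g j) x = OmC \<theta> x * g j x"
      by (rule th_dm[OF V s x contact(1) U[OF x] g(1)]) (use tg in blast)
    ultimately show ?thesis
      unfolding h_def gamma_eq_0_iff[OF V dg x contact(1) U[OF x]] by simp
  qed
  have "rumin_type_on V k j (e j)" for j
  proof (cases "j < a")
    case False
    then have e0: "e j = (\<lambda>x. 0)" by (simp add: e_def)
    show ?thesis unfolding e0 by (rule rumin_type_on_0)
  next
    case j: True
    then have ej: "e j = (\<lambda>x. g j x - h j x)" by (simp add: e_def)
    have es: "smf V (int k) (e j)" unfolding ej by (rule smf_diff[OF V g(1) h])
    have "gamma k (e j) x = 0" if x: "x \<in> V" for x
      unfolding gamma_eq_0_iff[OF V es x contact(1) U[OF x]]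
      by (simp only: ej right_diff_distrib left_diff_distrib thg[OF x j] thh[OF x] mult_zero_left diff_self)
    moreover have "gamma (k + 1) (dm (e j)) x = 0" if x: "x \<in> V" for x
    proof -
      have "gamma (k + 1) (dm (e j)) x = gamma (k + 1) (\<lambda>y. dm (g j) y - dm (h j) y) x"
        by (rule gamma_cong) (simp add: ej dm_diff[OF V x g(1) h])
      also have "\<dots> = h j x - gamma (k + 1) (dm (h j)) x"
        unfolding gamma_diff[OF V dg x smf_dm_nat[OF h]] by (simp add: h_def)
      finally show ?thesis using gamma_dm_gamma[OF V dg x, of j] by (simp add: h_def)
    qed
    moreover have "weight_type k j x (e j x)" if x: "x \<in> V" for x
      unfolding weight_type_def
    proof (intro conjI impI allI)
      assume r: "j > n \<or> k > j + n + 1"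
      have "dm (g j) x = dm (\<lambda>x. 0) x" by (rule dm_cong[OF V x]) (use gz[OF _ j r] in blast)
      then have "h j x = 0" unfolding h_def by (intro gamma_if_zero[OF V dg x]) (simp add: dm_0[OF V x])
      then show "e j x = 0" using gz[OF x j r] by (simp add: ej)
    next
      fix Zs Ws assume *: "set Zs \<subseteq> T10 x \<and> set Ws \<subseteq> T01 x \<and> length Ws \<noteq> j"
      then have HZ: "set (Zs @ Ws) \<subseteq> T10 x \<union> T01 x" by auto
      show "if k \<le> n then length Zs + length Ws = k \<longrightarrow> multi_extension (app (e j x)) (Zs @ Ws) = 0
        else length Zs + length Ws + 1 = k \<longrightarrow> (\<forall>v. multi_extension (app (ctr v (e j x))) (Zs @ Ws) = 0)"
      proof (cases "k \<le> n")
        case True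
        have "h j x = thC \<theta> x * cctr (vec_of_real (reebf \<theta> x)) (h j x)" by (rule cr_point.th_factor[OF cr[OF x] thh[OF x]])
        then have "multi_extension (app (e j x)) (Zs @ Ws) = multi_extension (app (g j x)) (Zs @ Ws)"
          unfolding ej using cr_point.multi_extension_horizontal[OF cr[OF x] HZ] by metis
        also have "\<dots> = 0"
          by (rule cr_point.eigen_multi_extension[OF cr[OF x] smf_alt[OF g(1) x] g(3)[OF x j]]) (use * in auto)
        finally show ?thesis using True by simp
      next
        case False
        let ?T = "vec_of_real (reebf \<theta> x)"
        let ?c = "cctr ?T (g j x)"
        have tg: "thC \<theta> x * g j x = 0" using thg[OF x j] False by simp
        have ex: "e j x = g j x" using ht[OF x j] False by (simp add: ej)
        have c0: "multi_extension (app ?c) (Zs @ Ws) = 0"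
        proof (rule cr_point.eigen_multi_extension[OF cr[OF x] alt_cctr[OF smf_alt[OF g(1) x]]])
          show "nop (Pm \<theta> x) ?c = sc (of_nat j) * ?c"
            by (simp only: cr_point.cctr_nop_T[OF cr[OF x] smf_alt[OF g(1) x], symmetric] g(3)[OF x j] cctr_sc_mult)
        qed (use * in auto)
        have "multi_extension (app (ctr v (e j x))) (Zs @ Ws) = 0" for v
          unfolding ex cr_point.multi_extension_ctr[OF cr[OF x] tg HZ] c0 by simp
        then show ?thesis using False by simp
      qed
    qed
    ultimately show ?thesis using es unfolding rumin_type_on_def rumin_on_def by blast
  qed
  moreover have "f x = (\<Sum>j<a. e j x)" if x: "x \<in> V" for x
  proof -
    have "(\<Sum>j<a. h j x) = gamma (k + 1) (\<lambda>y. \<Sum>j<a. dm (g j) y) x"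
      unfolding h_def by (rule gamma_sum[OF V x _ dg, symmetric]) simp
    also have "\<dots> = gamma (k + 1) (dm f) x"
    proof (rule gamma_cong)
      have "dm f x = dm (\<lambda>y. \<Sum>j<a. g j y) x" by (rule dm_cong[OF V x g(2)])
      then show "(\<Sum>j<a. dm (g j) x) = dm f x" by (simp add: dm_sum[OF V x g(1)])
    qed
    finally show ?thesis using f x g(2)[OF x] by (simp add: rumin_on_def e_def sum_subtractf)
  qed
  ultimately show ?thesis by blast
qed

lemma rumin_on_combination:
  assumes f: "rumin_on V k f" and g: "rumin_on V k g"
  shows "rumin_on V k (\<lambda>x. f x + sc c * g x)"
proof -
  note s = rumin_on_smf[OF f] rumin_on_smf[OF g]
  note cs = smf_sc_mult[OF V s(2), of c]
  note d = smf_dm_nat[OF s(1)] smf_dm_nat[OF s(2)]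
  have "gamma k (\<lambda>x. f x + sc c * g x) x = 0 \<and> gamma (k + 1) (dm (\<lambda>x. f x + sc c * g x)) x = 0" if x: "x \<in> V" for x
  proof
    note fx = f[unfolded rumin_on_def, THEN conjunct2, rule_format, OF x] g[unfolded rumin_on_def, THEN conjunct2, rule_format, OF x]
    show "gamma k (\<lambda>x. f x + sc c * g x) x = 0"
      by (simp add: gamma_add[OF V s(1) x cs] gamma_sc_mult[OF V s(2) x] fx)
    have "gamma (k + 1) (dm (\<lambda>x. f x + sc c * g x)) x = gamma (k + 1) (\<lambda>x. dm f x + sc c * dm g x) x"
      by (rule gamma_cong) (simp add: dm_add[OF V x s(1) cs] dm_sc_mult[OF V x s(2)])
    also have "\<dots> = gamma (k + 1) (dm f) x + sc c * gamma (k + 1) (dm g) x"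
      unfolding gamma_add[OF V d(1) x smf_sc_mult[OF V d(2)]] gamma_sc_mult[OF V d(2) x] ..
    finally show "gamma (k + 1) (dm (\<lambda>x. f x + sc c * g x)) x = 0" using fx by simp
  qed
  then show ?thesis unfolding rumin_on_def using smf_add[OF V s(1) cs] by blast
qed

lemma rumin_type_on_combination:
  "rumin_type_on V k j f \<Longrightarrow> rumin_type_on V k j g \<Longrightarrow> rumin_type_on V k j (\<lambda>x. f x + sc c * g x)"
  unfolding rumin_type_on_def using rumin_on_combination weight_type_add weight_type_sc_mult by blast

lemma rumin_type_on_cong:
  assumes "rumin_type_on V k j f" and eq: "\<And>x. x \<in> V \<Longrightarrow> g x = f x"
  shows "rumin_type_on V k j g"
  unfolding rumin_type_on_def rumin_on_def
proof (intro conjI ballI)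
  have f: "smf V (int k) f" "\<And>x. x \<in> V \<Longrightarrow> gamma k f x = 0" "\<And>x. x \<in> V \<Longrightarrow> gamma (k + 1) (dm f) x = 0"
    "\<And>x. x \<in> V \<Longrightarrow> weight_type k j x (f x)" using assms(1) unfolding rumin_type_on_def rumin_on_def by auto
  show "smf V (int k) g" by (rule iffD2[OF smf_cong[OF V eq] f(1)])
  fix x assume x: "x \<in> V"
  show "gamma k g x = 0" using gamma_cong[of g x f, OF eq[OF x]] f(2)[OF x] by simp
  show "gamma (k + 1) (dm g) x = 0" using gamma_cong[of "dm g" x "dm f", OF dm_cong[OF V x eq]] f(3)[OF x] by simp
  show "weight_type k j x (g x)" using f(4)[OF x] eq[OF x] by simp
qed

lemma rumin_type_on_local:
  assumes "\<And>x. x \<in> V \<Longrightarrow> \<exists>W. open W \<and> x \<in> W \<and> rumin_type_on W k j f"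
  shows "rumin_type_on V k j f"
  unfolding rumin_type_on_def rumin_on_def
proof (intro conjI ballI)
  show "smf V (int k) f"
    by (rule smf_local[OF V]) (use assms in \<open>unfold rumin_type_on_def rumin_on_def, blast\<close>)
  fix x assume "x \<in> V"
  from assms[OF this] obtain W where "x \<in> W" "rumin_type_on W k j f" by blast
  then show "gamma k f x = 0" "gamma (k + 1) (dm f) x = 0" "weight_type k j x (f x)"
    unfolding rumin_type_on_def rumin_on_def by blast+
qed

end

lemma rumin_type_on_subset: "rumin_type_on V k j f \<Longrightarrow> W \<subseteq> V \<Longrightarrow> rumin_type_on W k j f"
  unfolding rumin_type_on_def rumin_on_def using smf_subset by blast

lemma rumin_type_unique':
  assumes V: "open V" "x \<in> V" and e: "\<And>i. rumin_type_on V k i (e i)" "\<And>i. rumin_type_on V k i (e' i)"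
    and z: "\<And>x. x \<in> V \<Longrightarrow> (\<Sum>i\<le>k. e i x) = (\<Sum>i\<le>k. e' i x)" and j: "j \<le> k"
  shows "e j x = e' j x"
proof -
  have "e j x + sc (- 1) * e' j x = 0"
  proof (rule rumin_type_unique[OF V(1), of k "\<lambda>j x. e j x + sc (- 1) * e' j x", OF _ _ j V(2)])
    show "rumin_type_on V k i (\<lambda>x. e i x + sc (- 1) * e' i x)" for i
      by (rule rumin_type_on_combination[OF V(1) e])
    show "(\<Sum>i\<le>k. e i x + sc (- 1) * e' i x) = 0" if "x \<in> V" for x
      using z[OF that] by (simp add: sum_subtractf sc_uminus)
  qed
  then show ?thesis by (simp add: sc_uminus)
qed

text \<open>The local decompositions depend on a contact form only in their construction; uniqueness
  makes them agree on overlaps.\<close>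

lemma rumin_decomposition:
  assumes f: "rumin_on UNIV k f" and kf: "\<And>x. kills (T01 x) a (f x)"
  shows "\<exists>c. (\<forall>j. rumin_type_on UNIV k j (c j)) \<and> (\<forall>j x. a \<le> j \<longrightarrow> c j x = 0) \<and> (\<forall>x. f x = (\<Sum>j\<le>k. c j x))"
proof -
  \<comment> \<open>Every form of degree \<open>k\<close> is killed by \<open>Suc k\<close> vectors.
    Capping \<open>a\<close> there keeps all weights at most \<open>k\<close>, as the sum over
    \<open>j \<le> k\<close> requires.\<close>
  define b where "b = min a (Suc k)"
  have kb: "kills (T01 x) b (f x)" for x
    using kf[of x] kills_if_degree_less[OF smf_alt[OF rumin_on_smf[OF f] UNIV_I, of x], of "Suc k"]
    by (simp add: b_def min_def del: kills.simps)
  define D where "D x U e \<longleftrightarrow> open U \<and> x \<in> U \<and> (\<forall>j. rumin_type_on U k j (e j)) \<and>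
    (\<forall>y\<in>U. f y = (\<Sum>j\<le>k. e j y)) \<and> (\<forall>y j. b \<le> j \<longrightarrow> e j y = 0)" for x U e
  have "\<exists>U e. D x U e" for x
  proof -
    obtain U \<theta> where contact: "contact_form U \<theta>" and xU: "x \<in> U" using contact_form_exists[of x] by blast
    note U = contact_open[OF contact]
    have "rumin_on U k f" using f smf_subset unfolding rumin_on_def by blast
    from rumin_decomposition_contact[OF U this kb contact subset_refl]
    obtain e where e: "\<And>j. rumin_type_on U k j (e j)" "\<And>y. y \<in> U \<Longrightarrow> f y = (\<Sum>j<b. e j y)" by blast
    define e' where "e' j y = (if j < b then e j y else 0)" for j y
    have "rumin_type_on U k j (e' j)" for j
    proof (cases "j < b")
      case True
      then show ?thesis using e(1)[of j] by (simp add: e'_def[abs_def])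
    next
      case False
      then show ?thesis using rumin_type_on_0[OF U, of k j] by (simp add: e'_def[abs_def])
    qed
    moreover have "f y = (\<Sum>j\<le>k. e' j y)" if "y \<in> U" for y
      unfolding e(2)[OF that] e'_def by (rule sum.mono_neutral_cong_left) (auto simp: b_def)
    ultimately have "D x U e'" using U xU unfolding D_def by (auto simp: e'_def)
    then show ?thesis by blast
  qed
  then have "\<exists>U e. \<forall>x. D x (U x) (e x)" by metis
  then obtain U e where "\<And>x. D x (U x) (e x)" by blast
  then have U: "\<And>x. open (U x)" "\<And>x. x \<in> U x" and e: "\<And>x j. rumin_type_on (U x) k j (e x j)"
    "\<And>x y. y \<in> U x \<Longrightarrow> f y = (\<Sum>j\<le>k. e x j y)" "\<And>x y j. b \<le> j \<Longrightarrow> e x j y = 0"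
    unfolding D_def by auto
  define c where "c j x = e x j x" for j x
  have ce: "c j y = e x j y" if y: "y \<in> U x" for j x y
  proof (cases "j \<le> k")
    case True
    have W: "open (U y \<inter> U x)" "y \<in> U y \<inter> U x" using U y by auto
    show ?thesis
      unfolding c_def
    proof (rule rumin_type_unique'[where e = "e y" and e' = "e x", OF W _ _ _ True])
      show "rumin_type_on (U y \<inter> U x) k i (e y i)" "rumin_type_on (U y \<inter> U x) k i (e x i)" for i
        by (rule rumin_type_on_subset[OF e(1)], simp)+
      show "(\<Sum>i\<le>k. e y i z) = (\<Sum>i\<le>k. e x i z)" if "z \<in> U y \<inter> U x" for z
        using e(2)[of z y] e(2)[of z x] that by simp
    qed
  next
    case False
    then show ?thesis using e(3)[of j] by (simp add: c_def b_def)
  qed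
  have "rumin_type_on UNIV k j (c j)" for j
  proof (rule rumin_type_on_local[OF open_UNIV])
    fix x
    have "rumin_type_on (U x) k j (c j)" by (rule rumin_type_on_cong[OF U(1) e(1) ce])
    then show "\<exists>W. open W \<and> x \<in> W \<and> rumin_type_on W k j (c j)" using U by blast
  qed
  moreover have "c j x = 0" if "a \<le> j" for j x using e(3)[of j x x] that by (simp add: c_def b_def)
  moreover have "f x = (\<Sum>j\<le>k. c j x)" for x using e(2)[OF U(2)] by (simp add: c_def)
  ultimately show ?thesis by blast
qed

end

section \<open>Comparison of the ring-valued calculus with the forms and operators of the
  definitions\<close>

definition mfd :: "('a, 'v, 'b) form \<Rightarrow> 'a \<Rightarrow> ('v, 'b) mform" where
  "mfd \<omega> = (\<lambda>x. mf (\<omega> x))"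

lemma mfd_apply: "mfd \<omega> x = mf (\<omega> x)" by (simp add: mfd_def)

lemma mfd_eqI: "(\<And>x. mfd \<omega> x = mfd \<eta> x) \<Longrightarrow> \<omega> = \<eta>"
  by (simp add: mfd_def fun_eq_iff)

lemma mfd_app [simp]: "mfd (\<lambda>x. app (f x)) = f" by (simp add: mfd_def app_inverse)

lemma mfd_diff: "mfd (\<omega> - \<eta>) x = mfd \<omega> x - mfd \<eta> x"
  by (rule mform_eqI) (simp add: mfd_def)

lemma mfd_0: "mfd 0 x = 0"
  by (rule mform_eqI) (simp add: mfd_def)

lemma mfd_sum: "mfd (\<Sum>i\<in>I. \<omega> i) x = (\<Sum>i\<in>I. mfd (\<omega> i) x)"
  by (rule mform_eqI) (induction I rule: infinite_finite_induct, auto simp: mfd_def)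

lemma mfd_wedge: "mfd (\<omega> \<^bold>\<and> \<tau>) x = mfd \<omega> x * mfd \<tau> x"
  by (simp add: mfd_def mf_wedge)

lemma mfd_wedge_power: "mfd (wedge_power \<omega> m) x = mfd \<omega> x ^ m"
  by (simp add: mfd_def mf_wedge_power)

lemma wedge_eq_0_iff: "(\<omega> \<^bold>\<and> \<tau>) x = 0 \<longleftrightarrow> mfd (\<omega> \<^bold>\<and> \<tau>) x = 0"
  by (simp add: mfd_def zero_mform_def zero_fun_def)

lemma mfd_form_Re: "mfd (form_Re \<omega>) x = cmap Re (mfd \<omega> x)"
  by (rule mform_eqI) (simp add: mfd_def form_Re_def)

lemma mfd_form_Im: "mfd (form_Im \<omega>) x = cmap Im (mfd \<omega> x)"
  by (rule mform_eqI) (simp add: mfd_def form_Im_def)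

text \<open>Reduces every statement about imaginary parts to one about real parts.\<close>

lemma form_Im_eq: "form_Im \<omega> = form_Re (\<lambda>x vs. - \<i> * \<omega> x vs)"
  by (simp add: form_Im_def form_Re_def fun_eq_iff)

lemma two_form_power_commute: "alt 2 b \<Longrightarrow> b ^ m * f = f * b ^ m"
  using power_commuting_commutes[of b f m] two_form_commute[of b f] by simp

lemmas Re_linear = bounded_linear.linear[OF bounded_linear_Re]
lemmas Im_linear = bounded_linear.linear[OF bounded_linear_Im]
lemmas of_real_linear = bounded_linear.linear[OF bounded_linear_of_real]

lemma cmap_of_real_mult:
  fixes f g :: "('v, real) mform"
  shows "cmap complex_of_real (f * g) = cmap complex_of_real f * cmap complex_of_real g"
  using cmap_mult[OF of_real_linear, of "\<lambda>x. x" complex_of_real f g] of_real_linear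
  by (simp add: linear_iff) (simp add: cmap_def app_inverse)

lemma cmap_of_real_power: "cmap complex_of_real (f ^ m) = cmap complex_of_real f ^ m"
proof (induction m)
  case 0
  show ?case by (simp, rule mform_eqI) simp
qed (simp add: cmap_of_real_mult)

lemma cmap_Re_mult: "cmap Re (cmap complex_of_real f * g) = f * cmap Re g"
  using cmap_mult[OF Re_linear, of complex_of_real "\<lambda>x. x" f g] of_real_linear
  by (simp add: linear_iff) (simp add: cmap_def app_inverse)

lemma cmap_Re_sc_mult: "cmap Re (sc (- \<i>) * f) = cmap Im f"
  by (rule mform_eqI) simp

lemma complex_parts: "f = cmap complex_of_real (cmap Re f) + sc \<i> * cmap complex_of_real (cmap Im f)"
  by (rule mform_eqI) (simp add: complex_eq)

context CR_manifold
begin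

lemma smf_parts:
  fixes f :: "'a \<Rightarrow> 'm cform"
  shows "smf UNIV k f \<longleftrightarrow> smf UNIV k (\<lambda>x. cmap Re (f x)) \<and> smf UNIV k (\<lambda>x. cmap Im (f x))"
proof
  assume p: "smf UNIV k (\<lambda>x. cmap Re (f x)) \<and> smf UNIV k (\<lambda>x. cmap Im (f x))"
  have "smf UNIV k (\<lambda>x. cmap complex_of_real (cmap Re (f x)) + sc \<i> * cmap complex_of_real (cmap Im (f x)))"
    by (rule smf_add[OF open_UNIV smf_cmap[OF open_UNIV bounded_linear_of_real p[THEN conjunct1]]
        smf_sc_mult[OF open_UNIV smf_cmap[OF open_UNIV bounded_linear_of_real p[THEN conjunct2]]]])
  then show "smf UNIV k f" by (simp flip: complex_parts)
qed (simp add: smf_cmap bounded_linear_Re bounded_linear_Im)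

lemma forms_on_mfd: "\<omega> \<in> forms_on U k \<longleftrightarrow> smf U k (mfd \<omega>)"
  by (simp add: forms_on_iff mfd_def)

lemma dm_mfd: "dm (mfd \<omega>) x = mfd (ext_deriv \<omega>) x" for \<omega> :: "('a, real^'m, 'b::real_normed_field) form"
  by (simp add: mfd_def dm_ext_deriv)

lemma ext_deriv_form_Re:
  assumes "smf UNIV k (mfd \<omega>)"
  shows "ext_deriv (form_Re \<omega>) = form_Re (ext_deriv \<omega>)"
proof (rule mfd_eqI)
  fix x
  have "mfd (form_Re \<omega>) = (\<lambda>x. cmap Re (mfd \<omega> x))" by (simp add: mfd_form_Re fun_eq_iff)
  then show "mfd (ext_deriv (form_Re \<omega>)) x = mfd (form_Re (ext_deriv \<omega>)) x"
    using dm_cmap[OF open_UNIV UNIV_I bounded_linear_Re assms, of x]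
    by (simp only: mfd_form_Re flip: dm_mfd)
qed

context
  fixes U \<theta> x assumes contact: "contact_form U \<theta>" "x \<in> U"
begin

lemma th_Om_cmap:
  "thC \<theta> x * cmap complex_of_real f * OmC \<theta> x ^ m = cmap complex_of_real (mfd \<theta> x * f * mfd (ext_deriv \<theta>) x ^ m)"
  by (simp add: thC_def OmC_def mfd_def cmap_of_real_mult cmap_of_real_power)

lemma cmap_Re_th_Om: "cmap Re (thC \<theta> x * f * OmC \<theta> x ^ m) = mfd \<theta> x * cmap Re f * mfd (ext_deriv \<theta>) x ^ m"
proof -
  have "thC \<theta> x * f * OmC \<theta> x ^ m = cmap complex_of_real (mfd \<theta> x * mfd (ext_deriv \<theta>) x ^ m) * f"
    unfolding cmap_of_real_mult cmap_of_real_power mult.assoc mfd_apply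
    by (simp only: two_form_power_commute[OF alt_OmC[OF contact]] flip: thC_def[of \<theta>] OmC_def[of \<theta>])
  moreover have "alt 2 (mfd (ext_deriv \<theta>) x)" using smf_alt[OF smf_dcontact[OF contact(1)] contact(2)] by (simp add: mfd_def)
  ultimately show ?thesis by (simp only: cmap_Re_mult mult.assoc two_form_power_commute)
qed

lemma th_Om_parts:
  "thC \<theta> x * f * OmC \<theta> x ^ m = 0 \<longleftrightarrow> mfd \<theta> x * cmap Re f * mfd (ext_deriv \<theta>) x ^ m = 0 \<and>
     mfd \<theta> x * cmap Im f * mfd (ext_deriv \<theta>) x ^ m = 0"
proof -
  let ?h = "thC \<theta> x * f * OmC \<theta> x ^ m"
  have "cmap Im ?h = cmap Re (thC \<theta> x * (sc (- \<i>) * f) * OmC \<theta> x ^ m)"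
    by (simp only: cmap_Re_sc_mult[symmetric] mult.assoc sc_left_commute[of "thC \<theta> x"])
  then have Im: "cmap Im ?h = mfd \<theta> x * cmap Im f * mfd (ext_deriv \<theta>) x ^ m"
    by (simp only: cmap_Re_th_Om cmap_Re_sc_mult)
  have "?h = 0 \<longleftrightarrow> cmap Re ?h = 0 \<and> cmap Im ?h = 0"
    using complex_parts[of ?h] cmap_0[OF of_real_linear] cmap_0[OF Re_linear] cmap_0[OF Im_linear] by (metis add_0 mult_zero_right)
  then show ?thesis by (simp only: cmap_Re_th_Om Im)
qed

end

text \<open>Above the middle degree both exponents truncate to 0, which merges the two cases of the
  definition.\<close>

lemma rumin_iff: "\<alpha> \<in> rumin k \<longleftrightarrow> smf UNIV (int k) (mfd \<alpha>) \<and> (\<forall>U \<theta>. contact_form U \<theta> \<longrightarrow> (\<forall>x\<in>U.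
    mfd \<theta> x * mfd \<alpha> x * mfd (ext_deriv \<theta>) x ^ (n + 1 - k) = 0 \<and>
    mfd \<theta> x * mfd (ext_deriv \<alpha>) x * mfd (ext_deriv \<theta>) x ^ (n + 1 - (k + 1)) = 0))"
  unfolding rumin_def forms_on_mfd mem_Collect_eq
  by (cases "k \<le> n") (simp_all add: wedge_eq_0_iff mfd_wedge mfd_wedge_power mult.assoc)

lemma rumin_complex_iff: "\<omega> \<in> rumin_complex k \<longleftrightarrow> rumin_on UNIV k (mfd \<omega>)"
proof (cases "smf UNIV (int k) (mfd \<omega>)")
  case True
  let ?f = "mfd \<omega>"
  let ?i = "\<lambda>x. sc (- \<i>) * ?f x"
  note d = smf_dm_nat[OF open_UNIV True]
  have Im: "mfd (\<lambda>x vs. - \<i> * \<omega> x vs) = ?i" by (rule ext, rule mform_eqI) (simp add: mfd_def)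
  have "mfd (ext_deriv (form_Im \<omega>)) x = cmap Im (dm ?f x)" for x
  proof -
    have "mfd (ext_deriv (form_Im \<omega>)) x = cmap Re (dm ?i x)"
      unfolding form_Im_eq ext_deriv_form_Re[of _ "\<lambda>x vs. - \<i> * \<omega> x vs", unfolded Im, OF smf_sc_mult[OF open_UNIV True]]
      by (simp only: mfd_form_Re Im flip: dm_mfd)
    then show ?thesis by (simp only: dm_sc_mult[OF open_UNIV UNIV_I True] cmap_Re_sc_mult)
  qed
  moreover have "mfd (ext_deriv (form_Re \<omega>)) x = cmap Re (dm ?f x)" for x
    by (simp add: ext_deriv_form_Re[OF True] mfd_form_Re dm_mfd)
  moreover have "smf UNIV (int k) (mfd (form_Re \<omega>))" "smf UNIV (int k) (mfd (form_Im \<omega>))"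
    using True smf_parts[of "int k" ?f] by (simp_all add: mfd_form_Re[abs_def] mfd_form_Im[abs_def])
  ultimately have "\<omega> \<in> rumin_complex k \<longleftrightarrow> (\<forall>U \<theta>. contact_form U \<theta> \<longrightarrow> (\<forall>x\<in>U.
      thC \<theta> x * ?f x * OmC \<theta> x ^ (n + 1 - k) = 0 \<and> thC \<theta> x * dm ?f x * OmC \<theta> x ^ (n + 1 - (k + 1)) = 0))"
    unfolding rumin_complex_def rumin_iff mem_Collect_eq
    by (simp only: th_Om_parts mfd_form_Re mfd_form_Im cong: imp_cong ball_cong) blast
  also have "\<dots> \<longleftrightarrow> (\<forall>x. gamma k ?f x = 0 \<and> gamma (k + 1) (dm ?f) x = 0)"
    using gamma_eq_0_iff[OF open_UNIV True UNIV_I] gamma_eq_0_iff[OF open_UNIV d UNIV_I] contact_form_exists by metis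
  finally show ?thesis using True by (simp add: rumin_on_def)
next
  case False
  then have "\<not> (smf UNIV (int k) (mfd (form_Re \<omega>)) \<and> smf UNIV (int k) (mfd (form_Im \<omega>)))"
    using smf_parts[of "int k" "mfd \<omega>"] by (simp add: mfd_form_Re[abs_def] mfd_form_Im[abs_def])
  then show ?thesis using False unfolding rumin_complex_def rumin_iff rumin_on_def by blast
qed

lemma rumin_pq_iff: "\<omega> \<in> rumin_pq p q \<longleftrightarrow> rumin_type_on UNIV (p + q) q (mfd \<omega>)"
proof (cases "p \<le> n + 1 \<and> q \<le> n")
  case False
  then have "rumin_type_on UNIV (p + q) q (mfd \<omega>) \<Longrightarrow> \<omega> = 0"
    by (intro mfd_eqI) (auto simp: rumin_type_on_def weight_type_def mfd_0)
  moreover have "rumin_type_on UNIV (p + q) q (mfd 0)"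
    using rumin_type_on_0[OF open_UNIV] by (simp add: mfd_0[abs_def])
  ultimately show ?thesis using False by (auto simp: rumin_pq_def)
next
  case pq: True
  have app: "app (mfd \<omega> x) = \<omega> x" "app (ctr v (mfd \<omega> x)) = (\<lambda>vs. \<omega> x (v # vs))" for x v
    by (auto simp: mfd_def fun_eq_iff)
  have idx: "a + b = p' + q \<and> (a, b) \<noteq> (p', q) \<longleftrightarrow> a + b = p' + q \<and> b \<noteq> q" for a b p' :: nat by auto
  have eq: "has_type_on_H p' q x g \<longleftrightarrow> (\<forall>Zs Ws. set Zs \<subseteq> T10 x \<and> set Ws \<subseteq> T01 x \<and> length Ws \<noteq> q \<longrightarrow>
      length Zs + length Ws = p' + q \<longrightarrow> multi_extension g (Zs @ Ws) = 0)" for p' x g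
    unfolding has_type_on_H_def by auto
  show ?thesis
  proof (cases "p + q \<le> n")
    case True
    then show ?thesis using pq
      unfolding rumin_pq_def rumin_type_on_def weight_type_def eq
      by (auto simp: rumin_complex_iff app)
  next
    case False
    have "weight_type (p + q) q x (mfd \<omega> x)"
      \<comment> \<open>The definition tests contraction with Reeb vectors; since \<theta> times the
        form vanishes, contraction with any vector is proportional to it on horizontal
        arguments.\<close>
      if r: "rumin_on UNIV (p + q) (mfd \<omega>)" and t: "\<forall>U \<theta> x T. contact_form U \<theta> \<and> x \<in> U \<and> reeb_vector \<theta> x T \<longrightarrow>
                     has_type_on_H (p - 1) q x (\<lambda>vs. \<omega> x (T # vs))" for x
    proof -
      obtain U \<theta> where contact: "contact_form U \<theta>" "x \<in> U" using contact_form_exists[of x] by blast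
      have T: "has_type_on_H (p - 1) q x (app (ctr (reebf \<theta> x) (mfd \<omega> x)))"
        unfolding app using t contact reebf[OF contact] by blast
      have th: "thC \<theta> x * mfd \<omega> x = 0" using rumin_on_th(1)[OF open_UNIV r _ contact UNIV_I] False by simp
      have "multi_extension (app (ctr v (mfd \<omega> x))) (Zs @ Ws) = 0"
        if *: "set Zs \<subseteq> T10 x" "set Ws \<subseteq> T01 x" "length Ws \<noteq> q" "length Zs + length Ws + 1 = p + q" for v Zs Ws
      proof -
        have "set (Zs @ Ws) \<subseteq> T10 x \<union> T01 x" using * by auto
        moreover have "multi_extension (app (ctr (reebf \<theta> x) (mfd \<omega> x))) (Zs @ Ws) = 0"
          using T * False pq unfolding eq by auto
        ultimately show ?thesis
          using cr_point.multi_extension_ctr[OF cr_point_contact[OF contact] th, of "Zs @ Ws" v]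
          by (simp add: cctr_of_real[OF smf_alt[OF rumin_on_smf[OF r] UNIV_I]])
      qed
      then show ?thesis using pq False unfolding weight_type_def by auto
    qed
    moreover have "has_type_on_H (p - 1) q x (\<lambda>vs. \<omega> x (T # vs))" if "weight_type (p + q) q x (mfd \<omega> x)" for x T
      using that pq False unfolding weight_type_def eq app(2)[symmetric] by auto
    ultimately show ?thesis using pq False
      unfolding rumin_pq_def rumin_type_on_def by (auto simp: rumin_complex_iff)
  qed
qed

subsection \<open>The operators \<open>\<Gamma>\<close> and \<open>\<pi>\<close> on real and complex forms\<close>

lemma cmap_of_real_inject: "cmap complex_of_real f = cmap complex_of_real g \<Longrightarrow> f = g" for f g :: "('v, real) mform"
proof (rule mform_eqI)
  fix vs assume "cmap complex_of_real f = cmap complex_of_real g"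
  from arg_cong[OF this, of "\<lambda>h. app h vs"] show "app f vs = app g vs" by simp
qed

text \<open>\<theta> and d\<theta> are real, so the real part of a complex primitive solves the real
  equation. Conversely any real solution becomes a complex one, and pointwise uniqueness identifies
  the form described in \<open>Gamma\<close>.\<close>

lemma Gamma_form_Re:
  assumes s: "smf UNIV (int k) (mfd \<omega>)"
  shows "mfd (Gamma k (form_Re \<omega>)) x = cmap Re (gamma k (mfd \<omega>) x)"
proof -
  let ?\<alpha> = "form_Re \<omega>" and ?s = "n + 1 - k" and ?t = "k - (n + 1)"
  define \<eta> :: "('a, real^'m, real) form" where "\<eta> x = app (cmap Re (gamma k (mfd \<omega>) x))" for x
  have m\<eta>: "mfd \<eta> = (\<lambda>x. cmap Re (gamma k (mfd \<omega>) x))" unfolding \<eta>_def by (rule mfd_app)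
  define sol where "sol U \<theta> \<zeta> \<xi> \<longleftrightarrow> smf U (int n - int ?s - int ?t - 1) (mfd \<xi>) \<and> (\<forall>x\<in>U.
        mfd \<theta> x * mfd ?\<alpha> x * mfd (ext_deriv \<theta>) x ^ ?s = mfd \<theta> x * mfd \<xi> x * mfd (ext_deriv \<theta>) x ^ (?s + ?t + 1) \<and>
        mfd \<zeta> x = mfd \<theta> x * mfd \<xi> x * mfd (ext_deriv \<theta>) x ^ ?t)"
    for U \<theta> and \<zeta> \<xi> :: "('a, real^'m, real) form"
  \<comment> \<open>Puts both cases of the definition into the uniform shape with exponents
    \<open>?s\<close> and \<open>?t\<close>.\<close>
  have R: "(if k \<le> n
           then \<exists>\<xi>\<in>forms_on U (int k - 2). \<forall>x\<in>U.
                  (\<theta> \<^bold>\<and> ?\<alpha> \<^bold>\<and> wedge_power (ext_deriv \<theta>) (n + 1 - k)) x =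
                    (\<theta> \<^bold>\<and> \<xi> \<^bold>\<and> wedge_power (ext_deriv \<theta>) (n + 2 - k)) x \<and>
                  \<zeta> x = (\<theta> \<^bold>\<and> \<xi>) x
           else \<exists>\<xi>\<in>forms_on U (2 * int n - int k). \<forall>x\<in>U.
                  (\<theta> \<^bold>\<and> ?\<alpha>) x = (\<theta> \<^bold>\<and> \<xi> \<^bold>\<and> wedge_power (ext_deriv \<theta>) (k - n)) x \<and>
                  \<zeta> x = (\<theta> \<^bold>\<and> \<xi> \<^bold>\<and> wedge_power (ext_deriv \<theta>) (k - n - 1)) x) \<longleftrightarrow>
     (\<exists>\<xi>. sol U \<theta> \<zeta> \<xi>)" for U \<theta> \<zeta>
  proof -
    have eq: "f = (\<theta> \<^bold>\<and> \<xi>) x \<longleftrightarrow> mf f = mfd (\<theta> \<^bold>\<and> \<xi>) x" for f x and \<xi> :: "('a, real^'m, real) form" by (simp add: mfd_def)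
    show ?thesis
    proof (cases "k \<le> n")
      case True
      then have "int n - int ?s - int ?t - 1 = int k - 2" "?s + ?t + 1 = n + 2 - k" "?t = 0" by auto
      then show ?thesis using True
        by (simp only: sol_def if_True forms_on_mfd Bex_def eq mfd_wedge mfd_wedge_power mfd_apply[symmetric] mult.assoc power_0 mult_1_right)
    next
      case False
      then have "int n - int ?s - int ?t - 1 = 2 * int n - int k" "?s + ?t + 1 = k - n" "?t = k - n - 1" "?s = 0" by auto
      then show ?thesis using False
        by (simp only: sol_def if_False forms_on_mfd Bex_def eq mfd_wedge mfd_wedge_power mfd_apply[symmetric] mult.assoc power_0 mult_1_right)
    qed
  qed
  have real_solution: "\<exists>\<xi>. sol U \<theta> \<eta> \<xi>"
    if contact: "contact_form U \<theta>" for U \<theta>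
  proof -
    from gamma_primitive[OF open_UNIV s contact] obtain \<xi> where
      \<xi>: "smf U (int n - int ?s - int ?t - 1) \<xi>"
      "\<And>x. x \<in> U \<Longrightarrow> thC \<theta> x * mfd \<omega> x * OmC \<theta> x ^ ?s = thC \<theta> x * \<xi> x * OmC \<theta> x ^ (?s + ?t + 1)"
      "\<And>x. x \<in> U \<Longrightarrow> gamma k (mfd \<omega>) x = thC \<theta> x * \<xi> x * OmC \<theta> x ^ ?t" by auto
    let ?\<xi> = "\<lambda>x. app (cmap Re (\<xi> x))"
    show ?thesis
      unfolding sol_def
    proof (intro exI[of _ ?\<xi>] conjI ballI)
      show "smf U (int n - int ?s - int ?t - 1) (mfd ?\<xi>)"
        unfolding mfd_app by (rule smf_cmap[OF contact_open[OF contact] bounded_linear_Re \<xi>(1)])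
      fix x assume x: "x \<in> U"
      show "mfd \<theta> x * mfd ?\<alpha> x * mfd (ext_deriv \<theta>) x ^ ?s = mfd \<theta> x * mfd ?\<xi> x * mfd (ext_deriv \<theta>) x ^ (?s + ?t + 1)"
        using \<xi>(2)[OF x] by (simp only: mfd_app mfd_form_Re cmap_Re_th_Om[OF contact x, symmetric])
      show "mfd \<eta> x = mfd \<theta> x * mfd ?\<xi> x * mfd (ext_deriv \<theta>) x ^ ?t"
        using \<xi>(3)[OF x] by (simp only: mfd_app m\<eta> cmap_Re_th_Om[OF contact x, symmetric])
    qed
  qed
  have "Gamma k ?\<alpha> = \<eta>"
    unfolding Gamma_def R
  proof (rule the_equality, intro conjI allI impI)
    show "\<eta> \<in> forms_on UNIV (int k - 1)"
      unfolding forms_on_mfd m\<eta> by (rule smf_cmap[OF open_UNIV bounded_linear_Re smf_gamma[OF open_UNIV s]])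
    show "\<exists>\<xi>. sol U \<theta> \<eta> \<xi>" if "contact_form U \<theta>" for U \<theta> by (rule real_solution[OF that])
  next
    fix \<zeta> assume \<zeta>: "\<zeta> \<in> forms_on UNIV (int k - 1) \<and> (\<forall>U \<theta>. contact_form U \<theta> \<longrightarrow>
      (\<exists>\<xi>. sol U \<theta> \<zeta> \<xi>))"
    show "\<zeta> = \<eta>"
    proof (rule mfd_eqI)
      fix x
      obtain U \<theta> where contact: "contact_form U \<theta>" and x: "x \<in> U" using contact_form_exists[of x] by blast
      have rel: "gam_rel n (thC \<theta> x) (OmC \<theta> x) k (cmap complex_of_real (mfd ?\<alpha> x)) (cmap complex_of_real (mfd \<theta> x * f * mfd (ext_deriv \<theta>) x ^ ?t))"
        if "alt (int n - int ?s - int ?t - 1) f"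
          "mfd \<theta> x * mfd ?\<alpha> x * mfd (ext_deriv \<theta>) x ^ ?s = mfd \<theta> x * f * mfd (ext_deriv \<theta>) x ^ (?s + ?t + 1)" for f
        unfolding gam_rel_def th_Om_cmap[OF contact x, symmetric]
        using alt_cmap[OF of_real_linear that(1)] that(2)
        by (intro exI[of _ "cmap complex_of_real f"]) (simp only: th_Om_cmap[OF contact x] simp_thms)
      obtain \<xi> where \<xi>: "sol U \<theta> \<zeta> \<xi>" using \<zeta> contact by blast
      obtain \<xi>' where \<xi>': "sol U \<theta> \<eta> \<xi>'" using real_solution[OF contact] by blast
      have "cmap complex_of_real (mfd \<zeta> x) = cmap complex_of_real (mfd \<eta> x)"
        using cr_point.gam_rel_unique[OF cr_point_contact[OF contact x]
            rel[OF smf_alt[OF \<xi>[unfolded sol_def, THEN conjunct1] x]] rel[OF smf_alt[OF \<xi>'[unfolded sol_def, THEN conjunct1] x]]]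
          \<xi> \<xi>' x unfolding sol_def by simp
      then show "mfd \<zeta> x = mfd \<eta> x" by (rule cmap_of_real_inject)
    qed
  qed
  then show ?thesis by (simp add: m\<eta>)
qed

definition rproj :: "nat \<Rightarrow> ('a \<Rightarrow> 'm cform) \<Rightarrow> 'a \<Rightarrow> 'm cform" where
  "rproj k f x = f x - dm (gamma k f) x - gamma (k + 1) (dm f) x"

lemma rproj_combination:
  assumes f: "smf UNIV (int k) f" and g: "smf UNIV (int k) g"
  shows "rproj k (\<lambda>x. f x + sc c * g x) x = rproj k f x + sc c * rproj k g x"
proof -
  note O = open_UNIV UNIV_I
  have G: "gamma k (\<lambda>x. f x + sc c * g x) x = gamma k f x + sc c * gamma k g x"
    if "smf UNIV (int k) f" "smf UNIV (int k) g" for k f g x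
    by (simp only: gamma_add[OF open_UNIV that(1) UNIV_I smf_sc_mult[OF open_UNIV that(2)]] gamma_sc_mult[OF open_UNIV that(2) UNIV_I])
  have D: "dm (\<lambda>x. f x + sc c * g x) x = dm f x + sc c * dm g x"
    if "smf UNIV k f" "smf UNIV k g" for k f x and g :: "'a \<Rightarrow> 'm cform"
    by (simp only: dm_add[OF O that(1) smf_sc_mult[OF open_UNIV that(2)]] dm_sc_mult[OF O that(2)])
  have "dm (gamma k (\<lambda>x. f x + sc c * g x)) x = dm (gamma k f) x + sc c * dm (gamma k g) x"
    using dm_cong[OF O G[OF f g]] D[OF smf_gamma[OF open_UNIV f] smf_gamma[OF open_UNIV g]] by simp
  moreover have "gamma (k + 1) (dm (\<lambda>x. f x + sc c * g x)) x = gamma (k + 1) (dm f) x + sc c * gamma (k + 1) (dm g) x"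
    using gamma_cong[of "dm (\<lambda>x. f x + sc c * g x)" x "\<lambda>x. dm f x + sc c * dm g x", OF D[OF f g]]
      G[OF smf_dm_nat[OF open_UNIV f] smf_dm_nat[OF open_UNIV g]] by simp
  ultimately show ?thesis by (simp add: rproj_def algebra_simps)
qed

lemma rumin_projection_form_Re:
  assumes s: "smf UNIV (int k) (mfd \<omega>)"
  shows "mfd (rumin_projection k (form_Re \<omega>)) x = cmap Re (rproj k (mfd \<omega>) x)"
proof -
  have "mfd (ext_deriv (Gamma k (form_Re \<omega>))) x = dm (\<lambda>x. cmap Re (gamma k (mfd \<omega>) x)) x"
    unfolding dm_mfd[symmetric] by (rule dm_cong[OF open_UNIV UNIV_I Gamma_form_Re[OF s]])
  also have "\<dots> = cmap Re (dm (gamma k (mfd \<omega>)) x)"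
    by (rule dm_cmap[OF open_UNIV UNIV_I bounded_linear_Re smf_gamma[OF open_UNIV s]])
  finally have a: "mfd (ext_deriv (Gamma k (form_Re \<omega>))) x = cmap Re (dm (gamma k (mfd \<omega>)) x)" .
  have dm: "mfd (ext_deriv \<omega>) = dm (mfd \<omega>)" by (rule ext) (simp only: dm_mfd)
  then have "smf UNIV (int (k + 1)) (mfd (ext_deriv \<omega>))" using smf_dm_nat[OF open_UNIV s] by simp
  from Gamma_form_Re[OF this, of x]
  have "mfd (Gamma (k + 1) (ext_deriv (form_Re \<omega>))) x = cmap Re (gamma (k + 1) (dm (mfd \<omega>)) x)"
    by (simp only: ext_deriv_form_Re[OF s] dm)
  then show ?thesis
    by (simp only: rumin_projection_def mfd_diff a mfd_form_Re rproj_def cmap_diff[OF Re_linear])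
qed

lemma mfd_rumin_projection_complex:
  assumes s: "smf UNIV (int k) (mfd \<omega>)"
  shows "mfd (rumin_projection_complex k \<omega>) x = rproj k (mfd \<omega>) x"
proof -
  let ?\<omega> = "\<lambda>x vs. - \<i> * \<omega> x vs"
  \<comment> \<open>Minus \<i> times the form, written as the form plus a multiple of itself so that
    the linearity rule for \<open>rproj\<close> applies.\<close>
  have i: "mfd ?\<omega> = (\<lambda>x. mfd \<omega> x + sc (- \<i> - 1) * mfd \<omega> x)"
    by (rule ext, rule mform_eqI) (simp add: mfd_def algebra_simps)
  have "smf UNIV (int k) (mfd ?\<omega>)" unfolding i by (intro smf_add[OF open_UNIV s] smf_sc_mult[OF open_UNIV s])
  from rumin_projection_form_Re[OF this, of x]
  have "mfd (rumin_projection k (form_Im \<omega>)) x = cmap Re (rproj k (mfd \<omega>) x + sc (- \<i> - 1) * rproj k (mfd \<omega>) x)"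
    unfolding form_Im_eq by (simp only: i rproj_combination[OF s s])
  also have "\<dots> = cmap Im (rproj k (mfd \<omega>) x)" by (rule mform_eqI) simp
  finally have Im: "mfd (rumin_projection k (form_Im \<omega>)) x = cmap Im (rproj k (mfd \<omega>) x)" .
  show ?thesis
  proof (rule mform_eqI)
    fix vs
    show "app (mfd (rumin_projection_complex k \<omega>) x) vs = app (rproj k (mfd \<omega>) x) vs"
      using arg_cong[OF Im, of "\<lambda>f. app f vs"] arg_cong[OF rumin_projection_form_Re[OF s, of x], of "\<lambda>f. app f vs"]
      by (simp add: mfd_def rumin_projection_complex_def form_Complex_def)
  qed
qed

end

section \<open>Projection to Rumin forms, filtration and the product on cohomology\<close>

declare kills.simps(2) [simp del]

context CR_manifold
begin

lemmas UNIV_at = open_UNIV UNIV_I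

definition fil :: "nat \<Rightarrow> ('a \<Rightarrow> 'm cform) \<Rightarrow> bool" where
  "fil a f \<longleftrightarrow> (\<forall>x. kills (T01 x) a (f x))"

lemma fil_combination: "fil a f \<Longrightarrow> fil a g \<Longrightarrow> fil a (\<lambda>x. f x + sc c * g x)"
  unfolding fil_def using kills_add kills_sc_mult by blast

lemma fil_mono: "fil a f \<Longrightarrow> a \<le> b \<Longrightarrow> fil b f"
  unfolding fil_def using kills_mono by blast

lemma fil_mult: "fil a f \<Longrightarrow> fil b g \<Longrightarrow> a + b \<le> Suc c \<Longrightarrow> fil c (\<lambda>x. f x * g x)"
  unfolding fil_def using kills_mult_le by blast

lemma fil_zero: "fil a (\<lambda>x. 0)"
  by (simp add: fil_def)

lemma smf_combination:
  "smf UNIV k f \<Longrightarrow> smf UNIV k g \<Longrightarrow> smf UNIV k (\<lambda>x. f x + sc c * g x)" for f g :: "'a \<Rightarrow> 'm cform"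
  by (intro smf_add[OF open_UNIV] smf_sc_mult[OF open_UNIV])

lemma dm_combination:
  fixes f g :: "'a \<Rightarrow> 'm cform"
  assumes "smf UNIV k f" "smf UNIV k g"
  shows "dm (\<lambda>x. f x + sc c * g x) x = dm f x + sc c * dm g x"
  by (simp only: dm_add[OF UNIV_at assms(1) smf_sc_mult[OF open_UNIV assms(2)]] dm_sc_mult[OF UNIV_at assms(2)])

lemma fil_dm:
  fixes f :: "'a \<Rightarrow> 'm cform"
  assumes s: "smf UNIV k f" and f: "fil a f"
  shows "fil (Suc a) (dm f)"
proof (cases "k < 0")
  case True
  then have "f x = 0" for x using alt_neg[OF smf_alt[OF s UNIV_I]] by blast
  then have "dm f x = 0" for x using dm_cong[OF UNIV_at, of f "\<lambda>x. 0"] dm_0[OF UNIV_at] by simp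
  then show ?thesis by (simp add: fil_def)
next
  case False
  then have "smf UNIV (int (nat k)) f" using s by simp
  then show ?thesis using dm_kills[OF open_UNIV] f unfolding fil_def by blast
qed

lemma fil_gamma: "smf UNIV (int k) f \<Longrightarrow> fil a f \<Longrightarrow> fil (a - 1) (gamma k f)"
  unfolding fil_def using gamma_kills[OF open_UNIV _ UNIV_I] by blast

context
  fixes k :: nat and f :: "'a \<Rightarrow> 'm cform" assumes s: "smf UNIV (int k) f"
begin

lemma dm_rproj: "dm (rproj k f) x = dm f x - dm (gamma (k + 1) (dm f)) x"
proof -
  note d = smf_dm_nat[OF open_UNIV s]
  have dg: "smf UNIV (int k) (dm (gamma k f))" using smf_dm[OF open_UNIV smf_gamma[OF open_UNIV s]] by simp
  have gd: "smf UNIV (int k) (gamma (k + 1) (dm f))" using smf_gamma[OF open_UNIV d] by simp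
  have "dm (rproj k f) x = dm (\<lambda>x. (f x - dm (gamma k f) x) - gamma (k + 1) (dm f) x) x"
    by (rule dm_cong[OF UNIV_at]) (simp add: rproj_def)
  also have "\<dots> = dm f x - dm (dm (gamma k f)) x - dm (gamma (k + 1) (dm f)) x"
    by (simp only: dm_diff[OF UNIV_at smf_diff[OF open_UNIV s dg] gd] dm_diff[OF UNIV_at s dg])
  finally show ?thesis by (simp add: dm_dm[OF UNIV_at(1) smf_gamma[OF open_UNIV s]])
qed

lemma smf_rproj: "smf UNIV (int k) (rproj k f)"
proof -
  have "smf UNIV (int k) (dm (gamma k f))" "smf UNIV (int k) (gamma (k + 1) (dm f))"
    using smf_dm[OF open_UNIV smf_gamma[OF open_UNIV s]] smf_gamma[OF open_UNIV smf_dm_nat[OF open_UNIV s]] by simp_all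
  then show ?thesis unfolding rproj_def[abs_def] by (intro smf_diff[OF open_UNIV] s)
qed

lemma rproj_dm: "rproj (k + 1) (dm f) x = dm (rproj k f) x"
proof -
  note d = smf_dm_nat[OF open_UNIV s]
  have "gamma (k + 1 + 1) (dm (dm f)) x = 0"
    by (rule gamma_if_zero[OF open_UNIV smf_dm_nat[OF open_UNIV d] UNIV_I dm_dm[OF open_UNIV s UNIV_I]])
  then show ?thesis by (simp add: dm_rproj rproj_def)
qed

lemma gamma_gamma_zero: "gamma k (gamma (k + 1) (dm f)) x = 0"
proof -
  note d = smf_dm_nat[OF open_UNIV s]
  have gd: "smf UNIV (int k) (gamma (k + 1) (dm f))" using smf_gamma[OF open_UNIV d] by simp
  obtain U \<theta> where contact: "contact_form U \<theta>" "x \<in> U" using contact_form_exists[of x] by blast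
  show ?thesis
    unfolding gamma_eq_0_iff[OF open_UNIV gd UNIV_I contact] th_gamma[OF open_UNIV d UNIV_I contact] by simp
qed

text \<open>\<Gamma> of the projection is \<Gamma> - \<Gamma>d\<Gamma> - \<Gamma>\<Gamma>d, which
  vanishes because \<Gamma>d\<Gamma> = \<Gamma> and \<Gamma>\<Gamma>d = 0. For \<Gamma>d of the
  projection, dd = 0 leaves \<Gamma>d - \<Gamma>d\<Gamma>d, which vanishes for the same
  reason.\<close>

lemma rumin_on_rproj: "rumin_on UNIV k (rproj k f)"
  unfolding rumin_on_def
proof (intro conjI ballI)
  note d = smf_dm_nat[OF open_UNIV s]
  have dg: "smf UNIV (int k) (dm (gamma k f))" using smf_dm[OF open_UNIV smf_gamma[OF open_UNIV s]] by simp
  have gd: "smf UNIV (int k) (gamma (k + 1) (dm f))" using smf_gamma[OF open_UNIV d] by simp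
  show "smf UNIV (int k) (rproj k f)" by (rule smf_rproj)
  fix x
  have "gamma k (rproj k f) x = gamma k f x - gamma k (dm (gamma k f)) x - gamma k (gamma (k + 1) (dm f)) x"
    unfolding rproj_def[abs_def]
    by (simp only: gamma_diff[OF open_UNIV smf_diff[OF open_UNIV s dg] UNIV_I gd] gamma_diff[OF open_UNIV s UNIV_I dg])
  then show "gamma k (rproj k f) x = 0"
    by (simp add: gamma_dm_gamma[OF open_UNIV s UNIV_I] gamma_gamma_zero[unfolded Suc_eq_plus1[symmetric]])
  have "gamma (k + 1) (dm (rproj k f)) x = gamma (k + 1) (\<lambda>x. dm f x - dm (gamma (k + 1) (dm f)) x) x"
    by (rule gamma_cong) (rule dm_rproj)
  then show "gamma (k + 1) (dm (rproj k f)) x = 0"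
    by (simp only: gamma_diff[OF open_UNIV d UNIV_I smf_dm_nat[OF open_UNIV gd]] gamma_dm_gamma[OF open_UNIV d UNIV_I] diff_self)
qed

lemma fil_rproj:
  assumes f: "fil a f"
  shows "fil a (rproj k f)"
proof (cases a)
  \<comment> \<open>Index 0 is separate because \<open>a - 1\<close> truncates; a form in the zeroth
    step is identically zero.\<close>
  case 0
  then have z: "f x = 0" for x using f by (simp add: fil_def)
  have dz: "dm f x = 0" for x using dm_cong[OF UNIV_at z] dm_0[OF UNIV_at] by simp
  have "gamma k f x = 0" for x by (rule gamma_if_zero[OF open_UNIV s UNIV_I z])
  from dm_cong[OF UNIV_at this] have "dm (gamma k f) x = 0" for x using dm_0[OF UNIV_at] by simp
  moreover have "gamma (k + 1) (dm f) x = 0" for x by (rule gamma_if_zero[OF open_UNIV smf_dm_nat[OF open_UNIV s] UNIV_I dz])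
  ultimately show ?thesis using z by (simp add: fil_def rproj_def)
next
  case (Suc b)
  have "fil a (dm (gamma k f))"
    using fil_dm[OF smf_gamma[OF open_UNIV s] fil_gamma[OF s f]] Suc by simp
  moreover have "fil a (gamma (k + 1) (dm f))"
    using fil_gamma[OF smf_dm_nat[OF open_UNIV s] fil_dm[OF s f]] by simp
  ultimately show ?thesis using f unfolding fil_def rproj_def by (simp add: kills_diff)
qed

lemma rproj_if_rumin: "rumin_on UNIV k f \<Longrightarrow> rproj k f x = f x"
proof -
  assume r: "rumin_on UNIV k f"
  then have "gamma k f x = 0" "gamma (k + 1) (dm f) x = 0" for x unfolding rumin_on_def by auto
  moreover from dm_cong[OF UNIV_at this(1)] have "dm (gamma k f) x = 0" using dm_0[OF UNIV_at] by simp
  ultimately show ?thesis by (simp add: rproj_def)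
qed

end

lemma rumin_on_dm:
  assumes f: "rumin_on UNIV k f"
  shows "rumin_on UNIV (k + 1) (dm f)"
proof -
  note s = rumin_on_smf[OF f]
  note d = smf_dm_nat[OF open_UNIV s]
  have "gamma (k + 1 + 1) (dm (dm f)) x = 0" for x
    by (rule gamma_if_zero[OF open_UNIV smf_dm_nat[OF open_UNIV d] UNIV_I dm_dm[OF open_UNIV s UNIV_I]])
  then show ?thesis using f d unfolding rumin_on_def by auto
qed

subsection \<open>The projections\<close>

lemma rumin_type_on_fil: "rumin_type_on UNIV k j f \<Longrightarrow> fil (Suc j) f"
  unfolding fil_def using rumin_type_on_kills[OF open_UNIV _ UNIV_I] by blast

lemma sum_atMost_reverse: "(\<Sum>i\<le>k. g (k - i)) = (\<Sum>i\<le>(k::nat). g i)"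
  by (rule sum.reindex_bij_witness[of _ "\<lambda>i. k - i" "\<lambda>i. k - i"]) auto

text \<open>\<open>proj_pq\<close> numbers the summands by the first index of the bidegree, the
  decomposition by the weight, which is the second; hence the reversal of the sum.\<close>

lemma mfd_proj_pq:
  assumes c: "\<And>j. rumin_type_on UNIV (p + q) j (c j)" and sum: "\<And>x. mfd \<omega> x = (\<Sum>j\<le>p + q. c j x)"
  shows "mfd (proj_pq p q \<omega>) = c q"
proof -
  define C where "C i = (\<lambda>x. app (c (p + q - i) x))" for i
  have C: "mfd (C i) = c (p + q - i)" for i unfolding C_def by (rule mfd_app)
  have "proj_pq p q \<omega> = C p"
    unfolding proj_pq_def
  proof (rule the_equality)
    have "\<omega> = (\<Sum>i\<le>p + q. C i)"
      by (rule mfd_eqI) (simp only: mfd_sum C sum sum_atMost_reverse[of "\<lambda>j. c j _"])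
    moreover have "\<forall>i\<le>p + q. C i \<in> rumin_pq i (p + q - i)" using c by (simp add: rumin_pq_iff C)
    ultimately show "\<exists>c. (\<forall>i\<le>p + q. c i \<in> rumin_pq i (p + q - i)) \<and> \<omega> = (\<Sum>i\<le>p + q. c i) \<and> C p = c p" by blast
  next
    fix \<eta> assume "\<exists>c. (\<forall>i\<le>p + q. c i \<in> rumin_pq i (p + q - i)) \<and> \<omega> = (\<Sum>i\<le>p + q. c i) \<and> \<eta> = c p"
    then obtain c' where c': "\<And>i. i \<le> p + q \<Longrightarrow> c' i \<in> rumin_pq i (p + q - i)" "\<omega> = (\<Sum>i\<le>p + q. c' i)" "\<eta> = c' p" by blast
    define e where "e j = (if j \<le> p + q then mfd (c' (p + q - j)) else (\<lambda>x. 0))" for j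
    have e: "rumin_type_on UNIV (p + q) j (e j)" for j
    proof (cases "j \<le> p + q")
      case True
      then show ?thesis using c'(1)[of "p + q - j"] by (simp add: e_def rumin_pq_iff)
    next
      case False
      then show ?thesis using rumin_type_on_0[OF open_UNIV] by (simp add: e_def)
    qed
    have "(\<Sum>j\<le>p + q. e j x) = (\<Sum>j\<le>p + q. c j x)" for x
    proof -
      have "(\<Sum>j\<le>p + q. e j x) = (\<Sum>j\<le>p + q. mfd (c' (p + q - j)) x)" by (rule sum.cong) (auto simp: e_def)
      also have "\<dots> = mfd \<omega> x" unfolding c'(2) mfd_sum by (rule sum_atMost_reverse)
      finally show ?thesis by (simp only: sum)
    qed
    from rumin_type_unique'[where e = e and e' = c, OF UNIV_at e c this, of q]
    have "mfd (c' p) x = c q x" for x by (simp add: e_def)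
    then show "\<eta> = C p" unfolding c'(3) by (intro mfd_eqI) (simp add: C)
  qed
  then show ?thesis by (simp add: C)
qed

context
  fixes p q :: nat and \<omega> :: "('a, real^'m, complex) form"
  assumes r: "rumin_on UNIV (p + q) (mfd \<omega>)"
begin

lemma proj_decomposition:
  assumes "fil a (mfd \<omega>)"
  obtains c where "\<And>j. rumin_type_on UNIV (p + q) j (c j)" "\<And>j x. a \<le> j \<Longrightarrow> c j x = 0"
    "\<And>x. mfd \<omega> x = (\<Sum>j\<le>p + q. c j x)" "mfd (proj_pq p q \<omega>) = c q"
proof -
  have "\<exists>c. (\<forall>j. rumin_type_on UNIV (p + q) j (c j)) \<and> (\<forall>j x. a \<le> j \<longrightarrow> c j x = 0) \<and> (\<forall>x. mfd \<omega> x = (\<Sum>j\<le>p + q. c j x))"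
    by (rule rumin_decomposition[OF r]) (use assms in \<open>simp add: fil_def\<close>)
  then obtain c where c: "\<And>j. rumin_type_on UNIV (p + q) j (c j)" "\<And>j x. a \<le> j \<Longrightarrow> c j x = 0"
    "\<And>x. mfd \<omega> x = (\<Sum>j\<le>p + q. c j x)" by blast
  show ?thesis by (rule that[OF c mfd_proj_pq[OF c(1,3)]])
qed

lemma fil_top: "fil (Suc (p + q)) (mfd \<omega>)"
  unfolding fil_def using kills_if_degree_less[OF smf_alt[OF rumin_on_smf[OF r] UNIV_I]] by simp

lemma proj_pq_type: "rumin_type_on UNIV (p + q) q (mfd (proj_pq p q \<omega>))"
  by (rule proj_decomposition[OF fil_top]) simp

lemma proj_pq_remainder:
  assumes "fil (Suc q) (mfd \<omega>)"
  shows "fil q (\<lambda>x. mfd \<omega> x - mfd (proj_pq p q \<omega>) x)"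
proof -
  obtain c where c: "\<And>j. rumin_type_on UNIV (p + q) j (c j)" "\<And>j x. Suc q \<le> j \<Longrightarrow> c j x = 0"
    "\<And>x. mfd \<omega> x = (\<Sum>j\<le>p + q. c j x)" "mfd (proj_pq p q \<omega>) = c q" by (rule proj_decomposition[OF assms]) (rule that)
  have "kills (T01 x) q (c j x)" if "j \<noteq> q" for j x
  proof (cases "j < q")
    case True
    then show ?thesis using fil_mono[OF rumin_type_on_fil[OF c(1)], of j q] by (simp add: fil_def)
  next
    case False
    then show ?thesis using c(2)[of j x] that by simp
  qed
  then have "kills (T01 x) q (\<Sum>j\<in>{..p + q} - {q}. c j x)" for x by (intro kills_sum) simp
  moreover have "mfd \<omega> x - mfd (proj_pq p q \<omega>) x = (\<Sum>j\<in>{..p + q} - {q}. c j x)" for x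
    unfolding c(3,4) by (subst sum.remove[of "{..p + q}" q]) auto
  ultimately show ?thesis by (simp add: fil_def)
qed

lemma proj_pq_zero:
  assumes "fil q (mfd \<omega>)"
  shows "proj_pq p q \<omega> = 0"
proof (rule mfd_eqI)
  fix x
  obtain c where "\<And>j x. q \<le> j \<Longrightarrow> c j x = 0" "mfd (proj_pq p q \<omega>) = c q" by (rule proj_decomposition[OF assms]) (rule that)
  then show "mfd (proj_pq p q \<omega>) x = mfd 0 x" by (simp add: mfd_0)
qed

end

lemma proj_pq_diff:
  assumes r: "rumin_on UNIV (p + q) (mfd \<omega>)" "rumin_on UNIV (p + q) (mfd \<eta>)"
  shows "proj_pq p q (\<omega> - \<eta>) = proj_pq p q \<omega> - proj_pq p q \<eta>"
proof (rule mfd_eqI)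
  fix x
  obtain c where c: "\<And>j. rumin_type_on UNIV (p + q) j (c j)" "\<And>x. mfd \<omega> x = (\<Sum>j\<le>p + q. c j x)"
    "mfd (proj_pq p q \<omega>) = c q" by (rule proj_decomposition[OF r(1) fil_top[OF r(1)]]) (rule that)
  obtain c' where c': "\<And>j. rumin_type_on UNIV (p + q) j (c' j)" "\<And>x. mfd \<eta> x = (\<Sum>j\<le>p + q. c' j x)"
    "mfd (proj_pq p q \<eta>) = c' q" by (rule proj_decomposition[OF r(2) fil_top[OF r(2)]]) (rule that)
  have "mfd (proj_pq p q (\<omega> - \<eta>)) = (\<lambda>x. c q x + sc (- 1) * c' q x)"
  proof (rule mfd_proj_pq[of p q "\<lambda>j x. c j x + sc (- 1) * c' j x"])
    show "rumin_type_on UNIV (p + q) j (\<lambda>x. c j x + sc (- 1) * c' j x)" for j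
      by (rule rumin_type_on_combination[OF open_UNIV c(1) c'(1)])
  qed (simp add: mfd_diff c c' sc_uminus sum_subtractf)
  then show "mfd (proj_pq p q (\<omega> - \<eta>)) x = mfd (proj_pq p q \<omega> - proj_pq p q \<eta>) x"
    by (simp add: mfd_diff c c' sc_uminus)
qed

lemma proj_pq_ident:
  assumes "rumin_type_on UNIV (p + q) q (mfd \<omega>)"
  shows "proj_pq p q \<omega> = \<omega>"
proof -
  have "mfd (proj_pq p q \<omega>) = (if q = q then mfd \<omega> else (\<lambda>x. 0))"
  proof (rule mfd_proj_pq[of p q "\<lambda>j. if j = q then mfd \<omega> else (\<lambda>x. 0)"])
    show "rumin_type_on UNIV (p + q) j (if j = q then mfd \<omega> else (\<lambda>x. 0))" for j
      using assms rumin_type_on_0[OF open_UNIV] by simp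
    show "mfd \<omega> x = (\<Sum>j\<le>p + q. (if j = q then mfd \<omega> else (\<lambda>x. 0)) x)" for x
      by (subst sum.remove[of _ q]) simp_all
  qed
  then show ?thesis by (intro mfd_eqI) simp
qed

subsection \<open>Cocycles and coboundaries in terms of the filtration\<close>

text \<open>\<open>exact_mod p q\<close> is F q + d(F q) in degree p + q, and
  \<open>closed_mod p q\<close> is the space of w in F (q + 1) with dw in F (q + 1). The degree of
  \<open>v\<close> is an integer, so \<open>v\<close> vanishes when p + q = 0.\<close>

definition exact_mod :: "nat \<Rightarrow> nat \<Rightarrow> ('a \<Rightarrow> 'm cform) \<Rightarrow> bool" where
  "exact_mod p q f \<longleftrightarrow> (\<exists>e v. smf UNIV (int (p + q)) e \<and> fil q e \<and> smf UNIV (int (p + q) - 1) v \<and> fil q v \<and>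
     f = (\<lambda>x. e x + dm v x))"

definition closed_mod :: "nat \<Rightarrow> nat \<Rightarrow> ('a \<Rightarrow> 'm cform) \<Rightarrow> bool" where
  "closed_mod p q f \<longleftrightarrow> smf UNIV (int (p + q)) f \<and> fil (Suc q) f \<and> fil (Suc q) (dm f)"

lemma exact_mod_intro:
  assumes "smf UNIV (int (p + q)) e" "fil q e" "smf UNIV (int (p + q) - 1) v" "fil q v" "f = (\<lambda>x. e x + dm v x)"
  shows "exact_mod p q f"
  unfolding exact_mod_def using assms by blast

lemma exact_modI: "smf UNIV (int (p + q)) f \<Longrightarrow> fil q f \<Longrightarrow> exact_mod p q f"
  unfolding exact_mod_def
  by (intro exI[of _ f] exI[of _ "\<lambda>x. 0"]) (simp add: smf_0[OF open_UNIV] fil_zero dm_0[OF UNIV_at])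

lemma exact_mod_combination:
  assumes "exact_mod p q f" "exact_mod p q g"
  shows "exact_mod p q (\<lambda>x. f x + sc c * g x)"
proof -
  obtain e v where e: "smf UNIV (int (p + q)) e" "fil q e" "smf UNIV (int (p + q) - 1) v" "fil q v" "f = (\<lambda>x. e x + dm v x)"
    using assms(1) unfolding exact_mod_def by blast
  obtain e' v' where e': "smf UNIV (int (p + q)) e'" "fil q e'" "smf UNIV (int (p + q) - 1) v'" "fil q v'" "g = (\<lambda>x. e' x + dm v' x)"
    using assms(2) unfolding exact_mod_def by blast
  have eq: "(\<lambda>x. f x + sc c * g x) = (\<lambda>x. (e x + sc c * e' x) + dm (\<lambda>x. v x + sc c * v' x) x)"
    unfolding e(5) e'(5) dm_combination[OF e(3) e'(3)] by (simp add: algebra_simps)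
  show ?thesis
    by (rule exact_mod_intro[OF smf_combination[OF e(1) e'(1)] fil_combination[OF e(2) e'(2)]
        smf_combination[OF e(3) e'(3)] fil_combination[OF e(4) e'(4)] eq])
qed

lemma exact_mod_diff: "exact_mod p q f \<Longrightarrow> exact_mod p q g \<Longrightarrow> exact_mod p q (\<lambda>x. f x - g x)"
  using exact_mod_combination[of p q f g "- 1"] by (simp add: sc_uminus)

lemma exact_mod_add: "exact_mod p q f \<Longrightarrow> exact_mod p q g \<Longrightarrow> exact_mod p q (\<lambda>x. f x + g x)"
  using exact_mod_combination[of p q f g 1] by simp

lemma exact_mod_rproj:
  assumes w: "closed_mod p q w"
  shows "exact_mod p q (\<lambda>x. rproj (p + q) w x - w x)"
proof -
  let ?k = "p + q"
  have s: "smf UNIV (int ?k) w" and f: "fil (Suc q) w" "fil (Suc q) (dm w)" using w unfolding closed_mod_def by auto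
  \<comment> \<open>The term -\<Gamma>dw supplies the part in F q and v = -\<Gamma>w the exact part,
    each index having dropped by one.\<close>
  let ?e = "\<lambda>x. 0 + sc (- 1) * gamma (?k + 1) (dm w) x" and ?v = "\<lambda>x. 0 + sc (- 1) * gamma ?k w x"
  note g = smf_gamma[OF open_UNIV s]
  have h: "smf UNIV (int ?k) (gamma (?k + 1) (dm w))" using smf_gamma[OF open_UNIV smf_dm_nat[OF open_UNIV s]] by simp
  have eq: "(\<lambda>x. rproj ?k w x - w x) = (\<lambda>x. ?e x + dm ?v x)"
    unfolding dm_combination[OF smf_0[OF open_UNIV] g] by (simp add: rproj_def dm_0[OF UNIV_at] sc_uminus algebra_simps)
  have k: "fil q (gamma ?k w)" "fil q (gamma (?k + 1) (dm w))"
    using fil_gamma[OF s f(1)] fil_gamma[OF smf_dm_nat[OF open_UNIV s] f(2)] by simp_all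
  show ?thesis
    by (rule exact_mod_intro[OF smf_combination[OF smf_0[OF open_UNIV] h] fil_combination[OF fil_zero k(2)]
        smf_combination[OF smf_0[OF open_UNIV] g] fil_combination[OF fil_zero k(1)] eq])
qed

lemma closed_mod_rproj: "closed_mod p q w \<Longrightarrow> closed_mod p q (rproj (p + q) w)"
proof -
  assume w: "closed_mod p q w"
  then have s: "smf UNIV (int (p + q)) w" and f: "fil (Suc q) w" "fil (Suc q) (dm w)" unfolding closed_mod_def by auto
  have "fil (Suc q) (rproj (p + q + 1) (dm w))" by (rule fil_rproj[OF smf_dm_nat[OF open_UNIV s] f(2)])
  then have "fil (Suc q) (dm (rproj (p + q) w))" by (simp add: rproj_dm[OF s, unfolded Suc_eq_plus1[symmetric]] fil_def)
  then show ?thesis unfolding closed_mod_def using smf_rproj[OF s] fil_rproj[OF s f(1)] by blast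
qed

lemma closed_mod_dm:
  assumes "closed_mod p q f" "smf UNIV (int (p + q)) g" "fil q g"
  shows "closed_mod p q (\<lambda>x. f x + sc c * g x)"
proof -
  have s: "smf UNIV (int (p + q)) f" and f: "fil (Suc q) f" "fil (Suc q) (dm f)" using assms(1) unfolding closed_mod_def by auto
  have "fil (Suc q) (\<lambda>x. dm f x + sc c * dm g x)" by (rule fil_combination[OF f(2) fil_dm[OF assms(2,3)]])
  then have "fil (Suc q) (dm (\<lambda>x. f x + sc c * g x))" by (simp add: dm_combination[OF s assms(2)] fil_def)
  then show ?thesis
    unfolding closed_mod_def using smf_combination[OF s assms(2)] fil_combination[OF f(1) fil_mono[OF assms(3)]] by simp
qed

lemma smf_product:
  "smf UNIV k f \<Longrightarrow> smf UNIV l g \<Longrightarrow> m = k + l \<Longrightarrow> smf UNIV m (\<lambda>x. f x * g x)" for f g :: "'a \<Rightarrow> 'm cform"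
  using smf_mult[OF open_UNIV] by blast

lemma fil_ginv: "fil a f \<Longrightarrow> fil a (\<lambda>x. ginv (f x))"
  unfolding fil_def using kills_ginv by blast

lemma closed_mod_mult:
  assumes "closed_mod p q f" "closed_mod r s g"
  shows "closed_mod (p + r) (q + s) (\<lambda>x. f x * g x)"
proof -
  have f: "smf UNIV (int (p + q)) f" "fil (Suc q) f" "fil (Suc q) (dm f)"
    and g: "smf UNIV (int (r + s)) g" "fil (Suc s) g" "fil (Suc s) (dm g)" using assms unfolding closed_mod_def by auto
  have "fil (Suc (q + s)) (\<lambda>x. dm f x * g x)" "fil (Suc (q + s)) (\<lambda>x. ginv (f x) * dm g x)"
    by (rule fil_mult[OF f(3) g(2)] fil_mult[OF fil_ginv[OF f(2)] g(3)]; simp)+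
  then have "fil (Suc (q + s)) (dm (\<lambda>x. f x * g x))"
    by (simp add: dm_mult[OF UNIV_at f(1) g(1)] fil_def kills_add)
  then show ?thesis
    unfolding closed_mod_def using smf_product[OF f(1) g(1), of "int (p + r + (q + s))"] fil_mult[OF f(2) g(2)] by simp
qed

text \<open>With f = e + dv, the Leibniz rule moves the differential: f \<and> g is e \<and> g minus
  the signed v \<and> dg, plus d(v \<and> g). That dg stays in F (s + 1) is what keeps the middle
  term in F (q + s).\<close>

lemma exact_mod_mult_left:
  assumes "exact_mod p q f" "closed_mod r s g"
  shows "exact_mod (p + r) (q + s) (\<lambda>x. f x * g x)"
proof -
  obtain e v where e: "smf UNIV (int (p + q)) e" "fil q e" "smf UNIV (int (p + q) - 1) v" "fil q v" "f = (\<lambda>x. e x + dm v x)"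
    using assms(1) unfolding exact_mod_def by blast
  have g: "smf UNIV (int (r + s)) g" "fil (Suc s) g" "fil (Suc s) (dm g)" using assms(2) unfolding closed_mod_def by auto
  have eq: "(\<lambda>x. f x * g x) = (\<lambda>x. (e x * g x + sc (- 1) * (ginv (v x) * dm g x)) + dm (\<lambda>x. v x * g x) x)"
    unfolding e(5) by (simp add: dm_mult[OF UNIV_at e(3) g(1)] sc_uminus algebra_simps)
  have s: "smf UNIV (int (p + r + (q + s))) (\<lambda>x. e x * g x)"
    "smf UNIV (int (p + r + (q + s))) (\<lambda>x. ginv (v x) * dm g x)"
    "smf UNIV (int (p + r + (q + s)) - 1) (\<lambda>x. v x * g x)"
    by (rule smf_product[OF e(1) g(1)] smf_product[OF smf_ginv[OF open_UNIV e(3)] smf_dm[OF open_UNIV g(1)]]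
        smf_product[OF e(3) g(1)]; simp)+
  have k: "fil (q + s) (\<lambda>x. e x * g x)" "fil (q + s) (\<lambda>x. ginv (v x) * dm g x)" "fil (q + s) (\<lambda>x. v x * g x)"
    by (rule fil_mult[OF e(2) g(2)] fil_mult[OF fil_ginv[OF e(4)] g(3)] fil_mult[OF e(4) g(2)]; simp)+
  show ?thesis
    by (rule exact_mod_intro[OF smf_combination[OF s(1,2)] fil_combination[OF k(1,2)] s(3) k(3) eq])
qed

lemma exact_mod_mult_right:
  assumes "closed_mod p q f" "exact_mod r s g"
  shows "exact_mod (p + r) (q + s) (\<lambda>x. f x * g x)"
proof -
  obtain e v where e: "smf UNIV (int (r + s)) e" "fil s e" "smf UNIV (int (r + s) - 1) v" "fil s v" "g = (\<lambda>x. e x + dm v x)"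
    using assms(2) unfolding exact_mod_def by blast
  have f: "smf UNIV (int (p + q)) f" "fil (Suc q) f" "fil (Suc q) (dm f)" using assms(1) unfolding closed_mod_def by auto
  \<comment> \<open>The sign by which the grading involution acts on a form of the degree of
    \<open>f\<close>.\<close>
  define \<epsilon> :: complex where "\<epsilon> = (if even (p + q) then 1 else - 1)"
  have gi: "ginv (f x) = sc \<epsilon> * f x" for x
    using alt_ginv[OF smf_alt[OF f(1) UNIV_I], of x] by (simp add: \<epsilon>_def sc_uminus)
  have "f x * dm v x = sc \<epsilon> * (ginv (f x) * dm v x)" for x
    unfolding gi by (simp add: mult.assoc sc_mult_mult \<epsilon>_def)
  then have fd: "f x * dm v x = sc \<epsilon> * dm (\<lambda>x. f x * v x) x + sc (- \<epsilon>) * (dm f x * v x)" for x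
    by (simp add: dm_mult[OF UNIV_at f(1) e(3)] sc_uminus algebra_simps)
  have fv: "smf UNIV (int (p + r + (q + s)) - 1) (\<lambda>x. f x * v x)" by (rule smf_product[OF f(1) e(3)]) simp
  have eq: "(\<lambda>x. f x * g x) = (\<lambda>x. (f x * e x + sc (- \<epsilon>) * (dm f x * v x)) + dm (\<lambda>x. 0 + sc \<epsilon> * (f x * v x)) x)"
    unfolding e(5) dm_combination[OF smf_0[OF open_UNIV] fv] by (simp add: distrib_left fd dm_0[OF UNIV_at] add_ac)
  have s: "smf UNIV (int (p + r + (q + s))) (\<lambda>x. f x * e x)" "smf UNIV (int (p + r + (q + s))) (\<lambda>x. dm f x * v x)"
    by (rule smf_product[OF f(1) e(1)] smf_product[OF smf_dm[OF open_UNIV f(1)] e(3)]; simp)+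
  have k: "fil (q + s) (\<lambda>x. f x * e x)" "fil (q + s) (\<lambda>x. dm f x * v x)" "fil (q + s) (\<lambda>x. f x * v x)"
    by (rule fil_mult[OF f(2) e(2)] fil_mult[OF f(3) e(4)] fil_mult[OF f(2) e(4)]; simp)+
  show ?thesis
    by (rule exact_mod_intro[OF smf_combination[OF s] fil_combination[OF k(1,2)]
        smf_combination[OF smf_0[OF open_UNIV] fv] fil_combination[OF fil_zero k(3)] eq])
qed

lemma mfd_ext_deriv: "mfd (ext_deriv \<omega>) = dm (mfd \<omega>)" for \<omega> :: "('a, real^'m, complex) form"
  by (rule ext) (simp only: dm_mfd)

lemma mfd_minus: "mfd (\<omega> - \<eta>) = (\<lambda>x. mfd \<omega> x - mfd \<eta> x)" for \<omega> :: "('a, real^'m, complex) form"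
  by (rule ext) (rule mfd_diff)

lemma rumin_type_on_rumin: "rumin_type_on V k j f \<Longrightarrow> rumin_on V k f" by (simp add: rumin_type_on_def)

text \<open>The differential of a form of type (p, q) is a Rumin form in F (q + 2), and there the
  projection to type (p, q + 1) is zero exactly on the elements of F (q + 1).\<close>

lemma cocycles_iff: "\<omega> \<in> cocycles p q \<longleftrightarrow> rumin_type_on UNIV (p + q) q (mfd \<omega>) \<and> closed_mod p q (mfd \<omega>)"
proof (cases "rumin_type_on UNIV (p + q) q (mfd \<omega>)")
  case True
  note r = rumin_type_on_rumin[OF True]
  note s = rumin_on_smf[OF r]
  note f = rumin_type_on_fil[OF True]
  have d: "rumin_on UNIV (p + Suc q) (mfd (ext_deriv \<omega>))"
    using rumin_on_dm[OF r] by (simp add: mfd_ext_deriv)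
  have f2: "fil (Suc (Suc q)) (mfd (ext_deriv \<omega>))" unfolding mfd_ext_deriv by (rule fil_dm[OF s f])
  have "dbar p q \<omega> = 0 \<longleftrightarrow> fil (Suc q) (mfd (ext_deriv \<omega>))"
  proof
    assume "dbar p q \<omega> = 0"
    then have "mfd (proj_pq p (Suc q) (ext_deriv \<omega>)) x = 0" for x by (simp add: dbar_def mfd_0)
    with proj_pq_remainder[OF d f2] show "fil (Suc q) (mfd (ext_deriv \<omega>))" by (simp add: fil_def)
  next
    assume "fil (Suc q) (mfd (ext_deriv \<omega>))"
    from proj_pq_zero[OF d this] show "dbar p q \<omega> = 0" by (simp add: dbar_def)
  qed
  then show ?thesis using True s f by (simp add: cocycles_def rumin_pq_iff closed_mod_def mfd_ext_deriv)
qed (simp add: cocycles_def rumin_pq_iff)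

text \<open>For the converse, apply \<pi> to \<eta> = e + dv: this replaces e and v by Rumin forms
  in the same filtration steps. Then v is exchanged for its component \<zeta> of type (p, q - 1), at
  the cost of a remainder in F (q - 1), whose differential lies in F q. So \<eta> - d\<zeta> is in F
  q, and projecting to type (p, q) gives the claim.\<close>

lemma coboundaries_iff:
  assumes t: "rumin_type_on UNIV (p + q) q (mfd \<eta>)"
  shows "\<eta> \<in> coboundaries p q \<longleftrightarrow> exact_mod p q (mfd \<eta>)"
proof (cases q)
  case 0
  have "mfd \<eta> x = 0" if "exact_mod p 0 (mfd \<eta>)" for x
  proof -
    obtain e v where e: "fil 0 e" "fil 0 v" "mfd \<eta> = (\<lambda>x. e x + dm v x)" using \<open>exact_mod p 0 (mfd \<eta>)\<close> unfolding exact_mod_def by blast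
    then have "e x = 0" "v x = 0" for x by (simp_all add: fil_def)
    then show ?thesis using dm_cong[OF UNIV_at, of v "\<lambda>x. 0"] by (simp add: e(3) dm_0[OF UNIV_at])
  qed
  then have "exact_mod p 0 (mfd \<eta>) \<Longrightarrow> \<eta> = 0" by (intro mfd_eqI) (simp add: mfd_0)
  moreover have "exact_mod p 0 (mfd 0)" using exact_modI[OF smf_0[OF open_UNIV] fil_zero] by (simp add: mfd_0[abs_def])
  ultimately show ?thesis using 0 by (auto simp: coboundaries_def)
next
  case (Suc r)
  note \<eta> = rumin_type_on_rumin[OF t]
  have "exact_mod p q (mfd \<eta>)" if \<zeta>: "\<zeta> \<in> rumin_pq p r" "\<eta> = dbar p r \<zeta>" for \<zeta>
  proof -
    have t': "rumin_type_on UNIV (p + r) r (mfd \<zeta>)" using \<zeta>(1) by (simp add: rumin_pq_iff)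
    note s = rumin_on_smf[OF rumin_type_on_rumin[OF t']]
    note f = rumin_type_on_fil[OF t']
    have d: "rumin_on UNIV (p + Suc r) (mfd (ext_deriv \<zeta>))"
      using rumin_on_dm[OF rumin_type_on_rumin[OF t']] by (simp add: mfd_ext_deriv)
    have "fil (Suc r) (\<lambda>x. dm (mfd \<zeta>) x - mfd \<eta> x)"
      using proj_pq_remainder[OF d] fil_dm[OF s f] by (simp add: mfd_ext_deriv \<zeta>(2) dbar_def)
    then have "exact_mod p q (\<lambda>x. dm (mfd \<zeta>) x - mfd \<eta> x)"
      using smf_diff[OF open_UNIV rumin_on_smf[OF d] rumin_on_smf[OF \<eta>[unfolded Suc]]]
      by (intro exact_modI) (simp_all add: Suc mfd_ext_deriv)
    moreover have "exact_mod p q (dm (mfd \<zeta>))"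
      unfolding exact_mod_def using s f
      by (intro exI[of _ "\<lambda>x. 0"] exI[of _ "mfd \<zeta>"]) (simp add: smf_0[OF open_UNIV] fil_zero Suc)
    ultimately show ?thesis using exact_mod_diff[of p q "dm (mfd \<zeta>)" "\<lambda>x. dm (mfd \<zeta>) x - mfd \<eta> x"] by simp
  qed
  moreover have "\<exists>\<zeta>\<in>rumin_pq p r. \<eta> = dbar p r \<zeta>" if ex: "exact_mod p q (mfd \<eta>)"
  proof -
    obtain e v where e: "smf UNIV (int (p + q)) e" "fil q e" "smf UNIV (int (p + r)) v" "fil q v" "mfd \<eta> = (\<lambda>x. e x + dm v x)"
      using ex unfolding exact_mod_def by (auto simp: Suc)
    define h where "h x = app (rproj (p + r) v x)" for x
    have mh: "mfd h = rproj (p + r) v" unfolding h_def by (rule mfd_app)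
    define \<zeta> where "\<zeta> = proj_pq p r h"
    have h: "rumin_on UNIV (p + r) (mfd h)" "fil (Suc r) (mfd h)"
      unfolding mh using rumin_on_rproj[OF e(3)] fil_rproj[OF e(3,4)] by (simp_all add: Suc)
    have t': "rumin_type_on UNIV (p + r) r (mfd \<zeta>)" unfolding \<zeta>_def by (rule proj_pq_type[OF h(1)])
    note r' = rumin_type_on_rumin[OF t']
    have d: "rumin_on UNIV (p + q) (mfd (ext_deriv \<zeta>))" using rumin_on_dm[OF r'] by (simp add: mfd_ext_deriv Suc)
    have dv: "smf UNIV (int (p + q)) (dm v)" using smf_dm_nat[OF open_UNIV e(3)] by (simp add: Suc)
    have "rproj (p + q) (\<lambda>x. e x + sc 1 * dm v x) x = rproj (p + q) e x + sc 1 * rproj (p + q) (dm v) x" for x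
      by (rule rproj_combination[OF e(1) dv])
    then have "mfd \<eta> x = rproj (p + q) e x + dm (mfd h) x" for x
      using rproj_if_rumin[OF rumin_on_smf[OF \<eta>] \<eta>, of x] rproj_dm[OF e(3), of x] by (simp add: mh Suc e(5))
    moreover have "dm (\<lambda>x. mfd h x - mfd \<zeta> x) x = dm (mfd h) x - dm (mfd \<zeta>) x" for x
      by (rule dm_diff[OF UNIV_at rumin_on_smf[OF h(1)] rumin_on_smf[OF r']])
    moreover have "fil q (dm (\<lambda>x. mfd h x - mfd \<zeta> x))"
      unfolding Suc by (rule fil_dm[OF smf_diff[OF open_UNIV rumin_on_smf[OF h(1)] rumin_on_smf[OF r']]])
        (use proj_pq_remainder[OF h] in \<open>simp add: \<zeta>_def\<close>)
    moreover have "fil q (rproj (p + q) e)" by (rule fil_rproj[OF e(1,2)])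
    ultimately have "fil q (\<lambda>x. mfd \<eta> x - dm (mfd \<zeta>) x)"
      unfolding fil_def by (metis (no_types, lifting) add_diff_eq kills_add)
    then have "fil q (mfd (\<eta> - ext_deriv \<zeta>))" by (simp add: mfd_minus mfd_ext_deriv)
    moreover have "rumin_on UNIV (p + q) (mfd (\<eta> - ext_deriv \<zeta>))"
      using rumin_on_combination[OF open_UNIV \<eta> d, of "- 1"] by (simp add: mfd_minus sc_uminus)
    ultimately have "proj_pq p q (\<eta> - ext_deriv \<zeta>) = 0" by (intro proj_pq_zero)
    then have "proj_pq p q \<eta> = proj_pq p q (ext_deriv \<zeta>)" by (simp add: proj_pq_diff[OF \<eta> d])
    then have "\<eta> = dbar p r \<zeta>" using proj_pq_ident[OF t] by (simp add: dbar_def Suc)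
    then show ?thesis using t' by (auto simp: rumin_pq_iff)
  qed
  ultimately show ?thesis by (auto simp: coboundaries_def Suc image_iff)
qed

lemma cohomologous_iff:
  "(\<omega>, \<omega>') \<in> cohomologous p q \<longleftrightarrow> \<omega> \<in> cocycles p q \<and> \<omega>' \<in> cocycles p q \<and> exact_mod p q (\<lambda>x. mfd \<omega> x - mfd \<omega>' x)"
proof -
  have "rumin_type_on UNIV (p + q) q (mfd (\<omega> - \<omega>'))" if "\<omega> \<in> cocycles p q" "\<omega>' \<in> cocycles p q"
    using rumin_type_on_combination[OF open_UNIV, of "p + q" q "mfd \<omega>" "mfd \<omega>'" "- 1"] that
    by (simp add: cocycles_iff mfd_minus sc_uminus)
  from coboundaries_iff[OF this] show ?thesis by (auto simp: cohomologous_def mfd_minus)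
qed

lemma equiv_cohomologous: "equiv (cocycles p q) (cohomologous p q)"
proof (rule equivI)
  show "cohomologous p q \<subseteq> cocycles p q \<times> cocycles p q" by (auto simp: cohomologous_def)
  show "refl_on (cocycles p q) (cohomologous p q)"
    using exact_modI[OF smf_0[OF open_UNIV] fil_zero] by (auto simp: refl_on_def cohomologous_iff)
  show "sym (cohomologous p q)"
  proof (rule symI)
    fix \<omega> \<omega>' assume "(\<omega>, \<omega>') \<in> cohomologous p q"
    then show "(\<omega>', \<omega>) \<in> cohomologous p q"
      using exact_mod_diff[OF exact_modI[OF smf_0[OF open_UNIV] fil_zero], of p q "\<lambda>x. mfd \<omega> x - mfd \<omega>' x"]
      by (simp add: cohomologous_iff)
  qed
  show "trans (cohomologous p q)"
  proof (rule transI)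
    fix \<omega> \<omega>' \<omega>'' assume "(\<omega>, \<omega>') \<in> cohomologous p q" "(\<omega>', \<omega>'') \<in> cohomologous p q"
    then show "(\<omega>, \<omega>'') \<in> cohomologous p q"
      using exact_mod_add[of p q "\<lambda>x. mfd \<omega> x - mfd \<omega>' x" "\<lambda>x. mfd \<omega>' x - mfd \<omega>'' x"]
      by (simp add: cohomologous_iff)
  qed
qed

text \<open>The correction by \<pi> is covered by \<open>exact_mod_rproj\<close>; the projection to
  the type then changes the result only by \<open>?y\<close> in F (q + s), which affects neither
  membership in \<open>closed_mod\<close> nor the class.\<close>

lemma
  assumes "\<omega> \<in> cocycles p q" "\<tau> \<in> cocycles r s"
  shows form_product_cocycle: "form_product p q r s \<omega> \<tau> \<in> cocycles (p + r) (q + s)"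
    and form_product_wedge: "exact_mod (p + r) (q + s) (\<lambda>x. mfd (form_product p q r s \<omega> \<tau>) x - mfd \<omega> x * mfd \<tau> x)"
proof -
  let ?P = "p + r" and ?Q = "q + s" and ?w = "\<lambda>x. mfd \<omega> x * mfd \<tau> x"
  have w: "closed_mod ?P ?Q ?w" using assms by (intro closed_mod_mult) (simp_all add: cocycles_iff)
  then have s: "smf UNIV (int (?P + ?Q)) ?w" by (simp add: closed_mod_def)
  define \<pi> where "\<pi> = rumin_projection_complex (?P + ?Q) (\<omega> \<^bold>\<and> \<tau>)"
  have mw: "mfd (\<omega> \<^bold>\<and> \<tau>) = ?w" by (rule ext) (rule mfd_wedge)
  have m\<pi>: "mfd \<pi> = rproj (?P + ?Q) ?w"
    unfolding \<pi>_def by (rule ext, subst mfd_rumin_projection_complex) (simp_all only: mw s)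
  have "p + q + r + s = ?P + ?Q" by simp
  then have fp: "form_product p q r s \<omega> \<tau> = proj_pq ?P ?Q \<pi>" by (simp only: form_product_def \<pi>_def)
  have r: "rumin_on UNIV (?P + ?Q) (mfd \<pi>)" unfolding m\<pi> by (rule rumin_on_rproj[OF s])
  have c: "closed_mod ?P ?Q (mfd \<pi>)" unfolding m\<pi> by (rule closed_mod_rproj[OF w])
  let ?y = "\<lambda>x. mfd \<pi> x - mfd (proj_pq ?P ?Q \<pi>) x"
  have y: "fil ?Q ?y" by (rule proj_pq_remainder[OF r]) (use c in \<open>simp add: closed_mod_def\<close>)
  note t = proj_pq_type[OF r]
  have sy: "smf UNIV (int (?P + ?Q)) ?y"
    by (rule smf_diff[OF open_UNIV rumin_on_smf[OF r] rumin_on_smf[OF rumin_type_on_rumin[OF t]]])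
  have "closed_mod ?P ?Q (\<lambda>x. mfd \<pi> x + sc (- 1) * ?y x)" by (rule closed_mod_dm[OF c sy y])
  then show "form_product p q r s \<omega> \<tau> \<in> cocycles ?P ?Q"
    using t by (simp add: fp cocycles_iff sc_uminus)
  have "exact_mod ?P ?Q (\<lambda>x. (mfd \<pi> x - ?w x) - ?y x)"
    unfolding m\<pi> by (intro exact_mod_diff exact_mod_rproj[OF w] exact_modI) (use sy y in \<open>simp_all only: m\<pi>\<close>)
  then show "exact_mod ?P ?Q (\<lambda>x. mfd (form_product p q r s \<omega> \<tau>) x - ?w x)"
    by (simp add: fp)
qed

lemma congruent2_form_product:
  "congruent2 (cohomologous p q) (cohomologous r s)
     (\<lambda>\<omega> \<tau>. cohomology_class (p + r) (q + s) (form_product p q r s \<omega> \<tau>))"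
proof (rule congruent2I')
  fix \<omega> \<omega>' \<tau> \<tau>' assume *: "(\<omega>, \<omega>') \<in> cohomologous p q" "(\<tau>, \<tau>') \<in> cohomologous r s"
  then have c: "\<omega> \<in> cocycles p q" "\<omega>' \<in> cocycles p q" "\<tau> \<in> cocycles r s" "\<tau>' \<in> cocycles r s"
    and e: "exact_mod p q (\<lambda>x. mfd \<omega> x - mfd \<omega>' x)" "exact_mod r s (\<lambda>x. mfd \<tau> x - mfd \<tau>' x)"
    by (simp_all add: cohomologous_iff)
  have m: "closed_mod p q (mfd \<omega>')" "closed_mod r s (mfd \<tau>)" using c by (simp_all add: cocycles_iff)
  let ?P = "p + r" and ?Q = "q + s"
  \<comment> \<open>The difference of the wedge products is telescoped as (\<omega> - \<omega>')
    \<and> \<tau> + \<omega>' \<and> (\<tau> - \<tau>').\<close>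
  from exact_mod_add[OF exact_mod_diff[OF form_product_wedge[OF c(1,3)] form_product_wedge[OF c(2,4)]]
      exact_mod_add[OF exact_mod_mult_left[OF e(1) m(2)] exact_mod_mult_right[OF m(1) e(2)]]]
  have "exact_mod ?P ?Q (\<lambda>x. mfd (form_product p q r s \<omega> \<tau>) x - mfd (form_product p q r s \<omega>' \<tau>') x)"
    by (simp add: algebra_simps)
  then have "(form_product p q r s \<omega> \<tau>, form_product p q r s \<omega>' \<tau>') \<in> cohomologous ?P ?Q"
    using form_product_cocycle c by (simp add: cohomologous_iff)
  then show "cohomology_class ?P ?Q (form_product p q r s \<omega> \<tau>) = cohomology_class ?P ?Q (form_product p q r s \<omega>' \<tau>')"
    unfolding cohomology_class_def by (rule equiv_class_eq[OF equiv_cohomologous])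
qed

lemma cohomology_product_class:
  assumes "\<omega> \<in> cocycles p q" "\<tau> \<in> cocycles r s"
  shows "cohomology_product p q r s (cohomology_class p q \<omega>) (cohomology_class r s \<tau>) =
    cohomology_class (p + r) (q + s) (form_product p q r s \<omega> \<tau>)"
  unfolding cohomology_product_def
  by (subst (1 2) cohomology_class_def)
    (rule UN_equiv_class2[OF equiv_cohomologous equiv_cohomologous congruent2_form_product assms])

text \<open>Either bracketing is congruent to the triple wedge product, because the congruence is
  stable under multiplication by cocycles on both sides.\<close>

lemma form_product_assoc:
  assumes "\<omega> \<in> cocycles p q" "\<tau> \<in> cocycles r s" "\<sigma> \<in> cocycles t u"
  shows "cohomology_class (p + r + t) (q + s + u) (form_product (p + r) (q + s) t u (form_product p q r s \<omega> \<tau>) \<sigma>) =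
    cohomology_class (p + r + t) (q + s + u) (form_product p q (r + t) (s + u) \<omega> (form_product r s t u \<tau> \<sigma>))"
proof -
  let ?P = "p + r + t" and ?Q = "q + s + u"
  let ?a = "form_product p q r s \<omega> \<tau>" and ?b = "form_product r s t u \<tau> \<sigma>"
  let ?l = "form_product (p + r) (q + s) t u ?a \<sigma>" and ?r = "form_product p q (r + t) (s + u) \<omega> ?b"
  note a = form_product_cocycle[OF assms(1,2)] and b = form_product_cocycle[OF assms(2,3)]
  have m: "closed_mod p q (mfd \<omega>)" "closed_mod t u (mfd \<sigma>)" using assms by (simp_all add: cocycles_iff)
  have l: "exact_mod ?P ?Q (\<lambda>x. mfd ?l x - mfd \<omega> x * mfd \<tau> x * mfd \<sigma> x)"
    using exact_mod_add[OF form_product_wedge[OF a assms(3)] exact_mod_mult_left[OF form_product_wedge[OF assms(1,2)] m(2)]]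
    by (simp add: left_diff_distrib)
  have r: "exact_mod ?P ?Q (\<lambda>x. mfd ?r x - mfd \<omega> x * mfd \<tau> x * mfd \<sigma> x)"
    using exact_mod_add[OF form_product_wedge[OF assms(1) b] exact_mod_mult_right[OF m(1) form_product_wedge[OF assms(2,3)]]]
    by (simp add: right_diff_distrib mult.assoc add.assoc)
  from exact_mod_diff[OF l r] have "exact_mod ?P ?Q (\<lambda>x. mfd ?l x - mfd ?r x)" by simp
  moreover have "?l \<in> cocycles ?P ?Q" "?r \<in> cocycles ?P ?Q"
    using form_product_cocycle[OF a assms(3)] form_product_cocycle[OF assms(1) b] by (simp_all add: add.assoc)
  ultimately have "(?l, ?r) \<in> cohomologous ?P ?Q" by (simp add: cohomologous_iff)
  then show ?thesis unfolding cohomology_class_def by (rule equiv_class_eq[OF equiv_cohomologous])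
qed

lemma cohomology_product_assoc:
  assumes "X \<in> cohomology p q" "Y \<in> cohomology r s" "W \<in> cohomology t u"
  shows "cohomology_product (p + r) (q + s) t u (cohomology_product p q r s X Y) W =
    cohomology_product p q (r + t) (s + u) X (cohomology_product r s t u Y W)"
proof -
  obtain \<omega> where \<omega>: "\<omega> \<in> cocycles p q" "X = cohomology_class p q \<omega>"
    using assms(1) unfolding cohomology_def cohomology_class_def by (rule quotientE)
  obtain \<tau> where \<tau>: "\<tau> \<in> cocycles r s" "Y = cohomology_class r s \<tau>"
    using assms(2) unfolding cohomology_def cohomology_class_def by (rule quotientE)
  obtain \<sigma> where \<sigma>: "\<sigma> \<in> cocycles t u" "W = cohomology_class t u \<sigma>"
    using assms(3) unfolding cohomology_def cohomology_class_def by (rule quotientE)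
  show ?thesis
    unfolding \<omega>(2) \<tau>(2) \<sigma>(2) cohomology_product_class[OF \<omega>(1) \<tau>(1)] cohomology_product_class[OF \<tau>(1) \<sigma>(1)]
      cohomology_product_class[OF form_product_cocycle[OF \<omega>(1) \<tau>(1)] \<sigma>(1)]
      cohomology_product_class[OF \<omega>(1) form_product_cocycle[OF \<tau>(1) \<sigma>(1)]]
    using form_product_assoc[OF \<omega>(1) \<tau>(1) \<sigma>(1)] by (simp only: add.assoc)
qed

end


theorem corollary8p17:
  fixes charts :: "('a::{t2_space, second_countable_topology}, real^'m) chart set"
    and n :: nat and T10 :: "'a \<Rightarrow> (complex^'m) set"
    and p q r s :: nat
  assumes "CR_manifold charts n T10"
    and "p \<in> {0..n + 1}" and "r \<in> {0..n + 1}" and "q \<in> {0..n}" and "s \<in> {0..n}"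
  shows
    "(\<forall>\<omega>\<in>CR_manifold.cocycles charts n T10 p q. \<forall>\<tau>\<in>CR_manifold.cocycles charts n T10 r s.
       CR_manifold.form_product charts n T10 p q r s \<omega> \<tau>
         \<in> CR_manifold.cocycles charts n T10 (p + r) (q + s)) \<and>
     (congruent2 (CR_manifold.cohomologous charts n T10 p q)
       (CR_manifold.cohomologous charts n T10 r s)
       (\<lambda>\<omega> \<tau>. CR_manifold.cohomology_class charts n T10 (p + r) (q + s)
          (CR_manifold.form_product charts n T10 p q r s \<omega> \<tau>))) \<and>
     (\<forall>\<omega>\<in>CR_manifold.cocycles charts n T10 p q. \<forall>\<tau>\<in>CR_manifold.cocycles charts n T10 r s.
       CR_manifold.cohomology_product charts n T10 p q r s
           (CR_manifold.cohomology_class charts n T10 p q \<omega>)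
           (CR_manifold.cohomology_class charts n T10 r s \<tau>) =
         CR_manifold.cohomology_class charts n T10 (p + r) (q + s)
           (CR_manifold.form_product charts n T10 p q r s \<omega> \<tau>)) \<and>
     (\<forall>t\<in>{0..n + 1}. \<forall>u\<in>{0..n}.
       \<forall>X\<in>CR_manifold.cohomology charts n T10 p q.
       \<forall>Y\<in>CR_manifold.cohomology charts n T10 r s.
       \<forall>W\<in>CR_manifold.cohomology charts n T10 t u.
         CR_manifold.cohomology_product charts n T10 (p + r) (q + s) t u
             (CR_manifold.cohomology_product charts n T10 p q r s X Y) W =
           CR_manifold.cohomology_product charts n T10 p q (r + t) (s + u)
             X (CR_manifold.cohomology_product charts n T10 r s t u Y W))"
proof -
  interpret CR_manifold charts n T10 by (rule assms(1))
  show ?thesis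
    by (intro conjI ballI form_product_cocycle congruent2_form_product cohomology_product_class cohomology_product_assoc)
qed

end
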